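(* Let $H$ be a twisted Calabi-Yau Hopf algebra of dimension $d$ with bijective antipode. Then any Hopf-Galois object $A$ over $H$ is still a twisted Calabi-Yau algebra of dimension $d$.
   Context: $\Bbbk$ is a fixed field; all algebras are unital associative $\Bbbk$-algebras, and $\otimes=\otimes_\Bbbk$. Hopf-Galois objects. Let $H$ be a Hopf algebra. A left $H$-Galois object is a left $H$-comodule algebra $A\neq 0$ such that, with $\alpha:A\to H\otimes A$ the coaction and $m$ the multiplication of $A$, the linear map $(1_H\otimes m)\circ(\alpha\otimes 1_A):A\otimes A\to H\otimes A$ is an isomorphism. A right $H$-Galois object is a right $H$-comodule algebra $A\ne 0$ such that, with $\beta:A\to A\otimes H$ the coaction, the linear map $(m\otimes 1_H)\circ(1_A\otimes\beta):A\otimes A\to A\otimes H$ is an isomorphism. A Hopf-Galois object over $H$ is a left or right $H$-Galois object. Twisted Calabi-Yau algebras. For an algebra $A$ let $A^e=A\otimes A^{op}$; $A$-bimodules are identified with $A^e$-modules. For an automorphism $\mu$ of $A$, $A^\mu$ is the bimodule with underlying space $A$ and $a\cdot m\cdot b=am\mu(b)$. $A$ is twisted Calabi-Yau of dimension $d$ if (i) $A$ has a bounded resolution by finitely generated projective $A^e$-modules, and (ii) there is an algebra automorphism $\mu$ of $A$ such that $\mathrm{Ext}^i_{A^e}(A,A^e)=0$ for $i\ne d$ and $\mathrm{Ext}^d_{A^e}(A,A^e)\cong A^\mu$ as $A^e$-modules, where Ext is computed with the left $A^e$-module structure $(a\otimes b)\cdot(x\otimes y)=ax\otimes yb$ on $A^e$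 and the bimodule structure on Ext comes from the right structure $(x\otimes y)\cdot(a\otimes b)=xa\otimes by$. A Hopf algebra is twisted Calabi-Yau if its underlying algebra is. *)

theory Defs
  imports "HOL-Algebra.Module" "HOL-Algebra.AbelCoset"
begin

section \<open>Modules over a not necessarily commutative ring\<close>

text \<open>
  The library locale \<^locale>\<open>module\<close> requires a commutative ring of scalars. Left modules over an
  arbitrary ring use the same record type; its fields \<open>mult\<close> and \<open>one\<close> are then irrelevant.
\<close>

locale left_module = R?: ring R + M?: abelian_group M
  for R :: "('r, 'z) ring_scheme" (structure) and M :: "('r, 'm, 'y) module_scheme" (structure) +
  assumes smult_closed:
      "\<lbrakk>a \<in> carrier R; x \<in> carrier M\<rbrakk> \<Longrightarrow> a \<odot>\<^bsub>M\<^esub> x \<in> carrier M"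
    and smult_l_distr:
      "\<lbrakk>a \<in> carrier R; b \<in> carrier R; x \<in> carrier M\<rbrakk> \<Longrightarrow>
        (a \<oplus>\<^bsub>R\<^esub> b) \<odot>\<^bsub>M\<^esub> x = a \<odot>\<^bsub>M\<^esub> x \<oplus>\<^bsub>M\<^esub> b \<odot>\<^bsub>M\<^esub> x"
    and smult_r_distr:
      "\<lbrakk>a \<in> carrier R; x \<in> carrier M; y \<in> carrier M\<rbrakk> \<Longrightarrow>
        a \<odot>\<^bsub>M\<^esub> (x \<oplus>\<^bsub>M\<^esub> y) = a \<odot>\<^bsub>M\<^esub> x \<oplus>\<^bsub>M\<^esub> a \<odot>\<^bsub>M\<^esub> y"
    and smult_assoc:
      "\<lbrakk>a \<in> carrier R; b \<in> carrier R; x \<in> carrier M\<rbrakk> \<Longrightarrow>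
        (a \<otimes>\<^bsub>R\<^esub> b) \<odot>\<^bsub>M\<^esub> x = a \<odot>\<^bsub>M\<^esub> (b \<odot>\<^bsub>M\<^esub> x)"
    and smult_one: "x \<in> carrier M \<Longrightarrow> \<one>\<^bsub>R\<^esub> \<odot>\<^bsub>M\<^esub> x = x"

definition module_hom ::
    "('r, 'z) ring_scheme \<Rightarrow> ('r, 'm) module \<Rightarrow> ('r, 'n) module \<Rightarrow> ('m \<Rightarrow> 'n) set" where
  "module_hom R M N =
    {f \<in> carrier M \<rightarrow> carrier N.
      (\<forall>x\<in>carrier M. \<forall>y\<in>carrier M. f (x \<oplus>\<^bsub>M\<^esub> y) = f x \<oplus>\<^bsub>N\<^esub> f y) \<and>
      (\<forall>a\<in>carrier R. \<forall>x\<in>carrier M. f (a \<odot>\<^bsub>M\<^esub> x) = a \<odot>\<^bsub>N\<^esub> f x)}"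

definition regular_module :: "('r, 'z) ring_scheme \<Rightarrow> ('r, 'r) module" where
  "regular_module R =
    \<lparr>carrier = carrier R, mult = mult R, one = one R, zero = zero R, add = add R, smult = mult R\<rparr>"

definition submodule_span :: "('r, 'z) ring_scheme \<Rightarrow> ('r, 'm) module \<Rightarrow> 'm set \<Rightarrow> 'm set" where
  "submodule_span R M S = \<Inter>{N. submodule N R M \<and> S \<subseteq> N}"

definition quotient_module :: "('r, 'm) module \<Rightarrow> 'm set \<Rightarrow> ('r, 'm set) module" where
  "quotient_module M N =
    \<lparr>carrier = a_rcosets\<^bsub>M\<^esub> N, mult = undefined, one = undefined, zero = N,
     add = (\<lambda>X Y. X <+>\<^bsub>M\<^esub> Y), smult = (\<lambda>a X. \<Union>x\<in>X. N +>\<^bsub>M\<^esub> (a \<odot>\<^bsub>M\<^esub> x))\<rparr>"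

definition free_module :: "('r, 'z) ring_scheme \<Rightarrow> 'i set \<Rightarrow> ('r, 'i \<Rightarrow> 'r) module" where
  "free_module R I =
    \<lparr>carrier = {f. range f \<subseteq> carrier R \<and> finite {i. f i \<noteq> \<zero>\<^bsub>R\<^esub>} \<and> {i. f i \<noteq> \<zero>\<^bsub>R\<^esub>} \<subseteq> I},
     mult = undefined, one = undefined, zero = (\<lambda>i. \<zero>\<^bsub>R\<^esub>),
     add = (\<lambda>f g i. f i \<oplus>\<^bsub>R\<^esub> g i), smult = (\<lambda>a f i. a \<otimes>\<^bsub>R\<^esub> f i)\<rparr>"

definition free_basis :: "('r, 'z) ring_scheme \<Rightarrow> 'i \<Rightarrow> ('i \<Rightarrow> 'r)" where
  "free_basis R i = (\<lambda>j. if j = i then \<one>\<^bsub>R\<^esub> else \<zero>\<^bsub>R\<^esub>)"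

definition fin_generated :: "('r, 'z) ring_scheme \<Rightarrow> ('r, 'm) module \<Rightarrow> bool" where
  "fin_generated R M \<longleftrightarrow> (\<exists>S\<subseteq>carrier M. finite S \<and> submodule_span R M S = carrier M)"

text \<open>
  A projective module is a direct summand of a free module. It is enough to consider free modules
  whose basis is a set of elements of the type of \<open>P\<close>: if \<open>P\<close> is projective, the canonical
  surjection onto \<open>P\<close> from the free module on the set \<open>carrier P\<close> splits.
\<close>

definition projective_module :: "('r, 'z) ring_scheme \<Rightarrow> ('r, 'p) module \<Rightarrow> bool" where
  "projective_module R P \<longleftrightarrow> left_module R P \<and>
    (\<exists>(I :: 'p set) \<iota> \<pi>. \<iota> \<in> module_hom R P (free_module R I) \<and>
      \<pi> \<in> module_hom R (free_module R I) P \<and> (\<forall>x\<in>carrier P. \<pi> (\<iota> x) = x))"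


section \<open>Projective resolutions and Ext\<close>

text \<open>The differentials are \<open>\<delta> n : P (n + 1) \<rightarrow> P n\<close> and the augmentation is \<open>\<epsilon> : P 0 \<rightarrow> M\<close>.\<close>

definition projective_resolution ::
    "('r, 'z) ring_scheme \<Rightarrow> ('r, 'm) module \<Rightarrow> (nat \<Rightarrow> ('r, 'p) module) \<Rightarrow>
      (nat \<Rightarrow> 'p \<Rightarrow> 'p) \<Rightarrow> ('p \<Rightarrow> 'm) \<Rightarrow> bool" where
  "projective_resolution R M P \<delta> \<epsilon> \<longleftrightarrow>
    (\<forall>n. projective_module R (P n)) \<and>
    (\<forall>n. \<delta> n \<in> module_hom R (P (Suc n)) (P n)) \<and>
    \<epsilon> \<in> module_hom R (P 0) M \<and>
    \<epsilon> ` carrier (P 0) = carrier M \<and>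
    \<delta> 0 ` carrier (P (Suc 0)) = {x \<in> carrier (P 0). \<epsilon> x = \<zero>\<^bsub>M\<^esub>} \<and>
    (\<forall>n. \<delta> (Suc n) ` carrier (P (Suc (Suc n))) =
          {x \<in> carrier (P (Suc n)). \<delta> n x = \<zero>\<^bsub>P n\<^esub>})"

text \<open>
  The modules of a resolution have to live in a fixed type. With \<open>X = ('r + 'm) list\<close>, every module
  over a ring on \<open>'r\<close> with elements in \<open>'m\<close> is a quotient of the free module on \<open>X\<close>, and so is every
  submodule of that free module, because the latter has at most as many elements as \<open>X\<close>. So every
  module has a projective resolution in the following type. As \<open>X\<close> is infinite, the type also contains
  a copy of every finitely generated projective module.
\<close>

type_synonym ('r, 'm) resolution_elem = "('r + 'm) list \<Rightarrow> 'r"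

text \<open>
  Homomorphisms are made extensional so that equality of functions is equality of homomorphisms.
  Extra scalars acting on \<open>N\<close> by \<open>R\<close>-endomorphisms \<open>act s\<close> act on \<open>Hom(M, N)\<close> by composition.
\<close>

definition hom_module ::
    "('r, 'z) ring_scheme \<Rightarrow> ('r, 'm) module \<Rightarrow> ('r, 'n) module \<Rightarrow> ('s \<Rightarrow> 'n \<Rightarrow> 'n) \<Rightarrow>
      ('s, 'm \<Rightarrow> 'n) module" where
  "hom_module R M N act =
    \<lparr>carrier = module_hom R M N \<inter> extensional (carrier M), mult = undefined, one = undefined,
     zero = (\<lambda>x\<in>carrier M. \<zero>\<^bsub>N\<^esub>),
     add = (\<lambda>f g. \<lambda>x\<in>carrier M. f x \<oplus>\<^bsub>N\<^esub> g x),
     smult = (\<lambda>s f. \<lambda>x\<in>carrier M. act s (f x))\<rparr>"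

definition cocycles ::
    "('r, 'z) ring_scheme \<Rightarrow> (nat \<Rightarrow> ('r, 'p) module) \<Rightarrow> (nat \<Rightarrow> 'p \<Rightarrow> 'p) \<Rightarrow> ('r, 'n) module \<Rightarrow>
      nat \<Rightarrow> ('p \<Rightarrow> 'n) set" where
  "cocycles R P \<delta> N n =
    {f \<in> module_hom R (P n) N \<inter> extensional (carrier (P n)).
      \<forall>x\<in>carrier (P (Suc n)). f (\<delta> n x) = \<zero>\<^bsub>N\<^esub>}"

definition coboundaries ::
    "('r, 'z) ring_scheme \<Rightarrow> (nat \<Rightarrow> ('r, 'p) module) \<Rightarrow> (nat \<Rightarrow> 'p \<Rightarrow> 'p) \<Rightarrow> ('r, 'n) module \<Rightarrow>
      nat \<Rightarrow> ('p \<Rightarrow> 'n) set" where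
  "coboundaries R P \<delta> N n =
    (case n of
      0 \<Rightarrow> {\<lambda>x\<in>carrier (P 0). \<zero>\<^bsub>N\<^esub>}
    | Suc m \<Rightarrow> {\<lambda>x\<in>carrier (P n). g (\<delta> m x) | g. g \<in> module_hom R (P m) N})"

definition hom_cohomology ::
    "('r, 'z) ring_scheme \<Rightarrow> (nat \<Rightarrow> ('r, 'p) module) \<Rightarrow> (nat \<Rightarrow> 'p \<Rightarrow> 'p) \<Rightarrow> ('r, 'n) module \<Rightarrow>
      ('s \<Rightarrow> 'n \<Rightarrow> 'n) \<Rightarrow> nat \<Rightarrow> ('s, ('p \<Rightarrow> 'n) set) module" where
  "hom_cohomology R P \<delta> N act n =
    quotient_module
      ((hom_module R (P n) N act)\<lparr>carrier := cocycles R P \<delta> N n\<rparr>)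
      (coboundaries R P \<delta> N n)"

text \<open>
  \<open>Ext R M N act n\<close> is the \<open>n\<close>-th cohomology of \<open>Hom(P, N)\<close> for a chosen projective resolution \<open>P\<close>
  of \<open>M\<close>, with the scalar action induced by \<open>act\<close>.
\<close>

definition Ext ::
    "('r, 'z) ring_scheme \<Rightarrow> ('r, 'm) module \<Rightarrow> ('r, 'n) module \<Rightarrow> ('s \<Rightarrow> 'n \<Rightarrow> 'n) \<Rightarrow> nat \<Rightarrow>
      ('s, (('r, 'm) resolution_elem \<Rightarrow> 'n) set) module" where
  "Ext R M N act n =
    (let C = SOME C. \<exists>\<epsilon>. projective_resolution R M (fst C) (snd C) \<epsilon>
     in hom_cohomology R (fst C) (snd C) N act n)"


section \<open>Algebras over a field and their tensor products\<close>

text \<open>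
  The library locale \<^locale>\<open>algebra\<close> covers commutative algebras only.
\<close>

locale k_algebra = K?: field K + A?: ring A + module K A
  for K :: "('k, 'z) ring_scheme" (structure) and A :: "('k, 'a) module" (structure) +
  assumes smult_mult_left:
      "\<lbrakk>c \<in> carrier K; x \<in> carrier A; y \<in> carrier A\<rbrakk> \<Longrightarrow>
        (c \<odot>\<^bsub>A\<^esub> x) \<otimes>\<^bsub>A\<^esub> y = c \<odot>\<^bsub>A\<^esub> (x \<otimes>\<^bsub>A\<^esub> y)"
    and smult_mult_right:
      "\<lbrakk>c \<in> carrier K; x \<in> carrier A; y \<in> carrier A\<rbrakk> \<Longrightarrow>
        x \<otimes>\<^bsub>A\<^esub> (c \<odot>\<^bsub>A\<^esub> y) = c \<odot>\<^bsub>A\<^esub> (x \<otimes>\<^bsub>A\<^esub> y)"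

definition alg_hom ::
    "('k, 'z) ring_scheme \<Rightarrow> ('k, 'a) module \<Rightarrow> ('k, 'b) module \<Rightarrow> ('a \<Rightarrow> 'b) set" where
  "alg_hom K A B = ring_hom A B \<inter> module_hom K A B"

definition alg_aut :: "('k, 'z) ring_scheme \<Rightarrow> ('k, 'a) module \<Rightarrow> ('a \<Rightarrow> 'a) set" where
  "alg_aut K A = {\<mu> \<in> alg_hom K A A. bij_betw \<mu> (carrier A) (carrier A)}"

definition op_alg :: "('k, 'a) module \<Rightarrow> ('k, 'a) module" where
  "op_alg A = A\<lparr>mult := (\<lambda>x y. y \<otimes>\<^bsub>A\<^esub> x)\<rparr>"

text \<open>
  The tensor product is the free vector space on \<open>carrier V \<times> carrier W\<close> modulo the bilinearity
  relations, so its elements are cosets.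
\<close>

type_synonym ('k, 'v, 'w) tens = "('v \<times> 'w \<Rightarrow> 'k) set"

definition tens_relations ::
    "('k, 'z) ring_scheme \<Rightarrow> ('k, 'v) module \<Rightarrow> ('k, 'w) module \<Rightarrow> ('v \<times> 'w \<Rightarrow> 'k) set" where
  "tens_relations K V W =
    (let F = free_module K (carrier V \<times> carrier W); b = (\<lambda>v w. free_basis K (v, w)) in
      {b (v \<oplus>\<^bsub>V\<^esub> v') w \<ominus>\<^bsub>F\<^esub> (b v w \<oplus>\<^bsub>F\<^esub> b v' w) | v v' w.
        v \<in> carrier V \<and> v' \<in> carrier V \<and> w \<in> carrier W} \<union>
      {b v (w \<oplus>\<^bsub>W\<^esub> w') \<ominus>\<^bsub>F\<^esub> (b v w \<oplus>\<^bsub>F\<^esub> b v w') | v w w'.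
        v \<in> carrier V \<and> w \<in> carrier W \<and> w' \<in> carrier W} \<union>
      {b (c \<odot>\<^bsub>V\<^esub> v) w \<ominus>\<^bsub>F\<^esub> (c \<odot>\<^bsub>F\<^esub> b v w) | c v w.
        c \<in> carrier K \<and> v \<in> carrier V \<and> w \<in> carrier W} \<union>
      {b v (c \<odot>\<^bsub>W\<^esub> w) \<ominus>\<^bsub>F\<^esub> (c \<odot>\<^bsub>F\<^esub> b v w) | c v w.
        c \<in> carrier K \<and> v \<in> carrier V \<and> w \<in> carrier W})"

definition tens_null ::
    "('k, 'z) ring_scheme \<Rightarrow> ('k, 'v) module \<Rightarrow> ('k, 'w) module \<Rightarrow> ('v \<times> 'w \<Rightarrow> 'k) set" where
  "tens_null K V W =
    submodule_span K (free_module K (carrier V \<times> carrier W)) (tens_relations K V W)"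

definition tens_space ::
    "('k, 'z) ring_scheme \<Rightarrow> ('k, 'v) module \<Rightarrow> ('k, 'w) module \<Rightarrow>
      ('k, ('k, 'v, 'w) tens) module" where
  "tens_space K V W =
    quotient_module (free_module K (carrier V \<times> carrier W)) (tens_null K V W)"

definition pure_tens ::
    "('k, 'z) ring_scheme \<Rightarrow> ('k, 'v) module \<Rightarrow> ('k, 'w) module \<Rightarrow> 'v \<Rightarrow> 'w \<Rightarrow>
      ('k, 'v, 'w) tens" where
  "pure_tens K V W v w =
    tens_null K V W +>\<^bsub>free_module K (carrier V \<times> carrier W)\<^esub> free_basis K (v, w)"

text \<open>
  The linear map on \<open>V \<otimes> W\<close> with values in \<open>U\<close> induced by a bilinear map \<open>\<phi>\<close>, evaluated on a
  representative of the coset \<open>X\<close>.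
\<close>

definition tens_lift ::
    "('k, 'z) ring_scheme \<Rightarrow> ('k, 'u) module \<Rightarrow> ('v \<Rightarrow> 'w \<Rightarrow> 'u) \<Rightarrow> ('k, 'v, 'w) tens \<Rightarrow> 'u" where
  "tens_lift K U \<phi> X =
    (let f = SOME f. f \<in> X
     in \<Oplus>\<^bsub>U\<^esub>p\<in>{p. f p \<noteq> \<zero>\<^bsub>K\<^esub>}. f p \<odot>\<^bsub>U\<^esub> \<phi> (fst p) (snd p))"

text \<open>
  The tensor product of algebras, \<open>(a \<otimes> b) (a' \<otimes> b') = aa' \<otimes> bb'\<close>. It is also used for plain vector
  spaces; the fields \<open>mult\<close> and \<open>one\<close> are then irrelevant.
\<close>

definition tens ::
    "('k, 'z) ring_scheme \<Rightarrow> ('k, 'a) module \<Rightarrow> ('k, 'b) module \<Rightarrow>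
      ('k, ('k, 'a, 'b) tens) module" where
  "tens K A B = (tens_space K A B)
    \<lparr>mult := (\<lambda>X Y. tens_lift K (tens_space K A B) (\<lambda>a b.
        tens_lift K (tens_space K A B) (\<lambda>a' b'.
          pure_tens K A B (a \<otimes>\<^bsub>A\<^esub> a') (b \<otimes>\<^bsub>B\<^esub> b')) Y) X),
     one := pure_tens K A B \<one>\<^bsub>A\<^esub> \<one>\<^bsub>B\<^esub>\<rparr>"

definition tens_map ::
    "('k, 'z) ring_scheme \<Rightarrow> ('k, 'v) module \<Rightarrow> ('k, 'w) module \<Rightarrow> ('a \<Rightarrow> 'v) \<Rightarrow> ('b \<Rightarrow> 'w) \<Rightarrow>
      ('k, 'a, 'b) tens \<Rightarrow> ('k, 'v, 'w) tens" where
  "tens_map K V W f g = tens_lift K (tens K V W) (\<lambda>a b. pure_tens K V W (f a) (g b))"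

text \<open>The canonical map \<open>(U \<otimes> V) \<otimes> W \<rightarrow> U \<otimes> (V \<otimes> W)\<close>.\<close>

definition tens_assoc ::
    "('k, 'z) ring_scheme \<Rightarrow> ('k, 'u) module \<Rightarrow> ('k, 'v) module \<Rightarrow> ('k, 'w) module \<Rightarrow>
      ('k, ('k, 'u, 'v) tens, 'w) tens \<Rightarrow> ('k, 'u, ('k, 'v, 'w) tens) tens" where
  "tens_assoc K U V W =
    tens_lift K (tens K U (tens K V W)) (\<lambda>x w.
      tens_lift K (tens K U (tens K V W)) (\<lambda>u v.
        pure_tens K U (tens K V W) u (pure_tens K V W v w)) x)"

definition mult_map ::
    "('k, 'z) ring_scheme \<Rightarrow> ('k, 'a) module \<Rightarrow> ('k, 'a, 'a) tens \<Rightarrow> 'a" where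
  "mult_map K A = tens_lift K A (\<lambda>x y. x \<otimes>\<^bsub>A\<^esub> y)"


section \<open>Hopf algebras and Hopf-Galois objects\<close>

text \<open>
  The identifications \<open>K \<otimes> V = V = V \<otimes> K\<close> are built into the counit conditions.
\<close>

locale hopf_algebra = H?: k_algebra K H
  for K :: "('k, 'z) ring_scheme" (structure) and H :: "('k, 'h) module" (structure) +
  fixes \<Delta> :: "'h \<Rightarrow> ('k, 'h, 'h) tens" and \<epsilon> :: "'h \<Rightarrow> 'k" and S :: "'h \<Rightarrow> 'h"
  assumes comult_hom: "\<Delta> \<in> alg_hom K H (tens K H H)"
    and counit_hom: "\<epsilon> \<in> alg_hom K H (regular_module K)"
    and coassoc: "h \<in> carrier H \<Longrightarrow>
      tens_assoc K H H H (tens_map K (tens K H H) H \<Delta> (\<lambda>x. x) (\<Delta> h)) =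
      tens_map K H (tens K H H) (\<lambda>x. x) \<Delta> (\<Delta> h)"
    and counit_left: "h \<in> carrier H \<Longrightarrow> tens_lift K H (\<lambda>x y. \<epsilon> x \<odot>\<^bsub>H\<^esub> y) (\<Delta> h) = h"
    and counit_right: "h \<in> carrier H \<Longrightarrow> tens_lift K H (\<lambda>x y. \<epsilon> y \<odot>\<^bsub>H\<^esub> x) (\<Delta> h) = h"
    and antipode_linear: "S \<in> module_hom K H H"
    and antipode_left: "h \<in> carrier H \<Longrightarrow>
      mult_map K H (tens_map K H H S (\<lambda>x. x) (\<Delta> h)) = \<epsilon> h \<odot>\<^bsub>H\<^esub> \<one>\<^bsub>H\<^esub>"
    and antipode_right: "h \<in> carrier H \<Longrightarrow>
      mult_map K H (tens_map K H H (\<lambda>x. x) S (\<Delta> h)) = \<epsilon> h \<odot>\<^bsub>H\<^esub> \<one>\<^bsub>H\<^esub>"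

definition left_comodule_algebra ::
    "('k, 'z) ring_scheme \<Rightarrow> ('k, 'h) module \<Rightarrow> ('h \<Rightarrow> ('k, 'h, 'h) tens) \<Rightarrow> ('h \<Rightarrow> 'k) \<Rightarrow>
      ('k, 'a) module \<Rightarrow> ('a \<Rightarrow> ('k, 'h, 'a) tens) \<Rightarrow> bool" where
  "left_comodule_algebra K H \<Delta> \<epsilon> A \<alpha> \<longleftrightarrow>
    k_algebra K A \<and> \<alpha> \<in> alg_hom K A (tens K H A) \<and>
    (\<forall>a\<in>carrier A.
      tens_assoc K H H A (tens_map K (tens K H H) A \<Delta> (\<lambda>x. x) (\<alpha> a)) =
      tens_map K H (tens K H A) (\<lambda>x. x) \<alpha> (\<alpha> a)) \<and>
    (\<forall>a\<in>carrier A. tens_lift K A (\<lambda>h x. \<epsilon> h \<odot>\<^bsub>A\<^esub> x) (\<alpha> a) = a)"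

definition right_comodule_algebra ::
    "('k, 'z) ring_scheme \<Rightarrow> ('k, 'h) module \<Rightarrow> ('h \<Rightarrow> ('k, 'h, 'h) tens) \<Rightarrow> ('h \<Rightarrow> 'k) \<Rightarrow>
      ('k, 'a) module \<Rightarrow> ('a \<Rightarrow> ('k, 'a, 'h) tens) \<Rightarrow> bool" where
  "right_comodule_algebra K H \<Delta> \<epsilon> A \<beta> \<longleftrightarrow>
    k_algebra K A \<and> \<beta> \<in> alg_hom K A (tens K A H) \<and>
    (\<forall>a\<in>carrier A.
      tens_assoc K A H H (tens_map K (tens K A H) H \<beta> (\<lambda>x. x) (\<beta> a)) =
      tens_map K A (tens K H H) (\<lambda>x. x) \<Delta> (\<beta> a)) \<and>
    (\<forall>a\<in>carrier A. tens_lift K A (\<lambda>x h. \<epsilon> h \<odot>\<^bsub>A\<^esub> x) (\<beta> a) = a)"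

definition left_galois_object ::
    "('k, 'z) ring_scheme \<Rightarrow> ('k, 'h) module \<Rightarrow> ('h \<Rightarrow> ('k, 'h, 'h) tens) \<Rightarrow> ('h \<Rightarrow> 'k) \<Rightarrow>
      ('k, 'a) module \<Rightarrow> ('a \<Rightarrow> ('k, 'h, 'a) tens) \<Rightarrow> bool" where
  "left_galois_object K H \<Delta> \<epsilon> A \<alpha> \<longleftrightarrow>
    left_comodule_algebra K H \<Delta> \<epsilon> A \<alpha> \<and> carrier A \<noteq> {\<zero>\<^bsub>A\<^esub>} \<and>
    bij_betw
      (\<lambda>x. tens_map K H A (\<lambda>h. h) (mult_map K A)
        (tens_assoc K H A A (tens_map K (tens K H A) A \<alpha> (\<lambda>a. a) x)))
      (carrier (tens K A A)) (carrier (tens K H A))"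

definition right_galois_object ::
    "('k, 'z) ring_scheme \<Rightarrow> ('k, 'h) module \<Rightarrow> ('h \<Rightarrow> ('k, 'h, 'h) tens) \<Rightarrow> ('h \<Rightarrow> 'k) \<Rightarrow>
      ('k, 'a) module \<Rightarrow> ('a \<Rightarrow> ('k, 'a, 'h) tens) \<Rightarrow> bool" where
  "right_galois_object K H \<Delta> \<epsilon> A \<beta> \<longleftrightarrow>
    right_comodule_algebra K H \<Delta> \<epsilon> A \<beta> \<and> carrier A \<noteq> {\<zero>\<^bsub>A\<^esub>} \<and>
    bij_betw
      (\<lambda>x. tens_map K A H (mult_map K A) (\<lambda>h. h)
        (inv_into (carrier (tens K (tens K A A) H)) (tens_assoc K A A H)
          (tens_map K A (tens K A H) (\<lambda>a. a) \<beta> x)))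
      (carrier (tens K A A)) (carrier (tens K A H))"

definition hopf_galois_object ::
    "('k, 'z) ring_scheme \<Rightarrow> ('k, 'h) module \<Rightarrow> ('h \<Rightarrow> ('k, 'h, 'h) tens) \<Rightarrow> ('h \<Rightarrow> 'k) \<Rightarrow>
      ('k, 'a) module \<Rightarrow> bool" where
  "hopf_galois_object K H \<Delta> \<epsilon> A \<longleftrightarrow>
    (\<exists>\<alpha>. left_galois_object K H \<Delta> \<epsilon> A \<alpha>) \<or> (\<exists>\<beta>. right_galois_object K H \<Delta> \<epsilon> A \<beta>)"


section \<open>Twisted Calabi-Yau algebras\<close>

definition env_alg ::
    "('k, 'z) ring_scheme \<Rightarrow> ('k, 'a) module \<Rightarrow> ('k, ('k, 'a, 'a) tens) module" where
  "env_alg K A = tens K A (op_alg A)"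

text \<open>The bimodule \<open>A\<^sup>\<mu>\<close> as a left module over \<open>env_alg K A\<close>: \<open>(a \<otimes> b) \<cdot> m = a m \<mu>(b)\<close>.\<close>

definition twisted_bimodule ::
    "('k, 'z) ring_scheme \<Rightarrow> ('k, 'a) module \<Rightarrow> ('a \<Rightarrow> 'a) \<Rightarrow> (('k, 'a, 'a) tens, 'a) module" where
  "twisted_bimodule K A \<mu> =
    \<lparr>carrier = carrier A, mult = undefined, one = undefined, zero = zero A, add = add A,
     smult = (\<lambda>r m. tens_lift K A (\<lambda>a b. (a \<otimes>\<^bsub>A\<^esub> m) \<otimes>\<^bsub>A\<^esub> \<mu> b) r)\<rparr>"

text \<open>
  A right module over the enveloping algebra is a bimodule via \<open>a \<cdot> m \<cdot> b = m (b \<otimes> a)\<close>, hence a left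
  module over the enveloping algebra via \<open>(a \<otimes> b) \<cdot> m = m (b \<otimes> a)\<close>. For the right regular module this
  is the action \<open>(a \<otimes> b) \<cdot> (x \<otimes> y) = xb \<otimes> ay\<close>.
\<close>

definition env_flip ::
    "('k, 'z) ring_scheme \<Rightarrow> ('k, 'a) module \<Rightarrow> ('k, 'a, 'a) tens \<Rightarrow> ('k, 'a, 'a) tens" where
  "env_flip K A = tens_lift K (env_alg K A) (\<lambda>a b. pure_tens K A (op_alg A) b a)"

definition env_inner_act ::
    "('k, 'z) ring_scheme \<Rightarrow> ('k, 'a) module \<Rightarrow> ('k, 'a, 'a) tens \<Rightarrow> ('k, 'a, 'a) tens \<Rightarrow>
      ('k, 'a, 'a) tens" where
  "env_inner_act K A r m = m \<otimes>\<^bsub>env_alg K A\<^esub> env_flip K A r"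

definition Ext_env ::
    "('k, 'z) ring_scheme \<Rightarrow> ('k, 'a) module \<Rightarrow> nat \<Rightarrow>
      (('k, 'a, 'a) tens,
        ((('k, 'a, 'a) tens, 'a) resolution_elem \<Rightarrow> ('k, 'a, 'a) tens) set) module" where
  "Ext_env K A n =
    Ext (env_alg K A) (twisted_bimodule K A (\<lambda>a. a)) (regular_module (env_alg K A))
      (env_inner_act K A) n"

definition homologically_smooth :: "('k, 'z) ring_scheme \<Rightarrow> ('k, 'a) module \<Rightarrow> bool" where
  "homologically_smooth K A \<longleftrightarrow>
    (\<exists>(P :: nat \<Rightarrow> (_, (('k, 'a, 'a) tens, 'a) resolution_elem) module) \<delta> \<epsilon>.
      projective_resolution (env_alg K A) (twisted_bimodule K A (\<lambda>a. a)) P \<delta> \<epsilon> \<and>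
      (\<forall>n. fin_generated (env_alg K A) (P n)) \<and>
      (\<exists>l. \<forall>n>l. carrier (P n) = {\<zero>\<^bsub>P n\<^esub>}))"

definition twisted_CY :: "('k, 'z) ring_scheme \<Rightarrow> ('k, 'a) module \<Rightarrow> nat \<Rightarrow> bool" where
  "twisted_CY K A d \<longleftrightarrow>
    k_algebra K A \<and> homologically_smooth K A \<and>
    (\<exists>\<mu>\<in>alg_aut K A.
      (\<forall>i. i \<noteq> d \<longrightarrow> carrier (Ext_env K A i) = {\<zero>\<^bsub>Ext_env K A i\<^esub>}) \<and>
      (\<exists>\<phi>\<in>module_hom (env_alg K A) (Ext_env K A d) (twisted_bimodule K A \<mu>).
        bij_betw \<phi> (carrier (Ext_env K A d)) (carrier A)))"

end

theory Submission
  imports Defs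
begin

text \<open>
 A Hopf-Galois object \<open>A\<close> has a translation map, an algebra homomorphism \<open>\<kappa>\<close> from \<open>H\<close> to the enveloping
 algebra of \<open>A\<close>, along which the enveloping algebra of \<open>A\<close> is free, with either copy of \<open>A\<close> as space of
 coordinates. Base change of a bimodule resolution of \<open>H\<close> along \<open>x \<otimes> y \<mapsto> \<epsilon>(y) x\<close> resolves the trivial
 module over \<open>H\<close>, and a further base change along \<open>\<kappa>\<close> resolves the bimodule \<open>A\<close>. Finitely generated
 projective modules are idempotent matrices, so the transposed matrices undergo the same two base
 changes, and these again preserve homology. Hence Ext vanishes outside degree \<open>d\<close>, where it is generated
 by one class, freely over each of the two copies of \<open>A\<close>. Comparing the two actions of \<open>A\<close> on this class
 gives the twist. The antipode turns a right Galois object \<open>A\<close> into a left one on the opposite algebra.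
\<close>

text \<open>The base change from the enveloping algebra of \<open>H\<close> to \<open>H\<close>
  tensors over the inner copy of \<open>H\<close> with the trivial module, which is not exact. It
  preserves homology here because the homology is free over that copy: the complex then splits
  linearly over it. The bimodule \<open>H\<close> supplies this freeness for the resolution, and the
  free generator of Ext in degree \<open>d\<close> supplies it for the dual complex. The second base
  change is flat, but the dual complex consists of modules on the other side, so freeness along
  \<kappa> is needed from both sides, and on the side of the dual for both copies of
  \<open>A\<close>. The inverse antipode enters through these bijections, together with a map
  \<theta> on \<open>A\<close> that plays the part of the square of the antipode. Only one-sided
  freeness statements are carried through the base changes; the bimodule structure and the twist are
  rebuilt at the end from two such statements about one common class. Matrices make both base
  changes entrywise and make duality a transposition, so that no tensor product over a
  noncommutative ring has to be formed.\<close>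

abbreviation (input) "car == carrier"
abbreviation (input) "mhom == module_hom"
abbreviation (input) "reg == regular_module"
abbreviation (input) "cocs == cocycles"
abbreviation (input) "cobs == coboundaries"
abbreviation (input) "lmod == left_module"
abbreviation (input) "exact_at R P \<delta> N n == cocs R P \<delta> N n <= cobs R P \<delta> N n"
abbreviation (input) "freem == free_module"
abbreviation (input) mult_at ("_ *'__ _" [70, 1000, 71] 70) where "x *_A y == x \<otimes>\<^bsub>A\<^esub> y"
abbreviation (input) add_at ("_ +'__ _" [65, 1000, 66] 65) where "x +_A y == x \<oplus>\<^bsub>A\<^esub> y"
abbreviation (input) minus_at ("_ -'__ _" [65, 1000, 66] 65) where "x -_A y == x \<ominus>\<^bsub>A\<^esub> y"
abbreviation (input) smult_at ("_ .*'__ _" [70, 1000, 71] 70) where "c .*_A y == c \<odot>\<^bsub>A\<^esub> y"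
abbreviation (input) one_at ("1'__" [1000] 1000) where "1_A == \<one>\<^bsub>A\<^esub>"
abbreviation (input) zero_at ("0'__" [1000] 1000) where "0_A == \<zero>\<^bsub>A\<^esub>"

section \<open>Left modules and their homomorphisms\<close>

context abelian_group
begin

lemma minus_self: "x : car G ==> x \<ominus> x = \<zero>"
 by (simp add: a_minus_def r_neg)

lemma minus_eq_zero_iff: "[|x : car G; y : car G|] ==> x \<ominus> y = \<zero> \<longleftrightarrow> x = y"
 by (metis a_minus_def add.inv_closed add.inv_equality add.inv_inv minus_self)

lemma minus_add_cancel: "[|x : car G; y : car G|] ==> (x \<ominus> y) \<oplus> y = x"
 by (simp add: a_minus_def a_assoc l_neg)

lemma minus_zero_right: "x : car G ==> x \<ominus> \<zero> = x"
 by (simp add: a_minus_def)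

lemma minus_add_distrib:
 "[|x : car G; y : car G; z : car G; w : car G|] ==>
  (x \<oplus> y) \<ominus> (z \<oplus> w) = (x \<ominus> z) \<oplus> (y \<ominus> w)"
 by (simp add: a_minus_def minus_add a_ac)

lemma minus_minus_cancel:
 "[|x : car G; y : car G; z : car G|] ==> (x \<ominus> y) \<oplus> (y \<ominus> z) = x \<ominus> z"
 by (metis a_minus_def add.inv_closed add.m_assoc minus_add_cancel minus_closed)

lemma minus_minus_cancel_left:
 "[|x : car G; y : car G|] ==> x \<ominus> (x \<ominus> y) = y"
 by (metis a_minus_def a_comm add.inv_closed minus_add_cancel minus_minus minus_add minus_closed a_assoc r_neg l_zero)

lemma minus_eq_iff:
 "[|x : car G; y : car G; z : car G|] ==> x \<ominus> y = z \<longleftrightarrow> x = z \<oplus> y"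
 by (metis a_minus_def a_assoc add.inv_closed minus_add_cancel r_neg r_zero)

lemma minus_swap: "[|x : car G; y : car G|] ==> \<ominus> (x \<ominus> y) = y \<ominus> x"
 by (metis a_minus_def a_comm add.inv_closed minus_add minus_minus)

end

context left_module
begin

lemma smult_zero_left: "x : car M ==> 0_R .*_M x = 0_M"
 by (metis M.add.r_cancel_one' R.l_zero R.zero_closed smult_closed smult_l_distr)

lemma smult_zero_right: "a : car R ==> a .*_M 0_M = 0_M"
 by (metis M.add.r_cancel_one' M.l_zero M.zero_closed smult_closed smult_r_distr)

lemma smult_minus_right:
 "[|a : car R; x : car M|] ==> a .*_M (\<ominus>\<^bsub>M\<^esub> x) = \<ominus>\<^bsub>M\<^esub> (a .*_M x)"
 by (metis M.add.inv_closed M.l_neg M.minus_equality smult_closed smult_r_distr smult_zero_right)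

lemma smult_minus_left:
 "[|a : car R; x : car M|] ==> (\<ominus>\<^bsub>R\<^esub> a) .*_M x = \<ominus>\<^bsub>M\<^esub> (a .*_M x)"
 by (metis M.minus_equality R.add.inv_closed R.l_neg smult_closed smult_l_distr smult_zero_left)

lemma smult_diff_right:
 "[|a : car R; x : car M; y : car M|] ==>
  a .*_M (x -_M y) = a .*_M x -_M a .*_M y"
 by (simp add: a_minus_def smult_r_distr smult_minus_right)

lemma smult_finsum:
 "[|finite S; a : car R; f : S \<rightarrow> car M|] ==>
  a .*_M (finsum M (%i. f i) S) = (finsum M (%i. a .*_M f i) S)"
 by (induction set: finite) (simp_all add: smult_zero_right smult_r_distr smult_closed Pi_def)

end

lemma left_moduleI:
 assumes "ring R" "abelian_group M"
  and "!!a x. [|a : car R; x : car M|] ==> a .*_M x : car M"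
  and "!!a b x. [|a : car R; b : car R; x : car M|] ==>
    (a +_R b) .*_M x = a .*_M x +_M b .*_M x"
  and "!!a x y. [|a : car R; x : car M; y : car M|] ==>
    a .*_M (x +_M y) = a .*_M x +_M a .*_M y"
  and "!!a b x. [|a : car R; b : car R; x : car M|] ==>
    (a *_R b) .*_M x = a .*_M (b .*_M x)"
  and "!!x. x : car M ==> 1_R .*_M x = x"
 shows "lmod R M"
 using assms by (intro left_module.intro left_module_axioms.intro) auto

lemma left_module_of_module: "module R M ==> lmod R M"
 by (intro left_moduleI) (auto simp: module_def module_axioms_def intro: cring.axioms)

lemma module_of_left_module: "cring R ==> lmod R M ==> module R M"
 by (auto simp: module_def module_axioms_def left_module_def left_module_axioms_def)

lemma mhI:
 assumes "!!x. x : car M ==> f x : car N"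
  and "!!x y. [|x : car M; y : car M|] ==> f (x +_M y) = f x +_N f y"
  and "!!a x. [|a : car R; x : car M|] ==> f (a .*_M x) = a .*_N f x"
 shows "f : mhom R M N"
 using assms by (auto simp: module_hom_def)

lemma mh_closed: "[|f : mhom R M N; x : car M|] ==> f x : car N"
 by (auto simp: module_hom_def)

lemma mh_add:
 "[|f : mhom R M N; x : car M; y : car M|] ==> f (x +_M y) = f x +_N f y"
 by (auto simp: module_hom_def)

lemma mh_smult:
 "[|f : mhom R M N; a : car R; x : car M|] ==> f (a .*_M x) = a .*_N f x"
 by (auto simp: module_hom_def)

lemma mh_abelian_group_hom:
 assumes "f : mhom R M N" "abelian_group M" "abelian_group N"
 shows "abelian_group_hom M N f"
proof -
 interpret M: abelian_group M by fact
 interpret N: abelian_group N by fact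
 show ?thesis
  using assms
  by (intro abelian_group_homI group_hom.intro group_hom_axioms.intro M.a_group N.a_group)
   (auto simp: module_hom_def hom_def)
qed

lemma mh_zero:
 "[|f : mhom R M N; abelian_group M; abelian_group N|] ==> f 0_M = 0_N"
 by (metis abelian_group_hom.hom_zero mh_abelian_group_hom)

lemma mh_uminus:
 "[|f : mhom R M N; abelian_group M; abelian_group N; x : car M|] ==>
  f (\<ominus>\<^bsub>M\<^esub> x) = \<ominus>\<^bsub>N\<^esub> f x"
 by (metis abelian_group_hom.hom_a_inv mh_abelian_group_hom)

lemma mh_diff:
 assumes "f : mhom R M N" "abelian_group M" "abelian_group N" "x : car M" "y : car M"
 shows "f (x -_M y) = f x -_N f y"
 using assms by (simp add: a_minus_def mh_add[OF assms(1)] mh_uminus[OF assms(1)]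
   abelian_group.a_inv_closed)

lemma mh_finsum:
 assumes f: "f : mhom R M N" and M: "abelian_group M" and N: "abelian_group N"
  and "finite S" "g : S \<rightarrow> car M"
 shows "f (finsum M (%i. g i) S) = (finsum N (%i. f (g i)) S)"
proof -
 interpret M: abelian_group M by fact
 interpret N: abelian_group N by fact
 show ?thesis
  using assms(4,5)
 proof (induction set: finite)
  case empty
  then show ?case by (simp add: mh_zero[OF f M N])
 next
  case (insert x F)
  then show ?case
   by (simp add: M.finsum_insert N.finsum_insert Pi_def mh_add[OF f] mh_closed[OF f]
     M.finsum_closed)
 qed
qed

lemma mh_comp:
 "[|f : mhom R M N; g : mhom R N Q|] ==> (%x. g (f x)) : mhom R M Q"
 by (auto simp: module_hom_def Pi_def)

lemma mh_id: "(%x. x) : mhom R M M"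
 by (auto simp: module_hom_def)

lemma mh_cong:
 assumes "f : mhom R M N" "!!x. x : car M ==> g x = f x" "lmod R M"
 shows "g : mhom R M N"
proof -
 interpret left_module R M by fact
 show ?thesis using assms(1,2) by (auto simp: module_hom_def smult_closed)
qed

lemma mh_const_zero:
 "lmod R N ==> (%x. 0_N) : mhom R M N"
proof -
 assume "lmod R N"
 then interpret N: left_module R N .
 show ?thesis by (intro mhI) (simp_all add: N.smult_zero_right)
qed

lemma mh_plus:
 assumes f: "f : mhom R M N" and g: "g : mhom R M N" and "lmod R N"
 shows "(%x. f x +_N g x) : mhom R M N"
proof -
 interpret N: left_module R N by fact
 show ?thesis
  by (intro mhI)
   (simp_all add: mh_closed[OF f] mh_closed[OF g] mh_add[OF f]
    mh_add[OF g] mh_smult[OF f] mh_smult[OF g] N.smult_r_distr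
    N.M.a_ac)
qed

lemma mh_minus:
 assumes f: "f : mhom R M N" and g: "g : mhom R M N" and "lmod R N"
 shows "(%x. f x -_N g x) : mhom R M N"
proof -
 interpret N: left_module R N by fact
 show ?thesis
  by (intro mhI)
   (simp_all add: mh_closed[OF f] mh_closed[OF g] mh_add[OF f]
    mh_add[OF g] mh_smult[OF f] mh_smult[OF g] N.smult_diff_right
    N.M.minus_add_distrib)
qed

lemma regular_left_module: "ring R ==> lmod R (reg R)"
proof -
 assume "ring R"
 then interpret ring R .
 show ?thesis
  by (intro left_moduleI abelian_groupI)
   (auto simp: regular_module_def ring_axioms a_ac l_distr r_distr m_assoc intro: l_neg)
qed

section \<open>Free modules\<close>

text \<open>The map out of a free module with prescribed images \<phi> of the basis. Summing over
  the support of \<open>f\<close> keeps the index set out of the definition, so one function serves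
  all index sets.\<close>

definition flift :: "('r, 'm) module => ('r, 'z) ring_scheme => ('i => 'm) => ('i => 'r) => 'm" where
 "flift M R \<phi> f = (finsum M (%i. f i .*_M \<phi> i) {i. f i ~= 0_R})"

lemma free_sel:
 "car (freem R I) =
  {f. range f <= car R & finite {i. f i ~= 0_R} & {i. f i ~= 0_R} <= I}"
 "0_(freem R I) = (%i. 0_R)"
 "f +_(freem R I) g = (%i. f i +_R g i)"
 "a .*_(freem R I) f = (%i. a *_R f i)"
 by (simp_all add: free_module_def)

lemma freeD:
 "f : car (freem R I) ==> f i : car R"
 "f : car (freem R I) ==> finite {i. f i ~= 0_R}"
 by (auto simp: free_sel)

lemma free_module_outside: "f : car (freem R I) ==> i ~: I ==> f i = 0_R"
 by (auto simp: free_sel)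

context ring
begin

lemma free_moduleI:
 assumes "finite S" "!!i. f i : car R" "!!i. i ~: S ==> f i = \<zero>" "!!i. i ~: I ==> f i = \<zero>"
 shows "f : car (freem R I)"
 using assms by (auto simp: free_sel intro: finite_subset[of _ S])

lemma free_module_abelian_group: "abelian_group (freem R I)"
proof (rule abelian_groupI)
 fix f g
 assume f: "f : car (freem R I)" and g: "g : car (freem R I)"
 show "f +_(freem R I) g : car (freem R I)"
  unfolding free_sel(3)
  by (rule free_moduleI[of "{i. f i ~= \<zero>} \<union> {i. g i ~= \<zero>}"])
   (use f g in \<open>auto simp: freeD free_module_outside[OF f] free_module_outside[OF g]\<close>)
next
 fix f assume f: "f : car (freem R I)"
 have "(%i. \<ominus> f i) : car (freem R I)"
  by (rule free_moduleI[of "{i. f i ~= \<zero>}"]) (use f in \<open>auto simp: freeD dest: free_module_outside\<close>)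
 moreover have "(%i. \<ominus> f i) +_(freem R I) f = 0_(freem R I)"
  using f by (auto simp: free_sel(2,3) freeD l_neg)
 ultimately show "EX g:car (freem R I). g +_(freem R I) f = 0_(freem R I)"
  by blast
qed (auto simp: free_sel(2,3) freeD a_ac intro: free_moduleI[of "{}"])

lemma free_left_module: "lmod R (freem R I)"
proof (rule left_moduleI)
 fix a f assume "a : car R" and f: "f : car (freem R I)"
 then show "a .*_(freem R I) f : car (freem R I)"
  unfolding free_sel(4)
  by (intro free_moduleI[of "{i. f i ~= \<zero>}"]) (auto simp: freeD dest: free_module_outside)
qed (auto simp: free_sel(2,3,4) freeD a_ac l_distr r_distr m_assoc
  free_module_abelian_group ring_axioms)

lemma free_module_uminus:
 assumes f: "f : car (freem R I)"
 shows "\<ominus>\<^bsub>freem R I\<^esub> f = (%i. \<ominus> f i)"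
proof -
 interpret F: abelian_group "freem R I" by (rule free_module_abelian_group)
 have "(%i. \<ominus> f i) : car (freem R I)"
  by (rule free_moduleI[of "{i. f i ~= \<zero>}"]) (use f in \<open>auto simp: freeD dest: free_module_outside\<close>)
 moreover have "(%i. \<ominus> f i) +_(freem R I) f = 0_(freem R I)"
  using f by (auto simp: free_sel(2,3) freeD l_neg)
 ultimately show ?thesis using f F.minus_equality by blast
qed

lemma free_module_minus:
 assumes "f : car (freem R I)" "g : car (freem R I)"
 shows "f -_(freem R I) g = (%i. f i \<ominus> g i)"
 using assms by (simp add: a_minus_def free_module_uminus free_sel(3))

lemma free_module_finsum:
 assumes "finite S" "g : S \<rightarrow> car (freem R I)"
 shows "(finsum (freem R I) (%s. g s) S) = (%i. \<Oplus>s\<in>S. g s i)"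
proof -
 interpret F: abelian_group "freem R I" by (rule free_module_abelian_group)
 show ?thesis
  using assms
 proof (induction set: finite)
  case empty
  then show ?case by (simp add: free_sel(2))
 next
  case (insert x A)
  have "(finsum (freem R I) (%s. g s) (insert x A)) = g x +_(freem R I) (finsum (freem R I) (%s. g s) A)"
   using insert by (intro F.finsum_insert) auto
  also have "... = (%i. g x i \<oplus> (\<Oplus>s\<in>A. g s i))"
   using insert by (simp add: free_sel(3) Pi_def)
  also have "... = (%i. \<Oplus>s\<in>insert x A. g s i)"
   using insert by (intro ext finsum_insert[symmetric]) (auto simp: Pi_def intro: freeD(1))
  finally show ?case .
 qed
qed

lemma basis_closed: "i : I ==> free_basis R i : car (freem R I)"
 by (rule free_moduleI[of "{i}"]) (auto simp: free_basis_def)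

lemma flift_superset:
 assumes "lmod R M" "finite S" "!!i. f i : car R" "!!i. i ~: S ==> f i = \<zero>"
  and "!!i. i : S ==> f i ~= \<zero> ==> \<phi> i : car M"
  and "!!i. i : S ==> f i = \<zero> ==> f i .*_M \<phi> i = 0_M"
 shows "flift M R \<phi> f = (finsum M (%i. f i .*_M \<phi> i) S)"
proof -
 interpret M: left_module R M by fact
 have "f i .*_M \<phi> i : car M" if "i : S" for i
  using assms(3,5,6) that by (cases "f i = \<zero>") (auto intro: M.smult_closed)
 then show ?thesis
  unfolding flift_def using assms(2,4,6)
  by (intro M.add.finprod_mono_neutral_cong_left) auto
qed

lemma flift_superset':
 assumes "lmod R M" "finite S" "f : car (freem R I)" "{i. f i ~= \<zero>} <= S" "S <= I"
  "\<phi> : I \<rightarrow> car M"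
 shows "flift M R \<phi> f = (finsum M (%i. f i .*_M \<phi> i) S)"
proof (rule flift_superset)
 fix i assume "i : S" "f i = \<zero>"
 then show "f i .*_M \<phi> i = 0_M"
  using assms(5,6) left_module.smult_zero_left[OF assms(1)] by (auto simp: Pi_def)
qed (use assms in \<open>auto dest: freeD(1)\<close>)

lemma flift_hom:
 assumes M: "lmod R M" and \<phi>: "\<phi> : I \<rightarrow> car M"
 shows "flift M R \<phi> : mhom R (freem R I) M"
proof (rule mhI)
 interpret M: left_module R M by fact
 fix f assume f: "f : car (freem R I)"
 note fc [simp] = freeD(1)[OF f]
 let ?S = "{i. f i ~= \<zero>}"
 have S: "finite ?S" "?S <= I" using f by (auto simp: free_sel)
 have \<phi>S: "\<phi> i : car M" if "i : ?S" for i using that S(2) \<phi> by blast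
 show "flift M R \<phi> f : car M"
  unfolding flift_def using \<phi>S by (intro M.finsum_closed Pi_I M.smult_closed fc)
 {
  fix g assume g: "g : car (freem R I)"
  note gc [simp] = freeD(1)[OF g]
  let ?T = "?S \<union> {i. g i ~= \<zero>}"
  have T: "finite ?T" "?T <= I" using f g by (auto simp: free_sel)
  have \<phi>T: "\<phi> i : car M" if "i : ?T" for i using that T(2) \<phi> by blast
  have fg: "f +_(freem R I) g : car (freem R I)"
   by (rule abelian_monoid.a_closed[OF abelian_group.axioms(1)[OF free_module_abelian_group] f g])
  have "flift M R \<phi> (f +_(freem R I) g) = (finsum M (%i. (f i \<oplus> g i) .*_M \<phi> i) ?T)" (is "?l = _")
   by (subst flift_superset'[OF M T(1) fg _ T(2) \<phi>]) (auto simp: free_sel(3))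
  also have "... = (finsum M (%i. f i .*_M \<phi> i +_M g i .*_M \<phi> i) ?T)"
   by (intro M.finsum_cong' refl Pi_I) (simp_all only: M.smult_l_distr M.smult_closed M.M.a_closed \<phi>T fc gc)
  also have "... = (finsum M (%i. f i .*_M \<phi> i) ?T) +_M (finsum M (%i. g i .*_M \<phi> i) ?T)"
   by (intro M.finsum_addf Pi_I M.smult_closed fc gc \<phi>T)
  finally show "?l = flift M R \<phi> f +_M flift M R \<phi> g"
   using flift_superset'[OF M T(1) f _ T(2) \<phi>] flift_superset'[OF M T(1) g _ T(2) \<phi>] by auto
 }
 fix a assume a: "a : car R"
 have af: "a .*_(freem R I) f : car (freem R I)"
  using left_module.smult_closed[OF free_left_module a f] .
 have "flift M R \<phi> (a .*_(freem R I) f) = (finsum M (%i. (a \<otimes> f i) .*_M \<phi> i) ?S)" (is "?l = _")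
  by (subst flift_superset'[OF M S(1) af _ S(2) \<phi>]) (auto simp: free_sel(4) a)
 also have "... = (finsum M (%i. a .*_M (f i .*_M \<phi> i)) ?S)"
  by (intro M.finsum_cong' refl Pi_I) (simp_all only: M.smult_assoc M.smult_closed \<phi>S fc a)
 also have "... = a .*_M flift M R \<phi> f"
  unfolding flift_def by (intro M.smult_finsum[symmetric] S a Pi_I M.smult_closed fc \<phi>S)
 finally show "?l = a .*_M flift M R \<phi> f" .
qed

lemma flift_basis:
 assumes M: "lmod R M" and \<phi>: "\<phi> : I \<rightarrow> car M" and i: "i : I"
 shows "flift M R \<phi> (free_basis R i) = \<phi> i"
proof -
 interpret M: left_module R M by fact
 have "flift M R \<phi> (free_basis R i) = (finsum M (%j. free_basis R i j .*_M \<phi> j) {i})"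
  using i by (intro flift_superset'[OF M _ basis_closed[OF i] _ _ \<phi>]) (auto simp: free_basis_def)
 also have "... = \<phi> i"
  using i \<phi> by (simp add: free_basis_def M.finsum_insert M.smult_one Pi_def)
 finally show ?thesis .
qed

lemma free_module_expand:
 assumes f: "f : car (freem R I)"
 shows "f = flift (freem R I) R (free_basis R) f"
proof -
 interpret F: left_module R "freem R I" by (rule free_left_module)
 let ?S = "{i. f i ~= \<zero>}"
 have S: "finite ?S" "?S <= I" using f by (auto simp: free_sel)
 have "flift (freem R I) R (free_basis R) f = (%i. \<Oplus>j\<in>?S. (f j .*_(freem R I) free_basis R j) i)"
  unfolding flift_def
 proof (intro free_module_finsum S Pi_I F.smult_closed)
  fix j assume "j : ?S"
  show "f j : car R" by (rule freeD(1)[OF f])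
  show "free_basis R j : car (freem R I)"
   by (rule basis_closed[OF subsetD[OF S(2) \<open>j : ?S\<close>]])
 qed
 also have "... = f"
 proof
  fix i
  have "(\<Oplus>j\<in>?S. (f j .*_(freem R I) free_basis R j) i) = (\<Oplus>j\<in>?S. if i = j then f j else \<zero>)" (is "?l = _")
   using f by (intro finsum_cong') (auto simp: free_sel(4) free_basis_def freeD)
  also have "... = f i"
  proof (cases "f i = \<zero>")
   case True
   then have "(\<Oplus>j\<in>?S. if i = j then f j else \<zero>) = (\<Oplus>j\<in>?S. \<zero>)"
    by (intro finsum_cong') auto
   then show ?thesis using True by simp
  next
   case False
   then show ?thesis using S f by (intro add.finprod_singleton) (auto simp: freeD)
  qed
  finally show "?l = f i" .
 qed
 finally show ?thesis by simp
qed

lemma free_hom_flift: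
 assumes g: "g : mhom R (freem R I) M" and M: "lmod R M"
  and f: "f : car (freem R I)"
 shows "g f = flift M R (%i. g (free_basis R i)) f"
proof -
 interpret F: left_module R "freem R I" by (rule free_left_module)
 interpret M: left_module R M by fact
 let ?S = "{i. f i ~= \<zero>}"
 have S: "finite ?S" "?S <= I" using f by (auto simp: free_sel)
 have b: "free_basis R i : car (freem R I)" if "i : ?S" for i
  by (rule basis_closed[OF subsetD[OF S(2) that]])
 note fc = freeD(1)[OF f]
 have "g f = g (finsum (freem R I) (%i. f i .*_(freem R I) free_basis R i) ?S)"
  using free_module_expand[OF f] by (simp add: flift_def)
 also have "... = (finsum M (%i. g (f i .*_(freem R I) free_basis R i)) ?S)"
  by (intro mh_finsum[OF g F.abelian_group_axioms M.abelian_group_axioms] S Pi_I F.smult_closed fc b)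
 also have "... = flift M R (%i. g (free_basis R i)) f"
  unfolding flift_def
  by (intro M.finsum_cong' refl Pi_I) (simp_all only: M.smult_closed mh_smult[OF g] mh_closed[OF g] fc b)
 finally show ?thesis .
qed

lemma free_hom_eqI:
 assumes g: "g : mhom R (freem R I) M" and h: "h : mhom R (freem R I) M"
  and M: "lmod R M" and eq: "!!i. i : I ==> g (free_basis R i) = h (free_basis R i)"
  and f: "f : car (freem R I)"
 shows "g f = h f"
proof -
 interpret M: left_module R M by fact
 have "f i .*_M h (free_basis R i) : car M & g (free_basis R i) = h (free_basis R i)"
  if "f i ~= \<zero>" for i
  using that free_module_outside[OF f] freeD(1)[OF f] basis_closed[of i I] eq[of i]
  by (metis M.smult_closed mh_closed[OF h])
 then have "flift M R (%i. g (free_basis R i)) f = flift M R (%i. h (free_basis R i)) f"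
  unfolding flift_def by (intro M.finsum_cong') auto
 then show ?thesis
  using free_hom_flift[OF g M f] free_hom_flift[OF h M f] by simp
qed

end

section \<open>Quotient modules\<close>

lemma quotient_module_sel:
 "car (quotient_module M N) = a_rcosets\<^bsub>M\<^esub> N"
 "0_(quotient_module M N) = N"
 "X +_(quotient_module M N) Y = X <+>\<^bsub>M\<^esub> Y"
 "a .*_(quotient_module M N) X = (\<Union>x\<in>X. N +>\<^bsub>M\<^esub> (a .*_M x))"
 by (simp_all add: quotient_module_def)

lemma (in left_module) submodule_abelian_subgroup: "submodule N R M ==> abelian_subgroup N M"
 using M.abelian_group_axioms submodule.axioms(1)
 by (intro abelian_subgroupI3 additive_subgroupI) auto

context abelian_subgroup
begin

lemma coset_mem_quotient: "x : car G ==> H +> x : a_rcosets H"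
 using a_rcosetsI a_subset by blast

lemma coset_cases: "X : a_rcosets H ==> (!!x. x : car G ==> X = H +> x ==> thesis) ==> thesis"
 by (auto simp: A_RCOSETS_def' )

lemma coset_eq_iff:
 assumes "x : car G" "y : car G"
 shows "H +> x = H +> y \<longleftrightarrow> x \<ominus> y : H"
 using assms a_rcos_module[of y x] a_repr_independence'[of x y] a_rcos_self[of x]
 by (auto simp: a_minus_def)

lemma coset_zero: "H +> \<zero> = H"
 by (simp add: a_rcos_const)

lemma coset_eq_zero_iff: "x : car G ==> H +> x = H \<longleftrightarrow> x : H"
 using coset_eq_iff[of x \<zero>] coset_zero by (simp add: minus_zero_right)

end

text \<open>Only the single scalar \<open>a\<close> is asked to act additively and to preserve
  \<open>N\<close>. On cohomology the scalars act through an arbitrary family of maps, so the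
  cochains are not known to form a module.\<close>

lemma quotient_smult:
 fixes M :: "('r, 'm) module"
 assumes "abelian_subgroup N M" and x: "x : car M"
  and cl: "!!x. x : car M ==> a .*_M x : car M"
  and add: "!!x y. [|x : car M; y : car M|] ==> a .*_M (x +_M y) = a .*_M x +_M a .*_M y"
  and N: "!!x. x : N ==> a .*_M x : N"
 shows "a .*_(quotient_module M N) (N +>\<^bsub>M\<^esub> x) = N +>\<^bsub>M\<^esub> (a .*_M x)"
proof -
 interpret abelian_subgroup N M by fact
 have "N +>\<^bsub>M\<^esub> (a .*_M y) = N +>\<^bsub>M\<^esub> (a .*_M x)" if y: "y : N +>\<^bsub>M\<^esub> x" for y
 proof -
  obtain n where n: "n : N" "y = n +_M x" using y by (auto simp: a_r_coset_def')
  then have "a .*_M y = a .*_M n +_M a .*_M x" using add x by simp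
  moreover have "a .*_M n +_M a .*_M x : N +>\<^bsub>M\<^esub> (a .*_M x)"
   using N[OF n(1)] by (auto simp: a_r_coset_def')
  ultimately show ?thesis using a_repr_independence'[OF _ cl[OF x]] by simp
 qed
 then have "(\<Union>y\<in>N +>\<^bsub>M\<^esub> x. N +>\<^bsub>M\<^esub> (a .*_M y)) = (\<Union>y\<in>N +>\<^bsub>M\<^esub> x. N +>\<^bsub>M\<^esub> (a .*_M x))"
  by (rule SUP_cong[OF refl])
 also have "... = N +>\<^bsub>M\<^esub> (a .*_M x)" using a_rcos_self[OF x] by blast
 finally show ?thesis by (simp only: quotient_module_sel)
qed

lemma quotient_left_module:
 fixes M' :: "('r, 'm) module"
 assumes M': "lmod R M'" and N: "submodule N R M'"
 shows "lmod R (quotient_module M' N)"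
  and "(%x. N +>\<^bsub>M'\<^esub> x) : mhom R M' (quotient_module M' N)"
proof -
 interpret M': left_module R M' by fact
 interpret N: abelian_subgroup N M' using M'.submodule_abelian_subgroup N .
 let ?Q = "quotient_module M' N"
 note sm = quotient_smult[OF N.abelian_subgroup_axioms _ M'.smult_closed M'.smult_r_distr submodule.smult_closed[OF N]]
 have car: "N +>\<^bsub>M'\<^esub> x : car ?Q" if "x : car M'" for x
  using that by (simp add: quotient_module_sel N.coset_mem_quotient)
 have ca: "EX x:car M'. X = N +>\<^bsub>M'\<^esub> x" if "X : car ?Q" for X
  using that by (auto simp: quotient_module_sel elim: N.coset_cases)
 show hom: "(%x. N +>\<^bsub>M'\<^esub> x) : mhom R M' ?Q"
  by (rule mhI) (simp_all add: car sm N.a_rcos_sum quotient_module_sel(3))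
 have add: "(N +>\<^bsub>M'\<^esub> x) +_?Q (N +>\<^bsub>M'\<^esub> y) = N +>\<^bsub>M'\<^esub> (x +_M' y)"
  if "x : car M'" "y : car M'" for x y
  using that by (simp add: N.a_rcos_sum quotient_module_sel(3))
 have z: "0_?Q = N +>\<^bsub>M'\<^esub> 0_M'" by (simp add: quotient_module_sel N.coset_zero)
 have Q: "abelian_group ?Q"
 proof (rule abelian_groupI)
  fix X Y assume "X : car ?Q" "Y : car ?Q"
  then obtain x y where xy: "x : car M'" "X = N +>\<^bsub>M'\<^esub> x" "y : car M'" "Y = N +>\<^bsub>M'\<^esub> y"
   using ca by meson
  then show "X +_?Q Y : car ?Q" "X +_?Q Y = Y +_?Q X"
   by (simp_all add: add car M'.a_comm)
  fix Z assume "Z : car ?Q"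
  then obtain z where "z : car M'" "Z = N +>\<^bsub>M'\<^esub> z" using ca by meson
  then show "(X +_?Q Y) +_?Q Z = X +_?Q (Y +_?Q Z)"
   using xy by (simp add: add M'.a_assoc)
 next
  fix X assume "X : car ?Q"
  then obtain x where x: "x : car M'" "X = N +>\<^bsub>M'\<^esub> x" using ca by blast
  then show "EX Y:car ?Q. Y +_?Q X = 0_?Q"
   by (intro bexI[of _ "N +>\<^bsub>M'\<^esub> (\<ominus>\<^bsub>M'\<^esub> x)"]) (simp_all add: add z M'.l_neg car)
  show "0_?Q +_?Q X = X" unfolding z x(2) using x(1) by (simp only: add M'.zero_closed M'.l_zero)
 next
  show "0_?Q : car ?Q" unfolding z by (rule car) simp
 qed
 show "lmod R ?Q"
 proof (rule left_moduleI)
  fix a X assume a: "a : car R" and "X : car ?Q"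
  then obtain x where x: "x : car M'" "X = N +>\<^bsub>M'\<^esub> x" using ca by blast
  with a show "a .*_?Q X : car ?Q" by (simp add: sm car M'.smult_closed)
  {
   fix b assume "b : car R"
   then show "(a +_R b) .*_?Q X = a .*_?Q X +_?Q b .*_?Q X"
    "(a *_R b) .*_?Q X = a .*_?Q (b .*_?Q X)"
    using a x by (simp_all add: sm add M'.smult_l_distr M'.smult_assoc M'.smult_closed)
  }
  fix Y assume "Y : car ?Q"
  then obtain y where y: "y : car M'" "Y = N +>\<^bsub>M'\<^esub> y" using ca by blast
  with a x show "a .*_?Q (X +_?Q Y) = a .*_?Q X +_?Q a .*_?Q Y"
   by (simp add: sm add M'.smult_r_distr M'.smult_closed)
 next
  fix X assume "X : car ?Q"
  then obtain x where x: "x : car M'" "X = N +>\<^bsub>M'\<^esub> x" using ca by blast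
  then show "1_R .*_?Q X = X" by (simp add: sm M'.smult_one)
 qed (rule M'.R.ring_axioms, rule Q)
qed

context left_module
begin

lemma submoduleI:
 assumes "N <= car M" "0_M : N" "!!x y. x : N ==> y : N ==> x +_M y : N"
  and sm: "!!a x. a : car R ==> x : N ==> a .*_M x : N"
 shows "submodule N R M"
proof -
 have "\<ominus>\<^bsub>M\<^esub> x : N" if "x : N" for x
 proof -
  have "x : car M" using that assms(1) by blast
  then have "(\<ominus>\<^bsub>R\<^esub> 1_R) .*_M x = \<ominus>\<^bsub>M\<^esub> x"
   by (simp add: smult_minus_left smult_one)
  then show ?thesis using sm[of "\<ominus>\<^bsub>R\<^esub> 1_R" x] that by simp
 qed
 then have "subgroup N (add_monoid M)"
  using assms(1,2,3) by (intro M.add.subgroupI) blast+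
 then show ?thesis using sm by (intro submodule.intro submodule_axioms.intro)
qed

end

lemma submodule_span_submodule:
 fixes M :: "('r, 'm) module"
 assumes "lmod R M" "S <= car M"
 shows "submodule (submodule_span R M S) R M"
proof -
 interpret left_module R M by fact
 have c: "submodule (car M) R M"
  by (rule submoduleI) (simp_all add: smult_closed)
 then have ne: "{N. submodule N R M & S <= N} ~= {}" using assms by blast
 have "subgroup (\<Inter>{N. submodule N R M & S <= N}) (add_monoid M)"
  using ne submodule.axioms(1) by (intro M.add.subgroups_Inter) auto
 moreover have "a .*_M x : \<Inter>{N. submodule N R M & S <= N}"
  if "a : car R" "x : \<Inter>{N. submodule N R M & S <= N}" for a x
  using that submodule.smult_closed[of _ R M a x] by blast
 ultimately show ?thesis
  unfolding submodule_span_def by (intro submodule.intro submodule_axioms.intro)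
qed

lemma submodule_span_superset: "S <= submodule_span R M S"
 by (auto simp: submodule_span_def)

lemma submodule_span_minimal: "submodule N R M ==> S <= N ==> submodule_span R M S <= N"
 by (auto simp: submodule_span_def)

lemma kernel_submodule:
 assumes M: "lmod R M" and N: "lmod R N" and f: "f : mhom R M N"
 shows "submodule {x : car M. f x = 0_N} R M"
proof -
 interpret M: left_module R M by fact
 interpret N: left_module R N by fact
 show ?thesis
  by (rule M.submoduleI)
   (simp_all add: mh_zero[OF f M.abelian_group_axioms N.abelian_group_axioms] mh_add[OF f]
    mh_smult[OF f] N.smult_zero_right M.smult_closed subset_eq)
qed

section \<open>Comparison of projective resolutions\<close>

text \<open>A lift is chosen on the basis of a free module that has \<open>P\<close> as a summand.
  Asking that \<open>g\<close> maps into the image of \<open>p\<close>, instead of surjectivity of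
  \<open>p\<close>, lets the lemma apply to the differentials of exact complexes.\<close>

lemma projective_lift:
 fixes P :: "('r, 'p) module"
 assumes P: "projective_module R P" and M: "lmod R M" and N: "lmod R N"
  and p: "p : mhom R M N" and g: "g : mhom R P N"
  and im: "!!x. x : car P ==> g x : p ` car M"
 obtains h where "h : mhom R P M" "!!x. x : car P ==> p (h x) = g x"
proof -
 interpret M: left_module R M by fact
 obtain I :: "'p set" and \<iota> \<pi> where i: "\<iota> : mhom R P (freem R I)" and pi: "\<pi> : mhom R (freem R I) P"
  and id: "!!x. x : car P ==> \<pi> (\<iota> x) = x"
  using P unfolding projective_module_def by blast
 have "EX c. c : car M & p c = g (\<pi> (free_basis R j))" if "j : I" for j
  using im[OF mh_closed[OF pi M.R.basis_closed[OF that]]] by auto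
 then obtain c where c: "!!j. j : I ==> c j : car M" "!!j. j : I ==> p (c j) = g (\<pi> (free_basis R j))"
  by metis
 have cI: "c : I \<rightarrow> car M" using c(1) by (rule Pi_I)
 note h0 = M.R.flift_hom[OF M cI]
 have eq: "p (flift M R c f) = g (\<pi> f)" if f: "f : car (freem R I)" for f
  using f by (rule M.R.free_hom_eqI[OF mh_comp[OF h0 p] mh_comp[OF pi g] N, rotated])
   (simp add: M.R.flift_basis[OF M cI] c(2))
 show thesis
 proof (rule that[of "%x. flift M R c (\<iota> x)"])
  show "(%x. flift M R c (\<iota> x)) : mhom R P M" by (rule mh_comp[OF i h0])
  fix x assume x: "x : car P"
  show "p (flift M R c (\<iota> x)) = g x" using eq[OF mh_closed[OF i x]] id[OF x] by simp
 qed
qed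

locale resolution = M?: left_module R M for R (structure) and M :: "('r, 'm) module" +
 fixes P :: "nat => ('r, 'p) module" and \<delta> :: "nat => 'p => 'p" and \<epsilon> :: "'p => 'm"
 assumes res: "projective_resolution R M P \<delta> \<epsilon>"
begin

lemma proj: "projective_module R (P n)"
 using res by (simp add: projective_resolution_def)

lemma P_module: "lmod R (P n)"
 using proj by (simp add: projective_module_def)

lemma P_group: "abelian_group (P n)"
 using P_module by (simp add: left_module_def)

lemma \<delta>_hom: "\<delta> n : mhom R (P (Suc n)) (P n)"
 using res by (simp add: projective_resolution_def)

lemma \<epsilon>_hom: "\<epsilon> : mhom R (P 0) M"
 using res by (simp add: projective_resolution_def)

lemma \<epsilon>_surj: "\<epsilon> ` car (P 0) = car M"
 using res by (simp add: projective_resolution_def)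

lemma exact_0: "\<delta> 0 ` car (P (Suc 0)) = {x : car (P 0). \<epsilon> x = 0_M}"
 using res by (simp add: projective_resolution_def)

lemma exact_Suc: "\<delta> (Suc n) ` car (P (Suc (Suc n))) = {x : car (P (Suc n)). \<delta> n x = 0_(P n)}"
 using res by (simp add: projective_resolution_def)

lemma \<epsilon>_\<delta>: "x : car (P (Suc 0)) ==> \<epsilon> (\<delta> 0 x) = 0_M"
 using exact_0 by blast

lemma \<delta>_\<delta>: "x : car (P (Suc (Suc n))) ==> \<delta> n (\<delta> (Suc n) x) = 0_(P n)"
 using exact_Suc by blast

lemma \<delta>_zero: "\<delta> n 0_(P (Suc n)) = 0_(P n)"
 by (rule mh_zero[OF \<delta>_hom P_group P_group])

end

lemma resolution_chain_map:
 assumes "resolution R M P \<delta> \<epsilon>" and "resolution R M C \<gamma> \<eta>"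
 obtains u where "!!n. u n : mhom R (P n) (C n)" "!!x. x : car (P 0) ==> \<eta> (u 0 x) = \<epsilon> x"
  "!!n x. x : car (P (Suc n)) ==> \<gamma> n (u (Suc n) x) = u n (\<delta> n x)"
proof -
 interpret P: resolution R M P \<delta> \<epsilon> by fact
 interpret C: resolution R M C \<gamma> \<eta> by fact
 \<comment> \<open>The last clause makes the next lifting problem solvable, so dependent choice may
   forget all maps but the current one.\<close>
 let ?A = "%n u. u : mhom R (P n) (C n) & (n = 0 --> (ALL x:car (P 0). \<eta> (u x) = \<epsilon> x)) &
  (ALL x:car (P (Suc n)). u (\<delta> n x) : \<gamma> n ` car (C (Suc n)))"
 let ?Q = "%n u u'. ALL x:car (P (Suc n)). \<gamma> n (u' x) = u (\<delta> n x)"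
 have "EX u. ALL n. ?A n (u n) & ?Q n (u n) (u (Suc n))"
 proof (rule dependent_nat_choice)
  have im: "\<epsilon> x : \<eta> ` car (C 0)" if "x : car (P 0)" for x
   using mh_closed[OF P.\<epsilon>_hom that] C.\<epsilon>_surj by simp
  obtain u where u: "u : mhom R (P 0) (C 0)" "!!x. x : car (P 0) ==> \<eta> (u x) = \<epsilon> x"
   using projective_lift[OF P.proj C.P_module P.left_module_axioms C.\<epsilon>_hom P.\<epsilon>_hom im] by metis
  have "u (\<delta> 0 x) : \<gamma> 0 ` car (C (Suc 0))" if x: "x : car (P (Suc 0))" for x
   using u(2)[OF mh_closed[OF P.\<delta>_hom x]] P.\<epsilon>_\<delta>[OF x]
    mh_closed[OF u(1) mh_closed[OF P.\<delta>_hom x]]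
   by (simp add: C.exact_0)
  with u show "EX u. ?A 0 u" by blast
 next
  fix u n assume A: "?A n u"
  then have uh: "u : mhom R (P n) (C n)" by blast
  have im: "u (\<delta> n x) : \<gamma> n ` car (C (Suc n))" if "x : car (P (Suc n))" for x
   using A that by blast
  obtain u' where u': "u' : mhom R (P (Suc n)) (C (Suc n))"
   "!!x. x : car (P (Suc n)) ==> \<gamma> n (u' x) = u (\<delta> n x)"
   using projective_lift[OF P.proj C.P_module C.P_module C.\<delta>_hom mh_comp[OF P.\<delta>_hom uh] im]
   by metis
  have "u' (\<delta> (Suc n) x) : \<gamma> (Suc n) ` car (C (Suc (Suc n)))" if x: "x : car (P (Suc (Suc n)))" for x
  proof -
   note dx = mh_closed[OF P.\<delta>_hom x]
   have "\<gamma> n (u' (\<delta> (Suc n) x)) = 0_(C n)"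
    using u'(2)[OF dx] P.\<delta>_\<delta>[OF x] mh_zero[OF uh P.P_group C.P_group] by simp
   then show ?thesis using mh_closed[OF u'(1) dx] by (simp add: C.exact_Suc)
  qed
  with u' show "EX u'. ?A (Suc n) u' & ?Q n u u'" by blast
 qed
 then obtain u where "!!n. ?A n (u n) & ?Q n (u n) (u (Suc n))" by blast
 then show thesis using that[of u] by blast
qed

lemma resolution_null_homotopy:
 assumes "resolution R M P \<delta> \<epsilon>" and "resolution R M C \<gamma> \<eta>"
  and w: "!!n. w n : mhom R (P n) (C n)"
  and w0: "!!x. x : car (P 0) ==> \<eta> (w 0 x) = 0_M"
  and wS: "!!n x. x : car (P (Suc n)) ==> \<gamma> n (w (Suc n) x) = w n (\<delta> n x)"
 obtains h where "!!n. h n : mhom R (P n) (C (Suc n))"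
  "!!x. x : car (P 0) ==> \<gamma> 0 (h 0 x) = w 0 x"
  "!!n x. x : car (P (Suc n)) ==> \<gamma> (Suc n) (h (Suc n) x) = w (Suc n) x -_(C (Suc n)) h n (\<delta> n x)"
proof -
 interpret P: resolution R M P \<delta> \<epsilon> by fact
 interpret C: resolution R M C \<gamma> \<eta> by fact
 \<comment> \<open>Again the last clause is the solvability of the next lifting problem;
   \<open>?Q\<close> is the homotopy identity \<gamma> h = w - h \<delta>.\<close>
 let ?A = "%n h. h : mhom R (P n) (C (Suc n)) & (n = 0 --> (ALL x:car (P 0). \<gamma> 0 (h x) = w 0 x)) &
  (ALL x:car (P (Suc n)). w (Suc n) x -_(C (Suc n)) h (\<delta> n x) : \<gamma> (Suc n) ` car (C (Suc (Suc n))))"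
 let ?Q = "%n h h'. ALL x:car (P (Suc n)). \<gamma> (Suc n) (h' x) = w (Suc n) x -_(C (Suc n)) h (\<delta> n x)"
 have "EX h. ALL n. ?A n (h n) & ?Q n (h n) (h (Suc n))"
 proof (rule dependent_nat_choice)
  have im: "w 0 x : \<gamma> 0 ` car (C (Suc 0))" if "x : car (P 0)" for x
   using mh_closed[OF w that] w0[OF that] by (simp add: C.exact_0)
  obtain h where h: "h : mhom R (P 0) (C (Suc 0))" "!!x. x : car (P 0) ==> \<gamma> 0 (h x) = w 0 x"
   using projective_lift[OF P.proj C.P_module C.P_module C.\<delta>_hom w im] by metis
  have "w (Suc 0) x -_(C (Suc 0)) h (\<delta> 0 x) : \<gamma> (Suc 0) ` car (C (Suc (Suc 0)))"
   if x: "x : car (P (Suc 0))" for x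
  proof -
   interpret C1: abelian_group "C (Suc 0)" by (rule C.P_group)
   interpret C0: abelian_group "C 0" by (rule C.P_group)
   note dx = mh_closed[OF P.\<delta>_hom x]
   note cl = mh_closed[OF w x] mh_closed[OF h(1) dx]
   have "\<gamma> 0 (w (Suc 0) x -_(C (Suc 0)) h (\<delta> 0 x)) = 0_(C 0)"
    using mh_diff[OF C.\<delta>_hom C.P_group C.P_group cl] wS[OF x] h(2)[OF dx]
     C0.minus_self[OF mh_closed[OF w dx]] by simp
   then show ?thesis using cl by (simp add: C.exact_Suc)
  qed
  with h show "EX h. ?A 0 h" by blast
 next
  fix h n assume A: "?A n h"
  then have hh: "h : mhom R (P n) (C (Suc n))" by blast
  interpret C1: abelian_group "C (Suc n)" by (rule C.P_group)
  interpret C2: abelian_group "C (Suc (Suc n))" by (rule C.P_group)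
  have im: "w (Suc n) x -_(C (Suc n)) h (\<delta> n x) : \<gamma> (Suc n) ` car (C (Suc (Suc n)))"
   if "x : car (P (Suc n))" for x using A that by blast
  obtain h' where h': "h' : mhom R (P (Suc n)) (C (Suc (Suc n)))"
   "!!x. x : car (P (Suc n)) ==> \<gamma> (Suc n) (h' x) = w (Suc n) x -_(C (Suc n)) h (\<delta> n x)"
   using projective_lift[OF P.proj C.P_module C.P_module C.\<delta>_hom
     mh_minus[OF w mh_comp[OF P.\<delta>_hom hh] C.P_module] im]
   by metis
  have "w (Suc (Suc n)) x -_(C (Suc (Suc n))) h' (\<delta> (Suc n) x)
    : \<gamma> (Suc (Suc n)) ` car (C (Suc (Suc (Suc n))))" if x: "x : car (P (Suc (Suc n)))" for x
  proof -
   note dx = mh_closed[OF P.\<delta>_hom x]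
   note cl = mh_closed[OF w x] mh_closed[OF h'(1) dx]
   have "\<gamma> (Suc n) (w (Suc (Suc n)) x -_(C (Suc (Suc n))) h' (\<delta> (Suc n) x)) =
    w (Suc n) (\<delta> (Suc n) x) -_(C (Suc n)) (w (Suc n) (\<delta> (Suc n) x) -_(C (Suc n)) h (\<delta> n (\<delta> (Suc n) x)))"
    using mh_diff[OF C.\<delta>_hom C.P_group C.P_group cl] wS[OF x] h'(2)[OF dx] by simp
   also have "... = 0_(C (Suc n))"
    using P.\<delta>_\<delta>[OF x] mh_zero[OF hh P.P_group C.P_group] mh_closed[OF w dx]
    by (simp add: C1.minus_self C1.minus_zero_right)
   finally show ?thesis using cl by (simp add: C.exact_Suc)
  qed
  with h' show "EX h'. ?A (Suc n) h' & ?Q n h h'" by blast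
 qed
 then obtain h where "!!n. ?A n (h n) & ?Q n (h n) (h (Suc n))" by blast
 then show thesis using that[of h] by blast
qed

text \<open>
 The cohomology in degree \<open>n\<close> is generated by the class of \<open>z\<close>, freely over the operators \<open>act s\<close>
 with \<open>s \<in> S\<close>.
\<close>

definition coh_free ::
  "('r, 'y) ring_scheme => (nat => ('r, 'p) module) => (nat => 'p => 'p) => ('r, 'n) module =>
   nat => 's set => ('s => 'n => 'n) => ('p => 'n) => bool" where
 "coh_free R P \<delta> N n S act z \<longleftrightarrow> z : cocs R P \<delta> N n &
  (ALL f:cocs R P \<delta> N n. EX! s. s : S &
   (\<lambda>x\<in>car (P n). f x -_N act s (z x)) : cobs R P \<delta> N n)"

section \<open>Cocycles and coboundaries under chain maps, and independence of the
  resolution\<close>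

context resolution
begin

context
 fixes N :: "('r, 'n) module"
 assumes N: "lmod R N"
begin

interpretation N: left_module R N by (rule N)

lemma cocyclesD:
 assumes "f : cocs R P \<delta> N n"
 shows "f : mhom R (P n) N" "f : extensional (car (P n))"
  "!!x. x : car (P (Suc n)) ==> f (\<delta> n x) = 0_N"
 using assms by (auto simp: cocycles_def)

lemma cocyclesI:
 assumes f: "f : mhom R (P n) N" and "!!x. x : car (P (Suc n)) ==> f (\<delta> n x) = 0_N"
 shows "restrict f (car (P n)) : cocs R P \<delta> N n"
 using mh_cong[OF f _ P_module, of "restrict f (car (P n))"] assms(2)
  mh_closed[OF \<delta>_hom]
 by (auto simp: cocycles_def)

lemma coboundaries_zero: "(\<lambda>x\<in>car (P n). 0_N) : cobs R P \<delta> N n"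
proof (cases n)
 case (Suc m)
 have "EX g. (\<lambda>x\<in>car (P (Suc m)). 0_N) = (\<lambda>x\<in>car (P (Suc m)). g (\<delta> m x)) & g : mhom R (P m) N"
  by (rule exI[of _ "%x. 0_N"]) (simp add: mh_const_zero[OF N])
 then show ?thesis by (auto simp: coboundaries_def Suc)
qed (simp add: coboundaries_def)

lemma coboundaries_cases:
 assumes "b : cobs R P \<delta> N n"
 obtains "n = 0" "b = (\<lambda>x\<in>car (P 0). 0_N)"
  | m g where "n = Suc m" "g : mhom R (P m) N" "b = (\<lambda>x\<in>car (P (Suc m)). g (\<delta> m x))"
 using assms by (cases n) (auto simp: coboundaries_def)

lemma coboundaries_SucI:
 "g : mhom R (P m) N ==> (\<lambda>x\<in>car (P (Suc m)). g (\<delta> m x)) : cobs R P \<delta> N (Suc m)"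
 by (auto simp: coboundaries_def)

lemma coboundaries_cocycles: "cobs R P \<delta> N n <= cocs R P \<delta> N n"
proof
 fix b assume "b : cobs R P \<delta> N n"
 then show "b : cocs R P \<delta> N n"
 proof (cases rule: coboundaries_cases)
  case 1
  show ?thesis unfolding 1 by (rule cocyclesI[OF mh_const_zero[OF N]]) simp
 next
  case (2 m g)
  show ?thesis unfolding 2
  proof (rule cocyclesI[OF mh_comp[OF \<delta>_hom 2(2)]])
   fix x assume "x : car (P (Suc (Suc m)))"
   then show "g (\<delta> m (\<delta> (Suc m) x)) = 0_N"
    using \<delta>_\<delta> mh_zero[OF 2(2) P_group N.abelian_group_axioms] by simp
  qed
 qed
qed

lemma coboundaries_minus:
 assumes "b : cobs R P \<delta> N n" and "b' : cobs R P \<delta> N n"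
 shows "(\<lambda>x\<in>car (P n). b x -_N b' x) : cobs R P \<delta> N n"
 using assms(1)
proof (cases rule: coboundaries_cases)
 case 1
 with assms(2) show ?thesis by (auto simp: coboundaries_def N.minus_self cong: restrict_cong)
next
 case (2 m g)
 then obtain g' where g': "g' : mhom R (P m) N" "b' = (\<lambda>x\<in>car (P (Suc m)). g' (\<delta> m x))"
  using assms(2) by (auto simp: coboundaries_def)
 have "(\<lambda>x\<in>car (P n). b x -_N b' x) = (\<lambda>x\<in>car (P (Suc m)). g (\<delta> m x) -_N g' (\<delta> m x))"
  unfolding 2 g' by (rule restrict_ext) simp
 then show ?thesis using coboundaries_SucI[OF mh_minus[OF 2(2) g'(1) N]] 2(1) by simp
qed

lemma coboundaries_image:
 assumes "b : cobs R P \<delta> N n" and a: "a : mhom R N N"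
 shows "(\<lambda>x\<in>car (P n). a (b x)) : cobs R P \<delta> N n"
 using assms(1)
proof (cases rule: coboundaries_cases)
 case 1
 have "a 0_N = 0_N"
  by (rule mh_zero[OF a N.abelian_group_axioms N.abelian_group_axioms])
 with 1 show ?thesis by (auto simp: coboundaries_def cong: restrict_cong)
next
 case (2 m g)
 have "(\<lambda>x\<in>car (P n). a (b x)) = (\<lambda>x\<in>car (P (Suc m)). a (g (\<delta> m x)))"
  unfolding 2 by (rule restrict_ext) simp
 then show ?thesis using coboundaries_SucI[OF mh_comp[OF 2(2) a]] 2(1) by simp
qed

lemma coboundaries_pullback:
 assumes "resolution R M C \<gamma> \<eta>" and u: "!!n. u n : mhom R (C n) (P n)"
  and uS: "!!n x. x : car (C (Suc n)) ==> \<delta> n (u (Suc n) x) = u n (\<gamma> n x)"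
  and "b : cobs R P \<delta> N n"
 shows "(\<lambda>x\<in>car (C n). b (u n x)) : cobs R C \<gamma> N n"
 using assms(4)
proof (cases rule: coboundaries_cases)
 case 1
 then show ?thesis using mh_closed[OF u] by (auto simp: coboundaries_def cong: restrict_cong)
next
 case (2 m g)
 have "(\<lambda>x\<in>car (C n). b (u n x)) = (\<lambda>x\<in>car (C (Suc m)). g (u m (\<gamma> m x)))"
  unfolding 2 by (rule restrict_ext) (simp add: mh_closed[OF u] uS)
 then show ?thesis
  using mh_comp[OF u 2(2)] 2(1) by (auto simp: coboundaries_def)
qed

lemma cocycles_pullback:
 assumes C: "resolution R M C \<gamma> \<eta>" and u: "!!n. u n : mhom R (C n) (P n)"
  and uS: "!!n x. x : car (C (Suc n)) ==> \<delta> n (u (Suc n) x) = u n (\<gamma> n x)"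
  and f: "f : cocs R P \<delta> N n"
 shows "(\<lambda>x\<in>car (C n). f (u n x)) : cocs R C \<gamma> N n"
proof -
 interpret C: resolution R M C \<gamma> \<eta> by fact
 have "f (u n (\<gamma> n x)) = 0_N" if "x : car (C (Suc n))" for x
  using cocyclesD(3)[OF f mh_closed[OF u that]] uS[OF that] by simp
 then have "restrict (%x. f (u n x)) (car (C n)) : cocs R C \<gamma> N n"
  using mh_cong[OF mh_comp[OF u cocyclesD(1)[OF f]] _ C.P_module, of "restrict (%x. f (u n x)) (car (C n))"]
   mh_closed[OF C.\<delta>_hom]
  by (auto simp: cocycles_def)
 then show ?thesis by simp
qed

end

text \<open>Both \<open>w\<close> and the identity lift the identity of \<open>M\<close>, so w - id
  = \<delta> h + h \<delta>. A cocycle kills the first summand and turns the second, which is absent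
  in degree 0, into a coboundary.\<close>

lemma homotopic_cocycle:
 assumes N: "lmod R N" and w: "!!n. w n : mhom R (P n) (P n)"
  and w0: "!!x. x : car (P 0) ==> \<epsilon> (w 0 x) = \<epsilon> x"
  and wS: "!!n x. x : car (P (Suc n)) ==> \<delta> n (w (Suc n) x) = w n (\<delta> n x)"
  and f: "f : cocs R P \<delta> N n"
 shows "(\<lambda>x\<in>car (P n). f (w n x) -_N f x) : cobs R P \<delta> N n"
proof -
 interpret N: left_module R N by fact
 have ag: "abelian_group (P n)" for n by (rule P_group)
 define v where "v n x = w n x -_(P n) x" for n x
 have v: "v n : mhom R (P n) (P n)" for n
  unfolding v_def by (rule mh_minus[OF w mh_id P_module])
 have v0: "\<epsilon> (v 0 x) = 0_M" if "x : car (P 0)" for x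
  using mh_diff[OF \<epsilon>_hom ag M.abelian_group_axioms mh_closed[OF w that] that] w0[OF that]
   M.minus_self[OF mh_closed[OF \<epsilon>_hom that]] by (simp add: v_def)
 have vS: "\<delta> n (v (Suc n) x) = v n (\<delta> n x)" if "x : car (P (Suc n))" for n x
  using mh_diff[OF \<delta>_hom ag ag mh_closed[OF w that] that] wS[OF that] by (simp add: v_def)
 obtain h where h: "!!n. h n : mhom R (P n) (P (Suc n))"
  and h0: "!!x. x : car (P 0) ==> \<delta> 0 (h 0 x) = v 0 x"
  and hS: "!!n x. x : car (P (Suc n)) ==> \<delta> (Suc n) (h (Suc n) x) = v (Suc n) x -_(P (Suc n)) h n (\<delta> n x)"
  using resolution_null_homotopy[OF resolution_axioms resolution_axioms v v0 vS] by metis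
 note fD = cocyclesD[OF N f]
 have fv: "f (w n x) -_N f x = f (v n x)" if "x : car (P n)" for x
  using mh_diff[OF fD(1) ag N.abelian_group_axioms mh_closed[OF w that] that]
  by (simp add: v_def)
 show ?thesis
 proof (cases n)
  case 0
  have "f (v 0 x) = 0_N" if "x : car (P 0)" for x
   using fD(3)[unfolded 0, OF mh_closed[OF h that]] h0[OF that] by simp
  then have "(\<lambda>x\<in>car (P n). f (w n x) -_N f x) = (\<lambda>x\<in>car (P n). 0_N)"
   using fv unfolding 0 by (intro restrict_ext) simp
  then show ?thesis using coboundaries_zero[OF N] by simp
 next
  case (Suc m)
  note fD' = fD[unfolded Suc]
  have "f (v (Suc m) x) = f (h m (\<delta> m x))" if x: "x : car (P (Suc m))" for x
  proof -
   note cl = mh_closed[OF v x] mh_closed[OF h mh_closed[OF \<delta>_hom x]]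
   have "0_N = f (v (Suc m) x -_(P (Suc m)) h m (\<delta> m x))"
    using fD'(3)[OF mh_closed[OF h x]] hS[OF x] by simp
   also have "... = f (v (Suc m) x) -_N f (h m (\<delta> m x))"
    by (rule mh_diff[OF fD'(1) ag N.abelian_group_axioms cl])
   finally show ?thesis
    using N.minus_eq_zero_iff[OF mh_closed[OF fD'(1) cl(1)] mh_closed[OF fD'(1) cl(2)]] by simp
  qed
  then have "(\<lambda>x\<in>car (P n). f (w n x) -_N f x) = (\<lambda>x\<in>car (P (Suc m)). f (h m (\<delta> m x)))"
   using fv unfolding Suc by (intro restrict_ext) simp
  then show ?thesis using coboundaries_SucI[OF N mh_comp[OF h fD'(1)]] Suc by simp
 qed
qed

end

text \<open>Cochains are pulled back along comparison maps \<open>u\<close> and \<open>v\<close>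
  that are inverse to each other up to homotopy. The transport \<open>T\<close> depends neither on
  \<open>S\<close> nor on \<open>act\<close>, so a class that is a free generator for two different
  actions stays one common generator.\<close>

lemma resolution_independence:
 assumes P: "resolution R M P \<delta> \<epsilon>" and C: "resolution R M C \<gamma> \<eta>" and N: "lmod R N"
 obtains T where
  "!!n. exact_at R P \<delta> N n ==> exact_at R C \<gamma> N n"
  "!!n (S :: 's set) act z. (!!s. s : S ==> act s : mhom R N N) ==>
   coh_free R P \<delta> N n S act z ==> coh_free R C \<gamma> N n S act (T n z)"
proof -
 interpret P: resolution R M P \<delta> \<epsilon> by fact
 interpret C: resolution R M C \<gamma> \<eta> by fact
 interpret N: left_module R N by fact
 obtain u where u: "!!n. u n : mhom R (C n) (P n)" "!!x. x : car (C 0) ==> \<epsilon> (u 0 x) = \<eta> x"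
  "!!n x. x : car (C (Suc n)) ==> \<delta> n (u (Suc n) x) = u n (\<gamma> n x)"
  using resolution_chain_map[OF C P] by metis
 obtain v where v: "!!n. v n : mhom R (P n) (C n)" "!!x. x : car (P 0) ==> \<eta> (v 0 x) = \<epsilon> x"
  "!!n x. x : car (P (Suc n)) ==> \<gamma> n (v (Suc n) x) = v n (\<delta> n x)"
  using resolution_chain_map[OF P C] by metis
 note uc = mh_closed[OF u(1)] and vc = mh_closed[OF v(1)]
 have vu: "(\<lambda>x\<in>car (C n). f (v n (u n x)) -_N f x) : cobs R C \<gamma> N n"
  if "f : cocs R C \<gamma> N n" for f n
  by (rule C.homotopic_cocycle[OF N mh_comp[OF u(1) v(1)] _ _ that])
   (simp_all add: u v uc)
 have uv: "(\<lambda>x\<in>car (P n). f (u n (v n x)) -_N f x) : cobs R P \<delta> N n"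
  if "f : cocs R P \<delta> N n" for f n
  by (rule P.homotopic_cocycle[OF N mh_comp[OF v(1) u(1)] _ _ that])
   (simp_all add: u v vc)
 show thesis
 proof (rule that[of "%n z. \<lambda>x\<in>car (C n). z (u n x)"])
  fix n assume PB: "exact_at R P \<delta> N n"
  show "exact_at R C \<gamma> N n"
  proof
   fix f assume f: "f : cocs R C \<gamma> N n"
   note fc = mh_closed[OF C.cocyclesD(1)[OF N f]]
   have "(\<lambda>x\<in>car (P n). f (v n x)) : cobs R P \<delta> N n"
    using C.cocycles_pullback[OF N P v(1,3) f] PB by blast
   from P.coboundaries_pullback[OF N C u(1,3) this]
   have "(\<lambda>x\<in>car (C n). f (v n (u n x))) : cobs R C \<gamma> N n"
    by (simp add: uc cong: restrict_cong)
   from C.coboundaries_minus[OF N this vu[OF f]]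
   have "(\<lambda>x\<in>car (C n). f (v n (u n x)) -_N (f (v n (u n x)) -_N f x)) : cobs R C \<gamma> N n"
    by (simp cong: restrict_cong)
   moreover have "(\<lambda>x\<in>car (C n). f (v n (u n x)) -_N (f (v n (u n x)) -_N f x)) = restrict f (car (C n))"
    by (rule restrict_ext) (simp add: N.minus_minus_cancel_left fc uc vc)
   ultimately show "f : cobs R C \<gamma> N n"
    using C.cocyclesD(2)[OF N f] by (simp add: extensional_restrict)
  qed
 next
  fix n and S :: "'s set" and act z
  assume act: "!!s. s : S ==> act s : mhom R N N"
   and free: "coh_free R P \<delta> N n S act z"
  then have z: "z : cocs R P \<delta> N n" by (simp add: coh_free_def)
  note zc = mh_closed[OF P.cocyclesD(1)[OF N z]]
  have ac: "act s y : car N" if "s : S" "y : car N" for s y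
   using mh_closed[OF act[OF that(1)] that(2)] .
  show "coh_free R C \<gamma> N n S act (\<lambda>x\<in>car (C n). z (u n x))"
   unfolding coh_free_def
  proof (intro conjI ballI)
   show "(\<lambda>x\<in>car (C n). z (u n x)) : cocs R C \<gamma> N n"
    by (rule P.cocycles_pullback[OF N C u(1,3) z])
   fix f assume f: "f : cocs R C \<gamma> N n"
   note fc = mh_closed[OF C.cocyclesD(1)[OF N f]]
   let ?g = "\<lambda>x\<in>car (P n). f (v n x)"
   have g: "?g : cocs R P \<delta> N n" by (rule C.cocycles_pullback[OF N P v(1,3) f])
   \<comment> \<open>For every \<open>s\<close> the two conditions are equivalent, so existence and
     uniqueness of \<open>s\<close> pass over together.\<close>
   have iff: "(\<lambda>x\<in>car (C n). f x -_N act s ((\<lambda>x\<in>car (C n). z (u n x)) x)) : cobs R C \<gamma> N n \<longleftrightarrow>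
     (\<lambda>x\<in>car (P n). ?g x -_N act s (z x)) : cobs R P \<delta> N n" if s: "s : S" for s
   proof
    assume "(\<lambda>x\<in>car (P n). ?g x -_N act s (z x)) : cobs R P \<delta> N n"
    from P.coboundaries_pullback[OF N C u(1,3) this]
    have "(\<lambda>x\<in>car (C n). f (v n (u n x)) -_N act s (z (u n x))) : cobs R C \<gamma> N n"
     by (simp add: uc cong: restrict_cong)
    from C.coboundaries_minus[OF N this vu[OF f]]
    have 1: "(\<lambda>x\<in>car (C n). (f (v n (u n x)) -_N act s (z (u n x))) -_N (f (v n (u n x)) -_N f x)) : cobs R C \<gamma> N n"
     by (simp cong: restrict_cong)
    have ab: "(a -_N b) -_N (a -_N c) = c -_N b" if "a : car N" "b : car N" "c : car N" for a b c
     using that by (metis N.M.a_comm N.M.add.inv_closed N.M.minus_closed N.M.minus_minus_cancel N.M.minus_swap a_minus_def)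
    have "(\<lambda>x\<in>car (C n). f x -_N act s ((\<lambda>x\<in>car (C n). z (u n x)) x)) =
     (\<lambda>x\<in>car (C n). (f (v n (u n x)) -_N act s (z (u n x))) -_N (f (v n (u n x)) -_N f x))"
     by (rule restrict_ext) (simp add: ab fc uc vc zc ac s)
    with 1 show "(\<lambda>x\<in>car (C n). f x -_N act s ((\<lambda>x\<in>car (C n). z (u n x)) x)) : cobs R C \<gamma> N n"
     by simp
   next
    assume "(\<lambda>x\<in>car (C n). f x -_N act s ((\<lambda>x\<in>car (C n). z (u n x)) x)) : cobs R C \<gamma> N n"
    from C.coboundaries_pullback[OF N P v(1,3) this]
    have a: "(\<lambda>x\<in>car (P n). f (v n x) -_N act s (z (u n (v n x)))) : cobs R P \<delta> N n"
     by (simp add: vc cong: restrict_cong)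
    \<comment> \<open>The homotopy is applied to \<open>z\<close>; as \<open>act s\<close> is a
      module map, it takes the resulting coboundary to a coboundary.\<close>
    have "(\<lambda>x\<in>car (P n). act s (z (u n (v n x)) -_N z x)) : cobs R P \<delta> N n"
     using P.coboundaries_image[OF N uv[OF z] act[OF s]] by (simp cong: restrict_cong)
    from P.coboundaries_minus[OF N P.coboundaries_zero[OF N] this]
    have "(\<lambda>x\<in>car (P n). 0_N -_N act s (z (u n (v n x)) -_N z x)) : cobs R P \<delta> N n"
     by (simp cong: restrict_cong)
    from P.coboundaries_minus[OF N a this]
    have 1: "(\<lambda>x\<in>car (P n). (f (v n x) -_N act s (z (u n (v n x)))) -_N (0_N -_N act s (z (u n (v n x)) -_N z x)))
     : cobs R P \<delta> N n"
     by (simp cong: restrict_cong)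
    have ab: "(a -_N b) -_N (0_N -_N (b -_N c)) = a -_N c" if "a : car N" "b : car N" "c : car N" for a b c
    proof -
     have "(a -_N b) -_N (0_N -_N (b -_N c)) = (a -_N b) +_N (b -_N c)"
      using that by (simp add: a_minus_def N.M.minus_add)
     then show ?thesis using that N.M.minus_minus_cancel by simp
    qed
    have "(\<lambda>x\<in>car (P n). ?g x -_N act s (z x)) = (\<lambda>x\<in>car (P n). (f (v n x) -_N act s (z (u n (v n x)))) -_N (0_N -_N act s (z (u n (v n x)) -_N z x)))"
     by (rule restrict_ext)
      (simp add: mh_diff[OF act[OF s] N.abelian_group_axioms N.abelian_group_axioms] ab fc uc vc zc ac s)
    with 1 show "(\<lambda>x\<in>car (P n). ?g x -_N act s (z x)) : cobs R P \<delta> N n" by simp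
   qed
   have "EX! s. s : S & (\<lambda>x\<in>car (P n). ?g x -_N act s (z x)) : cobs R P \<delta> N n"
    using free g unfolding coh_free_def by blast
   then show "EX! s. s : S & (\<lambda>x\<in>car (C n). f x -_N act s ((\<lambda>x\<in>car (C n). z (u n x)) x))
     : cobs R C \<gamma> N n"
    by (simp only: conj_cong[OF refl iff])
  qed
 qed
qed

section \<open>Complexes of finitely generated projective modules as idempotent matrices\<close>

text \<open>Row times matrix. Writing maps of left modules on the right of rows keeps the factors in
  the correct order over a noncommutative ring.\<close>

definition mrow :: "('r, 'z) ring_scheme => 'i set => ('i => 'i => 'r) => ('i => 'r) => 'i => 'r" where
 "mrow R I D x = (%j. \<Oplus>\<^bsub>R\<^esub>i\<in>I. x i *_R D i j)"

abbreviation rows :: "('r, 'z) ring_scheme => 'i set => ('i => 'r) set" where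
 "rows R I == car (freem R I)"

context ring
begin

lemma rowsI:
 assumes "finite I" "!!i. i : I ==> x i : car R" "!!i. i ~: I ==> x i = \<zero>"
 shows "x : rows R I"
proof (rule free_moduleI[of I])
 show "x i : car R" for i using assms(2,3)[of i] by (cases "i : I") simp_all
qed (use assms in auto)

lemma rows_add:
 assumes "x : rows R I" "y : rows R I"
 shows "(%i. x i \<oplus> y i) : rows R I"
 using abelian_monoid.a_closed[OF abelian_group.axioms(1)[OF free_module_abelian_group] assms]
 by (simp add: free_sel(3))

lemma rows_minus:
 assumes "x : rows R I" "y : rows R I"
 shows "(%i. x i \<ominus> y i) : rows R I"
 using abelian_group.minus_closed[OF free_module_abelian_group assms] by (simp add: free_module_minus assms)

lemma rows_smult:
 assumes "a : car R" "x : rows R I"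
 shows "(%i. a \<otimes> x i) : rows R I"
 using left_module.smult_closed[OF free_left_module assms] by (simp add: free_sel(4))

lemma rows_zero: "(%i. \<zero>) : rows R I"
 using abelian_monoid.zero_closed[OF abelian_group.axioms(1)[OF free_module_abelian_group]]
 by (simp add: free_sel(2))

lemma mrow_cong: "(!!i j. i : I ==> D i j = D' i j) ==> (!!i. i : I ==> x i : car R) ==>
 (!!i j. i : I ==> D' i j : car R) ==> mrow R I D x = mrow R I D' x"
 unfolding mrow_def by (intro ext finsum_cong') auto

lemma mrow_flift:
 assumes I: "finite I" and D: "D : I \<rightarrow> rows R J" and x: "x : rows R I"
 shows "mrow R I D x = flift (freem R J) R D x"
proof -
 have "flift (freem R J) R D x = (finsum (freem R J) (%i. x i .*_(freem R J) D i) I)"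
  using x by (intro flift_superset'[OF free_left_module I x _ _ D]) (auto simp: free_sel)
 also have "... = (%j. \<Oplus>i\<in>I. (x i .*_(freem R J) D i) j)"
  using freeD(1)[OF x] D
  by (intro free_module_finsum I Pi_I left_module.smult_closed[OF free_left_module]) auto
 finally show ?thesis by (simp add: mrow_def free_sel(4))
qed

lemma mrow_hom:
 assumes "finite I" "D : I \<rightarrow> rows R J"
 shows "mrow R I D : mhom R (freem R I) (freem R J)"
 by (rule mh_cong[OF flift_hom[OF free_left_module assms(2)] mrow_flift[OF assms] free_left_module])

lemma mrow_closed: "finite I ==> D : I \<rightarrow> rows R J ==> x : rows R I ==> mrow R I D x : rows R J"
 by (rule mh_closed[OF mrow_hom])

lemma mrow_basis: "finite I ==> D : I \<rightarrow> rows R J ==> i : I ==> mrow R I D (free_basis R i) = D i"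
 by (simp add: mrow_flift basis_closed flift_basis[OF free_left_module])

lemma hom_mrow:
 assumes I: "finite I" and g: "g : mhom R (freem R I) (freem R J)" and x: "x : rows R I"
 shows "g x = mrow R I (%i. g (free_basis R i)) x"
proof -
 have "(%i. g (free_basis R i)) : I \<rightarrow> rows R J"
  using mh_closed[OF g basis_closed] by blast
 then show ?thesis using free_hom_flift[OF g free_left_module x] mrow_flift[OF I _ x] by metis
qed

lemma mrow_comp:
 assumes I: "finite I" and J: "finite J" and D: "D : I \<rightarrow> rows R J" and D': "D' : J \<rightarrow> rows R L"
  and x: "x : rows R I"
 shows "mrow R J D' (mrow R I D x) = mrow R I (%i. mrow R J D' (D i)) x"
proof -
 have "mrow R J D' (mrow R I D x) = mrow R I (%i. mrow R J D' (mrow R I D (free_basis R i))) x"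
  by (rule hom_mrow[OF I mh_comp[OF mrow_hom[OF I D] mrow_hom[OF J D']] x])
 also have "... = mrow R I (%i. mrow R J D' (D i)) x"
  using mrow_basis[OF I D] freeD(1)[OF mrow_closed[OF J D' funcset_mem[OF D]]] freeD(1)[OF x]
  by (intro mrow_cong) simp_all
 finally show ?thesis .
qed

lemma mrow_add:
 assumes "finite I" "D : I \<rightarrow> rows R J" "x : rows R I" "y : rows R I"
 shows "mrow R I D (%i. x i \<oplus> y i) = (%i. mrow R I D x i \<oplus> mrow R I D y i)"
 using mh_add[OF mrow_hom[OF assms(1,2)] assms(3,4)] by (simp add: free_sel(3))

lemma mrow_minus:
 assumes "finite I" "D : I \<rightarrow> rows R J" "x : rows R I" "y : rows R I"
 shows "mrow R I D (%i. x i \<ominus> y i) = (%i. mrow R I D x i \<ominus> mrow R I D y i)"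
 using mh_diff[OF mrow_hom[OF assms(1,2)] free_module_abelian_group free_module_abelian_group assms(3,4)]
 by (simp add: free_module_minus[OF assms(3,4)] free_module_minus[OF mrow_closed mrow_closed] assms)

lemma mrow_smult:
 assumes "finite I" "D : I \<rightarrow> rows R J" "a : car R" "x : rows R I"
 shows "mrow R I D (%i. a \<otimes> x i) = (%i. a \<otimes> mrow R I D x i)"
 using mh_smult[OF mrow_hom[OF assms(1,2)] assms(3,4)] by (simp add: free_sel(4))

lemma mrow_zero:
 assumes "finite I" "D : I \<rightarrow> rows R J"
 shows "mrow R I D (%i. \<zero>) = (%i. \<zero>)"
 using mh_zero[OF mrow_hom[OF assms] free_module_abelian_group free_module_abelian_group]
 by (simp add: free_sel(2))

end

lemma ring_hom_additive:
 assumes "h : ring_hom R S" "ring R" "ring S"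
 shows "h 0_R = 0_S" "!!x. x : car R ==> h (\<ominus>\<^bsub>R\<^esub> x) = \<ominus>\<^bsub>S\<^esub> h x"
  "!!x y. x : car R ==> y : car R ==> h (x -_R y) = h x -_S h y"
proof -
 interpret R: ring R by fact
 interpret S: ring S by fact
 interpret abelian_group_hom R S h
  using assms(1) by (intro abelian_group_homI group_hom.intro group_hom_axioms.intro R.abelian_group_axioms
    S.abelian_group_axioms R.a_group S.a_group) (auto simp: ring_hom_def hom_def)
 show "h 0_R = 0_S" "!!x. x : car R ==> h (\<ominus>\<^bsub>R\<^esub> x) = \<ominus>\<^bsub>S\<^esub> h x" by simp_all
 then show "!!x y. x : car R ==> y : car R ==> h (x -_R y) = h x -_S h y"
  by (simp add: a_minus_def)
qed

lemma ring_hom_finsum: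
 assumes h: "h : ring_hom R S" and R: "ring R" and S: "ring S" and "finite A" "f : A \<rightarrow> car R"
 shows "h (finsum R (%a. f a) A) = (finsum S (%a. h (f a)) A)"
proof -
 interpret R: ring R by fact
 interpret S: ring S by fact
 show ?thesis
  using assms(4,5)
 proof (induction set: finite)
  case empty
  then show ?case by (simp add: ring_hom_additive(1)[OF h R S])
 next
  case (insert x F)
  then show ?case
   using ring_hom_closed[OF h]
   by (simp add: R.finsum_insert S.finsum_insert Pi_def ring_hom_add[OF h] R.finsum_closed)
 qed
qed

lemma ring_hom_rows:
 assumes h: "h : ring_hom R S" and R: "ring R" and S: "ring S" and "finite I" "x : rows R I"
 shows "(%i. h (x i)) : rows S I"
 using assms(4,5) ring_hom_closed[OF h] ring_hom_additive(1)[OF h R S]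
 by (intro ring.rowsI[OF S]) (auto simp: freeD(1) free_module_outside[OF assms(5)])

text \<open>On the level of matrices this is all that base change consists of: applying
  \<open>h\<close> to every entry stands for tensoring with \<open>S\<close> over
  \<open>R\<close>.\<close>

lemma ring_hom_mrow:
 assumes h: "h : ring_hom R S" and R: "ring R" and S: "ring S"
  and I: "finite I" and D: "D : I \<rightarrow> rows R J" and x: "x : rows R I"
 shows "mrow S I (%i j. h (D i j)) (%i. h (x i)) = (%j. h (mrow R I D x j))"
proof
 fix j
 interpret R: ring R by fact
 interpret S: ring S by fact
 have cl: "x i : car R" "D i j : car R" if "i : I" for i
  using freeD(1)[OF x] freeD(1)[OF funcset_mem[OF D that]] by auto
 have "h (mrow R I D x j) = (finsum S (%i. h (x i *_R D i j)) I)"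
  unfolding mrow_def using cl by (intro ring_hom_finsum[OF h R S I]) auto
 also have "... = mrow S I (%i j. h (D i j)) (%i. h (x i)) j"
  unfolding mrow_def using cl ring_hom_closed[OF h] ring_hom_mult[OF h] by (intro S.finsum_cong') auto
 finally show "mrow S I (%i j. h (D i j)) (%i. h (x i)) j = h (mrow R I D x j)" by simp
qed

text \<open>
 \<open>E n\<close> is an idempotent matrix whose row space is the \<open>n\<close>-th module, \<open>D n\<close> is the matrix of the
 differential from degree \<open>n + 1\<close> to degree \<open>n\<close>; matrices act on rows from the right.
\<close>

locale mat_complex = R?: ring R for R (structure) +
 fixes I :: "nat => 'i set" and E D :: "nat => 'i => 'i => 'a"
 assumes fin: "finite (I n)"
  and E_rows: "E n : I n \<rightarrow> rows R (I n)"
  and D_rows: "D n : I (Suc n) \<rightarrow> rows R (I n)"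
  and E_E: "i : I n ==> mrow R (I n) (E n) (E n i) = E n i"
  and D_E: "i : I (Suc n) ==> mrow R (I n) (E n) (D n i) = D n i"
  and E_D: "i : I (Suc n) ==> mrow R (I (Suc n)) (D n) (E (Suc n) i) = D n i"
  and D_D: "i : I (Suc (Suc n)) ==> mrow R (I (Suc n)) (D n) (D (Suc n) i) = (%j. \<zero>)"

text \<open>No differential leaves degree 0, hence the guard on \<open>m\<close>.\<close>

definition mcycle where
 "mcycle R I E D n x \<longleftrightarrow> x : rows R (I n) & mrow R (I n) (E n) x = x &
  (ALL m. n = Suc m --> mrow R (I n) (D m) x = (%j. 0_R))"

definition mbdry where
 "mbdry R I D n x \<longleftrightarrow> (EX y:rows R (I (Suc n)). x = mrow R (I (Suc n)) (D n) y)"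

text \<open>
 The homology is concentrated in degree \<open>p\<close>, where it is generated by the class of \<open>z\<close>, freely
 over \<open>S\<close>.
\<close>

definition hfree where
 "hfree R I E D p S emb z \<longleftrightarrow> (ALL n x. n ~= p --> mcycle R I E D n x --> mbdry R I D n x) &
  mcycle R I E D p z &
  (ALL x. mcycle R I E D p x --> (EX! s. s : S & mbdry R I D p (%i. x i -_R emb s *_R z i)))"

context mat_complex
begin

abbreviation "cyc == mcycle R I E D"
abbreviation "bdr == mbdry R I D"

lemma xEE: "x : rows R (I n) ==> mrow R (I n) (E n) (mrow R (I n) (E n) x) = mrow R (I n) (E n) x"
 by (subst mrow_comp[OF fin fin E_rows E_rows], assumption, rule mrow_cong)
  (use E_rows[of n] in \<open>auto simp: E_E freeD(1) dest: funcset_mem\<close>)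

lemma xDE: "x : rows R (I (Suc n)) ==> mrow R (I n) (E n) (mrow R (I (Suc n)) (D n) x) = mrow R (I (Suc n)) (D n) x"
 by (subst mrow_comp[OF fin fin D_rows E_rows], assumption, rule mrow_cong)
  (use D_rows[of n] in \<open>auto simp: D_E freeD(1) dest: funcset_mem\<close>)

lemma xED: "x : rows R (I (Suc n)) ==> mrow R (I (Suc n)) (D n) (mrow R (I (Suc n)) (E (Suc n)) x) = mrow R (I (Suc n)) (D n) x"
 by (subst mrow_comp[OF fin fin E_rows D_rows], assumption, rule mrow_cong)
  (use D_rows[of n] in \<open>auto simp: E_D freeD(1) dest: funcset_mem\<close>)

lemma xDD: "x : rows R (I (Suc (Suc n))) ==> mrow R (I (Suc n)) (D n) (mrow R (I (Suc (Suc n))) (D (Suc n)) x) = (%j. \<zero>)"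
proof -
 assume x: "x : rows R (I (Suc (Suc n)))"
 have "mrow R (I (Suc n)) (D n) (mrow R (I (Suc (Suc n))) (D (Suc n)) x) = mrow R (I (Suc (Suc n))) (%i j. \<zero>) x"
  by (subst mrow_comp[OF fin fin D_rows D_rows x], rule mrow_cong) (use x in \<open>auto simp: D_D freeD(1)\<close>)
 also have "... = (%j. \<Oplus>i\<in>I (Suc (Suc n)). \<zero>)"
  unfolding mrow_def using x by (intro ext finsum_cong') (auto simp: freeD(1))
 finally show ?thesis by simp
qed

lemma cyc_rows: "cyc n x ==> x : rows R (I n)"
 by (simp add: mcycle_def)

lemma cyc_add: "cyc n x ==> cyc n y ==> cyc n (%i. x i \<oplus> y i)"
 by (auto simp: mcycle_def rows_add mrow_add[OF fin E_rows] mrow_add[OF fin D_rows])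

lemma cyc_minus: "cyc n x ==> cyc n y ==> cyc n (%i. x i \<ominus> y i)"
 by (auto simp: mcycle_def rows_minus mrow_minus[OF fin E_rows] mrow_minus[OF fin D_rows] minus_self)

lemma cyc_smult: "a : car R ==> cyc n x ==> cyc n (%i. a \<otimes> x i)"
 by (auto simp: mcycle_def rows_smult mrow_smult[OF fin E_rows] mrow_smult[OF fin D_rows])

lemma bdr_cyc: "bdr n x ==> cyc n x"
 by (auto simp: mcycle_def mbdry_def mrow_closed[OF fin D_rows] xDE xDD)

lemma bdr_add: "bdr n x ==> bdr n y ==> bdr n (%i. x i \<oplus> y i)"
 unfolding mbdry_def by (auto simp: mrow_add[OF fin D_rows, symmetric] intro!: bexI[OF _ rows_add])

lemma bdr_minus: "bdr n x ==> bdr n y ==> bdr n (%i. x i \<ominus> y i)"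
 unfolding mbdry_def by (auto simp: mrow_minus[OF fin D_rows, symmetric] intro!: bexI[OF _ rows_minus])

lemma bdr_smult: "a : car R ==> bdr n x ==> bdr n (%i. a \<otimes> x i)"
 unfolding mbdry_def by (auto simp: mrow_smult[OF fin D_rows, symmetric] intro!: bexI[OF _ rows_smult])

lemma bdr_zero: "bdr n (%i. \<zero>)"
 unfolding mbdry_def by (rule bexI[OF _ rows_zero]) (simp add: mrow_zero[OF fin D_rows])

text \<open>Cycles and boundaries map forward along any ring homomorphism. That nothing is gained or
  lost in homology depends on the finer hypotheses of the descent and ascent results.\<close>

lemma base_change:
 assumes h: "h : ring_hom R S" and S: "ring S"
 shows "mat_complex S I (%n i j. h (E n i j)) (%n i j. h (D n i j))"
  and "cyc n x ==> mcycle S I (%n i j. h (E n i j)) (%n i j. h (D n i j)) n (%i. h (x i))"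
  and "bdr n x ==> mbdry S I (%n i j. h (D n i j)) n (%i. h (x i))"
proof -
 note h0 = ring_hom_additive(1)[OF h ring_axioms S]
 note hr = ring_hom_rows[OF h ring_axioms S fin]
 note hm = ring_hom_mrow[OF h ring_axioms S fin]
 have Er: "(%i j. h (E n i j)) : I n \<rightarrow> rows S (I n)" for n using hr funcset_mem[OF E_rows] by blast
 have Dr: "(%i j. h (D n i j)) : I (Suc n) \<rightarrow> rows S (I n)" for n using hr funcset_mem[OF D_rows] by blast
 show "mat_complex S I (%n i j. h (E n i j)) (%n i j. h (D n i j))"
  by (intro mat_complex.intro mat_complex_axioms.intro S fin Er Dr)
   (simp_all add: hm[OF E_rows] hm[OF D_rows] funcset_mem[OF E_rows] funcset_mem[OF D_rows] E_E D_E E_D D_D h0)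
 show "mcycle S I (%n i j. h (E n i j)) (%n i j. h (D n i j)) n (%i. h (x i))" if "cyc n x"
  using that by (auto simp: mcycle_def hm[OF E_rows] hm[OF D_rows] hr h0)
 show "mbdry S I (%n i j. h (D n i j)) n (%i. h (x i))" if "bdr n x"
  using that by (auto simp: mbdry_def hm[OF D_rows, symmetric] intro!: bexI[OF _ hr])
qed

end

section \<open>Descent along a split augmentation\<close>

text \<open>
 \<open>R\<close> is free as a left module over \<open>T\<close> (acting through \<open>\<tau>\<close>) with basis \<open>\<sigma> b\<close>, and the kernel of \<open>bar\<close>
 consists of the elements all of whose coordinates are killed by \<open>bar \<circ> \<tau>\<close>. A complex whose homology
 is \<open>T\<close>-projective then splits over \<open>T\<close>, so its homology is compatible with the base change \<open>bar\<close>.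
\<close>

locale split_complex = mat_complex R I E D + T?: ring T + Rb?: ring Rb
 for R (structure) and I :: "nat => 'i set" and E D and T (structure) and Rb (structure) +
 fixes \<tau> :: "'t => 'a" and bar :: "'a => 's" and B :: "'bb set" and \<sigma> :: "'bb => 'a" and co :: "'bb => 'a => 't"
 assumes \<tau>: "\<tau> : ring_hom T R" and bar: "bar : ring_hom R Rb"
  and bar_surj: "bar ` car R = car Rb"
  and \<sigma>: "b : B ==> \<sigma> b : car R"
  and co_closed: "r : car R ==> co b r : car T"
  and co_add: "r : car R ==> r' : car R ==> co b (r +_R r') = co b r +_T co b r'"
  and co_smult: "t : car T ==> r : car R ==> co b (\<tau> t *_R r) = t *_T co b r"
  and co_fin: "r : car R ==> finite {b:B. co b r ~= 0_T}"
  and co_expand: "r : car R ==> r = (finsum R (%b. \<tau> (co b r) *_R \<sigma> b) {b:B. co b r ~= 0_T})"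
  and co_bar: "r : car R ==> bar r = 0_Rb ==> b : B ==> bar (\<tau> (co b r)) = 0_Rb"
begin

lemma \<tau>c: "t : car T ==> \<tau> t : car R"
 by (rule ring_hom_closed[OF \<tau>])

text \<open>Rows over \<open>R\<close> with scalars restricted to \<open>T\<close> along \<tau>. The
  splittings constructed below are linear over \<open>T\<close> only, so they are maps between these
  modules and not between \<open>R\<close>-modules.\<close>

definition Tr :: "'i set => ('t, 'i => 'a) module" where
 "Tr J = \<lparr>carrier = rows R J, mult = undefined, one = undefined, zero = (%i. 0_R),
  add = (%f g i. f i +_R g i), smult = (%t f i. \<tau> t *_R f i)\<rparr>"

lemma Tr_sel [simp]:
 "car (Tr J) = rows R J" "0_(Tr J) = (%i. 0_R)" "f +_(Tr J) g = (%i. f i +_R g i)"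
 "t .*_(Tr J) f = (%i. \<tau> t *_R f i)"
 by (simp_all add: Tr_def)

lemma Tr_module: "lmod T (Tr J)"
proof (rule left_moduleI)
 show "abelian_group (Tr J)"
 proof (rule abelian_groupI; unfold Tr_sel)
  fix x assume x: "x : rows R J"
  have "(%i. 0_R -_R x i) : rows R J" by (rule R.rows_minus[OF R.rows_zero x])
  moreover have "(%i. (0_R -_R x i) +_R x i) = (%i. 0_R)"
   using freeD(1)[OF x] by (simp add: R.minus_add_cancel)
  ultimately show "EX y:rows R J. (%i. y i +_R x i) = (%i. 0_R)"
   by (intro bexI[of _ "%i. 0_R -_R x i"])
 qed (simp_all add: R.rows_add R.rows_zero R.a_ac freeD(1))
qed (simp_all add: T.ring_axioms \<tau>c R.rows_smult ring_hom_add[OF \<tau>] ring_hom_mult[OF \<tau>] ring_hom_one[OF \<tau>]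
  R.l_distr R.r_distr R.m_assoc freeD(1))

lemma Tr_group: "abelian_group (Tr J)"
 using Tr_module by (simp add: left_module_def)

lemma Tr_minus: "x : rows R J ==> y : rows R J ==> x -_(Tr J) y = (%i. x i -_R y i)"
 using abelian_group.minus_eq_iff[OF Tr_group, of x J y "%i. x i -_R y i"]
 by (simp add: R.rows_minus R.minus_add_cancel freeD(1))

lemma Tr_finsum:
 assumes "finite P" "g : P \<rightarrow> rows R J"
 shows "(finsum (Tr J) (%s. g s) P) = (%i. \<Oplus>\<^bsub>R\<^esub>s\<in>P. g s i)"
proof -
 interpret F: abelian_group "Tr J" by (rule Tr_group)
 show ?thesis
  using assms
 proof (induction set: finite)
  case (insert x A)
  have "(finsum (Tr J) (%s. g s) (insert x A)) = g x +_(Tr J) (finsum (Tr J) (%s. g s) A)"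
   using insert by (intro F.finsum_insert) auto
  also have "... = (%i. g x i +_R (finsum R (%s. g s i) A))"
   using insert by (simp add: Pi_def)
  also have "... = (%i. \<Oplus>\<^bsub>R\<^esub>s\<in>insert x A. g s i)"
   using insert by (intro ext R.finsum_insert[symmetric]) (auto simp: Pi_def intro: freeD(1))
  finally show ?case .
 qed simp
qed

lemma Tr_hom: "f : mhom R (freem R J) (freem R L) ==> f : mhom T (Tr J) (Tr L)"
 using \<tau>c by (auto simp: module_hom_def free_sel(3,4))

text \<open>For finite \<open>J\<close>, coordinates \<open>crd\<close> and generators
  \<open>gen\<close> form a dual basis of \<open>Tr J\<close>, indexed by positions and elements of
  \<open>B\<close>. This makes \<open>Tr J\<close> projective over \<open>T\<close>.\<close>

definition crd :: "'i set => ('i => 'a) => 'i \<times> 'bb => 't" where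
 "crd J x p = (if fst p : J & snd p : B then co (snd p) (x (fst p)) else 0_T)"

definition gen :: "'i \<times> 'bb => 'i => 'a" where
 "gen p j = (if j = fst p then \<sigma> (snd p) else 0_R)"

lemma gen_rows: "finite J ==> gen : J \<times> B \<rightarrow> rows R J"
 by (auto simp: gen_def \<sigma> intro!: R.rowsI)

lemma crd_supp:
 assumes "finite J" "x : rows R J"
 shows "finite {p. crd J x p ~= 0_T}"
proof -
 have "{p. crd J x p ~= 0_T} <= Sigma J (%i. {b:B. co b (x i) ~= 0_T})"
  by (auto simp: crd_def split: if_splits)
 moreover have "finite (Sigma J (%i. {b:B. co b (x i) ~= 0_T}))"
  using assms co_fin by (intro finite_SigmaI) (auto simp: freeD(1))
 ultimately show ?thesis by (rule finite_subset)
qed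

lemma crd_hom:
 assumes J: "finite J"
 shows "crd J : mhom T (Tr J) (freem T (J \<times> B))"
proof (rule mhI)
 fix x assume "x : car (Tr J)"
 then have x: "x : rows R J" by simp
 show "crd J x : rows T (J \<times> B)"
  by (rule T.free_moduleI[OF crd_supp[OF J x]])
   (auto simp: crd_def co_closed freeD(1)[OF x])
qed (auto simp: fun_eq_iff crd_def free_sel(3,4) co_add co_smult freeD(1))

lemma crd_expand:
 assumes J: "finite J" and x: "x : rows R J"
 shows "flift (Tr J) T gen (crd J x) = x"
proof
 fix j
 interpret F: left_module T "Tr J" by (rule Tr_module)
 let ?S = "{p. crd J x p ~= 0_T}"
 have S: "?S <= J \<times> B" by (auto simp: crd_def split: if_splits)
 have c: "crd J x p : car T" for p by (simp add: crd_def co_closed freeD(1)[OF x])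
 have g: "gen p i : car R" if "p : ?S" for p i
  using that S \<sigma> by (auto simp: gen_def)
 have gr: "gen p : rows R J" if "p : ?S" for p using gen_rows[OF J] S that by blast
 have "flift (Tr J) T gen (crd J x) = (finsum (Tr J) (%p. (%i. \<tau> (crd J x p) *_R gen p i)) ?S)"
  by (simp add: flift_def)
 also have "... = (%i. \<Oplus>\<^bsub>R\<^esub>p\<in>?S. \<tau> (crd J x p) *_R gen p i)"
  by (intro Tr_finsum crd_supp[OF J x] Pi_I R.rows_smult \<tau>c c gr)
 finally have "flift (Tr J) T gen (crd J x) j = (finsum R (%p. \<tau> (crd J x p) *_R gen p j) ?S)" by simp
 also have "... = (finsum R (%p. \<tau> (crd J x p) *_R gen p j) (Pair j ` {b:B. j : J & co b (x j) ~= 0_T}))"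
 proof (rule R.add.finprod_mono_neutral_cong_right[OF crd_supp[OF J x]])
  show "\<tau> (crd J x p) *_R gen p j = 0_R"
   if p: "p : ?S - Pair j ` {b:B. j : J & co b (x j) ~= 0_T}" for p
  proof -
   have "fst p ~= j" using p by (cases p) (auto simp: crd_def split: if_splits)
   then show ?thesis by (simp add: gen_def \<tau>c c)
  qed
 qed (use \<tau>c c g in \<open>auto simp: crd_def\<close>)
 also have "... = (finsum R (%b. \<tau> (crd J x (j, b)) *_R gen (j, b) j) {b:B. j : J & co b (x j) ~= 0_T})"
  by (rule R.finsum_reindex) (auto simp: inj_on_def gen_def intro!: R.m_closed \<tau>c c \<sigma>)
 also have "... = x j"
 proof (cases "j : J")
  case True
  have "(finsum R (%b. \<tau> (crd J x (j, b)) *_R gen (j, b) j) {b:B. j : J & co b (x j) ~= 0_T})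
   = (finsum R (%b. \<tau> (co b (x j)) *_R \<sigma> b) {b:B. co b (x j) ~= 0_T})"
   using True co_closed[OF freeD(1)[OF x]]
   by (intro R.finsum_cong') (auto simp: crd_def gen_def intro!: R.m_closed \<tau>c \<sigma>)
  then show ?thesis using co_expand[OF freeD(1)[OF x]] by simp
 next
  case False
  then show ?thesis using free_module_outside[OF x] by simp
 qed
 finally show "flift (Tr J) T gen (crd J x) j = x j" .
qed

lemma Tr_hom_expand:
 assumes J: "finite J" and f: "f : mhom T (Tr J) M" and M: "lmod T M" and x: "x : rows R J"
 shows "f x = flift M T (%p. f (gen p)) (crd J x)"
proof -
 interpret M: left_module T M by fact
 have cx: "crd J x : rows T (J \<times> B)"
  using mh_closed[OF crd_hom[OF J]] x by simp
 note fl = T.flift_hom[OF Tr_module, of gen "J \<times> B" J] gen_rows[OF J]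
 have gr: "gen : J \<times> B \<rightarrow> car (Tr J)" using gen_rows[OF J] by simp
 have "f (flift (Tr J) T gen (crd J x)) = flift M T (%p. f (flift (Tr J) T gen (free_basis T p))) (crd J x)"
  by (rule T.free_hom_flift[OF mh_comp[OF T.flift_hom[OF Tr_module gr] f] M cx])
 also have "... = flift M T (%p. f (gen p)) (crd J x)"
  unfolding flift_def[of M]
 proof (intro M.finsum_cong' refl Pi_I M.smult_closed)
  fix p assume "p : {p. crd J x p ~= 0_T}"
  then have p: "p : J \<times> B" by (cases p) (auto simp: crd_def split: if_splits)
  show "crd J x p : car T" using freeD(1)[OF cx] .
  show "f (gen p) : car M" by (rule mh_closed[OF f funcset_mem[OF gr p]])
  show "crd J x p .*_M f (flift (Tr J) T gen (free_basis T p)) = crd J x p .*_M f (gen p)"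
   using T.flift_basis[OF Tr_module gr p] by simp
 qed
 finally show ?thesis using crd_expand[OF J x] by simp
qed

text \<open>By \<open>co_bar\<close> a row killed by \<open>bar\<close> is a combination of
  generators with coefficients in the kernel of bar \<circ> \<tau>, and a \<open>T\<close>-linear
  map keeps the coefficients. So maps that are only \<open>T\<close>-linear still respect the kernel
  of \<open>bar\<close>, which is what allows splittings over \<open>T\<close> to be used after base
  change.\<close>

lemma Tr_hom_kernel:
 assumes J: "finite J" and f: "f : mhom T (Tr J) (Tr L)" and x: "x : rows R J"
  and x0: "!!i. bar (x i) = 0_Rb"
 shows "bar (f x j) = 0_Rb"
proof -
 let ?S = "{p. crd J x p ~= 0_T}"
 have S: "?S <= J \<times> B" by (auto simp: crd_def split: if_splits)
 have c: "crd J x p : car T" for p by (simp add: crd_def co_closed freeD(1)[OF x])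
 have fr: "f (gen p) : rows R L" if "p : ?S" for p
  using mh_closed[OF f] funcset_mem[OF gen_rows[OF J] subsetD[OF S that]] by simp
 have "f x = (finsum (Tr L) (%p. (%i. \<tau> (crd J x p) *_R f (gen p) i)) ?S)"
  using Tr_hom_expand[OF J f Tr_module x] by (simp add: flift_def)
 also have "... = (%i. \<Oplus>\<^bsub>R\<^esub>p\<in>?S. \<tau> (crd J x p) *_R f (gen p) i)"
  by (intro Tr_finsum crd_supp[OF J x] Pi_I R.rows_smult \<tau>c c fr)
 finally have "bar (f x j) = (finsum Rb (%p. bar (\<tau> (crd J x p) *_R f (gen p) j)) ?S)"
  using ring_hom_finsum[OF bar R.ring_axioms Rb.ring_axioms crd_supp[OF J x], of "%p. \<tau> (crd J x p) *_R f (gen p) j"]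
   \<tau>c[OF c] freeD(1)[OF fr] by simp
 also have "... = (finsum Rb (%p. 0_Rb) ?S)"
 proof (intro Rb.finsum_cong' refl Pi_I Rb.zero_closed)
  fix p assume p: "p : ?S"
  then have "bar (\<tau> (crd J x p)) = 0_Rb"
   using co_bar[OF freeD(1)[OF x] x0] by (auto simp: crd_def split: if_splits)
  then show "bar (\<tau> (crd J x p) *_R f (gen p) j) = 0_Rb"
   using ring_hom_mult[OF bar \<tau>c[OF c] freeD(1)[OF fr[OF p]]]
    ring_hom_closed[OF bar freeD(1)[OF fr[OF p]]] by simp
 qed
 finally show ?thesis by simp
qed

text \<open>Projectivity over \<open>T\<close>: the lift is chosen on \<open>gen\<close> and
  extended through the coordinates.\<close>

lemma Tr_lift:
 assumes J: "finite J" and g: "g : mhom T (Tr J) (Tr L)" and q: "q : mhom T (Tr J') (Tr L)"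
  and im: "!!x. x : rows R J ==> g x : q ` rows R J'"
 obtains s where "s : mhom T (Tr J) (Tr J')" "!!x. x : rows R J ==> q (s x) = g x"
proof -
 have gr: "gen : J \<times> B \<rightarrow> car (Tr J)" using gen_rows[OF J] by simp
 have "EX c. c : rows R J' & q c = g (gen p)" if "p : J \<times> B" for p
  using im funcset_mem[OF gen_rows[OF J] that] by force
 then obtain c where c: "!!p. p : J \<times> B ==> c p : rows R J' & q (c p) = g (gen p)"
  by metis
 then have cI: "c : J \<times> B \<rightarrow> car (Tr J')" by auto
 note fc = T.flift_hom[OF Tr_module cI]
 show thesis
 proof (rule that[of "%x. flift (Tr J') T c (crd J x)"])
  show "(%x. flift (Tr J') T c (crd J x)) : mhom T (Tr J) (Tr J')"
   by (rule mh_comp[OF crd_hom[OF J] fc])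
  fix x assume x: "x : rows R J"
  have cx: "crd J x : rows T (J \<times> B)"
   using mh_closed[OF crd_hom[OF J]] x by simp
  have "q (flift (Tr J') T c (crd J x)) = g (flift (Tr J) T gen (crd J x))"
   by (rule T.free_hom_eqI[OF mh_comp[OF fc q] mh_comp[OF T.flift_hom[OF Tr_module gr] g]
      Tr_module _ cx])
    (simp add: T.flift_basis[OF Tr_module cI] T.flift_basis[OF Tr_module gr] c)
  then show "q (flift (Tr J') T c (crd J x)) = g x" using crd_expand[OF J x] by simp
 qed
qed

text \<open>\<open>w\<close> is a \<open>T\<close>-linear projection of all rows onto the cycles of degree \<open>n\<close>.\<close>

definition cycle_proj :: "nat => (('i => 'a) => 'i => 'a) => bool" where
 "cycle_proj n w \<longleftrightarrow> w : mhom T (Tr (I n)) (Tr (I n)) & (ALL x:rows R (I n). cyc n (w x)) &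
  (ALL y. cyc n y --> w y = y) &
  (ALL x:rows R (I n). (ALL j. bar (mrow R (I n) (E n) x j) = bar (x j)) &
   (ALL m. n = Suc m --> (ALL j. bar (mrow R (I n) (D m) x j) = 0_Rb)) --> (ALL j. bar (w x j) = bar (x j)))"

lemma cycle_proj_0: "cycle_proj 0 (mrow R (I 0) (E 0))"
 unfolding cycle_proj_def
 by (auto simp: mcycle_def R.mrow_closed[OF fin E_rows] xEE intro!: Tr_hom R.mrow_hom[OF fin E_rows])

text \<open>A projection \<open>g\<close> of all rows of degree \<open>n\<close> onto the boundaries
  lifts through the differential \<open>d\<close> to a map \<open>s\<close>, and e - s d, with
  \<open>e\<close> the idempotent, projects onto the cycles one degree higher. A row that is a cycle
  modulo \<open>bar\<close> is fixed modulo \<open>bar\<close>, because \<open>s\<close> respects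
  the kernel of \<open>bar\<close>.\<close>

lemma cycle_proj_Suc:
 assumes g: "g : mhom T (Tr (I n)) (Tr (I n))"
  and gb: "!!x. x : rows R (I n) ==> bdr n (g x)" and gid: "!!y. bdr n y ==> g y = y"
 shows "EX w. cycle_proj (Suc n) w"
proof -
 note DT = Tr_hom[OF R.mrow_hom[OF fin D_rows[of n]]]
 note ET = Tr_hom[OF R.mrow_hom[OF fin E_rows[of "Suc n"]]]
 have im: "g x : mrow R (I (Suc n)) (D n) ` rows R (I (Suc n))" if "x : rows R (I n)" for x
  using gb[OF that] by (auto simp: mbdry_def)
 obtain s0 where s0: "s0 : mhom T (Tr (I n)) (Tr (I (Suc n)))"
  "!!x. x : rows R (I n) ==> mrow R (I (Suc n)) (D n) (s0 x) = g x"
  using Tr_lift[OF fin g DT im] by metis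
 have s0c: "s0 x : rows R (I (Suc n))" if "x : rows R (I n)" for x
  using mh_closed[OF s0(1)] that by simp
 \<comment> \<open>Multiplication by the idempotent moves the lift into the projective module and
   does not change its image under the differential, as \<open>E\<close> followed by
   \<open>D\<close> is \<open>D\<close>.\<close>
 define s where "s x = mrow R (I (Suc n)) (E (Suc n)) (s0 x)" for x
 have s: "s : mhom T (Tr (I n)) (Tr (I (Suc n)))"
  unfolding s_def by (rule mh_comp[OF s0(1) ET])
 have sc: "s x : rows R (I (Suc n))" if "x : rows R (I n)" for x
  using mh_closed[OF s] that by simp
 have sD: "mrow R (I (Suc n)) (D n) (s x) = g x" if "x : rows R (I n)" for x
  using xED[OF s0c[OF that]] s0(2)[OF that] by (simp add: s_def)
 have sE: "mrow R (I (Suc n)) (E (Suc n)) (s x) = s x" if "x : rows R (I n)" for x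
  using xEE[OF s0c[OF that]] by (simp add: s_def)
 let ?d = "mrow R (I (Suc n)) (D n)" and ?e = "mrow R (I (Suc n)) (E (Suc n))"
 have dc: "?d x : rows R (I n)" and ec: "?e x : rows R (I (Suc n))" if "x : rows R (I (Suc n))" for x
  using that R.mrow_closed[OF fin D_rows] R.mrow_closed[OF fin E_rows] by auto
 define w where "w x = (%j. ?e x j -_R s (?d x) j)" for x
 have "w : mhom T (Tr (I (Suc n))) (Tr (I (Suc n)))"
  by (rule mh_cong[OF mh_minus[OF ET mh_comp[OF DT s] Tr_module] _ Tr_module])
   (simp add: w_def Tr_minus ec sc dc)
 moreover have "cyc (Suc n) (w x)" if x: "x : rows R (I (Suc n))" for x
  unfolding mcycle_def
 proof (intro conjI allI impI)
  show "w x : rows R (I (Suc n))" unfolding w_def by (intro R.rows_minus ec sc dc x)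
  show "?e (w x) = w x"
   unfolding w_def by (simp add: R.mrow_minus[OF fin E_rows] ec sc dc x xEE sE)
  fix m assume "Suc n = Suc m"
  then have "n = m" by simp
  moreover have "?d (w x) = (%j. 0_R)"
  proof -
   have "g (?d x) = ?d x" using x by (intro gid) (auto simp: mbdry_def)
   then show ?thesis
    unfolding w_def using freeD(1)[OF dc[OF x]]
    by (simp add: R.mrow_minus[OF fin D_rows] ec sc dc x xED sD R.minus_self)
  qed
  ultimately show "mrow R (I (Suc n)) (D m) (w x) = (%j. 0_R)" by simp
 qed
 moreover have "w y = y" if y: "cyc (Suc n) y" for y
 proof -
  have yr: "y : rows R (I (Suc n))" and "?e y = y" "?d y = (%j. 0_R)"
   using y by (auto simp: mcycle_def)
  moreover have "s (%j. 0_R) = (%j. 0_R)"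
   using mh_zero[OF s] Tr_module by (simp add: left_module_def)
  ultimately show ?thesis by (simp add: w_def R.minus_zero_right freeD(1)[OF yr])
 qed
 moreover have "bar (w x j) = bar (x j)" if x: "x : rows R (I (Suc n))"
  and 1: "ALL j. bar (?e x j) = bar (x j)" and 2: "ALL j. bar (?d x j) = 0_Rb" for x j
 proof -
  have "bar (s (?d x) j) = 0_Rb" using Tr_hom_kernel[OF fin s dc[OF x]] 2 by blast
  then show ?thesis
   unfolding w_def
   using ring_hom_additive(3)[OF bar R.ring_axioms Rb.ring_axioms freeD(1)[OF ec[OF x]] freeD(1)[OF sc[OF dc[OF x]]]]
    1 Rb.minus_zero_right[OF ring_hom_closed[OF bar freeD(1)[OF x]]] by simp
 qed
 ultimately show ?thesis unfolding cycle_proj_def by blast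
qed

lemma bar_lift:
 assumes J: "finite J" and x: "x : rows Rb J"
 obtains x' where "x' : rows R J" "!!i. bar (x' i) = x i"
proof -
 have "ALL i. EX r. r : car R & bar r = x i" using bar_surj freeD(1)[OF x] by (metis imageE)
 then obtain r where r: "!!i. r i : car R & bar (r i) = x i" by metis
 show thesis
  by (rule that[of "%i. if i : J then r i else 0_R"])
   (auto simp: r J free_module_outside[OF x] ring_hom_additive(1)[OF bar R.ring_axioms Rb.ring_axioms] intro!: R.rowsI)
qed

text \<open>Cycle projections exist in all degrees by induction: outside degree \<open>p\<close>
  cycles are boundaries, and in degree \<open>p\<close> the component along \<open>z\<close> is
  subtracted, which is a \<open>T\<close>-linear operation because the homology is free on
  \<open>z\<close>. The projections lift cycles over \<open>Rb\<close> to cycles over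
  \<open>R\<close>. They also show that if a multiple of \<open>z\<close> becomes a boundary under
  \<open>bar\<close>, then its coefficient dies under bar \<circ> \<tau>.\<close>

lemma homology_descent:
 assumes free: "hfree R I E D p (car T) \<tau> z"
  and \<chi>: "!!t. t : car T ==> \<chi> t : C & bar (\<tau> t) = emb (\<chi> t)"
  and \<chi>_surj: "!!c. c : C ==> EX t:car T. \<chi> t = c"
  and inj: "inj_on emb C"
 shows "hfree Rb I (%n i j. bar (E n i j)) (%n i j. bar (D n i j)) p C emb (%i. bar (z i))"
proof -
 let ?E = "%n i j. bar (E n i j)" and ?D = "%n i j. bar (D n i j)"
 have z: "cyc p z" and ex: "!!n x. n ~= p ==> cyc n x ==> bdr n x"
  and exp: "!!x. cyc p x ==> EX! t. t : car T & bdr p (%i. x i -_R \<tau> t *_R z i)"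
  using free by (auto simp: hfree_def)
 note zc = freeD(1)[OF cyc_rows[OF z]]
 \<comment> \<open>The coefficient of the class of a cycle. Its uniqueness makes it linear over
   \<open>T\<close> and zero on boundaries.\<close>
 define cl where "cl x = (THE t. t : car T & bdr p (%i. x i -_R \<tau> t *_R z i))" for x
 have cl: "cl x : car T" "bdr p (%i. x i -_R \<tau> (cl x) *_R z i)" if "cyc p x" for x
  using theI'[OF exp[OF that]] by (auto simp: cl_def)
 have cl_eq: "cl x = t" if "cyc p x" "t : car T" "bdr p (%i. x i -_R \<tau> t *_R z i)" for x t
  using that cl[OF that(1)] exp[OF that(1)] by blast
 have cl_add: "cl (%i. x i +_R y i) = cl x +_T cl y" if x: "cyc p x" and y: "cyc p y" for x y
 proof (rule cl_eq)
  note c = freeD(1)[OF cyc_rows[OF x]] freeD(1)[OF cyc_rows[OF y]] cl(1)[OF x] cl(1)[OF y]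
  have "(%i. (x i +_R y i) -_R \<tau> (cl x +_T cl y) *_R z i) =
   (%i. (x i -_R \<tau> (cl x) *_R z i) +_R (y i -_R \<tau> (cl y) *_R z i))"
   using c \<tau>c zc by (simp add: ring_hom_add[OF \<tau>] R.l_distr R.minus_add_distrib)
  then show "bdr p (%i. (x i +_R y i) -_R \<tau> (cl x +_T cl y) *_R z i)"
   using bdr_add[OF cl(2)[OF x] cl(2)[OF y]] by simp
 qed (use x y cl(1) cyc_add in auto)
 have cl_smult: "cl (%i. \<tau> t *_R x i) = t *_T cl x" if x: "cyc p x" and t: "t : car T" for x t
 proof (rule cl_eq)
  note c = freeD(1)[OF cyc_rows[OF x]] cl(1)[OF x]
  have "(%i. \<tau> t *_R x i -_R \<tau> (t *_T cl x) *_R z i) = (%i. \<tau> t *_R (x i -_R \<tau> (cl x) *_R z i))"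
   using c \<tau>c zc t by (simp add: ring_hom_mult[OF \<tau>] R.m_assoc R.r_distr a_minus_def R.r_minus)
  then show "bdr p (%i. \<tau> t *_R x i -_R \<tau> (t *_T cl x) *_R z i)"
   using bdr_smult[OF \<tau>c[OF t] cl(2)[OF x]] by simp
 qed (use x t cl(1) cyc_smult \<tau>c in auto)
 have cl_bdr: "cl y = 0_T" if y: "bdr p y" for y
 proof (rule cl_eq[OF bdr_cyc[OF y] T.zero_closed])
  have "(%i. y i -_R \<tau> 0_T *_R z i) = y"
   using zc freeD(1)[OF cyc_rows[OF bdr_cyc[OF y]]]
   by (simp add: ring_hom_additive(1)[OF \<tau> T.ring_axioms R.ring_axioms] R.minus_zero_right)
  then show "bdr p (%i. y i -_R \<tau> 0_T *_R z i)" using y by simp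
 qed
 have "EX w. cycle_proj n w" for n
 proof (induction n)
  case 0
  show ?case using cycle_proj_0 by blast
 next
  case (Suc n)
  then obtain w where w: "cycle_proj n w" by blast
  then have wh: "w : mhom T (Tr (I n)) (Tr (I n))" and wc: "!!x. x : rows R (I n) ==> cyc n (w x)"
   and wid: "!!y. cyc n y ==> w y = y"
   by (auto simp: cycle_proj_def)
  show ?case
  proof (cases "n = p")
   case False
   then show ?thesis using cycle_proj_Suc[OF wh] ex[OF False wc] wid[OF bdr_cyc] by blast
  next
   case True
   \<comment> \<open>Removing the component along \<open>z\<close> turns the projection onto cycles
     into a projection onto boundaries.\<close>
   define g where "g x = (%i. w x i -_R \<tau> (cl (w x)) *_R z i)" for x
   have wc': "cyc p (w x)" if "x : rows R (I p)" for x using wc that True by simp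
   note wr = freeD(1)[OF cyc_rows[OF wc']]
   have g: "g : mhom T (Tr (I n)) (Tr (I n))"
   proof (rule mhI; unfold True Tr_sel)
    fix x assume x: "x : rows R (I p)"
    show "g x : rows R (I p)"
     unfolding g_def by (intro R.rows_minus R.rows_smult cyc_rows wc' x z \<tau>c cl(1))
    {
     fix y assume y: "y : rows R (I p)"
     have "w (%i. x i +_R y i) = (%i. w x i +_R w y i)"
      using mh_add[OF wh] x y True by simp
     then show "g (%i. x i +_R y i) = (%i. g x i +_R g y i)"
      using cl(1)[OF wc'[OF x]] cl(1)[OF wc'[OF y]] \<tau>c zc wr[OF x] wr[OF y]
      by (simp add: g_def cl_add wc' x y ring_hom_add[OF \<tau>] R.l_distr R.minus_add_distrib)
    }
    fix t assume t: "t : car T"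
    have "w (%i. \<tau> t *_R x i) = (%i. \<tau> t *_R w x i)"
     using mh_smult[OF wh t] x True by simp
    then show "g (%i. \<tau> t *_R x i) = (%i. \<tau> t *_R g x i)"
     using cl(1)[OF wc'[OF x]] \<tau>c zc wr[OF x] t
     by (simp add: g_def cl_smult wc' x ring_hom_mult[OF \<tau>] R.m_assoc R.r_distr a_minus_def R.r_minus)
   qed
   show ?thesis
   proof (rule cycle_proj_Suc[OF g])
    show "bdr n (g x)" if "x : rows R (I n)" for x
     unfolding g_def using cl(2) wc that True by simp
    show "g y = y" if "bdr n y" for y
     using that wid[OF bdr_cyc[OF that]] cl_bdr zc freeD(1)[OF cyc_rows[OF bdr_cyc[OF that]]] True
     by (simp add: g_def ring_hom_additive(1)[OF \<tau> T.ring_axioms R.ring_axioms] R.minus_zero_right)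
   qed
  qed
 qed
 then obtain w where w: "!!n. cycle_proj n (w n)" by metis
 \<comment> \<open>Any entrywise lift is a cycle modulo \<open>bar\<close>, so the projection
   corrects it to a cycle without changing its image.\<close>
 have lift: "EX x'. cyc n x' & (ALL i. bar (x' i) = x i)" if x: "mcycle Rb I ?E ?D n x" for n x
 proof -
  have xr: "x : rows Rb (I n)" using x by (simp add: mcycle_def)
  obtain y where y: "y : rows R (I n)" "!!i. bar (y i) = x i" using bar_lift[OF fin xr] by blast
  then have xy: "x = (%i. bar (y i))" by auto
  have "bar (mrow R (I n) (E n) y j) = bar (y j)" for j
   using x ring_hom_mrow[OF bar R.ring_axioms Rb.ring_axioms fin E_rows y(1)]
   unfolding xy mcycle_def by metis
  moreover have "bar (mrow R (I n) (D m) y j) = 0_Rb" if n: "n = Suc m" for j m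
   using x ring_hom_mrow[OF bar R.ring_axioms Rb.ring_axioms fin D_rows[of m] y(1)[unfolded n]]
   unfolding xy mcycle_def n by metis
  ultimately have "ALL j. bar (w n y j) = bar (y j)" using w[of n] y(1) unfolding cycle_proj_def by blast
  then show ?thesis using w[of n] y unfolding cycle_proj_def by metis
 qed
 note bc = base_change[OF bar Rb.ring_axioms]
 interpret b: mat_complex Rb I ?E ?D by (rule bc(1))
 have emb: "emb c : car Rb" if c: "c : C" for c
  using \<chi>_surj[OF c] \<chi> ring_hom_closed[OF bar \<tau>c] by metis
 show ?thesis
  unfolding hfree_def
 proof (intro conjI allI impI)
  show "mcycle Rb I ?E ?D p (%i. bar (z i))" by (rule bc(2)[OF z])
  fix n x assume "n ~= p" and "mcycle Rb I ?E ?D n x"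
  then obtain x' where x': "cyc n x'" "ALL i. bar (x' i) = x i" using lift by blast
  then have "x = (%i. bar (x' i))" by auto
  then show "mbdry Rb I ?D n x" using bc(3)[OF ex[OF \<open>n ~= p\<close> x'(1)]] by simp
 next
  fix x assume x: "mcycle Rb I ?E ?D p x"
  then obtain x' where x': "cyc p x'" "ALL i. bar (x' i) = x i" using lift by blast
  then have xx: "x = (%i. bar (x' i))" by auto
  show "EX! c. c : C & mbdry Rb I ?D p (%i. x i -_Rb emb c *_Rb bar (z i))"
  proof (rule ex_ex1I)
   have "(%i. bar (x' i -_R \<tau> (cl x') *_R z i)) = (%i. x i -_Rb emb (\<chi> (cl x')) *_Rb bar (z i))"
    using \<chi>[OF cl(1)[OF x'(1)]] freeD(1)[OF cyc_rows[OF x'(1)]] \<tau>c[OF cl(1)[OF x'(1)]] zc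
    by (simp add: xx ring_hom_additive(3)[OF bar R.ring_axioms Rb.ring_axioms] ring_hom_mult[OF bar])
   then show "EX c. c : C & mbdry Rb I ?D p (%i. x i -_Rb emb c *_Rb bar (z i))"
    using bc(3)[OF cl(2)[OF x'(1)]] \<chi>[OF cl(1)[OF x'(1)]] by auto
  next
   fix c c'
   assume c: "c : C & mbdry Rb I ?D p (%i. x i -_Rb emb c *_Rb bar (z i))"
    and c': "c' : C & mbdry Rb I ?D p (%i. x i -_Rb emb c' *_Rb bar (z i))"
   obtain t t' where t: "t : car T" "\<chi> t = c" and t': "t' : car T" "\<chi> t' = c'"
    using \<chi>_surj c c' by metis
   have et: "emb c = bar (\<tau> t)" "emb c' = bar (\<tau> t')" using \<chi> t t' by auto
   have xc: "x i : car Rb" "bar (z i) : car Rb" for i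
    using ring_hom_closed[OF bar freeD(1)[OF cyc_rows[OF x'(1)]]] ring_hom_closed[OF bar zc] by (auto simp: xx)
   note btc = ring_hom_closed[OF bar \<tau>c[OF t(1)]] ring_hom_closed[OF bar \<tau>c[OF t'(1)]]
   have "(x i -_Rb bar (\<tau> t') *_Rb bar (z i)) -_Rb (x i -_Rb bar (\<tau> t) *_Rb bar (z i))
    = bar (\<tau> (t -_T t') *_R z i)" for i
   proof -
    have "bar (\<tau> (t -_T t') *_R z i) = (bar (\<tau> t) -_Rb bar (\<tau> t')) *_Rb bar (z i)"
     using t t' zc by (simp add: ring_hom_mult[OF bar] ring_hom_additive(3)[OF bar R.ring_axioms Rb.ring_axioms]
       ring_hom_additive(3)[OF \<tau> T.ring_axioms R.ring_axioms] \<tau>c)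
    moreover have "(a -_Rb b *_Rb d) -_Rb (a -_Rb c *_Rb d) = (c -_Rb b) *_Rb d"
     if "a : car Rb" "b : car Rb" "c : car Rb" "d : car Rb" for a b c d
     using that by algebra
    ultimately show ?thesis using xc[of i] btc by simp
   qed
   then have "mbdry Rb I ?D p (%i. bar (\<tau> (t -_T t') *_R z i))"
    using b.bdr_minus[OF conjunct2[OF c'] conjunct2[OF c]] by (simp add: et)
   then obtain y where y: "y : rows Rb (I (Suc p))"
    "(%i. bar (\<tau> (t -_T t') *_R z i)) = mrow Rb (I (Suc p)) (?D p) y"
    unfolding mbdry_def by blast
   obtain y' where y': "y' : rows R (I (Suc p))" "!!i. bar (y' i) = y i" using bar_lift[OF fin y(1)] by blast
   let ?s = "t -_T t'" and ?y = "mrow R (I (Suc p)) (D p) y'"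
   have s: "?s : car T" using t t' by simp
   have yb: "bdr p ?y" using y'(1) by (auto simp: mbdry_def)
   note yc = freeD(1)[OF cyc_rows[OF bdr_cyc[OF yb]]]
   \<comment> \<open>The boundary over \<open>Rb\<close> has been lifted to a boundary
     \<open>?y\<close> over \<open>R\<close>. All entries of the cycle \<open>?v\<close> lie in the
     kernel of \<open>bar\<close>, while its class is that of (t - t') z.\<close>
   let ?v = "%i. \<tau> ?s *_R z i -_R ?y i"
   have v: "cyc p ?v" by (rule cyc_minus[OF cyc_smult[OF \<tau>c[OF s] z] bdr_cyc[OF yb]])
   have bv: "bar (?v i) = 0_Rb" for i
   proof -
    have "mrow Rb (I (Suc p)) (?D p) y = (%j. bar (?y j))"
     using ring_hom_mrow[OF bar R.ring_axioms Rb.ring_axioms fin D_rows y'(1)] y'(2) by simp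
    then have "bar (\<tau> ?s *_R z i) = bar (?y i)" using y(2) by (metis (no_types))
    then show ?thesis
     using ring_hom_additive(3)[OF bar R.ring_axioms Rb.ring_axioms R.m_closed[OF \<tau>c[OF s] zc] yc]
      Rb.minus_self[OF ring_hom_closed[OF bar yc]] by simp
   qed
   have clv: "cl ?v = ?s"
   proof (rule cl_eq[OF v s])
    have "(%i. ?v i -_R \<tau> ?s *_R z i) = (%i. 0_R -_R ?y i)"
    proof
     fix i
     have "(a -_R b) -_R a = 0_R -_R b" if "a : car R" "b : car R" for a b
      using that by algebra
     then show "?v i -_R \<tau> ?s *_R z i = 0_R -_R ?y i" using \<tau>c[OF s] zc yc by simp
    qed
    then show "bdr p (%i. ?v i -_R \<tau> ?s *_R z i)" using bdr_minus[OF bdr_zero yb] by simp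
   qed
   \<comment> \<open>Reading off the class after projecting is \<open>T\<close>-linear, so
     \<open>Tr_hom_kernel\<close> applies. The value is packed into rows with a single position;
     \<open>undefined\<close> is just some index of the right type.\<close>
   define L where "L x = (%j :: 'i. if j = undefined then \<tau> (cl (w p x)) else 0_R)" for x
   have wp: "w p : mhom T (Tr (I p)) (Tr (I p))" "!!x. x : rows R (I p) ==> cyc p (w p x)" "w p ?v = ?v"
    using w[of p] v unfolding cycle_proj_def by blast+
   have "L : mhom T (Tr (I p)) (Tr {undefined})"
   proof (rule mhI; unfold Tr_sel)
    fix x assume x: "x : rows R (I p)"
    note clx = cl(1)[OF wp(2)[OF x]]
    show "L x : rows R {undefined}" by (rule R.rowsI) (auto simp: L_def clx \<tau>c)
    show "L (%i. \<tau> t *_R x i) = (%i. \<tau> t *_R L x i)" if "t : car T" for t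
     using mh_smult[OF wp(1) that] x cl_smult[OF wp(2)[OF x] that] clx that
     by (auto simp: L_def ring_hom_mult[OF \<tau>] \<tau>c)
    show "L (%i. x i +_R y i) = (%i. L x i +_R L y i)" if y: "y : rows R (I p)" for y
     using mh_add[OF wp(1)] x y cl_add[OF wp(2)[OF x] wp(2)[OF y]] clx cl(1)[OF wp(2)[OF y]]
     by (auto simp: L_def ring_hom_add[OF \<tau>] \<tau>c)
   qed
   from Tr_hom_kernel[OF fin this cyc_rows[OF v] bv, of undefined]
   have "bar (\<tau> ?s) = 0_Rb" by (simp add: L_def wp(3) clv)
   then have "bar (\<tau> t) = bar (\<tau> t')"
    using ring_hom_additive(3)[OF bar R.ring_axioms Rb.ring_axioms \<tau>c[OF t(1)] \<tau>c[OF t'(1)]]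
     ring_hom_additive(3)[OF \<tau> T.ring_axioms R.ring_axioms t(1) t'(1)] Rb.minus_eq_zero_iff[OF btc] by simp
   then show "c = c'" using inj c c' by (simp add: et[symmetric] inj_on_def)
  qed
 qed
qed

end

section \<open>Ascent along a free ring extension\<close>

text \<open>The ring \<open>S\<close> as a right \<open>R\<close>-module through \<kappa>, with
  generators \<open>e\<close> and right linear coordinates \<open>co\<close>. The coordinates of a
  row over \<open>S\<close> are rows over \<open>R\<close>, and taking them commutes with matrices
  that come from \<open>R\<close>, so cycles and boundaries over \<open>S\<close> can be treated
  coordinate by coordinate.\<close>

locale free_extension = mat_complex R I E D + S?: ring S
 for R (structure) and I :: "nat => 'i set" and E D and S (structure) +
 fixes \<kappa> :: "'a => 's" and B :: "'bb set" and e :: "'bb => 's" and co :: "'bb => 's => 'a"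
 assumes \<kappa>: "\<kappa> : ring_hom R S"
  and e: "b : B ==> e b : car S"
  and co_closed: "b : B ==> s : car S ==> co b s : car R"
  and co_add: "b : B ==> s : car S ==> s' : car S ==> co b (s +_S s') = co b s +_R co b s'"
  and co_mult: "b : B ==> s : car S ==> r : car R ==> co b (s *_S \<kappa> r) = co b s *_R r"
  and co_fin: "s : car S ==> finite {b:B. co b s ~= 0_R}"
  and co_expand: "s : car S ==> s = (finsum S (%b. e b *_S \<kappa> (co b s)) {b:B. co b s ~= 0_R})"
begin

abbreviation "\<kappa>E == %n i j. \<kappa> (E n i j)"
abbreviation "\<kappa>D == %n i j. \<kappa> (D n i j)"

lemma \<kappa>c: "r : car R ==> \<kappa> r : car S"
 by (rule ring_hom_closed[OF \<kappa>])

lemma co_zero: "b : B ==> co b 0_S = 0_R"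
 using co_add[of b "0_S" "0_S"] co_closed[of b "0_S"] R.add.r_cancel_one' by force

lemma co_minus: "b : B ==> s : car S ==> s' : car S ==> co b (s -_S s') = co b s -_R co b s'"
 using co_add[of b "s -_S s'" s'] S.minus_add_cancel[of s s'] co_closed[of b]
 by (metis R.minus_eq_iff S.minus_closed)

lemma co_finsum:
 assumes b: "b : B"
 shows "finite A ==> f : A \<rightarrow> car S ==> co b (finsum S (%a. f a) A) = (finsum R (%a. co b (f a)) A)"
proof (induction set: finite)
 case empty
 then show ?case by (simp add: co_zero b)
next
 case (insert x F)
 then show ?case
  by (simp add: S.finsum_insert R.finsum_insert Pi_def co_add[OF b] co_closed[OF b] S.finsum_closed)
qed

lemma co_rows: "finite J ==> b : B ==> x : rows S J ==> (%i. co b (x i)) : rows R J"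
 by (rule R.rowsI) (auto simp: co_closed freeD(1) free_module_outside[of x S J] co_zero)

lemma co_mrow:
 assumes J: "finite J" and M: "M : J \<rightarrow> rows R L" and x: "x : rows S J" and b: "b : B"
 shows "(%j. co b (mrow S J (%i j. \<kappa> (M i j)) x j)) = mrow R J M (%i. co b (x i))"
proof
 fix j
 have c: "x i : car S" "M i j : car R" if "i : J" for i
  using freeD(1)[OF x] freeD(1)[OF funcset_mem[OF M that]] by auto
 have "co b (mrow S J (%i j. \<kappa> (M i j)) x j) = (finsum R (%i. co b (x i *_S \<kappa> (M i j))) J)" (is "?l = _")
  unfolding mrow_def using c \<kappa>c by (intro co_finsum[OF b J]) auto
 also have "... = mrow R J M (%i. co b (x i)) j"
  unfolding mrow_def using c co_mult[OF b] co_closed[OF b] by (intro R.finsum_cong') auto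
 finally show "?l = mrow R J M (%i. co b (x i)) j" .
qed

lemma co_cyc: "mcycle S I \<kappa>E \<kappa>D n x ==> b : B ==> cyc n (%i. co b (x i))"
proof -
 assume x: "mcycle S I \<kappa>E \<kappa>D n x" and b: "b : B"
 then have xr: "x : rows S (I n)" by (simp add: mcycle_def)
 show "cyc n (%i. co b (x i))"
  unfolding mcycle_def
 proof (intro conjI allI impI)
  show "(%i. co b (x i)) : rows R (I n)" by (rule co_rows[OF fin b xr])
  show "mrow R (I n) (E n) (%i. co b (x i)) = (%i. co b (x i))"
   unfolding co_mrow[OF fin E_rows xr b, symmetric] using x by (simp add: mcycle_def)
  fix m assume n: "n = Suc m"
  show "mrow R (I n) (D m) (%i. co b (x i)) = (%j. 0_R)"
   unfolding n co_mrow[OF fin D_rows xr[unfolded n] b, symmetric]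
   using x by (simp add: mcycle_def n co_zero b)
 qed
qed

lemma co_bdr: "mbdry S I \<kappa>D n x ==> b : B ==> bdr n (%i. co b (x i))"
 unfolding mbdry_def by (auto simp: co_mrow[OF fin D_rows] intro!: bexI[OF _ co_rows[OF fin]])

lemma co_expand_superset:
 assumes s: "s : car S" and F: "finite F" "F <= B" "{b:B. co b s ~= 0_R} <= F"
 shows "s = (finsum S (%b. e b *_S \<kappa> (co b s)) F)"
proof -
 have "(finsum S (%b. e b *_S \<kappa> (co b s)) {b:B. co b s ~= 0_R}) = (finsum S (%b. e b *_S \<kappa> (co b s)) F)"
  using F s co_closed e \<kappa>c
  by (intro S.add.finprod_mono_neutral_cong_left F(1,3))
  (auto simp: ring_hom_additive(1)[OF \<kappa> R.ring_axioms S.ring_axioms] dest!: subsetD[OF F(2)])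
 then show ?thesis using co_expand[OF s] by simp
qed

lemma co_inj: "s : car S ==> s' : car S ==> (!!b. b : B ==> co b s = co b s') ==> s = s'"
proof -
 assume s: "s : car S" and s': "s' : car S" and eq: "!!b. b : B ==> co b s = co b s'"
 have F: "{b:B. co b s ~= 0_R} = {b:B. co b s' ~= 0_R}" using eq by auto
 have "s = (finsum S (%b. e b *_S \<kappa> (co b s)) {b:B. co b s ~= 0_R})" by (rule co_expand[OF s])
 also have "... = (finsum S (%b. e b *_S \<kappa> (co b s')) {b:B. co b s' ~= 0_R})"
  unfolding F using s' co_closed e \<kappa>c eq by (intro S.finsum_cong') auto
 also have "... = s'" by (rule co_expand[OF s', symmetric])
 finally show "s = s'" .
qed

text \<open>The coordinates of a cycle are cycles over \<open>R\<close>, with coefficients in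
  \<open>C\<close>. Here \<open>A\<close> stands for the finitely supported families of such
  coefficients indexed by \<open>B\<close>: \<open>comb\<close> assembles a family into an element
  of \<open>A\<close>, and \<open>coA\<close> says that the coordinates of an element of
  \<open>A\<close> come from \<open>C\<close>.\<close>

lemma homology_ascent:
 assumes free: "hfree R I E D p C emb0 z"
  and emb0: "!!c. c : C ==> emb0 c : car R"
  and emb: "!!a. a : A ==> emb a : car S" and inj: "inj_on emb A"
  and coA: "!!a b. a : A ==> b : B ==> EX c:C. co b (emb a) = emb0 c"
  and comb: "!!F c. finite F ==> F <= B ==> (!!b. b : F ==> c b : C) ==>
    EX a:A. emb a = (finsum S (%b. e b *_S \<kappa> (emb0 (c b))) F)"
 shows "hfree S I \<kappa>E \<kappa>D p A emb (%i. \<kappa> (z i))"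
proof -
 have z: "cyc p z" and ex: "!!n x. n ~= p ==> cyc n x ==> bdr n x"
  and exp: "!!x. cyc p x ==> EX! c. c : C & bdr p (%i. x i -_R emb0 c *_R z i)"
  using free by (auto simp: hfree_def)
 note zc = freeD(1)[OF cyc_rows[OF z]]
 note bc = base_change[OF \<kappa> S.ring_axioms]
 interpret s: mat_complex S I \<kappa>E \<kappa>D by (rule bc(1))
 \<comment> \<open>A row has finitely many entries with finitely many coordinates each, so one
   finite set of generators serves the whole row.\<close>
 have supp: "EX F. finite F & F <= B & (ALL i. {b:B. co b (x i) ~= 0_R} <= F)" if x: "x : rows S (I n)" for n x
 proof (intro exI conjI allI)
  let ?F = "\<Union>i\<in>I n. {b:B. co b (x i) ~= 0_R}"
  show "finite ?F" using fin co_fin[OF freeD(1)[OF x]] by blast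
  show "?F <= B" by blast
  show "{b:B. co b (x i) ~= 0_R} <= ?F" for i
   using free_module_outside[OF x, of i] co_zero by (cases "i : I n") auto
 qed
 \<comment> \<open>Preimages under the differential are recombined with the same coefficients
   \<open>e b\<close>, because the differential over \<open>S\<close> is left linear.\<close>
 have glue: "mbdry S I \<kappa>D n (%i. \<Oplus>\<^bsub>S\<^esub>b\<in>F. e b *_S \<kappa> (v b i))"
  if F: "finite F" "F <= B" and v: "!!b. b : F ==> bdr n (v b)" for F n v
 proof -
  have "ALL b:F. EX y. y : rows R (I (Suc n)) & v b = mrow R (I (Suc n)) (D n) y"
   using v unfolding mbdry_def by blast
  then obtain y where y: "!!b. b : F ==> y b : rows R (I (Suc n))"
   "!!b. b : F ==> v b = mrow R (I (Suc n)) (D n) (y b)" by metis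
  let ?Y = "\<Oplus>\<^bsub>freem S (I (Suc n))\<^esub>b\<in>F. e b .*_(freem S (I (Suc n))) (%i. \<kappa> (y b i))"
  interpret F1: left_module S "freem S (I (Suc n))" by (rule S.free_left_module)
  interpret F0: left_module S "freem S (I n)" by (rule S.free_left_module)
  note rw = ring_hom_rows[OF \<kappa> R.ring_axioms S.ring_axioms fin]
  have yc: "e b .*_(freem S (I (Suc n))) (%i. \<kappa> (y b i)) : rows S (I (Suc n))" if "b : F" for b
   using that F(2) e y rw by (intro F1.smult_closed) auto
  have vr: "v b : rows R (I n)" if "b : F" for b using cyc_rows[OF bdr_cyc[OF v[OF that]]] .
  note hom = S.mrow_hom[OF fin s.D_rows[of n]]
  have "mrow S (I (Suc n)) (\<kappa>D n) ?Y = (finsum (freem S (I n)) (%b.     mrow S (I (Suc n)) (\<kappa>D n) (e b .*_(freem S (I (Suc n))) (%i. \<kappa> (y b i)))) F)"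
   by (intro mh_finsum[OF hom] F1.abelian_group_axioms F0.abelian_group_axioms F(1) Pi_I yc)
  also have "... = (finsum (freem S (I n)) (%b. e b .*_(freem S (I n)) (%i. \<kappa> (v b i))) F)"
  proof (intro F0.finsum_cong' refl Pi_I F0.smult_closed rw vr)
   fix b assume b: "b : F"
   then show "e b : car S" using e F(2) by blast
   then show "mrow S (I (Suc n)) (\<kappa>D n) (e b .*_(freem S (I (Suc n))) (%i. \<kappa> (y b i))) =
     e b .*_(freem S (I n)) (%i. \<kappa> (v b i))"
    using mh_smult[OF hom _ rw[OF y(1)[OF b]]]
     ring_hom_mrow[OF \<kappa> R.ring_axioms S.ring_axioms fin D_rows y(1)[OF b]] y(2)[OF b] by simp
  qed
  also have "... = (%i. \<Oplus>\<^bsub>S\<^esub>b\<in>F. (e b .*_(freem S (I n)) (%i. \<kappa> (v b i))) i)"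
   using e F(2) by (intro S.free_module_finsum F(1) Pi_I F0.smult_closed rw vr) auto
  finally have "(%i. \<Oplus>\<^bsub>S\<^esub>b\<in>F. e b *_S \<kappa> (v b i)) = mrow S (I (Suc n)) (\<kappa>D n) ?Y"
   by (simp add: free_sel(4))
  moreover have "?Y : rows S (I (Suc n))" using yc by (intro F1.finsum_closed Pi_I)
  ultimately show ?thesis unfolding mbdry_def by blast
 qed
 show ?thesis
  unfolding hfree_def
 proof (intro conjI allI impI)
  show "mcycle S I \<kappa>E \<kappa>D p (%i. \<kappa> (z i))" by (rule bc(2)[OF z])
  fix n x assume np: "n ~= p" and x: "mcycle S I \<kappa>E \<kappa>D n x"
  obtain F where F: "finite F" "F <= B" "!!i. {b:B. co b (x i) ~= 0_R} <= F"
   using supp[OF s.cyc_rows[OF x]] by metis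
  have "mbdry S I \<kappa>D n (%i. \<Oplus>\<^bsub>S\<^esub>b\<in>F. e b *_S \<kappa> (co b (x i)))"
   using F(2) by (intro glue F(1,2) ex[OF np] co_cyc[OF x]) auto
  then show "mbdry S I \<kappa>D n x"
   using co_expand_superset[OF freeD(1)[OF s.cyc_rows[OF x]] F] by simp
 next
  fix x assume x: "mcycle S I \<kappa>E \<kappa>D p x"
  note xc = freeD(1)[OF s.cyc_rows[OF x]]
  have \<kappa>z: "\<kappa> (z i) : car S" for i using \<kappa>c zc by blast
  show "EX! a. a : A & mbdry S I \<kappa>D p (%i. x i -_S emb a *_S \<kappa> (z i))"
  proof (rule ex_ex1I)
   obtain F where F: "finite F" "F <= B" "!!i. {b:B. co b (x i) ~= 0_R} <= F"
    using supp[OF s.cyc_rows[OF x]] by metis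
   obtain c where c: "!!b. b : B ==> c b : C"
    "!!b. b : B ==> bdr p (%i. co b (x i) -_R emb0 (c b) *_R z i)"
    using exp[OF co_cyc[OF x]] by metis
   obtain a where a: "a : A" "emb a = (finsum S (%b. e b *_S \<kappa> (emb0 (c b))) F)"
    using comb[OF F(1,2)] c(1) F(2) by (metis subsetD)
   have "mbdry S I \<kappa>D p (%i. \<Oplus>\<^bsub>S\<^esub>b\<in>F. e b *_S \<kappa> (co b (x i) -_R emb0 (c b) *_R z i))"
    using F(2) c(2) by (intro glue F(1,2)) auto
   moreover have "(finsum S (%b. e b *_S \<kappa> (co b (x i) -_R emb0 (c b) *_R z i)) F) = x i -_S emb a *_S \<kappa> (z i)" for i
   proof -
    have cl: "e b : car S" "co b (x i) : car R" "emb0 (c b) : car R" "\<kappa> (co b (x i)) : car S"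
     "\<kappa> (emb0 (c b)) : car S" if "b : F" for b
     using that F(2) e co_closed[OF _ xc] emb0 c(1) \<kappa>c by blast+
    have "(finsum S (%b. e b *_S \<kappa> (co b (x i) -_R emb0 (c b) *_R z i)) F) +_S emb a *_S \<kappa> (z i) =
     (finsum S (%b. e b *_S \<kappa> (co b (x i) -_R emb0 (c b) *_R z i)) F) +_S (finsum S (%b. e b *_S \<kappa> (emb0 (c b)) *_S \<kappa> (z i)) F)" (is "?l = _")
     unfolding a(2) using cl \<kappa>z by (subst S.finsum_ldistr[OF F(1)]) auto
    also have "... = (finsum S (%b. e b *_S \<kappa> (co b (x i) -_R emb0 (c b) *_R z i) +_S e b *_S \<kappa> (emb0 (c b)) *_S \<kappa> (z i)) F)"
     using cl \<kappa>z zc \<kappa>c by (intro S.finsum_addf[symmetric]) auto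
    also have "... = (finsum S (%b. e b *_S \<kappa> (co b (x i))) F)"
    proof (intro S.finsum_cong' refl Pi_I S.m_closed cl)
     fix b assume b: "b : F"
     have "e b *_S (u -_S v *_S w) +_S e b *_S v *_S w = e b *_S u"
      if "u : car S" "v : car S" "w : car S" for u v w
      using cl(1)[OF b] that by algebra
     then show "e b *_S \<kappa> (co b (x i) -_R emb0 (c b) *_R z i) +_S e b *_S \<kappa> (emb0 (c b)) *_S \<kappa> (z i) =
      e b *_S \<kappa> (co b (x i))"
      using cl[OF b] zc \<kappa>z
      by (simp add: ring_hom_additive(3)[OF \<kappa> R.ring_axioms S.ring_axioms] ring_hom_mult[OF \<kappa>])
    qed
    also have "... = x i" using co_expand_superset[OF xc F] by simp
    finally have "?l = x i" .
    moreover have "(finsum S (%b. e b *_S \<kappa> (co b (x i) -_R emb0 (c b) *_R z i)) F) : car S"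
     using cl zc by (intro S.finsum_closed Pi_I S.m_closed \<kappa>c R.minus_closed R.m_closed)
    ultimately show ?thesis
     using S.minus_eq_iff[OF xc[of i] S.m_closed[OF emb[OF a(1)] \<kappa>z[of i]]] by metis
   qed
   ultimately show "EX a. a : A & mbdry S I \<kappa>D p (%i. x i -_S emb a *_S \<kappa> (z i))"
    using a(1) by auto
  next
   fix a a'
   assume a: "a : A & mbdry S I \<kappa>D p (%i. x i -_S emb a *_S \<kappa> (z i))"
    and a': "a' : A & mbdry S I \<kappa>D p (%i. x i -_S emb a' *_S \<kappa> (z i))"
   \<comment> \<open>Both coordinates are coefficients of one and the same cycle over
     \<open>R\<close>, so uniqueness over \<open>R\<close> identifies them.\<close>
   have "co b (emb a) = co b (emb a')" if b: "b : B" for b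
   proof -
    obtain c c' where c: "c : C" "co b (emb a) = emb0 c" and c': "c' : C" "co b (emb a') = emb0 c'"
     using coA a a' b by metis
    have "co b (x i -_S emb d *_S \<kappa> (z i)) = co b (x i) -_R co b (emb d) *_R z i" if "d : A" for i d
     using xc emb[OF that] zc \<kappa>z b by (simp add: co_minus co_mult)
    then have "bdr p (%i. co b (x i) -_R emb0 c *_R z i)" "bdr p (%i. co b (x i) -_R emb0 c' *_R z i)"
     using co_bdr[OF conjunct2[OF a] b] co_bdr[OF conjunct2[OF a'] b] a a' c c' by simp_all
    then have "c = c'" using exp[OF co_cyc[OF x b]] c(1) c'(1) by blast
    then show ?thesis using c c' by simp
   qed
   then have "emb a = emb a'" using co_inj emb a a' by blast
   then show "a = a'" using inj a a' by (simp add: inj_on_def)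
  qed
 qed
qed

end

section \<open>Resolutions by finitely generated projectives and matrices\<close>

text \<open>The finite index set may be taken in any infinite type. This freedom is used to give the
  resolution over \<open>H\<close> index sets that fit the type prescribed for resolutions over
  \<open>A\<close>.\<close>

lemma fin_generated_summand:
 fixes P :: "('r, 'p) module"
 assumes P: "projective_module R P" and fg: "fin_generated R P" and inf: "infinite (UNIV :: 'i set)"
 shows "EX (I :: 'i set) \<iota> \<pi>. finite I & \<iota> : mhom R P (freem R I) &
  \<pi> : mhom R (freem R I) P & (ALL x:car P. \<pi> (\<iota> x) = x)"
proof -
 have Pm: "lmod R P" using P by (simp add: projective_module_def)
 interpret P: left_module R P by (rule Pm)
 obtain S where S: "S <= car P" "finite S" "submodule_span R P S = car P"
  using fg by (auto simp: fin_generated_def)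
 obtain I :: "'i set" where I: "finite I" "card I = card S"
  using infinite_arbitrarily_large[OF inf] by metis
 obtain f where f: "bij_betw f I S" using finite_same_card_bij[OF I(1) S(2) I(2)] by blast
 then have fI: "f : I \<rightarrow> car P" using S(1) by (auto simp: bij_betw_def)
 let ?q = "flift P R f"
 have q: "?q : mhom R (freem R I) P" by (rule P.R.flift_hom[OF Pm fI])
 have "submodule (?q ` rows R I) R P"
 proof (rule P.submoduleI)
  interpret F: left_module R "freem R I" by (rule P.R.free_left_module)
  show "?q ` rows R I <= car P" using mh_closed[OF q] by blast
  show "0_P : ?q ` rows R I"
   using mh_zero[OF q F.abelian_group_axioms P.abelian_group_axioms] by (metis F.M.zero_closed imageI)
  show "x +_P y : ?q ` rows R I"
   if x: "x : ?q ` rows R I" and y: "y : ?q ` rows R I" for x y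
  proof -
   obtain u v where u: "u : rows R I" "x = ?q u" and v: "v : rows R I" "y = ?q v"
    using x y by blast
   show ?thesis unfolding u(2) v(2) mh_add[OF q u(1) v(1), symmetric]
    by (rule imageI[OF F.M.a_closed[OF u(1) v(1)]])
  qed
  show "a .*_P x : ?q ` rows R I"
   if a: "a : car R" and x: "x : ?q ` rows R I" for a x
  proof -
   obtain u where u: "u : rows R I" "x = ?q u" using x by blast
   show ?thesis unfolding u(2) mh_smult[OF q a u(1), symmetric]
    by (rule imageI[OF F.smult_closed[OF a u(1)]])
  qed
 qed
 moreover have "S <= ?q ` rows R I"
 proof
  fix s assume "s : S"
  then obtain i where i: "i : I" "s = f i" using f by (auto simp: bij_betw_def)
  then show "s : ?q ` rows R I"
   using P.R.flift_basis[OF Pm fI i(1)] P.R.basis_closed[OF i(1)] by (metis imageI)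
 qed
 ultimately have "car P <= ?q ` rows R I"
  using submodule_span_minimal S(3) by metis
 then have im: "x : ?q ` rows R I" if "x : car P" for x using that by blast
 obtain \<iota> where "\<iota> : mhom R P (freem R I)" "!!x. x : car P ==> ?q (\<iota> x) = x"
  using projective_lift[OF P P.R.free_left_module Pm q mh_id im] by metis
 then show ?thesis using I(1) q by blast
qed

text \<open>The definition of projectivity wants a basis indexed by elements of the type of
  \<open>P\<close>; the injection \<open>j\<close> relabels the indices accordingly.\<close>

lemma projective_moduleI:
 fixes P :: "('r, 'p) module"
 assumes Pm: "lmod R P" and I: "finite I"
  and i: "\<iota> : mhom R P (freem R I)" and pi: "\<pi> : mhom R (freem R I) P"
  and id: "!!x. x : car P ==> \<pi> (\<iota> x) = x" and j: "inj_on (j :: 'i => 'p) I"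
 shows "projective_module R P"
proof -
 interpret P: left_module R P by (rule Pm)
 let ?h = "%f p. if p : j ` I then f (inv_into I j p) else 0_R"
 let ?k = "%f i. if i : I then f (j i) else 0_R"
 have h: "?h : mhom R (freem R I) (freem R (j ` I))"
  by (rule mhI)
   (use I in \<open>auto simp: free_sel(3,4) fun_eq_iff freeD(1) intro!: P.R.rowsI\<close>)
 have k: "?k : mhom R (freem R (j ` I)) (freem R I)"
  by (rule mhI)
   (use I in \<open>auto simp: free_sel(3,4) fun_eq_iff freeD(1) intro!: P.R.rowsI\<close>)
 have kh: "?k (?h f) = f" if f: "f : rows R I" for f
  using j free_module_outside[OF f] by (auto simp: fun_eq_iff)
 show ?thesis
  unfolding projective_module_def
 proof (intro conjI exI ballI Pm)
  show "(%x. ?h (\<iota> x)) : mhom R P (freem R (j ` I))" by (rule mh_comp[OF i h])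
  show "(%f. \<pi> (?k f)) : mhom R (freem R (j ` I)) P" by (rule mh_comp[OF k pi])
  show "\<pi> (?k (?h (\<iota> x))) = x" if "x : car P" for x
   using kh[OF mh_closed[OF i that]] id[OF that] by simp
 qed
qed

abbreviation op_ring :: "('r, 'z) ring_scheme => ('r, 'z) ring_scheme" where
 "op_ring R == R\<lparr>mult := (%x y. y *_R x)\<rparr>"

lemma op_ring_ring: "ring R ==> ring (op_ring R)"
proof -
 assume "ring R"
 then interpret ring R .
 show ?thesis
  by (intro ringI abelian_groupI monoidI)
   (auto simp: a_ac l_distr r_distr m_assoc intro: l_neg)
qed

lemma op_ring_finsum: "finsum (op_ring R) f A = finsum R f A"
 by (simp add: finsum_def finprod_def cong: if_cong)

lemma op_ring_rows: "rows (op_ring R) I = rows R I"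
 by (simp add: free_sel)

text \<open>A resolution with each term given as a retract of a finite free module. The matrices of
  \<open>\<iota> \<pi>\<close> and \<open>\<iota> \<delta> \<pi>\<close> describe the same complex
  by idempotent matrices.\<close>

locale presented = resolution R M P \<delta> \<epsilon>
 for R (structure) and M :: "('r, 'm) module" and P :: "nat => ('r, 'p) module" and \<delta> \<epsilon> +
 fixes I :: "nat => 'i set" and \<iota> :: "nat => 'p => 'i => 'r" and \<pi> :: "nat => ('i => 'r) => 'p"
 assumes finI: "finite (I n)"
  and \<iota>: "\<iota> n : mhom R (P n) (freem R (I n))"
  and \<pi>: "\<pi> n : mhom R (freem R (I n)) (P n)"
  and \<pi>_\<iota>: "x : car (P n) ==> \<pi> n (\<iota> n x) = x"
begin

definition E where "E n i = \<iota> n (\<pi> n (free_basis R i))"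
definition D where "D n i = \<iota> n (\<delta> n (\<pi> (Suc n) (free_basis R i)))"

lemmas \<iota>c = mh_closed[OF \<iota>]
lemmas \<pi>c = mh_closed[OF \<pi>]
lemmas \<delta>c = mh_closed[OF \<delta>_hom]

lemma E_rows: "E n : I n \<rightarrow> rows R (I n)"
 unfolding E_def by (intro Pi_I \<iota>c \<pi>c M.R.basis_closed)

lemma D_rows: "D n : I (Suc n) \<rightarrow> rows R (I n)"
 unfolding D_def by (intro Pi_I \<iota>c \<delta>c \<pi>c M.R.basis_closed)

lemma mrow_E: "x : rows R (I n) ==> mrow R (I n) (E n) x = \<iota> n (\<pi> n x)"
 unfolding E_def[abs_def] by (rule M.R.hom_mrow[OF finI mh_comp[OF \<pi> \<iota>], symmetric])

lemma mrow_D: "x : rows R (I (Suc n)) ==> mrow R (I (Suc n)) (D n) x = \<iota> n (\<delta> n (\<pi> (Suc n) x))"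
 unfolding D_def[abs_def]
 by (rule M.R.hom_mrow[OF finI mh_comp[OF mh_comp[OF \<pi> \<delta>_hom] \<iota>], symmetric])

lemma \<iota>_zero: "\<iota> n 0_(P n) = (%i. \<zero>)"
 using mh_zero[OF \<iota> P_group M.R.free_module_abelian_group] by (simp add: free_sel(2))

lemma mat_complex: "mat_complex R I E D"
proof (intro mat_complex.intro mat_complex_axioms.intro M.R.ring_axioms finI E_rows D_rows)
 fix n i
 note b = M.R.basis_closed[of i]
 show "mrow R (I n) (E n) (E n i) = E n i" if "i : I n"
  using funcset_mem[OF E_rows that] \<pi>_\<iota>[OF \<pi>c[OF b[OF that]]] by (simp add: mrow_E) (simp add: E_def)
 show "mrow R (I n) (E n) (D n i) = D n i" if "i : I (Suc n)"
  using funcset_mem[OF D_rows that] \<pi>_\<iota>[OF \<delta>c[OF \<pi>c[OF b[OF that]]]] by (simp add: mrow_E) (simp add: D_def)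
 show "mrow R (I (Suc n)) (D n) (E (Suc n) i) = D n i" if "i : I (Suc n)"
  using funcset_mem[OF E_rows that] \<pi>_\<iota>[OF \<pi>c[OF b[OF that]]] by (simp add: mrow_D) (simp add: E_def D_def)
 show "mrow R (I (Suc n)) (D n) (D (Suc n) i) = (%j. \<zero>)" if "i : I (Suc (Suc n))"
  using funcset_mem[OF D_rows that] \<pi>_\<iota>[OF \<delta>c[OF \<pi>c[OF b[OF that]]]] \<delta>_\<delta>[OF \<pi>c[OF b[OF that]]]
  by (simp add: mrow_D) (simp add: D_def \<iota>_zero)
qed

sublocale mc: mat_complex R I E D by (rule mat_complex)

lemma \<iota>_inj: "x : car (P n) ==> \<iota> n x = (%i. \<zero>) ==> x = 0_(P n)"
proof -
 assume x: "x : car (P n)" and x0: "\<iota> n x = (%i. \<zero>)"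
 have "0_(P n) : car (P n)" using abelian_monoid.zero_closed[OF abelian_group.axioms(1)[OF P_group]] .
 then show ?thesis using \<pi>_\<iota>[OF x] \<pi>_\<iota>[of "0_(P n)" n] x0 \<iota>_zero[of n] by simp
qed

lemma cycle_Suc_bdry: "mc.cyc (Suc n) x ==> mc.bdr (Suc n) x"
proof -
 assume x: "mc.cyc (Suc n) x"
 then have xr: "x : rows R (I (Suc n))" and xE: "\<iota> (Suc n) (\<pi> (Suc n) x) = x"
  and xD: "\<iota> n (\<delta> n (\<pi> (Suc n) x)) = (%i. \<zero>)"
  by (auto simp: mcycle_def mrow_E mrow_D)
 have "\<pi> (Suc n) x : \<delta> (Suc n) ` car (P (Suc (Suc n)))"
  using \<iota>_inj[OF \<delta>c[OF \<pi>c[OF xr]] xD] \<pi>c[OF xr] by (simp add: exact_Suc)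
 then obtain y where y: "y : car (P (Suc (Suc n)))" "\<pi> (Suc n) x = \<delta> (Suc n) y" by blast
 show ?thesis
  unfolding mbdry_def by (rule bexI[of _ "\<iota> (Suc (Suc n)) y"]) (use y xE in \<open>simp_all add: \<iota>c mrow_D \<pi>_\<iota>\<close>)
qed

lemma cycle_0_bdry: "mc.cyc 0 x ==> mc.bdr 0 x \<longleftrightarrow> \<epsilon> (\<pi> 0 x) = 0_M"
proof
 assume x: "mc.cyc 0 x"
 then have xr: "x : rows R (I 0)" and xE: "\<iota> 0 (\<pi> 0 x) = x"
  by (auto simp: mcycle_def mrow_E)
 {
  assume "\<epsilon> (\<pi> 0 x) = 0_M"
  then have "\<pi> 0 x : \<delta> 0 ` car (P (Suc 0))" using \<pi>c[OF xr] by (simp add: exact_0)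
  then obtain y where y: "y : car (P (Suc 0))" "\<pi> 0 x = \<delta> 0 y" by blast
  show "mc.bdr 0 x"
   unfolding mbdry_def by (rule bexI[of _ "\<iota> (Suc 0) y"]) (use y xE in \<open>simp_all add: \<iota>c mrow_D \<pi>_\<iota>\<close>)
 next
  assume "mc.bdr 0 x"
  then show "\<epsilon> (\<pi> 0 x) = 0_M"
   unfolding mbdry_def by (auto simp: mrow_D \<pi>_\<iota> \<delta>c \<pi>c \<epsilon>_\<delta>)
 }
qed

text \<open>The homology of the matrix complex of a resolution is \<open>M\<close>, in degree 0,
  read off through \<epsilon> and \<pi>. So freeness of \<open>M\<close> on \<epsilon> q becomes
  freeness of the homology on the class of \<iota> q.\<close>

lemma hfree_0:
 assumes q: "q : car (P 0)" and emb: "!!s. s : S ==> emb s : car R"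
  and free: "!!m. m : car M ==> EX! s. s : S & m = emb s .*_M \<epsilon> q"
 shows "hfree R I E D 0 S emb (\<iota> 0 q)"
 unfolding hfree_def
proof (intro conjI allI impI)
 fix n x assume "n ~= 0" "mc.cyc n x"
 then show "mc.bdr n x" using cycle_Suc_bdry by (cases n) auto
next
 show q': "mc.cyc 0 (\<iota> 0 q)" using q by (simp add: mcycle_def \<iota>c mrow_E \<pi>_\<iota>)
 fix x assume x: "mc.cyc 0 x"
 then have xr: "x : rows R (I 0)" by (simp add: mcycle_def)
 have iff: "mc.bdr 0 (%i. x i \<ominus> emb s \<otimes> \<iota> 0 q i) \<longleftrightarrow> \<epsilon> (\<pi> 0 x) = emb s .*_M \<epsilon> q" if s: "s : S" for s
 proof -
  have eq: "(%i. x i \<ominus> emb s \<otimes> \<iota> 0 q i) = x -_(freem R (I 0)) emb s .*_(freem R (I 0)) \<iota> 0 q"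
   using M.R.free_module_minus[OF xr M.R.rows_smult[OF emb[OF s] \<iota>c[OF q]]] by (simp add: free_sel(4))
  note ec = left_module.smult_closed[OF M.R.free_left_module emb[OF s] \<iota>c[OF q]]
  have "\<pi> 0 (%i. x i \<ominus> emb s \<otimes> \<iota> 0 q i) = \<pi> 0 x -_(P 0) emb s .*_(P 0) q"
   unfolding eq using mh_diff[OF \<pi> M.R.free_module_abelian_group P_group xr ec]
    mh_smult[OF \<pi> emb[OF s] \<iota>c[OF q]] \<pi>_\<iota>[OF q] by simp
  also have "\<epsilon> ... = \<epsilon> (\<pi> 0 x) -_M emb s .*_M \<epsilon> q"
   using mh_diff[OF \<epsilon>_hom P_group M.abelian_group_axioms \<pi>c[OF xr] left_module.smult_closed[OF P_module emb[OF s] q]]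
    mh_smult[OF \<epsilon>_hom emb[OF s] q] by simp
  finally show ?thesis
   using cycle_0_bdry[OF mc.cyc_minus[OF x mc.cyc_smult[OF emb[OF s] q']]]
    M.minus_eq_zero_iff[OF mh_closed[OF \<epsilon>_hom \<pi>c[OF xr]] M.smult_closed[OF emb[OF s] mh_closed[OF \<epsilon>_hom q]]]
   by simp
 qed
 show "EX! s. s : S & mc.bdr 0 (%i. x i \<ominus> emb s \<otimes> \<iota> 0 q i)"
  using free[OF mh_closed[OF \<epsilon>_hom \<pi>c[OF xr]]] by (simp only: conj_cong[OF refl iff])
qed

end

section \<open>The dual complex\<close>

text \<open>Rows over the opposite ring are columns; \<open>pairing\<close> is the product of a row and a column.\<close>

definition pairing :: "('r, 'z) ring_scheme => 'i set => ('i => 'r) => ('i => 'r) => 'r" where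
 "pairing R I y x = (finsum R (%i. x i *_R y i) I)"

text \<open>The guard on \<open>k\<close> makes the transposed rows vanish outside \<open>I\<close>,
  as membership in \<open>rows\<close> requires.\<close>

definition mtrans :: "('r, 'z) ring_scheme => 'i set => ('i => 'i => 'r) => 'i => 'i => 'r" where
 "mtrans R I D i k = (if k : I then D k i else 0_R)"

context ring
begin

lemma pairing_hom:
 assumes I: "finite I" and y: "y : rows R I"
 shows "pairing R I y : mhom R (freem R I) (reg R)"
proof (rule mhI)
 fix x assume x: "x : rows R I"
 note c = freeD(1)[OF x] freeD(1)[OF y]
 show "pairing R I y x : car (reg R)"
  using c by (auto simp: pairing_def regular_module_def intro!: finsum_closed)
 show "pairing R I y (a .*_(freem R I) x) = a .*_(reg R) pairing R I y x" if "a : car R" for a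
  using c I that by (simp add: pairing_def regular_module_def free_sel(4) finsum_rdistr m_assoc Pi_def)
 fix x' assume x': "x' : rows R I"
 show "pairing R I y (x +_(freem R I) x') = pairing R I y x +_(reg R) pairing R I y x'"
  using c freeD(1)[OF x'] I
  by (simp add: pairing_def regular_module_def free_sel(3) l_distr finsum_addf Pi_def)
qed

lemma pairing_closed: "finite I ==> y : rows R I ==> x : rows R I ==> pairing R I y x : car R"
 using mh_closed[OF pairing_hom] by (simp add: regular_module_def)

lemma pairing_basis:
 assumes I: "finite I" and y: "!!i. y i : car R" and i: "i : I"
 shows "pairing R I y (free_basis R i) = y i"
proof -
 have "pairing R I y (free_basis R i) = (\<Oplus>j\<in>I. if i = j then y j else \<zero>)"
  unfolding pairing_def using y by (intro finsum_cong') (auto simp: free_basis_def)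
 then show ?thesis using finsum_singleton[OF i I, of y] y by simp
qed

lemma pairing_basis_right:
 assumes I: "finite I" and x: "!!i. x i : car R" and i: "i : I"
 shows "pairing R I (free_basis R i) x = x i"
proof -
 have "pairing R I (free_basis R i) x = (\<Oplus>j\<in>I. if i = j then x j else \<zero>)"
  unfolding pairing_def using x by (intro finsum_cong') (auto simp: free_basis_def)
 then show ?thesis using finsum_singleton[OF i I, of x] x by simp
qed

lemma pairing_eqI:
 assumes I: "finite I" and f: "f : mhom R (freem R I) (reg R)" and y: "y : rows R I"
  and eq: "!!i. i : I ==> f (free_basis R i) = y i" and x: "x : rows R I"
 shows "f x = pairing R I y x"
 by (rule free_hom_eqI[OF f pairing_hom[OF I y] regular_left_module[OF ring_axioms] _ x])
  (simp add: eq pairing_basis[OF I freeD(1)[OF y]])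

lemma mtrans_rows: "finite I ==> D : I \<rightarrow> rows R J ==> mtrans R I D i : rows R I"
 by (rule rowsI) (auto simp: mtrans_def freeD(1) dest: funcset_mem)

lemma mrow_mtrans:
 assumes I: "finite I" and J: "finite J" and D: "D : I \<rightarrow> rows R J" and y: "y : rows R J"
 shows "mrow (op_ring R) J (mtrans R I D) y = (%k. if k : I then pairing R J y (D k) else \<zero>)"
proof
 fix k
 show "mrow (op_ring R) J (mtrans R I D) y k = (if k : I then pairing R J y (D k) else \<zero>)"
 proof (cases "k : I")
  case True
  then show ?thesis by (simp add: mrow_def mtrans_def pairing_def op_ring_finsum)
 next
  case False
  have "(\<Oplus>i\<in>J. \<zero> \<otimes> y i) = (\<Oplus>i\<in>J. \<zero>)"
   using freeD(1)[OF y] by (intro finsum_cong') auto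
  then show ?thesis using False by (simp add: mrow_def mtrans_def op_ring_finsum)
 qed
qed

text \<open>Transposition is the adjoint with respect to the pairing: both sides are linear in
  \<open>x\<close> and agree on basis rows.\<close>

lemma pairing_mtrans:
 assumes I: "finite I" and J: "finite J" and D: "D : I \<rightarrow> rows R J" and y: "y : rows R J" and x: "x : rows R I"
 shows "pairing R I (mrow (op_ring R) J (mtrans R I D) y) x = pairing R J y (mrow R I D x)"
proof -
 have r: "mrow (op_ring R) J (mtrans R I D) y : rows R I"
  unfolding mrow_mtrans[OF I J D y] using pairing_closed[OF J y funcset_mem[OF D]] by (intro rowsI[OF I]) auto
 show ?thesis
  by (rule pairing_eqI[OF I mh_comp[OF mrow_hom[OF I D] pairing_hom[OF J y]] r _ x, symmetric])
   (simp add: mrow_basis[OF I D] mrow_mtrans[OF I J D y])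
qed

lemma mtrans_basis:
 assumes I: "finite I" and J: "finite J" and D: "D : I \<rightarrow> rows R J" and i: "i : J"
 shows "mtrans R I D i = mrow (op_ring R) J (mtrans R I D) (free_basis R i)"
 unfolding mrow_mtrans[OF I J D basis_closed[OF i]]
 using pairing_basis_right[OF J freeD(1)[OF funcset_mem[OF D]] i] by (auto simp: mtrans_def fun_eq_iff)

text \<open>Transposition reverses products, which is why they are formed over the opposite ring.
  Describing the product by its rows \<open>G k\<close> covers all four identities of a matrix
  complex.\<close>

lemma mtrans_comp:
 assumes I: "finite I" and J: "finite J" and L: "finite L" and D: "D : I \<rightarrow> rows R J" and F: "F : J \<rightarrow> rows R L"
  and i: "i : L" and G: "!!k. k : I ==> mrow R J F (D k) = G k"
 shows "mrow (op_ring R) J (mtrans R I D) (mtrans R J F i) = mtrans R I G i"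
proof
 fix k
 have "pairing R J (mtrans R J F i) (D k) = G k i" if k: "k : I"
 proof -
  note Dk = funcset_mem[OF D k]
  have "pairing R J (mtrans R J F i) (D k) = pairing R L (free_basis R i) (mrow R J F (D k))"
   unfolding mtrans_basis[OF J L F i] by (rule pairing_mtrans[OF J L F basis_closed[OF i] Dk])
  also have "... = G k i"
   using pairing_basis_right[OF L freeD(1)[OF mrow_closed[OF J F Dk]] i] G[OF k] by simp
  finally show ?thesis .
 qed
 then show "mrow (op_ring R) J (mtrans R I D) (mtrans R J F i) k = mtrans R I G i k"
  unfolding mrow_mtrans[OF I J D mtrans_rows[OF J F]] by (simp add: mtrans_def)
qed

end

context presented
begin

context
 fixes L :: nat
 assumes bnd: "!!n. L < n ==> car (P n) = {0_(P n)}"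
begin

text \<open>The dual is a cochain complex, while differentials of a \<open>mat_complex\<close> lower
  the degree. Degree \<open>n\<close> is therefore put in position L - n. Index sets beyond
  \<open>L\<close> are empty, so the truncated subtractions in \<open>E'\<close> and
  \<open>D'\<close> do no harm there.\<close>

definition J where "J j = (if j <= L then I (L - j) else {})"
definition E' where "E' j = mtrans R (J j) (E (L - j))"
definition D' where "D' j = mtrans R (J j) (D (L - Suc j))"

abbreviation "oR == op_ring R"

lemma finJ: "finite (J j)" by (simp add: J_def finI)

lemma EJ: "E (L - j) : J j \<rightarrow> rows R (J j)"
 using E_rows by (auto simp: J_def)

lemma DJ: "D (L - Suc j) : J j \<rightarrow> rows R (J (Suc j))" if "Suc j <= L"
 using D_rows[of "L - Suc j"] that by (auto simp: J_def Suc_diff_Suc)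

lemma E'_act: "y : rows R (J j) ==> mrow oR (J j) (E' j) y = (%k. if k : J j then pairing R (J j) y (E (L - j) k) else \<zero>)"
 unfolding E'_def by (rule M.R.mrow_mtrans[OF finJ finJ EJ])

lemma D'_act: "y : rows R (J (Suc j)) ==> Suc j <= L ==>
  mrow oR (J (Suc j)) (D' j) y = (%k. if k : J j then pairing R (J (Suc j)) y (D (L - Suc j) k) else \<zero>)"
 unfolding D'_def by (rule M.R.mrow_mtrans[OF finJ finJ DJ])

lemma D'_act_pairing: "y : rows R (J (Suc j)) ==> Suc j <= L ==> x : rows R (J j) ==>
  pairing R (J j) (mrow oR (J (Suc j)) (D' j) y) x = pairing R (J (Suc j)) y (mrow R (J j) (D (L - Suc j)) x)"
 unfolding D'_def by (rule M.R.pairing_mtrans[OF finJ finJ DJ])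

lemma E'_rows: "E' j : J j \<rightarrow> rows R (J j)"
 unfolding E'_def by (intro Pi_I M.R.mtrans_rows[OF finJ EJ])

lemma D'_rows: "D' j : J (Suc j) \<rightarrow> rows R (J j)"
proof (cases "Suc j <= L")
 case True
 then show ?thesis unfolding D'_def by (intro Pi_I M.R.mtrans_rows[OF finJ DJ])
qed (auto simp: J_def)

lemma dual_mat_complex: "mat_complex oR J E' D'"
proof (intro mat_complex.intro mat_complex_axioms.intro op_ring_ring M.R.ring_axioms finJ; (unfold op_ring_rows)?)
 fix j
 show "E' j : J j \<rightarrow> rows R (J j)" by (rule E'_rows)
 show "D' j : J (Suc j) \<rightarrow> rows R (J j)" by (rule D'_rows)
 fix i
 show "mrow oR (J j) (E' j) (E' j i) = E' j i" if i: "i : J j"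
 proof -
  have "mrow R (J j) (E (L - j)) (E (L - j) k) = E (L - j) k" if "k : J j" for k
   using that mc.E_E[of k "L - j"] by (auto simp: J_def split: if_splits)
  then show ?thesis unfolding E'_def by (rule M.R.mtrans_comp[OF finJ finJ finJ EJ EJ i])
 qed
 {
  assume i: "i : J (Suc j)"
  then have jL: "Suc j <= L" by (auto simp: J_def split: if_splits)
  then have J1: "L - j = Suc (L - Suc j)" "J j = I (Suc (L - Suc j))" "J (Suc j) = I (L - Suc j)"
   by (simp_all add: J_def Suc_diff_Suc)
  have "mrow R (J j) (D (L - Suc j)) (E (L - j) k) = D (L - Suc j) k" if "k : J j" for k
   using mc.E_D[of k "L - Suc j"] that by (simp add: J1)
  then show "mrow oR (J j) (E' j) (D' j i) = D' j i"
   unfolding E'_def D'_def by (rule M.R.mtrans_comp[OF finJ finJ finJ EJ DJ[OF jL] i])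
  have "mrow R (J (Suc j)) (E (L - Suc j)) (D (L - Suc j) k) = D (L - Suc j) k" if "k : J j" for k
   using mc.D_E[of k "L - Suc j"] that by (simp add: J1)
  then show "mrow oR (J (Suc j)) (D' j) (E' (Suc j) i) = D' j i"
   unfolding E'_def D'_def by (rule M.R.mtrans_comp[OF finJ finJ finJ DJ[OF jL] EJ i])
 }
 assume i: "i : J (Suc (Suc j))"
 have jL: "Suc (Suc j) <= L" using i by (auto simp: J_def split: if_splits)
 then have jL': "Suc j <= L" by simp
 have J1: "J j = I (Suc (Suc (L - Suc (Suc j))))" "J (Suc j) = I (Suc (L - Suc (Suc j)))"
  "J (Suc (Suc j)) = I (L - Suc (Suc j))" "L - Suc j = Suc (L - Suc (Suc j))"
  using jL by (simp_all add: J_def Suc_diff_Suc)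
 have "mrow R (J (Suc j)) (D (L - Suc (Suc j))) (D (L - Suc j) k) = (%i. \<zero>)" if "k : J j" for k
  using mc.D_D[of k "L - Suc (Suc j)"] that by (simp add: J1)
 then have "mrow oR (J (Suc j)) (D' j) (D' (Suc j) i) = mtrans R (J j) (%k i. \<zero>) i"
  unfolding D'_def by (rule M.R.mtrans_comp[OF finJ finJ finJ DJ[OF jL'] DJ[OF jL] i])
 also have "... = (%j. 0_oR)" by (rule ext) (simp add: mtrans_def)
 finally show "mrow oR (J (Suc j)) (D' j) (D' (Suc j) i) = (%j. 0_oR)" .
qed

interpretation dc: mat_complex oR J E' D' by (rule dual_mat_complex)

text \<open>A functional on \<open>P n\<close> is recorded by its values on the generators;
  conversely a column yields the functional that pairs it with \<open>\<iota> n x\<close>. This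
  identifies functionals with the columns fixed by the transposed idempotent.\<close>

definition col :: "nat => ('p => 'r) => 'i => 'r" where
 "col n f = (%i. if i : I n then f (\<pi> n (free_basis R i)) else \<zero>)"

definition fun_of_col :: "nat => ('i => 'r) => 'p => 'r" where
 "fun_of_col n y = (\<lambda>x\<in>car (P n). pairing R (I n) y (\<iota> n x))"

abbreviation "RR == reg R"

lemma RR: "lmod R RR" by (rule regular_left_module[OF M.R.ring_axioms])

lemma RR_sel [simp]: "car RR = car R" "0_RR = \<zero>" "x +_RR y = x \<oplus> y" "x .*_RR y = x \<otimes> y"
 by (simp_all add: regular_module_def)

lemma RR_minus [simp]: "x : car R ==> y : car R ==> x -_RR y = x \<ominus> y"
proof -
 assume x: "x : car R" "y : car R"
 interpret RR: left_module R RR by (rule RR)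
 show ?thesis using x RR.M.minus_eq_iff[of x y "x \<ominus> y"] by (simp add: M.R.minus_add_cancel)
qed

lemma col_rows: "f : mhom R (P n) RR ==> col n f : rows R (I n)"
 unfolding col_def using mh_closed[of f R "P n" RR, OF _ \<pi>c[OF M.R.basis_closed]]
 by (intro M.R.rowsI finI) auto

lemma pairing_col:
 assumes f: "f : mhom R (P n) RR" and x: "x : rows R (I n)"
 shows "pairing R (I n) (col n f) x = f (\<pi> n x)"
 by (rule M.R.pairing_eqI[OF finI mh_comp[OF \<pi> f] col_rows[OF f] _ x, symmetric]) (simp add: col_def)

lemma fun_of_col_hom: "y : rows R (I n) ==> fun_of_col n y : mhom R (P n) RR"
 by (rule mh_cong[OF mh_comp[OF \<iota> M.R.pairing_hom[OF finI]] _ P_module])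
  (simp_all add: fun_of_col_def)

lemma fun_of_col_col: "f : mhom R (P n) RR ==> f : extensional (car (P n)) ==> fun_of_col n (col n f) = f"
 by (auto simp: fun_of_col_def pairing_col \<iota>c \<pi>_\<iota> extensional_def fun_eq_iff)

lemma J_rev: "n <= L ==> J (L - n) = I n" by (simp add: J_def)

lemma cocycle_cyc:
 assumes n: "n <= L" and f: "f : cocs R P \<delta> RR n"
 shows "dc.cyc (L - n) (col n f)"
proof -
 note fD = cocyclesD[OF RR f]
 note cr = col_rows[OF fD(1)]
 show ?thesis
  unfolding mcycle_def op_ring_rows J_rev[OF n]
 proof (intro conjI allI impI cr)
  have "pairing R (I n) (col n f) (E n k) = f (\<pi> n (free_basis R k))" if "k : I n" for k
   using pairing_col[OF fD(1) funcset_mem[OF E_rows that]] \<pi>_\<iota>[OF \<pi>c[OF M.R.basis_closed[OF that]]]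
   by (simp add: E_def)
  then show "mrow oR (I n) (E' (L - n)) (col n f) = col n f"
   using E'_act[of "col n f" "L - n"] n cr by (auto simp: J_rev col_def fun_eq_iff)
  fix m assume m: "L - n = Suc m"
  then have nm: "Suc m <= L" "L - Suc m = n" "J (Suc m) = I n" "J m = I (Suc n)"
   using n by (auto simp: J_def intro!: arg_cong[of _ _ I])
  have "pairing R (I n) (col n f) (D n k) = \<zero>" if "k : I (Suc n)" for k
   using pairing_col[OF fD(1) funcset_mem[OF D_rows that]] \<pi>_\<iota>[OF \<delta>c[OF \<pi>c[OF M.R.basis_closed[OF that]]]]
    fD(3)[OF \<pi>c[OF M.R.basis_closed[OF that]]] by (simp add: D_def)
  then show "mrow oR (I n) (D' m) (col n f) = (%j. 0_oR)"
   using D'_act[of "col n f" m] cr by (auto simp: nm fun_eq_iff)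
 qed
qed

lemma cyc_cocycle:
 assumes n: "n <= L" and y: "dc.cyc (L - n) y"
 shows "fun_of_col n y : cocs R P \<delta> RR n" and "col n (fun_of_col n y) = y"
proof -
 have yr: "y : rows R (I n)" using y by (simp add: mcycle_def op_ring_rows J_rev[OF n])
 note h = fun_of_col_hom[OF yr]
 show "fun_of_col n y : cocs R P \<delta> RR n"
  unfolding cocycles_def
 proof (intro CollectI conjI ballI)
  show "fun_of_col n y : mhom R (P n) RR \<inter> extensional (car (P n))"
   using h by (simp add: fun_of_col_def)
  fix x assume x: "x : car (P (Suc n))"
  show "fun_of_col n y (\<delta> n x) = 0_RR"
  proof (cases "n = L")
   \<comment> \<open>Degree \<open>L\<close> sits in position 0 of the dual complex, where being a
     cycle says nothing about a differential. There the cocycle condition holds because the next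
     module of the resolution is zero.\<close>
   case True
   then have "x = 0_(P (Suc n))" using bnd[of "Suc n"] x by auto
   then have "fun_of_col n y (\<delta> n x) = fun_of_col n y 0_(P n)" using \<delta>_zero by simp
   then show ?thesis using mh_zero[OF h P_group] RR by (simp add: left_module_def)
  next
   case False
   then obtain m where m: "L - n = Suc m" using n by (cases "L - n") auto
   then have nm: "Suc m <= L" "L - Suc m = n" "J (Suc m) = I n" "J m = I (Suc n)"
    using n by (auto simp: J_def intro!: arg_cong[of _ _ I])
   have 0: "mrow oR (I n) (D' m) y = (%j. \<zero>)"
    using y by (simp add: mcycle_def m nm(3))
   note ix = \<iota>c[OF x]
   have "pairing R (I n) y (mrow R (I (Suc n)) (D n) (\<iota> (Suc n) x)) = pairing R (I (Suc n)) (%j. \<zero>) (\<iota> (Suc n) x)"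
    using D'_act_pairing[of y m "\<iota> (Suc n) x"] ix yr 0 by (simp add: nm)
   also have "... = (\<Oplus>i\<in>I (Suc n). \<zero>)"
    unfolding pairing_def using freeD(1)[OF ix] by (intro M.R.finsum_cong') auto
   finally show ?thesis using x by (simp add: fun_of_col_def mrow_D ix \<pi>_\<iota> \<delta>c)
  qed
 qed
 have "pairing R (I n) y (E n k) = y k" if "k : I n" for k
 proof -
  have "mrow oR (I n) (E' (L - n)) y = y" using y by (simp add: mcycle_def J_rev[OF n])
  then show ?thesis using E'_act[of y "L - n"] yr that n by (auto simp: J_rev fun_eq_iff split: if_splits)
 qed
 then show "col n (fun_of_col n y) = y"
  using free_module_outside[OF yr] \<pi>c[OF M.R.basis_closed]
  by (auto simp: col_def fun_of_col_def E_def[symmetric] fun_eq_iff)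
qed

lemma coboundary_bdr:
 assumes n: "n <= L" and f: "f : cobs R P \<delta> RR n"
 shows "dc.bdr (L - n) (col n f)"
proof -
 consider (a) "n = 0" "f = (\<lambda>x\<in>car (P 0). 0_RR)"
  | (b) m g where "n = Suc m" "g : mhom R (P m) RR" "f = (\<lambda>x\<in>car (P (Suc m)). g (\<delta> m x))"
  using coboundaries_cases[OF RR f] by metis
 then show ?thesis
 proof cases
 case a
 have "col n f = (%i. 0_oR)" unfolding a col_def using \<pi>c[OF M.R.basis_closed] by (auto simp: fun_eq_iff)
 then show ?thesis using dc.bdr_zero by simp
next
 case (b m g)
 have nm: "Suc (L - n) <= L" "L - Suc (L - n) = m" "J (Suc (L - n)) = I m" "J (L - n) = I (Suc m)"
  using n b(1) by (auto simp: J_def intro!: arg_cong[of _ _ I])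
 note cg = col_rows[OF b(2)]
 have "pairing R (I m) (col m g) (D m k) = g (\<delta> m (\<pi> (Suc m) (free_basis R k)))" if "k : I (Suc m)" for k
  using pairing_col[OF b(2) funcset_mem[OF D_rows that]] \<pi>_\<iota>[OF \<delta>c[OF \<pi>c[OF M.R.basis_closed[OF that]]]]
  by (simp add: D_def)
 then have k: "col n f k = (if k : I (Suc m) then pairing R (I m) (col m g) (D m k) else \<zero>)" for k
  unfolding b col_def[of "Suc m"] using \<pi>c[OF M.R.basis_closed] by simp
 have "mrow oR (J (Suc (L - n))) (D' (L - n)) (col m g) =
   (%k. if k : J (L - n) then pairing R (J (Suc (L - n))) (col m g) (D (L - Suc (L - n)) k) else \<zero>)"
  by (rule D'_act) (simp_all only: nm cg)
 then have "col n f = mrow oR (J (Suc (L - n))) (D' (L - n)) (col m g)"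
  unfolding nm using k by (intro ext) simp
 then show ?thesis using cg by (auto simp: mbdry_def op_ring_rows nm)
qed
qed

lemma bdr_coboundary:
 assumes n: "n <= L" and x: "dc.bdr (L - n) x"
 shows "fun_of_col n x : cobs R P \<delta> RR n"
proof -
 obtain y where y: "y : rows R (J (Suc (L - n)))" "x = mrow oR (J (Suc (L - n))) (D' (L - n)) y"
  using x by (auto simp: mbdry_def op_ring_rows)
 show ?thesis
 proof (cases n)
  case 0
  then have "J (Suc (L - n)) = {}" by (simp add: J_def)
  then have "x = (%i. \<zero>)" using y by (simp add: mrow_def op_ring_finsum)
  moreover have "pairing R (I 0) (%i. \<zero>) (\<iota> 0 p) = \<zero>" if "p : car (P 0)" for p
  proof -
   have "pairing R (I 0) (%i. \<zero>) (\<iota> 0 p) = (\<Oplus>i\<in>I 0. \<zero>)"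
    unfolding pairing_def using freeD(1)[OF \<iota>c[OF that]] by (intro M.R.finsum_cong') auto
   then show ?thesis by simp
  qed
  ultimately have "fun_of_col n x = (\<lambda>x\<in>car (P n). 0_RR)"
   unfolding fun_of_col_def 0 by (intro restrict_ext) simp
  then show ?thesis using coboundaries_zero[OF RR] by simp
 next
  case (Suc m)
  have nm: "Suc (L - n) <= L" "L - Suc (L - n) = m" "J (Suc (L - n)) = I m" "J (L - n) = I (Suc m)"
   using n Suc by (auto simp: J_def intro!: arg_cong[of _ _ I])
  have yr: "y : rows R (I m)" using y(1) by (simp add: nm)
  have "pairing R (I (Suc m)) x (\<iota> (Suc m) p) = fun_of_col m y (\<delta> m p)" if p: "p : car (P (Suc m))" for p
   using D'_act_pairing[of y "L - n" "\<iota> (Suc m) p"] yr \<iota>c[OF p] p y(2)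
   by (simp add: nm mrow_D \<pi>_\<iota> fun_of_col_def \<delta>c)
  then have "fun_of_col n x = (\<lambda>p\<in>car (P (Suc m)). fun_of_col m y (\<delta> m p))"
   by (auto simp: fun_of_col_def[of "Suc m"] Suc fun_eq_iff)
  then show ?thesis using coboundaries_SucI[OF RR fun_of_col_hom[OF yr]] Suc by simp
 qed
qed

lemma col_minus:
 assumes "f : mhom R (P n) RR" "g : mhom R (P n) RR" "a : car R"
 shows "col n (\<lambda>x\<in>car (P n). f x -_RR g x \<otimes> a) = (%i. col n f i -_oR a *_oR col n g i)"
proof
 fix i
 have om: "x -_oR y = x \<ominus> y" if "x : car R" "y : car R" for x y
  using dc.minus_eq_iff[of x y "x \<ominus> y"] that by (simp add: M.R.minus_add_cancel)
 show "col n (\<lambda>x\<in>car (P n). f x -_RR g x \<otimes> a) i = col n f i -_oR a *_oR col n g i"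
 proof (cases "i : I n")
  case True
  note p = \<pi>c[OF M.R.basis_closed[OF True]]
  show ?thesis
   using True p mh_closed[OF assms(1) p] mh_closed[OF assms(2) p] assms(3)
   by (simp add: col_def om)
 next
  case False
  then show ?thesis using assms(3) om[of \<zero> \<zero>] by (simp add: col_def M.R.minus_self)
 qed
qed

lemma act_hom: "a : car R ==> (%x. x \<otimes> a) : mhom R RR RR"
 by (rule mhI) (simp_all add: M.R.l_distr M.R.m_assoc)

lemma coboundary_iff:
 assumes n: "n <= L" and f: "f : cocs R P \<delta> RR n"
 shows "f : cobs R P \<delta> RR n \<longleftrightarrow> dc.bdr (L - n) (col n f)"
 using coboundary_bdr[OF n] bdr_coboundary[OF n, of "col n f"] fun_of_col_col[OF cocyclesD(1,2)[OF RR f]] by auto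

lemma cocycle_minus:
 assumes f: "f : cocs R P \<delta> RR n" and z: "z : cocs R P \<delta> RR n" and a: "a : car R"
 shows "(\<lambda>x\<in>car (P n). f x -_RR z x \<otimes> a) : cocs R P \<delta> RR n"
 using cocyclesI[OF RR mh_minus[OF cocyclesD(1)[OF RR f] mh_comp[OF cocyclesD(1)[OF RR z] act_hom[OF a]] RR]]
  cocyclesD(3)[OF RR f] cocyclesD(3)[OF RR z] a by (simp add: M.R.minus_self)

text \<open>Right multiplication of the values of a cochain is left multiplication of its column
  over the opposite ring, so freeness of the cohomology is freeness of the homology of the dual
  complex. Beyond \<open>L\<close> both sides vanish.\<close>

lemma dual_free_iff:
 assumes d: "d <= L" and z: "z : cocs R P \<delta> RR d" and emb: "!!s. s : S ==> emb s : car R"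
 shows "(ALL n. n ~= d --> exact_at R P \<delta> RR n) &
   coh_free R P \<delta> RR d S (%s x. x \<otimes> emb s) z \<longleftrightarrow>
  hfree oR J E' D' (L - d) S emb (col d z)"
proof -
 have 1: "(ALL n. n ~= d --> exact_at R P \<delta> RR n) \<longleftrightarrow>
  (ALL j x. j ~= L - d --> dc.cyc j x --> dc.bdr j x)"
 proof (intro iffI allI impI subsetI)
  fix j x assume A: "ALL n. n ~= d --> exact_at R P \<delta> RR n"
   and j: "j ~= L - d" and x: "dc.cyc j x"
  show "dc.bdr j x"
  proof (cases "j <= L")
   case True
   then have jj: "j = L - (L - j)" by simp
   have n: "L - j <= L" "L - j ~= d" using j True d by auto
   have c: "fun_of_col (L - j) x : cocs R P \<delta> RR (L - j)" "col (L - j) (fun_of_col (L - j) x) = x"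
    using cyc_cocycle[OF n(1), of x] x jj by auto
   then show ?thesis using coboundary_iff[OF n(1) c(1)] A n(2) jj by auto
  next
   case False
   then have "x = (%i. 0_oR)" using free_module_outside[OF dc.cyc_rows[OF x]] by (auto simp: J_def fun_eq_iff)
   then show ?thesis using dc.bdr_zero by simp
  qed
 next
  fix n f assume A: "ALL j x. j ~= L - d --> dc.cyc j x --> dc.bdr j x" and n: "n ~= d" and f: "f : cocs R P \<delta> RR n"
  show "f : cobs R P \<delta> RR n"
  proof (cases "n <= L")
   case True
   then show ?thesis using A cocycle_cyc[OF True f] coboundary_iff[OF True f] n d by auto
  next
   case False
   have "f x = 0_RR" if "x : car (P n)" for x
    using mh_zero[OF cocyclesD(1)[OF RR f] P_group] RR bnd[of n] False that
    by (auto simp: left_module_def)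
   then have "f = (\<lambda>x\<in>car (P n). 0_RR)"
    using cocyclesD(2)[OF RR f] by (auto simp: fun_eq_iff extensional_def)
   then show ?thesis using coboundaries_zero[OF RR] by simp
  qed
 qed
 have eq: "(\<lambda>x\<in>car (P d). f x -_RR z x \<otimes> emb s) : cobs R P \<delta> RR d \<longleftrightarrow>
   dc.bdr (L - d) (%i. col d f i -_oR emb s *_oR col d z i)"
  if "f : cocs R P \<delta> RR d" "s : S" for f s
  using coboundary_iff[OF d cocycle_minus[OF that(1) z emb[OF that(2)]]]
   col_minus[OF cocyclesD(1)[OF RR that(1)] cocyclesD(1)[OF RR z] emb[OF that(2)]] by simp
 have 2: "(ALL f:cocs R P \<delta> RR d. EX! s. s : S & (\<lambda>x\<in>car (P d). f x -_RR z x \<otimes> emb s) : cobs R P \<delta> RR d)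
  \<longleftrightarrow> (ALL x. dc.cyc (L - d) x --> (EX! s. s : S & dc.bdr (L - d) (%i. x i -_oR emb s *_oR col d z i)))"
 proof (intro iffI allI impI ballI)
  fix x assume A: "ALL f:cocs R P \<delta> RR d. EX! s. s : S & (\<lambda>x\<in>car (P d). f x -_RR z x \<otimes> emb s) : cobs R P \<delta> RR d"
   and x: "dc.cyc (L - d) x"
  note c = cyc_cocycle[OF d x]
  from A c(1) have "EX! s. s : S & (\<lambda>y\<in>car (P d). fun_of_col d x y -_RR z y \<otimes> emb s) : cobs R P \<delta> RR d" by blast
  then show "EX! s. s : S & dc.bdr (L - d) (%i. x i -_oR emb s *_oR col d z i)"
   by (simp only: conj_cong[OF refl eq[OF c(1)]] c(2))
 next
  fix f assume A: "ALL x. dc.cyc (L - d) x --> (EX! s. s : S & dc.bdr (L - d) (%i. x i -_oR emb s *_oR col d z i))"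
   and f: "f : cocs R P \<delta> RR d"
  from A cocycle_cyc[OF d f]
  have "EX! s. s : S & dc.bdr (L - d) (%i. col d f i -_oR emb s *_oR col d z i)" by blast
  then show "EX! s. s : S & (\<lambda>x\<in>car (P d). f x -_RR z x \<otimes> emb s) : cobs R P \<delta> RR d"
   by (simp only: conj_cong[OF refl eq[OF f]])
 qed
 show ?thesis
  unfolding coh_free_def hfree_def by (simp only: 1 2 z cocycle_cyc[OF d z] simp_thms)
qed

lemma dual_free_col:
 assumes d: "d <= L" and z: "hfree oR J E' D' (L - d) S emb z"
 shows "fun_of_col d z : cocs R P \<delta> RR d" "col d (fun_of_col d z) = z"
 using cyc_cocycle[OF d] z by (auto simp: hfree_def)

end

end

section \<open>The resolution defined by an exact matrix complex\<close>

context mat_complex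
begin

definition modl :: "nat => ('a, 'i => 'a) module" where
 "modl n = (freem R (I n))\<lparr>carrier := {x : rows R (I n). mrow R (I n) (E n) x = x}\<rparr>"

lemma modl_sel [simp]:
 "car (modl n) = {x : rows R (I n). mrow R (I n) (E n) x = x}" "0_(modl n) = (%i. \<zero>)"
 "x +_(modl n) y = (%i. x i \<oplus> y i)" "a .*_(modl n) x = (%i. a \<otimes> x i)"
 by (simp_all add: modl_def free_sel)

lemma modl_module: "lmod R (modl n)"
proof (rule left_moduleI)
 show "abelian_group (modl n)"
 proof (rule abelian_groupI)
  fix x assume "x : car (modl n)"
  then have x: "x : rows R (I n)" "mrow R (I n) (E n) x = x" by auto
  have "(%i. \<zero> \<ominus> x i) : car (modl n)"
   using x rows_minus[OF rows_zero x(1)] mrow_minus[OF fin E_rows rows_zero x(1)] mrow_zero[OF fin E_rows[of n]] by simp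
  moreover have "(%i. \<zero> \<ominus> x i) +_(modl n) x = 0_(modl n)"
   using freeD(1)[OF x(1)] by (simp add: minus_add_cancel)
  ultimately show "EX y:car (modl n). y +_(modl n) x = 0_(modl n)" by blast
 qed (auto simp: rows_add rows_zero mrow_add[OF fin E_rows] mrow_zero[OF fin E_rows] a_ac freeD(1))
qed (auto simp: ring_axioms rows_smult mrow_smult[OF fin E_rows] l_distr r_distr m_assoc freeD(1))

lemma modl_incl: "(%x. x) : mhom R (modl n) (freem R (I n))"
 by (rule mhI) (simp_all add: free_sel(3,4))

lemma modl_proj: "mrow R (I n) (E n) : mhom R (freem R (I n)) (modl n)"
 by (rule mhI)
  (simp_all add: free_sel(3,4) mrow_add[OF fin E_rows] mrow_smult[OF fin E_rows] mrow_closed[OF fin E_rows] xEE)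

lemma modl_diff: "mrow R (I (Suc n)) (D n) : mhom R (modl (Suc n)) (modl n)"
 by (rule mhI)
  (simp_all add: mrow_add[OF fin D_rows] mrow_smult[OF fin D_rows] mrow_closed[OF fin D_rows] xDE)

text \<open>As 1 differs from 0 the unit rows are distinct, so they can serve as the basis labels
  that projectivity takes from the type of the module.\<close>

lemma modl_projective:
 assumes nontriv: "\<one> ~= \<zero>"
 shows "projective_module R (modl n)"
proof (rule projective_moduleI[OF modl_module fin modl_incl modl_proj])
 have "i = j" if "free_basis R i = free_basis R j" for i j :: 'i
  using nontriv fun_cong[OF that, of i] by (auto simp: free_basis_def split: if_splits)
 then show "inj_on (free_basis R) (I n)" by (rule inj_onI)
qed simp

lemma modl_fin_generated: "fin_generated R (modl n)"
 unfolding fin_generated_def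
proof (intro exI conjI)
 show sub: "E n ` I n <= car (modl n)" using E_rows E_E by auto
 show "finite (E n ` I n)" using fin by simp
 interpret Q: left_module R "modl n" by (rule modl_module)
 let ?N = "submodule_span R (modl n) (E n ` I n)"
 have N: "submodule ?N R (modl n)" by (rule submodule_span_submodule[OF modl_module sub])
 have N0: "0_(modl n) : ?N" and Nadd: "!!x y. x : ?N ==> y : ?N ==> x +_(modl n) y : ?N"
  and Nsub: "?N <= car (modl n)"
  using submodule.axioms(1)[OF N] by (auto simp: subgroup_def)
 show "?N = car (modl n)"
 proof
  show "?N <= car (modl n)" by (rule Nsub)
  show "car (modl n) <= ?N"
  proof
   fix x assume x: "x : car (modl n)"
   then have xr: "x : rows R (I n)" by simp
   have *: "(finsum (modl n) (%i. x i .*_(modl n) E n i) F) : ?N" if "finite F" "F <= I n" for F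
    using that
   proof (induction set: finite)
    case empty
    then show ?case using N0 by simp
   next
    case (insert i F)
    have mem: "x i .*_(modl n) E n i : ?N" if "i : I n" for i
     by (rule submodule.smult_closed[OF N freeD(1)[OF xr] subsetD[OF submodule_span_superset imageI[OF that]]])
    have Fc: "(%i. x i .*_(modl n) E n i) : F \<rightarrow> car (modl n)" using mem insert.prems Nsub by blast
    have ic: "x i .*_(modl n) E n i : car (modl n)" using mem insert.prems Nsub by blast
    show ?case
     using Q.finsum_insert[OF insert.hyps(1,2) Fc ic] Nadd[OF mem] insert.IH insert.prems by simp
   qed
   have EQ: "E n : I n \<rightarrow> car (modl n)" using sub by blast
   have "x = mrow R (I n) (E n) x" using x by simp
   also have "... = flift (modl n) R (%i. mrow R (I n) (E n) (free_basis R i)) x"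
    by (rule free_hom_flift[OF modl_proj modl_module xr])
   also have "... = (finsum (modl n) (%i. x i .*_(modl n) mrow R (I n) (E n) (free_basis R i)) (I n))"
    using sub free_module_outside[OF xr] by (intro flift_superset'[OF modl_module fin xr]) (auto simp: mrow_basis[OF fin E_rows])
   also have "... = (finsum (modl n) (%i. x i .*_(modl n) E n i) (I n))"
    using EQ by (intro Q.finsum_cong' refl Pi_I Q.smult_closed freeD(1)[OF xr])
     (auto simp: mrow_basis[OF fin E_rows])
   also have "... : ?N" by (rule *[OF fin subset_refl])
   finally show "x : ?N" .
  qed
 qed
qed

text \<open>The result comes in presented form, with the inclusion and the idempotent as \<iota> and
  \<pi>. Its matrices, and hence its dual complex, are therefore those of the given complex.\<close>

lemma modl_resolution:
 assumes nontriv: "\<one> ~= \<zero>" and M: "lmod R M" and \<eta>: "\<eta> : I 0 \<rightarrow> car M"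
  and exact: "!!n x. cyc (Suc n) x ==> bdr (Suc n) x"
  and exact0: "!!x. cyc 0 x ==> flift M R \<eta> x = 0_M ==> bdr 0 x"
  and D\<eta>: "!!i. i : I (Suc 0) ==> flift M R \<eta> (D 0 i) = 0_M"
  and surj: "!!m. m : car M ==> EX x. cyc 0 x & flift M R \<eta> x = m"
 shows "presented R M modl (%n. mrow R (I (Suc n)) (D n)) (flift M R \<eta>) I (%n x. x) (%n. mrow R (I n) (E n))"
proof -
 note h = flift_hom[OF M \<eta>]
 interpret M: left_module R M by (rule M)
 have \<eta>D: "flift M R \<eta> (mrow R (I (Suc 0)) (D 0) x) = 0_M" if x: "x : rows R (I (Suc 0))" for x
  by (rule free_hom_eqI[OF mh_comp[OF mrow_hom[OF fin D_rows] h] mh_const_zero[OF M] M _ x])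
   (simp add: mrow_basis[OF fin D_rows] D\<eta>)
 \<comment> \<open>Restricting the differential to the row space loses no boundary: a preimage may
   be multiplied by the idempotent beforehand.\<close>
 have im: "mrow R (I (Suc n)) (D n) ` car (modl (Suc n)) = {x. bdr n x}" for n
 proof (intro equalityI subsetI)
  fix x assume "x : {x. bdr n x}"
  then obtain y where y: "y : rows R (I (Suc n))" "x = mrow R (I (Suc n)) (D n) y" by (auto simp: mbdry_def)
  then have eq: "x = mrow R (I (Suc n)) (D n) (mrow R (I (Suc n)) (E (Suc n)) y)" by (simp add: xED)
  have "mrow R (I (Suc n)) (E (Suc n)) y : car (modl (Suc n))"
   by (simp add: y mrow_closed[OF fin E_rows] xEE)
  then show "x : mrow R (I (Suc n)) (D n) ` car (modl (Suc n))"
   unfolding eq by (rule imageI)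
 qed (auto simp: mbdry_def)
 show ?thesis
 proof (intro presented.intro resolution.intro resolution_axioms.intro presented_axioms.intro
   M fin modl_incl modl_proj)
  show "projective_resolution R M modl (%n. mrow R (I (Suc n)) (D n)) (flift M R \<eta>)"
   unfolding projective_resolution_def
  proof (intro conjI allI)
   show "projective_module R (modl n)" for n by (rule modl_projective[OF nontriv])
   show "mrow R (I (Suc n)) (D n) : mhom R (modl (Suc n)) (modl n)" for n by (rule modl_diff)
   show "flift M R \<eta> : mhom R (modl 0) M" by (rule mh_comp[OF modl_incl h])
   show "flift M R \<eta> ` car (modl 0) = car M"
    using surj mh_closed[OF h] by (force simp: mcycle_def)
   show "mrow R (I (Suc 0)) (D 0) ` car (modl (Suc 0)) = {x : car (modl 0). flift M R \<eta> x = 0_M}"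
   proof (intro equalityI subsetI)
    fix x assume "x : mrow R (I (Suc 0)) (D 0) ` car (modl (Suc 0))"
    then have x: "bdr 0 x" using im by blast
    then obtain y where "y : rows R (I (Suc 0))" "x = mrow R (I (Suc 0)) (D 0) y" by (auto simp: mbdry_def)
    then have "flift M R \<eta> x = 0_M" using \<eta>D by simp
    then show "x : {x : car (modl 0). flift M R \<eta> x = 0_M}"
     using bdr_cyc[OF x] by (simp add: mcycle_def)
   next
    fix x assume "x : {x : car (modl 0). flift M R \<eta> x = 0_M}"
    then have "bdr 0 x" by (intro exact0) (auto simp: mcycle_def)
    then show "x : mrow R (I (Suc 0)) (D 0) ` car (modl (Suc 0))" using im by blast
   qed
   show "mrow R (I (Suc (Suc n))) (D (Suc n)) ` car (modl (Suc (Suc n))) =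
     {x : car (modl (Suc n)). mrow R (I (Suc n)) (D n) x = 0_(modl n)}" for n
   proof (intro equalityI subsetI)
    fix x assume "x : mrow R (I (Suc (Suc n))) (D (Suc n)) ` car (modl (Suc (Suc n)))"
    then have "bdr (Suc n) x" using im[of "Suc n"] by blast
    then show "x : {x : car (modl (Suc n)). mrow R (I (Suc n)) (D n) x = 0_(modl n)}"
     using bdr_cyc[of "Suc n" x] by (simp add: mcycle_def)
   next
    fix x assume "x : {x : car (modl (Suc n)). mrow R (I (Suc n)) (D n) x = 0_(modl n)}"
    then have "bdr (Suc n) x" by (intro exact) (auto simp: mcycle_def)
    then show "x : mrow R (I (Suc (Suc n))) (D (Suc n)) ` car (modl (Suc (Suc n)))"
     using im[of "Suc n"] by blast
   qed
  qed
 qed simp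
qed

lemma modl_zero: "(!!i j. i : I n ==> E n i j = \<zero>) ==> car (modl n) = {0_(modl n)}"
proof -
 assume E0: "!!i j. i : I n ==> E n i j = \<zero>"
 have "mrow R (I n) (E n) x = (%i. \<zero>)" if x: "x : rows R (I n)" for x
 proof
  fix j
  have "mrow R (I n) (E n) x j = (\<Oplus>i\<in>I n. \<zero>)"
   unfolding mrow_def using freeD(1)[OF x] by (intro finsum_cong') (auto simp: E0)
  then show "mrow R (I n) (E n) x j = \<zero>" by simp
 qed
 then show ?thesis using rows_zero mrow_zero[OF fin E_rows] by auto
qed

end

section \<open>Vector spaces and tensor products\<close>

definition bil ::
  "('k, 'z) ring_scheme => ('k, 'v) module => ('k, 'w) module => ('k, 'u) module => ('v => 'w => 'u) => bool" where
 "bil K V W U \<phi> \<longleftrightarrow> (ALL v:car V. (%w. \<phi> v w) : mhom K W U) &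
  (ALL w:car W. (%v. \<phi> v w) : mhom K V U)"

lemma bilI:
 assumes "!!v. v : car V ==> (%w. \<phi> v w) : mhom K W U"
  and "!!w. w : car W ==> (%v. \<phi> v w) : mhom K V U"
 shows "bil K V W U \<phi>"
 using assms by (simp add: bil_def)

lemma bil_lin1: "bil K V W U \<phi> ==> w : car W ==> T : mhom K X V ==> (%x. \<phi> (T x) w) : mhom K X U"
 using mh_comp[of T K X V "%v. \<phi> v w" U] by (simp add: bil_def)

lemma bil_lin2: "bil K V W U \<phi> ==> v : car V ==> T : mhom K X W ==> (%x. \<phi> v (T x)) : mhom K X U"
 using mh_comp[of T K X W "%w. \<phi> v w" U] by (simp add: bil_def)

lemma bil_closed: "bil K V W U \<phi> ==> v : car V ==> w : car W ==> \<phi> v w : car U"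
 by (auto simp: bil_def module_hom_def)

text \<open>\<open>tens\<close> and \<open>op_alg\<close> alter only the multiplication and the
  unit, which linear statements do not see. This and the following simplification rules make
  \<open>tens_space\<close> of the plain algebras the normal form.\<close>

lemma tens_sel [simp]:
 "car (tens K V W) = car (tens_space K V W)" "0_(tens K V W) = 0_(tens_space K V W)"
 "add (tens K V W) = add (tens_space K V W)" "smult (tens K V W) = smult (tens_space K V W)"
 by (simp_all add: tens_def)

lemma op_alg_sel [simp]:
 "car (op_alg V) = car V" "zero (op_alg V) = zero V" "add (op_alg V) = add V" "smult (op_alg V) = smult V"
 "one (op_alg V) = one V" "x *_(op_alg V) y = y *_V x"
 by (simp_all add: op_alg_def)

lemma op_alg_op_alg [simp]: "op_alg (op_alg A) = A"
 by (simp add: op_alg_def)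

lemma tens_relations_op [simp]:
 "tens_relations K (op_alg V) W = tens_relations K V W" "tens_relations K V (op_alg W) = tens_relations K V W"
 by (simp_all add: tens_relations_def)

lemma tens_space_op [simp]:
 "tens_space K (op_alg V) W = tens_space K V W" "tens_space K V (op_alg W) = tens_space K V W"
 by (simp_all add: tens_space_def tens_null_def)

lemma pure_tens_op [simp]:
 "pure_tens K (op_alg V) W = pure_tens K V W" "pure_tens K V (op_alg W) = pure_tens K V W"
 by (simp_all add: pure_tens_def tens_null_def fun_eq_iff)

lemma mh_op [simp]:
 "mhom K (op_alg V) W = mhom K V W" "mhom K V (op_alg W) = mhom K V W"
 by (simp_all add: module_hom_def)

lemma mh_tens [simp]:
 "mhom K (tens K A B) U = mhom K (tens_space K A B) U"
 "mhom K U (tens K A B) = mhom K U (tens_space K A B)"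
 by (simp_all add: module_hom_def)

lemma bil_op [simp]:
 "bil K (op_alg V) W U = bil K V W U" "bil K V (op_alg W) U = bil K V W U" "bil K V W (op_alg U) = bil K V W U"
 by (simp_all add: bil_def fun_eq_iff)

lemma bil_tens [simp]:
 "bil K (tens K A B) W U = bil K (tens_space K A B) W U" "bil K V (tens K A B) U = bil K V (tens_space K A B) U"
 "bil K V W (tens K A B) = bil K V W (tens_space K A B)"
 by (simp_all add: bil_def fun_eq_iff)

lemma tens_relations_tens [simp]:
 "tens_relations K (tens K A B) W = tens_relations K (tens_space K A B) W"
 "tens_relations K W (tens K A B) = tens_relations K W (tens_space K A B)"
 by (simp_all add: tens_relations_def)

lemma tens_space_tens [simp]:
 "tens_space K (tens K A B) W = tens_space K (tens_space K A B) W"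
 "tens_space K W (tens K A B) = tens_space K W (tens_space K A B)"
 by (simp_all add: tens_space_def tens_null_def)

lemma pure_tens_tens [simp]:
 "pure_tens K (tens K A B) W = pure_tens K (tens_space K A B) W"
 "pure_tens K W (tens K A B) = pure_tens K W (tens_space K A B)"
 by (simp_all add: pure_tens_def tens_null_def fun_eq_iff)

lemma tens_lift_cong_space:
 fixes U U' :: "('k, 'u) module"
 assumes "car U = car U'" "add U = add U'" "zero U = zero U'" "smult U = smult U'"
 shows "tens_lift K U \<phi> t = tens_lift K U' \<phi> t"
 by (simp add: tens_lift_def finsum_def assms)

lemma tens_lift_tens [simp]: "tens_lift K (tens K A B) = tens_lift K (tens_space K A B)"
 by (intro ext tens_lift_cong_space) simp_all

lemma tens_lift_op [simp]: "tens_lift K (op_alg U) = tens_lift K U"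
 by (intro ext tens_lift_cong_space) simp_all

lemma left_module_op [simp]: "lmod K (op_alg V) \<longleftrightarrow> lmod K V"
proof -
 have "lmod K W ==> lmod K (op_alg W)" for W :: "('k, 'v) module" and K :: "('k, 'z) ring_scheme"
 proof -
  assume "lmod K W"
  then interpret W: left_module K W .
  show ?thesis
   by (intro left_moduleI abelian_groupI)
    (auto simp: W.R.ring_axioms W.smult_closed W.smult_l_distr W.smult_r_distr W.smult_assoc W.smult_one W.M.a_ac intro: W.M.l_neg)
 qed
 from this[of K V] this[of K "op_alg V"] show ?thesis by auto
qed

locale vfield = K?: field K for K (structure)
begin

abbreviation lin where "lin == mhom K"
abbreviation vs where "vs == left_module K"
abbreviation FV where "FV V W == freem K (car V \<times> car W)"
abbreviation TS where "TS == tens_space K"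
abbreviation pt where "pt == pure_tens K"
abbreviation tL where "tL == tens_lift K"

lemma tens_lift_flift: "tL U \<phi> X = flift U K (%p. \<phi> (fst p) (snd p)) (SOME f. f : X)"
 by (simp add: tens_lift_def flift_def Let_def)

context
 fixes V :: "('a, 'v) module" and W :: "('a, 'w) module"
 assumes V: "vs V" and W: "vs W"
begin

interpretation V: left_module K V by (rule V)
interpretation W: left_module K W by (rule W)
interpretation F: left_module K "FV V W" by (rule K.free_left_module)

lemma basisc: "v : car V ==> w : car W ==> free_basis K (v, w) : car (FV V W)"
 by (rule K.basis_closed) simp

lemma tens_relations_closed: "tens_relations K V W <= car (FV V W)"
 unfolding tens_relations_def Let_def
 by (auto intro!: F.M.minus_closed F.M.a_closed F.smult_closed basisc V.smult_closed W.smult_closed)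

lemma tens_null_submodule: "submodule (tens_null K V W) K (FV V W)"
 unfolding tens_null_def by (rule submodule_span_submodule[OF K.free_left_module tens_relations_closed])

lemma TS_module: "vs (TS V W)"
 unfolding tens_space_def by (rule quotient_left_module(1)[OF K.free_left_module tens_null_submodule])

interpretation Q: left_module K "TS V W" by (rule TS_module)
interpretation N: abelian_subgroup "tens_null K V W" "FV V W"
 by (rule F.submodule_abelian_subgroup[OF tens_null_submodule])

abbreviation "cls == (%f. tens_null K V W +>\<^bsub>FV V W\<^esub> f)"

lemma cls_hom: "cls : lin (FV V W) (TS V W)"
 unfolding tens_space_def by (rule quotient_left_module(2)[OF K.free_left_module tens_null_submodule])

lemma pure_cls: "pt V W v w = cls (free_basis K (v, w))"
 by (simp add: pure_tens_def)

lemma pure_closed: "v : car V ==> w : car W ==> pt V W v w : car (TS V W)"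
 unfolding pure_cls by (rule mh_closed[OF cls_hom basisc])

lemma cls_eqI: "f : car (FV V W) ==> g : car (FV V W) ==> f -_(FV V W) g : tens_relations K V W ==> cls f = cls g"
 using N.coset_eq_iff[of f g] submodule_span_superset[of "tens_relations K V W" K "FV V W"]
 by (auto simp: tens_null_def)

lemma tens_relationsI:
 "[|v : car V; v' : car V; w : car W|] ==>
  free_basis K (v +_V v', w) -_(FV V W) (free_basis K (v, w) +_(FV V W) free_basis K (v', w)) : tens_relations K V W"
 "[|v : car V; w : car W; w' : car W|] ==>
  free_basis K (v, w +_W w') -_(FV V W) (free_basis K (v, w) +_(FV V W) free_basis K (v, w')) : tens_relations K V W"
 "[|c : car K; v : car V; w : car W|] ==>
  free_basis K (c .*_V v, w) -_(FV V W) (c .*_(FV V W) free_basis K (v, w)) : tens_relations K V W"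
 "[|c : car K; v : car V; w : car W|] ==>
  free_basis K (v, c .*_W w) -_(FV V W) (c .*_(FV V W) free_basis K (v, w)) : tens_relations K V W"
 unfolding tens_relations_def Let_def by blast+

lemma pure_bil: "bil K V W (TS V W) (pt V W)"
proof (rule bilI; rule mhI)
 fix v w assume v: "v : car V" and w: "w : car W"
 show "pt V W v w : car (TS V W)" "pt V W v w : car (TS V W)" by (rule pure_closed[OF v w])+
 show "pt V W v (w +_W w') = pt V W v w +_(TS V W) pt V W v w'" if w': "w' : car W" for w'
  unfolding pure_cls mh_add[OF cls_hom basisc[OF v w] basisc[OF v w'], symmetric]
  by (rule cls_eqI) (intro basisc F.M.a_closed F.smult_closed V.M.a_closed W.M.a_closed V.smult_closed W.smult_closed tens_relationsI v w w')+
 show "pt V W (v +_V v') w = pt V W v w +_(TS V W) pt V W v' w" if v': "v' : car V" for v'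
  unfolding pure_cls mh_add[OF cls_hom basisc[OF v w] basisc[OF v' w], symmetric]
  by (rule cls_eqI) (intro basisc F.M.a_closed F.smult_closed V.M.a_closed W.M.a_closed V.smult_closed W.smult_closed tens_relationsI v w v')+
 fix a assume a: "a : car K"
 show "pt V W v (a .*_W w) = a .*_(TS V W) pt V W v w"
  unfolding pure_cls mh_smult[OF cls_hom a basisc[OF v w], symmetric]
  by (rule cls_eqI) (intro basisc F.M.a_closed F.smult_closed V.M.a_closed W.M.a_closed V.smult_closed W.smult_closed tens_relationsI v w a)+
 show "pt V W (a .*_V v) w = a .*_(TS V W) pt V W v w"
  unfolding pure_cls mh_smult[OF cls_hom a basisc[OF v w], symmetric]
  by (rule cls_eqI) (intro basisc F.M.a_closed F.smult_closed V.M.a_closed W.M.a_closed V.smult_closed W.smult_closed tens_relationsI v w a)+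
qed

lemma tens_cases:
 assumes "t : car (TS V W)"
 obtains f where "f : car (FV V W)" "t = cls f"
 using assms by (auto simp: tens_space_def quotient_module_sel elim: N.coset_cases)

lemma tens_eqI:
 assumes f: "f : lin (TS V W) U" and g: "g : lin (TS V W) U" and U: "vs U"
  and eq: "!!v w. v : car V ==> w : car W ==> f (pt V W v w) = g (pt V W v w)"
  and t: "t : car (TS V W)"
 shows "f t = g t"
proof -
 obtain x where x: "x : car (FV V W)" "t = cls x" using tens_cases[OF t] by blast
 show ?thesis
  unfolding x(2)
  by (rule K.free_hom_eqI[OF mh_comp[OF cls_hom f] mh_comp[OF cls_hom g] U _ x(1)])
   (auto simp: eq pure_cls[symmetric])
qed

context
 fixes U :: "('a, 'u) module" and \<phi>
 assumes U: "vs U" and \<phi>: "bil K V W U \<phi>"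
begin

interpretation U: left_module K U by (rule U)

lemma \<phi>F: "(%p. \<phi> (fst p) (snd p)) : car V \<times> car W \<rightarrow> car U"
 using bil_closed[OF \<phi>] by auto

lemma flift_null: "n : tens_null K V W ==> flift U K (%p. \<phi> (fst p) (snd p)) n = 0_U"
proof -
 let ?L = "flift U K (%p. \<phi> (fst p) (snd p))"
 note L = K.flift_hom[OF U \<phi>F]
 have Lb: "?L (free_basis K (v, w)) = \<phi> v w" if "v : car V" "w : car W" for v w
  using K.flift_basis[OF U \<phi>F, of "(v, w)"] that by simp
 have Ldiff: "?L (x -_(FV V W) y) = 0_U" if "x : car (FV V W)" "y : car (FV V W)" "?L x = ?L y" for x y
  using mh_diff[OF L F.abelian_group_axioms U.abelian_group_axioms that(1,2)] that(3)
   U.M.minus_self[OF mh_closed[OF L that(2)]] by simp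
 have \<phi>1: "(%w. \<phi> v w) : lin W U" if "v : car V" for v using \<phi> that by (simp add: bil_def)
 have \<phi>2: "(%v. \<phi> v w) : lin V U" if "w : car W" for w using \<phi> that by (simp add: bil_def)
 have "?L x = 0_U" if "x : tens_relations K V W" for x
  using that unfolding tens_relations_def Let_def
  by (elim UnE CollectE exE conjE; hypsubst; intro Ldiff)
   (simp_all add: basisc Lb V.smult_closed W.smult_closed F.smult_closed mh_add[OF L] mh_smult[OF L]
    mh_add[OF \<phi>1] mh_add[OF \<phi>2] mh_smult[OF \<phi>1] mh_smult[OF \<phi>2])
 then have "tens_relations K V W <= {x : car (FV V W). ?L x = 0_U}"
  using tens_relations_closed by blast
 then have "tens_null K V W <= {x : car (FV V W). ?L x = 0_U}"
  unfolding tens_null_def by (rule submodule_span_minimal[OF kernel_submodule[OF K.free_left_module U L]])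
 then show "n : tens_null K V W ==> ?L n = 0_U" by blast
qed

text \<open>Two representatives of a coset differ by an element of the span of the bilinearity
  relations, which \<open>flift_null\<close> sends to zero. So the choice inside
  \<open>tens_lift\<close> does not matter.\<close>

lemma tl_cls: "f : car (FV V W) ==> tL U \<phi> (cls f) = flift U K (%p. \<phi> (fst p) (snd p)) f"
proof -
 let ?L = "flift U K (%p. \<phi> (fst p) (snd p))"
 note L = K.flift_hom[OF U \<phi>F]
 assume f: "f : car (FV V W)"
 define g where "g = (SOME g. g : cls f)"
 have g: "g : cls f" unfolding g_def using someI_ex[of "%g. g : cls f"] N.a_rcos_self[OF f] by blast
 then have gc: "g : car (FV V W)" using N.a_elemrcos_carrier[OF f] by blast
 have "g -_(FV V W) f : tens_null K V W"
  using N.a_rcos_module_imp[OF f g] by (simp add: a_minus_def)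
 then have "?L (g -_(FV V W) f) = 0_U" by (rule flift_null)
 then have "?L g = ?L f"
  using mh_diff[OF L F.abelian_group_axioms U.abelian_group_axioms gc f]
   U.M.minus_eq_zero_iff[OF mh_closed[OF L gc] mh_closed[OF L f]] by simp
 then show ?thesis by (simp add: tens_lift_flift g_def)
qed

lemma tl_pure: "v : car V ==> w : car W ==> tL U \<phi> (pt V W v w) = \<phi> v w"
 unfolding pure_cls using K.flift_basis[OF U \<phi>F, of "(v, w)"] by (simp add: tl_cls basisc)

lemma tl_hom: "tL U \<phi> : lin (TS V W) U"
proof (rule mhI)
 note L = K.flift_hom[OF U \<phi>F]
 fix t assume "t : car (TS V W)"
 then obtain f where f: "f : car (FV V W)" "t = cls f" by (rule tens_cases)
 show "tL U \<phi> t : car U" using f by (simp add: tl_cls mh_closed[OF L])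
 show "tL U \<phi> (a .*_(TS V W) t) = a .*_U tL U \<phi> t" if a: "a : car K" for a
  unfolding f(2) mh_smult[OF cls_hom a f(1), symmetric]
  using f(1) a by (simp add: tl_cls F.smult_closed mh_smult[OF L])
 fix t' assume "t' : car (TS V W)"
 then obtain f' where f': "f' : car (FV V W)" "t' = cls f'" by (rule tens_cases)
 show "tL U \<phi> (t +_(TS V W) t') = tL U \<phi> t +_U tL U \<phi> t'"
  unfolding f(2) f'(2) mh_add[OF cls_hom f(1) f'(1), symmetric]
  using f(1) f'(1) by (simp add: tl_cls F.M.a_closed mh_add[OF L])
qed

end

lemma tl_cong:
 assumes U: "vs U" and t: "t : car (TS V W)"
  and eq: "!!v w. v : car V ==> w : car W ==> \<phi> v w = \<psi> v w"
  and \<psi>: "bil K V W U \<psi>"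
 shows "tL U \<phi> t = tL U \<psi> t"
proof -
 have \<phi>: "bil K V W U \<phi>"
 proof (rule bilI)
  fix v assume v: "v : car V"
  show "(%w. \<phi> v w) : lin W U"
   by (rule mh_cong[of "%w. \<psi> v w", OF _ _ W]) (use \<psi> v eq in \<open>auto simp: bil_def\<close>)
 next
  fix w assume w: "w : car W"
  show "(%v. \<phi> v w) : lin V U"
   by (rule mh_cong[of "%v. \<psi> v w", OF _ _ V]) (use \<psi> w eq in \<open>auto simp: bil_def\<close>)
 qed
 show ?thesis
  by (rule tens_eqI[OF tl_hom[OF U \<phi>] tl_hom[OF U \<psi>] U _ t]) (simp add: tl_pure[OF U \<phi>] tl_pure[OF U \<psi>] eq)
qed

lemma tl_id: "t : car (TS V W) ==> tL (TS V W) (pt V W) t = t"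
 by (rule tens_eqI[OF tl_hom[OF TS_module pure_bil] mh_id TS_module])
  (simp_all add: tl_pure[OF TS_module pure_bil])

lemma tl_push:
 assumes U: "vs U" and U': "vs U'" and \<phi>: "bil K V W U \<phi>" and f: "f : lin U U'"
  and t: "t : car (TS V W)"
 shows "f (tL U \<phi> t) = tL U' (%v w. f (\<phi> v w)) t"
proof -
 have b: "bil K V W U' (%v w. f (\<phi> v w))"
  by (rule bilI; rule mh_comp[OF _ f]) (use \<phi> in \<open>auto simp: bil_def\<close>)
 show ?thesis
  by (rule tens_eqI[OF mh_comp[OF tl_hom[OF U \<phi>] f] tl_hom[OF U' b] U' _ t])
   (simp add: tl_pure[OF U \<phi>] tl_pure[OF U' b])
qed

text \<open>Scalars are absorbed into the first factor and zero is a pure tensor, so closure under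
  sums suffices.\<close>

lemma tens_induct [consumes 1, case_names pure add]:
 assumes t: "t : car (TS V W)"
  and pure: "!!v w. v : car V ==> w : car W ==> P (pt V W v w)"
  and add: "!!x y. x : car (TS V W) ==> y : car (TS V W) ==> P x ==> P y ==> P (x +_(TS V W) y)"
 shows "P t"
proof -
 obtain f where f: "f : car (FV V W)" "t = cls f" using t by (rule tens_cases)
 have smult_pure: "a .*_(TS V W) pt V W v w = pt V W (a .*_V v) w"
  if "a : car K" "v : car V" "w : car W" for a v w
  using pure_bil that mh_smult[of "%v. pt V W v w" K V "TS V W" a v] by (simp add: bil_def)
 have P0: "P 0_(TS V W)"
  using pure[of "0_V" "0_W"] smult_pure[of \<zero> "0_V" "0_W"] pure_closed[of "0_V" "0_W"]
  by (simp add: Q.smult_zero_left V.smult_zero_left)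
 have fc: "f p : car K" for p by (rule freeD(1)[OF f(1)])
 have "P (finsum (TS V W) (%p. f p .*_(TS V W) cls (free_basis K p)) S) & (finsum (TS V W) (%p. f p .*_(TS V W) cls (free_basis K p)) S) : car (TS V W)"
  if "finite S" "S <= car V \<times> car W" for S
  using that
 proof (induction set: finite)
  case empty
  then show ?case using P0 by simp
 next
  case (insert p S)
  have c: "f p .*_(TS V W) cls (free_basis K p) : car (TS V W)" if "p : car V \<times> car W" for p
   using that pure_closed[of "fst p" "snd p"] fc by (auto simp: pure_cls intro!: Q.smult_closed)
  then have cS: "(%p. f p .*_(TS V W) cls (free_basis K p)) : S \<rightarrow> car (TS V W)" and cp: "f p .*_(TS V W) cls (free_basis K p) : car (TS V W)"
   using insert.prems by auto
  obtain v w where p: "p = (v, w)" "v : car V" "w : car W" using insert.prems by auto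
  have "P (f p .*_(TS V W) cls (free_basis K p))"
   using pure[OF V.smult_closed[OF fc[of p] p(2)] p(3)] smult_pure[OF fc[of p] p(2,3)] by (simp add: p(1) pure_cls)
  then show ?case
   using Q.M.finsum_insert[OF insert.hyps(1,2) cS cp] add[OF cp] insert.IH insert.prems cp by auto
 qed
 from this[of "{p. f p ~= \<zero>}"] have "P (flift (TS V W) K (%p. cls (free_basis K p)) f)"
  using f(1) by (simp add: flift_def free_sel)
 then show ?thesis
  using K.free_hom_flift[OF cls_hom TS_module f(1)] f(2) by simp
qed

end

lemma tl_lin_arg:
 assumes "vs V" "vs W" "vs U" "bil K V W U \<phi>" "T : lin X (TS V W)"
 shows "(%x. tL U \<phi> (T x)) : lin X U"
 by (rule mh_comp[OF assms(5) tl_hom[OF assms(1-4)]])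

lemma tl_closed:
 assumes "vs V" "vs W" "vs U" "bil K V W U \<phi>" "t : car (TS V W)"
 shows "tL U \<phi> t : car U"
 by (rule mh_closed[OF tl_hom[OF assms(1-4)] assms(5)])

text \<open>Linearity in a parameter of the bilinear map, where \<open>tl_lin_arg\<close> gives
  linearity through the tensor. The two rules drive all proofs that nested Sweedler sums are
  multilinear.\<close>

lemma tl_lin_body:
 assumes V: "vs V" and W: "vs W" and U: "vs U" and X: "vs X"
  and t: "t : car (TS V W)"
  and lin: "!!v w. v : car V ==> w : car W ==> (%x. \<phi> x v w) : lin X U"
  and bil: "!!x. x : car X ==> bil K V W U (\<phi> x)"
 shows "(%x. tL U (\<phi> x) t) : lin X U"
proof (rule mhI)
 interpret U: left_module K U by (rule U)
 interpret X: left_module K X by (rule X)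
 note TSm = TS_module[OF V W]
 note h = tl_hom[OF V W U bil] and p = tl_pure[OF V W U bil]
 fix x assume x: "x : car X"
 show "tL U (\<phi> x) t : car U" by (rule mh_closed[OF h[OF x] t])
 show "tL U (\<phi> (x +_X y)) t = tL U (\<phi> x) t +_U tL U (\<phi> y) t" if y: "y : car X" for y
  by (rule tens_eqI[OF V W h[OF X.M.a_closed[OF x y]] mh_plus[OF h[OF x] h[OF y] U] U _ t])
   (simp add: p x y mh_add[OF lin])
 show "tL U (\<phi> (a .*_X x)) t = a .*_U tL U (\<phi> x) t" if a: "a : car K" for a
 proof (rule tens_eqI[OF V W h[OF X.smult_closed[OF a x]] _ U _ t])
  show "(%t. a .*_U tL U (\<phi> x) t) : lin (TS V W) U"
   using mh_closed[OF h[OF x]] mh_add[OF h[OF x]] mh_smult[OF h[OF x]] a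
   by (intro mhI) (simp_all add: U.smult_closed U.smult_r_distr U.smult_assoc[symmetric] K.m_comm)
  fix v w assume "v : car V" "w : car W"
  then show "tL U (\<phi> (a .*_X x)) (pt V W v w) = a .*_U tL U (\<phi> x) (pt V W v w)"
   using a x by (simp add: p X.smult_closed mh_smult[OF lin])
 qed
qed

text \<open>Both sides are linear in \<open>t\<close>, so \<open>t\<close> may be taken pure. The
  lemma exchanges two independent Sweedler sums.\<close>

lemma tl_swap:
 assumes V: "vs V" and W: "vs W" and X: "vs X" and Y: "vs Y"
  and U: "vs U" and t: "t : car (TS V W)" and t': "t' : car (TS X Y)"
  and 1: "!!v w. v : car V ==> w : car W ==> bil K X Y U (\<phi> v w)"
  and 2: "!!x y. x : car X ==> y : car Y ==> bil K V W U (%v w. \<phi> v w x y)"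
 shows "tL U (%v w. tL U (%x y. \<phi> v w x y) t') t = tL U (%x y. tL U (%v w. \<phi> v w x y) t) t'"
proof -
 have b1: "bil K V W U (%v w. tL U (%x y. \<phi> v w x y) t')"
  by (rule bilI; rule tl_lin_body[OF X Y U _ t'])
   (use V W 1 2 in \<open>auto simp: bil_def\<close>)
 have b2: "bil K X Y U (%x y. tL U (%v w. \<phi> v w x y) s)" if "s : car (TS V W)" for s
  by (rule bilI; rule tl_lin_body[OF V W U _ that])
   (use X Y 1 2 in \<open>auto simp: bil_def\<close>)
 have b3: "(%s. tL U (%x y. tL U (%v w. \<phi> v w x y) s) t') : lin (TS V W) U"
  by (rule tl_lin_body[OF X Y U TS_module[OF V W] t' tl_hom[OF V W U 2] b2])
 show ?thesis
 proof (rule tens_eqI[OF V W tl_hom[OF V W U b1] b3 U _ t])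
  fix v w assume vw: "v : car V" "w : car W"
  have "tL U (%x y. tL U (%v w. \<phi> v w x y) (pt V W v w)) t' = tL U (\<phi> v w) t'"
   by (rule tl_cong[OF X Y U t' _ 1[OF vw]]) (simp add: tl_pure[OF V W U 2] vw)
  then show "tL U (%v w. tL U (%x y. \<phi> v w x y) t') (pt V W v w) = tL U (%x y. tL U (%v w. \<phi> v w x y) (pt V W v w)) t'"
   by (simp add: tl_pure[OF V W U b1] vw)
 qed
qed

section \<open>Bases\<close>

text \<open>Coordinates are kept as linear functionals indexed by the basis elements themselves, the
  form in which they can be applied to one factor of a tensor.\<close>

definition vbasis :: "('a, 'v) module => 'v set => ('v => 'v => 'a) => bool" where
 "vbasis V B c \<longleftrightarrow> B <= car V & (ALL b. c b : lin V (reg K)) &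
  (ALL v:car V. finite {b:B. c b v ~= \<zero>} & v = (finsum V (%b. c b v .*_V b) {b:B. c b v ~= \<zero>}))"

lemma vbasisD:
 assumes "vbasis V B c"
 shows "B <= car V" "c b : lin V (reg K)"
  "v : car V ==> finite {b:B. c b v ~= \<zero>}"
  "v : car V ==> v = (finsum V (%b. c b v .*_V b) {b:B. c b v ~= \<zero>})"
  "v : car V ==> c b v : car K"
 using assms mh_closed[of "c b" K V "reg K" v] by (auto simp: vbasis_def regular_module_def)

text \<open>Zorn's lemma gives a maximal independent set. A vector \<open>v\<close> outside its span
  could be added, since a relation with nonzero coefficient at \<open>v\<close> can be solved for
  \<open>v\<close>.\<close>

lemma basis_exists:
 fixes V :: "('a, 'v) module"
 assumes V: "vs V"
 shows "EX B c. vbasis V B c"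
proof -
 interpret V: left_module K V by (rule V)
 let ?L = "flift V K (%b. b)"
 define indep where "indep B \<longleftrightarrow> B <= car V & (ALL f:rows K B. ?L f = 0_V --> (ALL b. f b = \<zero>))" for B
 have L: "?L : lin (freem K B) V" if "B <= car V" for B
  by (rule K.flift_hom[OF V]) (use that in auto)
 have "EX B:Collect indep. ALL X:Collect indep. B <= X --> X = B"
 proof (rule subset_Zorn')
  fix C assume C: "subset.chain (Collect indep) C"
  show "\<Union>C : Collect indep"
  proof (cases "C = {}")
   case True
   show ?thesis
    unfolding True indep_def mem_Collect_eq
   proof (intro conjI ballI impI allI)
    fix f b assume "f : rows K (\<Union>{})"
    then show "f b = \<zero>" by (rule free_module_outside) simp
   qed simp
  next
   case False
   have Ci: "indep B" if "B : C" for B using C that by (auto simp: subset.chain_def)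
   show ?thesis
    unfolding indep_def mem_Collect_eq
   proof (intro conjI ballI impI)
    show "\<Union>C <= car V" using Ci by (auto simp: indep_def)
    fix f assume f: "f : rows K (\<Union>C)" and f0: "?L f = 0_V"
    have "finite {b. f b ~= \<zero>}" "{b. f b ~= \<zero>} <= \<Union>C" using f by (auto simp: free_sel)
    then obtain B where B: "B : C" "{b. f b ~= \<zero>} <= B"
     using finite_subset_Union_chain[of _ C "Collect indep"] C False by metis
    then have "f : rows K B" using f by (auto simp: free_sel)
    then show "ALL b. f b = \<zero>" using Ci[OF B(1)] f0 by (auto simp: indep_def)
   qed
  qed
 qed
 then obtain B where B: "indep B" and max: "!!X. indep X ==> B <= X ==> X = B" by blast
 have BV: "B <= car V" using B by (simp add: indep_def)
 interpret F: left_module K "freem K B" by (rule K.free_left_module)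
 have span: "EX f:rows K B. ?L f = v" if v: "v : car V" for v
 proof (rule ccontr)
  assume no: "~ ?thesis"
  have "v ~: B"
  proof
   assume "v : B"
   then have "?L (free_basis K v) = v" using BV by (intro K.flift_basis[OF V, of _ B]) auto
   then show False using no K.basis_closed[OF \<open>v : B\<close>] by blast
  qed
  have "indep (insert v B)"
   unfolding indep_def
  proof (intro conjI ballI impI)
   show vB: "insert v B <= car V" using v BV by simp
   fix f assume f: "f : rows K (insert v B)" and f0: "?L f = 0_V"
   note fc = freeD(1)[OF f]
   define g where "g b = (if b = v then \<zero> else f b)" for b
   have g: "g : rows K B"
    unfolding g_def using f free_module_outside[OF f]
    by (intro K.free_moduleI[of "{i. f i ~= \<zero>}"]) (auto simp: freeD)
   have g': "g : rows K (insert v B)" using g by (auto simp: free_sel)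
   interpret F': left_module K "freem K (insert v B)" by (rule K.free_left_module)
   have bv: "free_basis K v : rows K (insert v B)" by (rule K.basis_closed) simp
   have eq: "f = (f v .*_(freem K (insert v B)) free_basis K v) +_(freem K (insert v B)) g"
    by (auto simp: fun_eq_iff free_sel(3,4) free_basis_def g_def fc)
   have "?L f = f v .*_V v +_V ?L g"
    using arg_cong[OF eq, of ?L] mh_add[OF L[OF vB] F'.smult_closed[OF fc bv] g'] mh_smult[OF L[OF vB] fc bv]
     K.flift_basis[OF V, of "%b. b" "insert v B" v] Pi_I[of "insert v B" "%b. b" "%_. car V"] subsetD[OF vB] by simp
   then have e: "f v .*_V v = \<ominus>\<^bsub>V\<^esub> ?L g"
    using f0 V.M.minus_equality[of "f v .*_V v" "?L g"] V.smult_closed[OF fc v] mh_closed[OF L[OF BV] g] by simp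
   have "f v = \<zero>"
   proof (rule ccontr)
    assume nz: "f v ~= \<zero>"
    then have u: "f v : Units K" using K.field_Units fc by simp
    let ?c = "inv f v"
    have c: "?c : car K" "?c \<otimes> f v = \<one>" using u by simp_all
    have "v = ?c .*_V (f v .*_V v)" using V.smult_assoc[OF c(1) fc v, symmetric] c(2) V.smult_one[OF v] by simp
    also have "... = ?L (?c .*_(freem K B) (\<ominus>\<^bsub>freem K B\<^esub> g))"
     unfolding e using mh_smult[OF L[OF BV] c(1) F.M.a_inv_closed[OF g]]
      mh_uminus[OF L[OF BV] F.abelian_group_axioms V.abelian_group_axioms g] by simp
    finally show False using no F.smult_closed[OF c(1) F.M.a_inv_closed[OF g]] by metis
   qed
   then have "?L g = 0_V"
    using e V.smult_zero_left[OF v] V.M.add.inv_eq_1_iff[OF mh_closed[OF L[OF BV] g]] by simp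
   then have g0: "ALL b. g b = \<zero>" using B g by (auto simp: indep_def)
   show "ALL b. f b = \<zero>"
   proof
    fix b
    show "f b = \<zero>" using \<open>f v = \<zero>\<close> g0[rule_format, of b] by (cases "b = v") (simp_all add: g_def)
   qed
  qed
  then show False using max[of "insert v B"] \<open>v ~: B\<close> by auto
 qed
 define cr where "cr v = (SOME f. f : rows K B & ?L f = v)" for v
 have cr: "cr v : rows K B" "?L (cr v) = v" if "v : car V" for v
  using someI_ex[of "%f. f : rows K B & ?L f = v"] span[OF that] by (auto simp: cr_def)
 have uniq: "f = g" if f: "f : rows K B" and g: "g : rows K B" and "?L f = ?L g" for f g
 proof -
  have "?L (f -_(freem K B) g) = 0_V"
   using mh_diff[OF L[OF BV] F.abelian_group_axioms V.abelian_group_axioms f g] that(3)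
    V.M.minus_self[OF mh_closed[OF L[OF BV] g]] by simp
  then have "f b \<ominus> g b = \<zero>" for b
   using B F.M.minus_closed[OF f g] K.free_module_minus[OF f g] by (auto simp: indep_def)
  then show ?thesis using K.minus_eq_zero_iff[OF freeD(1)[OF f] freeD(1)[OF g]] by blast
 qed
 have crh: "cr : lin V (freem K B)"
 proof (rule mhI)
  fix x y assume x: "x : car V" and y: "y : car V"
  show "cr (x +_V y) = cr x +_(freem K B) cr y"
   by (rule uniq) (simp_all add: cr x y mh_add[OF L[OF BV]])
 next
  fix a x assume a: "a : car K" and x: "x : car V"
  show "cr (a .*_V x) = a .*_(freem K B) cr x"
   by (rule uniq) (simp_all add: cr a x mh_smult[OF L[OF BV]] V.smult_closed F.smult_closed)
 qed (rule cr)
 have "vbasis V B (%b v. cr v b)"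
  unfolding vbasis_def
 proof (intro conjI ballI allI)
  show "B <= car V" by (rule BV)
  show "(%v. cr v b) : lin V (reg K)" for b
   using mh_closed[OF crh] mh_add[OF crh] mh_smult[OF crh]
   by (intro mhI) (simp_all add: regular_module_def free_sel(3,4) freeD(1)[OF cr(1)])
  fix v assume v: "v : car V"
  have eq: "{b:B. cr v b ~= \<zero>} = {b. cr v b ~= \<zero>}" using cr(1)[OF v] by (auto simp: free_sel)
  show "finite {b:B. cr v b ~= \<zero>}" unfolding eq using cr(1)[OF v] by (simp add: free_sel)
  show "v = (finsum V (%b. cr v b .*_V b) {b:B. cr v b ~= \<zero>})"
   unfolding eq using cr(2)[OF v] by (simp add: flift_def)
 qed
 then show ?thesis by blast
qed

lemma functional_one:
 assumes V: "vs V" and v: "v : car V" "v ~= 0_V"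
 obtains f where "f : lin V (reg K)" "f v = \<one>"
proof -
 interpret V: left_module K V by (rule V)
 obtain B c where "vbasis V B c" using basis_exists[OF V] by blast
 note B = vbasisD[OF this]
 have "EX b. c b v ~= \<zero>"
 proof (rule ccontr)
  assume "\<nexists>b. c b v ~= \<zero>"
  then have e: "{b:B. c b v ~= \<zero>} = {}" by auto
  have "v = (finsum V (%b. c b v .*_V b) {})" using B(4)[OF v(1)] unfolding e .
  then show False using v(2) by simp
 qed
 then obtain b where b: "c b v ~= \<zero>" by blast
 have cc: "c b x : car K" if "x : car V" for x
  using mh_closed[OF B(2) that] by (simp add: regular_module_def)
 have u: "c b v : Units K" using b cc[OF v(1)] K.field_Units by simp
 show thesis
 proof (rule that[of "%x. inv (c b v) \<otimes> c b x"])
  show "(%x. inv (c b v) \<otimes> c b x) : lin V (reg K)"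
   using cc mh_add[OF B(2)] mh_smult[OF B(2)] u
   by (intro mhI) (auto simp: regular_module_def K.r_distr K.m_lcomm)
  show "inv (c b v) \<otimes> c b v = \<one>" using u by simp
 qed
qed

end

section \<open>Tensor products of algebras\<close>

context vfield
begin

lemma vs_regular: "vs (reg K)"
 by (rule regular_left_module[OF K.ring_axioms])

lemma regular_sel [simp]: "car (reg K) = car K" "smult (reg K) = mult K"
 "add (reg K) = add K" "zero (reg K) = zero K"
 by (simp_all add: regular_module_def)

context
 fixes B :: "('a, 'v) module"
 assumes B: "k_algebra K B"
begin

interpretation B: k_algebra K B by (rule B)

lemma alg_vs: "vs B"
 by (rule left_module_of_module[OF B.module_axioms])

lemma alg_ring: "ring B"
 by (rule B.A.ring_axioms)

lemma op_alg_algebra: "k_algebra K (op_alg B)"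
proof -
 have 1: "module K (op_alg B)"
  by (rule module_of_left_module[OF K.is_cring]) (simp add: alg_vs)
 have 2: "ring (op_alg B)"
  using op_ring_ring[OF alg_ring] by (simp add: op_alg_def)
 show ?thesis
  by (intro k_algebra.intro k_algebra_axioms.intro K.field_axioms 1 2)
   (simp_all add: B.smult_mult_left B.smult_mult_right)
qed

lemma mult_lin1: "y : car B ==> T : lin X B ==> (%x. T x *_B y) : lin X B"
 using mh_closed[of T K X B] mh_add[of T K X B] mh_smult[of T K X B]
 by (intro mhI) (simp_all add: B.l_distr B.smult_mult_left)

lemma mult_lin2: "y : car B ==> T : lin X B ==> (%x. y *_B T x) : lin X B"
 using mh_closed[of T K X B] mh_add[of T K X B] mh_smult[of T K X B]
 by (intro mhI) (simp_all add: B.r_distr B.smult_mult_right)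

end

lemma smult_lin:
 assumes U: "vs U" and c: "c : car K" and T: "T : lin X U"
 shows "(%x. c .*_U T x) : lin X U"
proof -
 interpret U: left_module K U by (rule U)
 show ?thesis
  using mh_closed[OF T] mh_add[OF T] mh_smult[OF T] c
  by (intro mhI) (simp_all add: U.smult_closed U.smult_r_distr U.smult_assoc[symmetric] K.m_comm)
qed

lemma scalar_lin:
 assumes U: "vs U" and u: "u : car U" and T: "T : lin X (reg K)"
 shows "(%x. T x .*_U u) : lin X U"
proof -
 interpret U: left_module K U by (rule U)
 show ?thesis
  using mh_closed[OF T] mh_add[OF T] mh_smult[OF T] u
  by (intro mhI) (simp_all add: U.smult_closed U.smult_l_distr U.smult_assoc)
qed

lemma pure_lin1: "vs V ==> vs W ==> w : car W ==> T : lin X V ==> (%x. pt V W (T x) w) : lin X (TS V W)"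
 by (rule bil_lin1[OF pure_bil])

lemma pure_lin2: "vs V ==> vs W ==> v : car V ==> T : lin X W ==> (%x. pt V W v (T x)) : lin X (TS V W)"
 by (rule bil_lin2[OF pure_bil])

context
 fixes B :: "('a, 'v) module" and C :: "('a, 'w) module"
 assumes B: "k_algebra K B" and C: "k_algebra K C"
begin

interpretation B: k_algebra K B by (rule B)
interpretation C: k_algebra K C by (rule C)

abbreviation "BC == tens K B C"

lemma BC_vs: "vs (TS B C)"
 by (rule TS_module[OF alg_vs[OF B] alg_vs[OF C]])

lemma BC_one: "1_BC = pt B C 1_B 1_C"
 by (simp add: tens_def)

lemma BC_mult_def: "X *_BC Y = tL (TS B C) (%a b. tL (TS B C) (%a' b'. pt B C (a *_B a') (b *_C b')) Y) X"
 by (simp add: tens_def)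

lemma BC_bil_inner: "a : car B ==> b : car C ==> bil K B C (TS B C) (%a' b'. pt B C (a *_B a') (b *_C b'))"
 by (intro bilI pure_lin1 pure_lin2 alg_vs B C mult_lin2[OF B] mult_lin2[OF C] mh_id B.m_closed C.m_closed)

lemma BC_bil_outer: "Y : car (TS B C) ==> bil K B C (TS B C) (%a b. tL (TS B C) (%a' b'. pt B C (a *_B a') (b *_C b')) Y)"
 by (rule bilI; rule tl_lin_body[OF alg_vs[OF B] alg_vs[OF C] BC_vs])
  (simp_all add: BC_bil_inner alg_vs[OF B] alg_vs[OF C] pure_lin1 pure_lin2 mult_lin1[OF B] mult_lin1[OF C] mh_id)

lemma BC_mult_lin1: "Y : car (TS B C) ==> (%X. X *_BC Y) : lin (TS B C) (TS B C)"
 unfolding BC_mult_def by (rule tl_hom[OF alg_vs[OF B] alg_vs[OF C] BC_vs BC_bil_outer])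

lemma BC_mult_lin2: "X : car (TS B C) ==> (%Y. X *_BC Y) : lin (TS B C) (TS B C)"
 unfolding BC_mult_def
 by (rule tl_lin_body[OF alg_vs[OF B] alg_vs[OF C] BC_vs BC_vs _ tl_hom[OF alg_vs[OF B] alg_vs[OF C] BC_vs BC_bil_inner] BC_bil_outer])

lemma BC_mult_closed: "X : car (TS B C) ==> Y : car (TS B C) ==> X *_BC Y : car (TS B C)"
 using mh_closed[OF BC_mult_lin1] by blast

lemma BC_pure: "b : car B ==> c : car C ==> pt B C b c : car (TS B C)"
 by (rule pure_closed[OF alg_vs[OF B] alg_vs[OF C]])

lemma BC_mult_pure:
 assumes "a : car B" "b : car C" "a' : car B" "b' : car C"
 shows "pt B C a b *_BC pt B C a' b' = pt B C (a *_B a') (b *_C b')"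
 unfolding BC_mult_def using assms
 by (simp add: tl_pure[OF alg_vs[OF B] alg_vs[OF C] BC_vs] BC_bil_outer BC_bil_inner BC_pure)

lemma BC_eqI:
 "f : lin (TS B C) U ==> g : lin (TS B C) U ==> vs U ==>
 (!!v w. v : car B ==> w : car C ==> f (pt B C v w) = g (pt B C v w)) ==> t : car (TS B C) ==> f t = g t"
 by (rule tens_eqI[OF alg_vs[OF B] alg_vs[OF C]])

lemma BC_assoc:
 assumes X: "X : car (TS B C)" and Y: "Y : car (TS B C)" and Z: "Z : car (TS B C)"
 shows "(X *_BC Y) *_BC Z = X *_BC (Y *_BC Z)"
proof (rule BC_eqI[of "%X. (X *_BC Y) *_BC Z" _ "%X. X *_BC (Y *_BC Z)", OF _ _ BC_vs _ X])
 show "(%X. (X *_BC Y) *_BC Z) : lin (TS B C) (TS B C)"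
  by (rule mh_comp[OF BC_mult_lin1[OF Y] BC_mult_lin1[OF Z]])
 show "(%X. X *_BC (Y *_BC Z)) : lin (TS B C) (TS B C)"
  by (rule BC_mult_lin1[OF BC_mult_closed[OF Y Z]])
 fix a b assume ab: "a : car B" "b : car C"
 note p = BC_pure[OF ab]
 show "(pt B C a b *_BC Y) *_BC Z = pt B C a b *_BC (Y *_BC Z)"
 proof (rule BC_eqI[of "%Y. (pt B C a b *_BC Y) *_BC Z" _ "%Y. pt B C a b *_BC (Y *_BC Z)", OF _ _ BC_vs _ Y])
  show "(%Y. (pt B C a b *_BC Y) *_BC Z) : lin (TS B C) (TS B C)"
   by (rule mh_comp[OF BC_mult_lin2[OF p] BC_mult_lin1[OF Z]])
  show "(%Y. pt B C a b *_BC (Y *_BC Z)) : lin (TS B C) (TS B C)"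
   by (rule mh_comp[OF BC_mult_lin1[OF Z] BC_mult_lin2[OF p]])
  fix a' b' assume ab': "a' : car B" "b' : car C"
  note p' = BC_pure[OF ab']
  note pp = BC_pure[OF B.m_closed[OF ab(1) ab'(1)] C.m_closed[OF ab(2) ab'(2)]]
  show "(pt B C a b *_BC pt B C a' b') *_BC Z = pt B C a b *_BC (pt B C a' b' *_BC Z)"
   unfolding BC_mult_pure[OF ab ab']
   by (rule BC_eqI[OF BC_mult_lin2[OF pp] mh_comp[OF BC_mult_lin2[OF p'] BC_mult_lin2[OF p]] BC_vs _ Z])
    (simp add: BC_mult_pure ab ab' B.m_assoc C.m_assoc)
 qed
qed

lemma BC_one_closed: "pt B C 1_B 1_C : car (TS B C)"
 by (rule BC_pure) simp_all

lemma BC_l_one: "x : car (TS B C) ==> pt B C 1_B 1_C *_BC x = x"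
 by (erule BC_eqI[OF BC_mult_lin2[OF BC_one_closed] mh_id BC_vs, rotated])
  (simp only: BC_mult_pure B.one_closed C.one_closed B.l_one C.l_one)

lemma BC_r_one: "x : car (TS B C) ==> x *_BC pt B C 1_B 1_C = x"
 by (erule BC_eqI[OF BC_mult_lin1[OF BC_one_closed] mh_id BC_vs, rotated])
  (simp only: BC_mult_pure B.one_closed C.one_closed B.r_one C.r_one)

lemma BC_left_module: "vs BC"
proof -
 interpret V: left_module K "TS B C" by (rule BC_vs)
 show ?thesis
 proof (rule left_moduleI)
  show "abelian_group BC"
   by (intro abelian_groupI) (auto simp: V.M.a_ac intro: V.M.l_neg)
 qed (simp_all add: K.ring_axioms V.smult_closed V.smult_l_distr V.smult_r_distr V.smult_assoc V.smult_one)
qed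

lemma BC_monoid: "monoid BC"
 by (rule monoidI) (simp_all only: tens_sel BC_one BC_mult_closed BC_assoc BC_one_closed BC_l_one BC_r_one)

lemma BC_l_distr:
 assumes "x : car BC" "y : car BC" "z : car BC"
 shows "(x +_BC y) *_BC z = x *_BC z +_BC y *_BC z"
 using mh_add[OF BC_mult_lin1, of z x y] assms by (simp only: tens_sel)

lemma BC_r_distr:
 assumes "x : car BC" "y : car BC" "z : car BC"
 shows "z *_BC (x +_BC y) = z *_BC x +_BC z *_BC y"
 using mh_add[OF BC_mult_lin2, of z x y] assms by (simp only: tens_sel)

lemma BC_smult_left:
 assumes "c : car K" "x : car BC" "y : car BC"
 shows "(c .*_BC x) *_BC y = c .*_BC (x *_BC y)"
 using mh_smult[OF BC_mult_lin1, of y c x] assms by (simp only: tens_sel)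

lemma BC_smult_right:
 assumes "c : car K" "x : car BC" "y : car BC"
 shows "x *_BC (c .*_BC y) = c .*_BC (x *_BC y)"
 using mh_smult[OF BC_mult_lin2, of x c y] assms by (simp only: tens_sel)

lemma tens_algebra: "k_algebra K BC"
proof -
 have ag: "abelian_group BC" using BC_left_module unfolding left_module_def by blast
 show ?thesis
  by (intro k_algebra.intro k_algebra_axioms.intro K.field_axioms module_of_left_module[OF K.is_cring BC_left_module]
   ringI[OF ag BC_monoid BC_l_distr BC_r_distr] BC_smult_left BC_smult_right)
qed

text \<open>Evaluating a bilinear map on a product of tensors expands both factors. This is how
  multiplicativity of comultiplications and coactions enters Sweedler computations.\<close>

lemma tL_mult:
 assumes X: "X : car (TS B C)" and Y: "Y : car (TS B C)" and U: "vs U" and \<phi>: "bil K B C U \<phi>"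
 shows "tL U \<phi> (X *_BC Y) = tL U (%a b. tL U (%a' b'. \<phi> (a *_B a') (b *_C b')) Y) X"
proof -
 note vs = alg_vs[OF B] alg_vs[OF C]
 have "tL U \<phi> (X *_BC Y) = tL U (%a b. tL U \<phi> (tL (TS B C) (%a' b'. pt B C (a *_B a') (b *_C b')) Y)) X"
  unfolding BC_mult_def by (rule tl_push[OF vs BC_vs U BC_bil_outer[OF Y] tl_hom[OF vs U \<phi>] X])
 also have "... = tL U (%a b. tL U (%a' b'. \<phi> (a *_B a') (b *_C b')) Y) X"
 proof (rule tl_cong[OF vs U X])
  have i: "bil K B C U (%a' b'. \<phi> (a *_B a') (b *_C b'))" if "a : car B" "b : car C" for a b
   using that by (intro bilI bil_lin1[OF \<phi>] bil_lin2[OF \<phi>] mult_lin2[OF B] mult_lin2[OF C] mh_id B.m_closed C.m_closed)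
  show "bil K B C U (%a b. tL U (%a' b'. \<phi> (a *_B a') (b *_C b')) Y)"
   by (rule bilI; rule tl_lin_body[OF vs U])
    (simp_all add: i vs Y bil_lin1[OF \<phi>] bil_lin2[OF \<phi>] mult_lin1[OF B] mult_lin1[OF C] mh_id)
  fix a b assume ab: "a : car B" "b : car C"
  have "tL U \<phi> (tL (TS B C) (%a' b'. pt B C (a *_B a') (b *_C b')) Y) = tL U (%a' b'. tL U \<phi> (pt B C (a *_B a') (b *_C b'))) Y" (is "?l = _")
   by (rule tl_push[OF vs BC_vs U BC_bil_inner[OF ab] tl_hom[OF vs U \<phi>] Y])
  also have "... = tL U (%a' b'. \<phi> (a *_B a') (b *_C b')) Y"
   by (rule tl_cong[OF vs U Y _ i[OF ab]]) (simp add: tl_pure[OF vs U \<phi>] ab)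
  finally show "?l = tL U (%a' b'. \<phi> (a *_B a') (b *_C b')) Y" .
 qed
 finally show ?thesis .
qed

end

end

context vfield
begin

context
 fixes A :: "('a, 'x) module"
 assumes kA: "k_algebra K A"
begin

lemma env_alg_sel: "car (env_alg K A) = car (TS A A)" "1_(env_alg K A) = pt A A 1_A 1_A"
 "add (env_alg K A) = add (TS A A)" "zero (env_alg K A) = zero (TS A A)" "smult (env_alg K A) = smult (TS A A)"
 unfolding env_alg_def BC_one[OF kA op_alg_algebra[OF kA]] by simp_all

lemma env_alg_algebra: "k_algebra K (env_alg K A)"
 unfolding env_alg_def by (rule tens_algebra[OF kA op_alg_algebra[OF kA]])

lemma env_alg_lin: "lin X (env_alg K A) = lin X (TS A A)" "lin (env_alg K A) X = lin (TS A A) X"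
 unfolding env_alg_def by simp_all

lemma env_alg_mult_pure: "a : car A ==> b : car A ==> a' : car A ==> b' : car A ==>
  pt A A a b *_(env_alg K A) pt A A a' b' = pt A A (a *_A a') (b' *_A b)"
 unfolding env_alg_def using BC_mult_pure[OF kA op_alg_algebra[OF kA], of a b a' b'] by simp

lemma tL_env_alg_mult:
 "X : car (TS A A) ==> Y : car (TS A A) ==> vs U ==> bil K A A U \<phi> ==>
  tL U \<phi> (X *_(env_alg K A) Y) = tL U (%p q. tL U (%p' q'. \<phi> (p *_A p') (q' *_A q)) Y) X"
 unfolding env_alg_def using tL_mult[OF kA op_alg_algebra[OF kA], of X Y U \<phi>] by simp

end

end

section \<open>Trilinear maps and coassociativity\<close>

definition tri ::
  "('k, 'z) ring_scheme => ('k, 'v) module => ('k, 'w) module => ('k, 'x) module => ('k, 'u) module =>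
   ('v => 'w => 'x => 'u) => bool" where
 "tri K V W X U \<phi> \<longleftrightarrow> (ALL v:car V. bil K W X U (\<phi> v)) &
  (ALL w:car W. ALL x:car X. (%v. \<phi> v w x) : mhom K V U)"

lemma triI:
 assumes "!!w x. w : car W ==> x : car X ==> (%v. \<phi> v w x) : mhom K V U"
  and "!!v x. v : car V ==> x : car X ==> (%w. \<phi> v w x) : mhom K W U"
  and "!!v w. v : car V ==> w : car W ==> (%x. \<phi> v w x) : mhom K X U"
 shows "tri K V W X U \<phi>"
 using assms by (simp add: tri_def bil_def)

lemma tri_lin1: "tri K V W X U \<phi> ==> w : car W ==> x : car X ==> T : mhom K Z V ==> (%z. \<phi> (T z) w x) : mhom K Z U"
 using mh_comp[of T K Z V "%v. \<phi> v w x" U] by (simp add: tri_def)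

lemma tri_lin2: "tri K V W X U \<phi> ==> v : car V ==> x : car X ==> T : mhom K Z W ==> (%z. \<phi> v (T z) x) : mhom K Z U"
 using mh_comp[of T K Z W "%w. \<phi> v w x" U] by (simp add: tri_def bil_def)

lemma tri_lin3: "tri K V W X U \<phi> ==> v : car V ==> w : car W ==> T : mhom K Z X ==> (%z. \<phi> v w (T z)) : mhom K Z U"
 using mh_comp[of T K Z X "%x. \<phi> v w x" U] by (simp add: tri_def bil_def)

context vfield
begin

text \<open>The triple tensor product is tested against trilinear maps.\<close>

definition lift3 :: "('a, 'u) module => ('v => 'w => 'x => 'u) => ('a, 'v, ('a, 'w, 'x) tens) tens => 'u" where
 "lift3 U \<phi> = tL U (%v y. tL U (%w x. \<phi> v w x) y)"

lemma lift3_bil: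
 assumes V: "vs V" and W: "vs W" and X: "vs X" and U: "vs U"
  and \<phi>: "tri K V W X U \<phi>"
 shows "bil K V (TS W X) U (%v y. tL U (%w x. \<phi> v w x) y)"
proof (rule bilI)
 show "(%y. tL U (%w x. \<phi> v w x) y) : lin (TS W X) U" if "v : car V" for v
  using \<phi> that by (intro tl_hom[OF W X U]) (simp add: tri_def)
 show "(%v. tL U (%w x. \<phi> v w x) y) : lin V U" if "y : car (TS W X)" for y
  using \<phi> by (intro tl_lin_body[OF W X U V that]) (auto simp: tri_def)
qed

lemma lift3_hom:
 assumes V: "vs V" and W: "vs W" and X: "vs X" and U: "vs U"
  and \<phi>: "tri K V W X U \<phi>"
 shows "lift3 U \<phi> : lin (TS V (TS W X)) U"
 unfolding lift3_def by (rule tl_hom[OF V TS_module[OF W X] U lift3_bil[OF assms]])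

lemma lift3_pure:
 assumes V: "vs V" and W: "vs W" and X: "vs X" and U: "vs U"
  and \<phi>: "tri K V W X U \<phi>" and "v : car V" "w : car W" "x : car X"
 shows "lift3 U \<phi> (pt V (TS W X) v (pt W X w x)) = \<phi> v w x"
 unfolding lift3_def using assms
 by (simp add: tl_pure[OF V TS_module[OF W X] U lift3_bil[OF V W X U \<phi>]] pure_closed tl_pure[OF W X U] tri_def)

lemma lift3_left:
 assumes V: "vs V" and W: "vs W" and X: "vs X" and U: "vs U" and C: "vs C"
  and \<phi>: "tri K V W X U \<phi>" and \<delta>: "\<delta> : lin C (TS V W)" and t: "t : car (TS C X)"
 shows "lift3 U \<phi> (tL (TS V (TS W X)) (%c x. tL (TS V (TS W X)) (%v w. pt V (TS W X) v (pt W X w x)) (\<delta> c)) t) =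
  tL U (%c x. tL U (%v w. \<phi> v w x) (\<delta> c)) t"
proof -
 let ?Q = "TS V (TS W X)"
 note Q = TS_module[OF V TS_module[OF W X]]
 note h = lift3_hom[OF V W X U \<phi>]
 have p: "bil K V W ?Q (%v w. pt V (TS W X) v (pt W X w x))" if "x : car X" for x
  using that by (intro bilI pure_lin1 pure_lin2 V W X TS_module mh_id pure_closed)
 have q: "bil K V W U (%v w. \<phi> v w x)" if "x : car X" for x
  using that by (intro bilI tri_lin1[OF \<phi>] tri_lin2[OF \<phi>] mh_id)
 have dc: "\<delta> c : car (TS V W)" if "c : car C" for c using mh_closed[OF \<delta> that] .
 have b1: "bil K C X ?Q (%c x. tL ?Q (%v w. pt V (TS W X) v (pt W X w x)) (\<delta> c))"
  by (intro bilI tl_lin_arg[OF V W Q p \<delta>] tl_lin_body[OF V W Q X dc _ p] pure_lin2 pure_closed V W X TS_module mh_id)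
 have b2: "bil K C X U (%c x. tL U (%v w. \<phi> v w x) (\<delta> c))"
  by (intro bilI tl_lin_arg[OF V W U q \<delta>] tl_lin_body[OF V W U X dc _ q] tri_lin3[OF \<phi>] mh_id)
 have "lift3 U \<phi> (tL ?Q (%c x. tL ?Q (%v w. pt V (TS W X) v (pt W X w x)) (\<delta> c)) t) =
  tL U (%c x. lift3 U \<phi> (tL ?Q (%v w. pt V (TS W X) v (pt W X w x)) (\<delta> c))) t"
  by (rule tl_push[OF C X Q U b1 h t])
 also have "... = tL U (%c x. tL U (%v w. \<phi> v w x) (\<delta> c)) t"
 proof (rule tl_cong[OF C X U t _ b2])
  fix c x assume c: "c : car C" and x: "x : car X"
  have "lift3 U \<phi> (tL ?Q (%v w. pt V (TS W X) v (pt W X w x)) (\<delta> c)) =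
   tL U (%v w. lift3 U \<phi> (pt V (TS W X) v (pt W X w x))) (\<delta> c)" (is "?l = _")
   by (rule tl_push[OF V W Q U p[OF x] h dc[OF c]])
  also have "... = tL U (%v w. \<phi> v w x) (\<delta> c)"
   by (rule tl_cong[OF V W U dc[OF c] _ q[OF x]]) (rule lift3_pure[OF V W X U \<phi> _ _ x])
  finally show "?l = tL U (%v w. \<phi> v w x) (\<delta> c)" .
 qed
 finally show ?thesis .
qed

lemma lift3_right:
 assumes V: "vs V" and W: "vs W" and X: "vs X" and U: "vs U" and C: "vs C"
  and \<phi>: "tri K V W X U \<phi>" and \<delta>: "\<delta> : lin C (TS W X)" and t: "t : car (TS V C)"
 shows "lift3 U \<phi> (tL (TS V (TS W X)) (%v c. tL (TS V (TS W X)) (%w x. pt V (TS W X) v (pt W X w x)) (\<delta> c)) t) =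
  tL U (%v c. tL U (%w x. \<phi> v w x) (\<delta> c)) t"
proof -
 let ?Q = "TS V (TS W X)"
 note Q = TS_module[OF V TS_module[OF W X]]
 note h = lift3_hom[OF V W X U \<phi>]
 have p: "bil K W X ?Q (%w x. pt V (TS W X) v (pt W X w x))" if "v : car V" for v
  using that by (intro bilI pure_lin1 pure_lin2 V W X TS_module mh_id pure_closed)
 have q: "bil K W X U (%w x. \<phi> v w x)" if "v : car V" for v
  using that by (intro bilI tri_lin3[OF \<phi>] tri_lin2[OF \<phi>] mh_id)
 have dc: "\<delta> c : car (TS W X)" if "c : car C" for c using mh_closed[OF \<delta> that] .
 have b1: "bil K V C ?Q (%v c. tL ?Q (%w x. pt V (TS W X) v (pt W X w x)) (\<delta> c))"
  by (intro bilI tl_lin_arg[OF W X Q p \<delta>] tl_lin_body[OF W X Q V dc _ p] pure_lin1 pure_closed V W X TS_module mh_id)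
 have b2: "bil K V C U (%v c. tL U (%w x. \<phi> v w x) (\<delta> c))"
  by (intro bilI tl_lin_arg[OF W X U q \<delta>] tl_lin_body[OF W X U V dc _ q] tri_lin1[OF \<phi>] mh_id)
 have "lift3 U \<phi> (tL ?Q (%v c. tL ?Q (%w x. pt V (TS W X) v (pt W X w x)) (\<delta> c)) t) =
  tL U (%v c. lift3 U \<phi> (tL ?Q (%w x. pt V (TS W X) v (pt W X w x)) (\<delta> c))) t"
  by (rule tl_push[OF V C Q U b1 h t])
 also have "... = tL U (%v c. tL U (%w x. \<phi> v w x) (\<delta> c)) t"
 proof (rule tl_cong[OF V C U t _ b2])
  fix v c assume c: "c : car C" and v: "v : car V"
  have "lift3 U \<phi> (tL ?Q (%w x. pt V (TS W X) v (pt W X w x)) (\<delta> c)) =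
   tL U (%w x. lift3 U \<phi> (pt V (TS W X) v (pt W X w x))) (\<delta> c)" (is "?l = _")
   by (rule tl_push[OF W X Q U p[OF v] h dc[OF c]])
  also have "... = tL U (%w x. \<phi> v w x) (\<delta> c)"
   by (rule tl_cong[OF W X U dc[OF c] _ q[OF v]]) (rule lift3_pure[OF V W X U \<phi> v])
  finally show "?l = tL U (%w x. \<phi> v w x) (\<delta> c)" .
 qed
 finally show ?thesis .
qed

lemma tens_map_left:
 assumes V: "vs V" and W: "vs W" and X: "vs X" and C: "vs C"
  and \<delta>: "\<delta> : lin C (TS V W)" and t: "t : car (TS C X)"
 shows "tens_assoc K V W X (tens_map K (tens K V W) X \<delta> (%x. x) t) =
  tL (TS V (TS W X)) (%c x. tL (TS V (TS W X)) (%v w. pt V (TS W X) v (pt W X w x)) (\<delta> c)) t"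
proof -
 let ?Q = "TS V (TS W X)" and ?L = "TS (TS V W) X"
 note Q = TS_module[OF V TS_module[OF W X]] and VW = TS_module[OF V W]
 note L = TS_module[OF VW X]
 have p: "bil K V W ?Q (%v w. pt V (TS W X) v (pt W X w x))" if "x : car X" for x
  using that by (intro bilI pure_lin1 pure_lin2 V W X TS_module mh_id pure_closed)
 have g: "bil K (TS V W) X ?Q (%s x. tL ?Q (%v w. pt V (TS W X) v (pt W X w x)) s)"
  by (intro bilI tl_hom[OF V W Q p] tl_lin_body[OF V W Q X _ _ p] pure_lin2 pure_closed V W X TS_module mh_id)
 have f: "bil K C X ?L (%c x. pt (TS V W) X (\<delta> c) x)"
  by (intro bilI pure_lin1 pure_lin2 VW X mh_id \<delta> mh_closed[OF \<delta>])
 have b1: "bil K C X ?Q (%c x. tL ?Q (%v w. pt V (TS W X) v (pt W X w x)) (\<delta> c))"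
  by (intro bilI tl_lin_arg[OF V W Q p \<delta>] tl_lin_body[OF V W Q X mh_closed[OF \<delta>] _ p] pure_lin2 pure_closed V W X TS_module mh_id)
 have "tens_assoc K V W X (tens_map K (tens K V W) X \<delta> (%x. x) t) =
  tL ?Q (%s x. tL ?Q (%v w. pt V (TS W X) v (pt W X w x)) s) (tL ?L (%c x. pt (TS V W) X (\<delta> c) x) t)"
  by (simp add: tens_assoc_def tens_map_def)
 also have "... = tL ?Q (%c x. tL ?Q (%s x. tL ?Q (%v w. pt V (TS W X) v (pt W X w x)) s) (pt (TS V W) X (\<delta> c) x)) t"
  by (rule tl_push[OF C X L Q f tl_hom[OF VW X Q g] t])
 also have "... = tL ?Q (%c x. tL ?Q (%v w. pt V (TS W X) v (pt W X w x)) (\<delta> c)) t"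
  by (rule tl_cong[OF C X Q t _ b1]) (rule tl_pure[OF VW X Q g mh_closed[OF \<delta>]])
 finally show ?thesis .
qed

lemma tens_map_right:
 assumes V: "vs V" and W: "vs W" and X: "vs X" and C: "vs C"
  and \<delta>: "\<delta> : lin C (TS W X)" and t: "t : car (TS V C)"
 shows "tens_map K V (tens K W X) (%x. x) \<delta> t =
  tL (TS V (TS W X)) (%v c. tL (TS V (TS W X)) (%w x. pt V (TS W X) v (pt W X w x)) (\<delta> c)) t"
proof -
 let ?Q = "TS V (TS W X)"
 note Q = TS_module[OF V TS_module[OF W X]] and WX = TS_module[OF W X]
 have p: "bil K W X ?Q (%w x. pt V (TS W X) v (pt W X w x))" if "v : car V" for v
  using that by (intro bilI pure_lin1 pure_lin2 V W X TS_module mh_id pure_closed)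
 have b1: "bil K V C ?Q (%v c. tL ?Q (%w x. pt V (TS W X) v (pt W X w x)) (\<delta> c))"
  by (intro bilI tl_lin_arg[OF W X Q p \<delta>] tl_lin_body[OF W X Q V mh_closed[OF \<delta>] _ p] pure_lin1 pure_closed V W X TS_module mh_id)
 have "tens_map K V (tens K W X) (%x. x) \<delta> t = tL ?Q (%v c. pt V (TS W X) v (\<delta> c)) t"
  by (simp add: tens_map_def)
 also have "... = tL ?Q (%v c. tL ?Q (%w x. pt V (TS W X) v (pt W X w x)) (\<delta> c)) t"
 proof (rule tl_cong[OF V C Q t _ b1])
  fix v c assume v: "v : car V" and c: "c : car C"
  note dc = mh_closed[OF \<delta> c]
  have h: "(%y. pt V (TS W X) v y) : lin (TS W X) ?Q" by (intro pure_lin2 V WX v mh_id)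
  have "pt V (TS W X) v (\<delta> c) = pt V (TS W X) v (tL (TS W X) (pt W X) (\<delta> c))" (is "?l = _")
   by (simp add: tl_id[OF W X dc])
  also have "... = tL ?Q (%w x. pt V (TS W X) v (pt W X w x)) (\<delta> c)"
   by (rule tl_push[OF W X WX Q pure_bil[OF W X] h dc])
  finally show "?l = tL ?Q (%w x. pt V (TS W X) v (pt W X w x)) (\<delta> c)" .
 qed
 finally show ?thesis .
qed

text \<open>Coassociativity is an equation in a triple tensor product; applying the linear map
  induced by \<phi> turns it into an equation between nested sums. Keeping \<delta> and \<delta>'
  apart covers the comultiplication and both left and right coactions.\<close>

lemma coassoc_tri:
 assumes V: "vs V" and W: "vs W" and X: "vs X" and U: "vs U"
  and C: "vs C" and C': "vs C'"
  and \<phi>: "tri K V W X U \<phi>" and \<delta>: "\<delta> : lin C (TS V W)" and \<delta>': "\<delta>' : lin C' (TS W X)"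
  and t: "t : car (TS C X)" and t': "t' : car (TS V C')"
  and eq: "tens_assoc K V W X (tens_map K (tens K V W) X \<delta> (%x. x) t) = tens_map K V (tens K W X) (%x. x) \<delta>' t'"
 shows "tL U (%c x. tL U (%v w. \<phi> v w x) (\<delta> c)) t = tL U (%v c. tL U (%w x. \<phi> v w x) (\<delta>' c)) t'"
 using eq unfolding tens_map_left[OF V W X C \<delta> t] tens_map_right[OF V W X C' \<delta>' t']
 unfolding lift3_left[OF V W X U C \<phi> \<delta> t, symmetric] lift3_right[OF V W X U C' \<phi> \<delta>' t', symmetric] by simp

end

section \<open>Sweedler calculus in a Hopf algebra\<close>

text \<open>
 For a bilinear map \<open>\<phi>\<close> with values in \<open>U\<close>, the sum \<open>\<phi>(h\<^sub>1, h\<^sub>2)\<close> in Sweedler notation is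
 \<open>tL U \<phi> (\<Delta> h)\<close>.
\<close>

locale hopfc = vfield K for K (structure) +
 fixes H :: "('a, 'h) module" and \<Delta> :: "'h => ('a, 'h, 'h) tens" and \<epsilon> :: "'h => 'a" and S :: "'h => 'h"
 assumes hopf: "hopf_algebra K H \<Delta> \<epsilon> S"
begin

lemma kH: "k_algebra K H"
 using hopf by (simp add: hopf_algebra_def)

sublocale HA: k_algebra K H by (rule kH)

lemmas vsH = alg_vs[OF kH]

lemma \<Delta>_hom: "\<Delta> : alg_hom K H (tens K H H)"
 and \<epsilon>_hom: "\<epsilon> : alg_hom K H (reg K)"
 and S_lin: "S : lin H H"
 using hopf by (simp_all add: hopf_algebra_def hopf_algebra_axioms_def)

lemma \<Delta>_lin: "\<Delta> : lin H (TS H H)"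
 using \<Delta>_hom by (simp add: alg_hom_def)

lemma \<epsilon>_lin: "\<epsilon> : lin H (reg K)"
 using \<epsilon>_hom by (simp add: alg_hom_def)

lemmas \<Delta>c = mh_closed[OF \<Delta>_lin]
lemmas Sc = mh_closed[OF S_lin]

lemma \<epsilon>c: "h : car H ==> \<epsilon> h : car K"
 using mh_closed[OF \<epsilon>_lin] by simp

lemma \<epsilon>_mult: "g : car H ==> h : car H ==> \<epsilon> (g *_H h) = \<epsilon> g \<otimes> \<epsilon> h"
 using \<epsilon>_hom ring_hom_mult[of \<epsilon> H "reg K" g h] by (simp add: alg_hom_def regular_module_def)

lemma \<epsilon>_one: "\<epsilon> 1_H = \<one>"
 using \<epsilon>_hom ring_hom_one by (fastforce simp: alg_hom_def regular_module_def)

lemma \<Delta>_one: "\<Delta> 1_H = pt H H 1_H 1_H"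
 using \<Delta>_hom ring_hom_one[of \<Delta> H "tens K H H"] by (simp add: alg_hom_def BC_one[OF kH kH])

lemma \<Delta>_mult: "g : car H ==> h : car H ==> \<Delta> (g *_H h) = \<Delta> g *_(tens K H H) \<Delta> h"
 using \<Delta>_hom ring_hom_mult[of \<Delta> H "tens K H H"] by (simp add: alg_hom_def)

lemma S_comp: "T : lin X H ==> (%x. S (T x)) : lin X H"
 by (rule mh_comp[OF _ S_lin])

lemma \<Delta>_comp: "T : lin X H ==> (%x. \<Delta> (T x)) : lin X (TS H H)"
 by (rule mh_comp[OF _ \<Delta>_lin])

lemma \<epsilon>_smult_lin: "vs U ==> u : car U ==> T : lin X H ==> (%x. \<epsilon> (T x) .*_U u) : lin X U"
 by (rule scalar_lin[OF _ _ mh_comp[OF _ \<epsilon>_lin]])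

lemma \<Delta>_arg: "vs U ==> bil K H H U \<phi> ==> T : lin X H ==> (%x. tL U \<phi> (\<Delta> (T x))) : lin X U"
 by (rule tl_lin_arg[OF vsH vsH _ _ \<Delta>_comp])

lemma \<Delta>_body: "vs U ==> vs X ==> h : car H ==>
  (!!v w. v : car H ==> w : car H ==> (%x. \<phi> x v w) : lin X U) ==>
  (!!x. x : car X ==> bil K H H U (\<phi> x)) ==> (%x. tL U (\<phi> x) (\<Delta> h)) : lin X U"
 by (rule tl_lin_body[OF vsH vsH _ _ \<Delta>c])

lemma \<Delta>_closed: "vs U ==> bil K H H U \<phi> ==> h : car H ==> tL U \<phi> (\<Delta> h) : car U"
 by (rule tl_closed[OF vsH vsH _ _ \<Delta>c])

lemma \<Delta>_cong: "h : car H ==> vs U ==>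
  (!!x y. x : car H ==> y : car H ==> \<phi> x y = \<psi> x y) ==> bil K H H U \<psi> ==> tL U \<phi> (\<Delta> h) = tL U \<psi> (\<Delta> h)"
 by (rule tl_cong[OF vsH vsH _ \<Delta>c])

lemma \<Delta>_push: "vs U ==> vs U' ==> f : lin U U' ==> bil K H H U \<phi> ==> h : car H ==>
  f (tL U \<phi> (\<Delta> h)) = tL U' (%v w. f (\<phi> v w)) (\<Delta> h)"
 by (rule tl_push[OF vsH vsH _ _ _ _ \<Delta>c])

lemmas smult_cl = left_module.smult_closed

text \<open>Closure and linearity rules for Sweedler expressions, applied from the outside inwards.
  The collections \<open>LA\<close>, \<open>LB\<close>, \<open>LK\<close>, \<open>LT\<close> and
  \<open>LQ\<close> extend them to further structure maps.\<close>

lemmas LR = bilI triI mh_id S_comp \<Delta>_comp \<epsilon>_smult_lin \<Delta>_arg \<Delta>_body \<Delta>_closed Sc \<Delta>c \<epsilon>c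
 mult_lin1[OF kH] mult_lin2[OF kH] HA.A.m_closed HA.A.one_closed smult_lin smult_cl pure_lin1 pure_lin2 pure_closed
 vsH vs_regular TS_module

lemma coassoc_\<Delta>:
 assumes h: "h : car H" and U: "vs U" and \<phi>: "tri K H H H U \<phi>"
 shows "tL U (%c x. tL U (%v w. \<phi> v w x) (\<Delta> c)) (\<Delta> h) = tL U (%v c. tL U (%w x. \<phi> v w x) (\<Delta> c)) (\<Delta> h)"
 by (rule coassoc_tri[OF vsH vsH vsH U vsH vsH \<phi> \<Delta>_lin \<Delta>_lin \<Delta>c[OF h] \<Delta>c[OF h]])
  (use hopf h in \<open>simp add: hopf_algebra_def hopf_algebra_axioms_def del: tens_sel tens_space_tens pure_tens_tens tens_lift_tens mh_tens\<close>)

lemma counit_left: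
 assumes h: "h : car H" and U: "vs U" and f: "f : lin H U"
 shows "tL U (%x y. \<epsilon> x .*_U f y) (\<Delta> h) = f h"
proof -
 note fl = mh_comp[OF _ f]
 have "f h = f (tL H (%x y. \<epsilon> x .*_H y) (\<Delta> h))"
  using hopf h by (simp add: hopf_algebra_def hopf_algebra_axioms_def)
 also have "... = tL U (%x y. f (\<epsilon> x .*_H y)) (\<Delta> h)"
  by (rule \<Delta>_push[OF vsH U f _ h]) (intro LR)
 also have "... = tL U (%x y. \<epsilon> x .*_U f y) (\<Delta> h)"
 proof (rule \<Delta>_cong[OF h U])
  show "bil K H H U (%x y. \<epsilon> x .*_U f y)" by (intro LR f U mh_closed[OF f])
  show "f (\<epsilon> x .*_H y) = \<epsilon> x .*_U f y" if "x : car H" "y : car H" for x y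
   using mh_smult[OF f \<epsilon>c] that by simp
 qed
 finally show ?thesis by simp
qed

lemma counit_right:
 assumes h: "h : car H" and U: "vs U" and f: "f : lin H U"
 shows "tL U (%x y. \<epsilon> y .*_U f x) (\<Delta> h) = f h"
proof -
 have "f h = f (tL H (%x y. \<epsilon> y .*_H x) (\<Delta> h))"
  using hopf h by (simp add: hopf_algebra_def hopf_algebra_axioms_def)
 also have "... = tL U (%x y. f (\<epsilon> y .*_H x)) (\<Delta> h)"
  by (rule \<Delta>_push[OF vsH U f _ h]) (intro LR)
 also have "... = tL U (%x y. \<epsilon> y .*_U f x) (\<Delta> h)"
 proof (rule \<Delta>_cong[OF h U])
  show "bil K H H U (%x y. \<epsilon> y .*_U f x)" by (intro LR f U mh_closed[OF f])
  show "f (\<epsilon> y .*_H x) = \<epsilon> y .*_U f x" if "x : car H" "y : car H" for x y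
   using mh_smult[OF f \<epsilon>c] that by simp
 qed
 finally show ?thesis by simp
qed

lemma mult_map_tens_map:
 assumes B: "k_algebra K B" and f: "f : lin H B" and g: "g : lin H B" and h: "h : car H"
 shows "mult_map K B (tens_map K B B f g (\<Delta> h)) = tL B (%x y. f x *_B g y) (\<Delta> h)"
proof -
 interpret B: k_algebra K B by (rule B)
 note vsB = alg_vs[OF B]
 note LB = LR mult_lin1[OF B] mult_lin2[OF B] vsB B.m_closed mh_closed[OF f] mh_closed[OF g]
   mh_comp[OF _ f] mh_comp[OF _ g]
 have m: "bil K B B B (%x y. x *_B y)"
  by (intro bilI mult_lin1[OF B] mult_lin2[OF B] mh_id)
 have b: "bil K H H (TS B B) (%a b. pt B B (f a) (g b))"
  by (intro bilI pure_lin1 pure_lin2 vsB f g mh_closed[OF f] mh_closed[OF g])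
 have b': "bil K H H B (%x y. f x *_B g y)"
  by (intro bilI mult_lin1[OF B] mult_lin2[OF B] f g mh_closed[OF f] mh_closed[OF g])
 have "mult_map K B (tens_map K B B f g (\<Delta> h)) = tL B (%x y. x *_B y) (tL (TS B B) (%a b. pt B B (f a) (g b)) (\<Delta> h))"
  by (simp add: mult_map_def tens_map_def)
 also have "... = tL B (%a b. tL B (%x y. x *_B y) (pt B B (f a) (g b))) (\<Delta> h)"
  by (rule \<Delta>_push[OF TS_module[OF vsB vsB] vsB tl_hom[OF vsB vsB vsB m] b h])
 also have "... = tL B (%x y. f x *_B g y) (\<Delta> h)"
  by (rule \<Delta>_cong[OF h vsB _ b'])
   (rule tl_pure[OF vsB vsB vsB m mh_closed[OF f] mh_closed[OF g]])
 finally show ?thesis .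
qed

lemma antipode_left:
 assumes h: "h : car H" and U: "vs U" and f: "f : lin H U"
 shows "tL U (%x y. f (S x *_H y)) (\<Delta> h) = \<epsilon> h .*_U f 1_H"
proof -
 have "tL U (%x y. f (S x *_H y)) (\<Delta> h) = f (tL H (%x y. S x *_H y) (\<Delta> h))"
  by (rule \<Delta>_push[OF vsH U f _ h, symmetric]) (intro LR)
 also have "tL H (%x y. S x *_H y) (\<Delta> h) = \<epsilon> h .*_H 1_H"
  using hopf h mult_map_tens_map[OF kH S_lin mh_id h] by (simp add: hopf_algebra_def hopf_algebra_axioms_def)
 finally show ?thesis using mh_smult[OF f \<epsilon>c[OF h]] by simp
qed

lemma antipode_right:
 assumes h: "h : car H" and U: "vs U" and f: "f : lin H U"
 shows "tL U (%x y. f (x *_H S y)) (\<Delta> h) = \<epsilon> h .*_U f 1_H"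
proof -
 have "tL U (%x y. f (x *_H S y)) (\<Delta> h) = f (tL H (%x y. x *_H S y) (\<Delta> h))"
  by (rule \<Delta>_push[OF vsH U f _ h, symmetric]) (intro LR)
 also have "tL H (%x y. x *_H S y) (\<Delta> h) = \<epsilon> h .*_H 1_H"
  using hopf h mult_map_tens_map[OF kH mh_id S_lin h] by (simp add: hopf_algebra_def hopf_algebra_axioms_def)
 finally show ?thesis using mh_smult[OF f \<epsilon>c[OF h]] by simp
qed

section \<open>Convolution and the behaviour of the antipode on products and coproducts\<close>

definition conv :: "('a, 'v) module => ('h => 'v) => ('h => 'v) => 'h => 'v" where
 "conv B f g h = tL B (%x y. f x *_B g y) (\<Delta> h)"

text \<open>In the convolution algebra f = f * (g * k) = (f * g) * k = u k. The constant
  \<open>u\<close> makes it possible to treat maps of two variables one variable at a time.\<close>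

lemma conv_unique:
 assumes B: "k_algebra K B" and f: "f : lin H B" and g: "g : lin H B" and k: "k : lin H B"
  and u: "u : car B"
  and fg: "!!h. h : car H ==> conv B f g h = \<epsilon> h .*_B u"
  and gk: "!!h. h : car H ==> conv B g k h = \<epsilon> h .*_B 1_B"
  and h: "h : car H"
 shows "f h = u *_B k h"
proof -
 interpret B: k_algebra K B by (rule B)
 note vsB = alg_vs[OF B]
 note fc = mh_closed[OF f] and gc = mh_closed[OF g] and kc = mh_closed[OF k]
 note LB = LR mult_lin1[OF B] mult_lin2[OF B] vsB B.A.m_closed B.A.one_closed fc gc kc f g k u
 have "u *_B k h = tL B (%x y. \<epsilon> x .*_B (u *_B k y)) (\<Delta> h)"
  by (rule counit_left[OF h vsB, symmetric]) (intro LB)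
 also have "... = tL B (%x y. tL B (%a b. (f a *_B g b) *_B k y) (\<Delta> x)) (\<Delta> h)"
 proof (rule \<Delta>_cong[OF h vsB])
  fix x y assume x: "x : car H" and y: "y : car H"
  have "\<epsilon> x .*_B (u *_B k y) = conv B f g x *_B k y" (is "?l = _")
   unfolding fg[OF x] using x y by (simp add: B.smult_mult_left \<epsilon>c u kc)
  also have "... = tL B (%a b. (f a *_B g b) *_B k y) (\<Delta> x)"
   unfolding conv_def by (rule \<Delta>_push[OF vsB vsB _ _ x, of "%z. z *_B k y"]) (intro LB y)+
  finally show "?l = tL B (%a b. (f a *_B g b) *_B k y) (\<Delta> x)" .
 qed (intro LB)
 also have "... = tL B (%x y. tL B (%a b. (f x *_B g a) *_B k b) (\<Delta> y)) (\<Delta> h)"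
  by (rule coassoc_\<Delta>[OF h vsB]) (intro LB)
 also have "... = tL B (%x y. \<epsilon> y .*_B f x) (\<Delta> h)"
 proof (rule \<Delta>_cong[OF h vsB])
  fix x y assume x: "x : car H" and y: "y : car H"
  have "tL B (%a b. (f x *_B g a) *_B k b) (\<Delta> y) = tL B (%a b. f x *_B (g a *_B k b)) (\<Delta> y)" (is "?l = _")
  proof (rule \<Delta>_cong[OF y vsB])
   show "bil K H H B (%a b. f x *_B (g a *_B k b))" by (intro LB x)
  qed (simp add: B.A.m_assoc fc gc kc x)
  also have "... = f x *_B conv B g k y"
   unfolding conv_def by (rule \<Delta>_push[OF vsB vsB _ _ y, of "%z. f x *_B z", symmetric]) (intro LB x)+
  also have "... = \<epsilon> y .*_B f x"
   unfolding gk[OF y] using x y by (simp add: B.smult_mult_right \<epsilon>c fc)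
  finally show "?l = \<epsilon> y .*_B f x" .
 qed (intro LB)
 also have "... = f h" by (rule counit_right[OF h vsB f])
 finally show ?thesis by simp
qed

lemma conv_antipode: "h : car H ==> conv H (%x. x) S h = \<epsilon> h .*_H 1_H"
 unfolding conv_def by (rule antipode_right[OF _ vsH mh_id])

text \<open>For fixed \<open>g\<close>, the map \<open>h \<mapsto> S(g\<^sub>1 h) g\<^sub>2\<close>
  convolved with the identity is \<epsilon>(g) times the counit, so it equals
  \<open>\<epsilon>(g) S h\<close>. This says in turn that \<open>g \<mapsto> S(g h)\<close>
  convolved with the identity is \<open>\<epsilon>(g) S h\<close>, and uniqueness applies once more
  with \<open>u = S h\<close>.\<close>

lemma S_mult:
 assumes g: "g : car H" and h: "h : car H"
 shows "S (g *_H h) = S h *_H S g"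
proof -
 have 1: "tL H (%a b. S (a *_H h) *_H b) (\<Delta> g) = \<epsilon> g .*_H S h" if g: "g : car H" for g
 proof -
  have e: "\<epsilon> g .*_H 1_H : car H" using g \<epsilon>c by simp
  have "tL H (%a b. S (a *_H h) *_H b) (\<Delta> g) = (\<epsilon> g .*_H 1_H) *_H S h"
  proof (rule conv_unique[OF kH _ mh_id S_lin e _ conv_antipode h])
   show "(%h. tL H (%a b. S (a *_H h) *_H b) (\<Delta> g)) : lin H H" by (intro LR g)
   fix h assume h: "h : car H"
   have "conv H (%h. tL H (%a b. S (a *_H h) *_H b) (\<Delta> g)) (%x. x) h =
    tL H (%x y. tL H (%a b. S (a *_H x) *_H (b *_H y)) (\<Delta> g)) (\<Delta> h)" (is "?l = _")
    unfolding conv_def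
   proof (rule \<Delta>_cong[OF h vsH])
    fix x y assume x: "x : car H" and y: "y : car H"
    have "tL H (%a b. S (a *_H x) *_H b) (\<Delta> g) *_H y = tL H (%a b. (S (a *_H x) *_H b) *_H y) (\<Delta> g)" (is "?l = _")
     by (rule \<Delta>_push[OF vsH vsH _ _ g, of "%z. z *_H y"]) (intro LR x y)+
    also have "... = tL H (%a b. S (a *_H x) *_H (b *_H y)) (\<Delta> g)"
     by (rule \<Delta>_cong[OF g vsH]) (simp add: HA.A.m_assoc Sc x y, intro LR x y)
    finally show "?l = tL H (%a b. S (a *_H x) *_H (b *_H y)) (\<Delta> g)" .
   qed (intro LR g)
   also have "... = tL H (%a b. tL H (%x y. S (a *_H x) *_H (b *_H y)) (\<Delta> h)) (\<Delta> g)"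
    by (rule tl_swap[OF vsH vsH vsH vsH vsH \<Delta>c[OF h] \<Delta>c[OF g]]; intro LR)
   also have "... = tL H (%x y. S x *_H y) (\<Delta> (g *_H h))"
    unfolding \<Delta>_mult[OF g h] by (rule tL_mult[OF kH kH \<Delta>c[OF g] \<Delta>c[OF h] vsH, symmetric]) (intro LR)
   also have "... = \<epsilon> (g *_H h) .*_H 1_H"
    by (rule antipode_left[OF HA.A.m_closed[OF g h] vsH mh_id])
   also have "... = \<epsilon> h .*_H (\<epsilon> g .*_H 1_H)"
    using g h by (simp add: \<epsilon>_mult HA.smult_assoc1[symmetric] \<epsilon>c K.m_comm)
   finally show "?l = \<epsilon> h .*_H (\<epsilon> g .*_H 1_H)" .
  qed
  then show ?thesis using g h by (simp add: HA.smult_mult_left \<epsilon>c Sc)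
 qed
 show ?thesis
  by (rule conv_unique[OF kH _ mh_id S_lin Sc[OF h] _ conv_antipode g])
   (intro LR h, simp add: conv_def 1)
qed

lemma S_one: "S 1_H = 1_H"
proof -
 have "bil K H H H (%x y. S x *_H y)" by (intro LR)
 then have "tL H (%x y. S x *_H y) (\<Delta> 1_H) = S 1_H *_H 1_H"
  unfolding \<Delta>_one by (intro tl_pure vsH) simp_all
 then show ?thesis using antipode_left[OF HA.A.one_closed vsH mh_id] by (simp add: \<epsilon>_one Sc)
qed

text \<open>\<open>\<Delta> S\<close> is a left and
  \<open>h \<mapsto> S h\<^sub>2 \<otimes> S h\<^sub>1\<close> a right convolution inverse of
  \<Delta>, hence they agree.\<close>

lemma S_comult:
 assumes h: "h : car H" and U: "vs U" and \<phi>: "bil K H H U \<phi>"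
 shows "tL U \<phi> (\<Delta> (S h)) = tL U (%x y. \<phi> (S y) (S x)) (\<Delta> h)"
proof -
 let ?B = "tens K H H" and ?Q = "TS H H"
 note kB = tens_algebra[OF kH kH]
 interpret B: k_algebra K ?B by (rule kB)
 note Q = TS_module[OF vsH vsH]
 define k where "k h = tL ?Q (%x y. pt H H (S y) (S x)) (\<Delta> h)" for h
 have kb: "bil K H H ?Q (%x y. pt H H (S y) (S x))" by (intro LR)
 have k: "k : lin H ?Q" unfolding k_def by (intro LR)
 have kc: "k h : car ?Q" if "h : car H" for h using mh_closed[OF k that] .
 have tk: "tL V \<psi> (k y) = tL V (%p q. \<psi> (S q) (S p)) (\<Delta> y)"
  if V: "vs V" and \<psi>: "bil K H H V \<psi>" and y: "y : car H" for V :: "('a, 'v) module" and \<psi> y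
 proof -
  have "tL V \<psi> (k y) = tL V (%p q. tL V \<psi> (pt H H (S q) (S p))) (\<Delta> y)"
   unfolding k_def by (rule \<Delta>_push[OF Q V tl_hom[OF vsH vsH V \<psi>] kb y])
  also have "... = tL V (%p q. \<psi> (S q) (S p)) (\<Delta> y)"
   by (rule \<Delta>_cong[OF y V]) (rule tl_pure[OF vsH vsH V \<psi> Sc Sc], assumption, assumption, intro LR bil_lin1[OF \<psi>] bil_lin2[OF \<psi>])
  finally show ?thesis .
 qed
 have "\<Delta> (S h) = 1_?B *_?B k h"
 proof (rule conv_unique[OF kB, of "%h. \<Delta> (S h)" \<Delta> k, OF _ _ _ B.A.one_closed _ _ h])
  show "(%h. \<Delta> (S h)) : lin H ?B" using \<Delta>_comp[OF S_lin] by simp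
  show "\<Delta> : lin H ?B" using \<Delta>_lin by simp
  show "k : lin H ?B" using k by simp
  fix h assume h: "h : car H"
  have "conv ?B (%h. \<Delta> (S h)) \<Delta> h = tL ?Q (%x y. \<Delta> (S x *_H y)) (\<Delta> h)" (is "?l = _")
   unfolding conv_def tens_lift_tens
   by (rule \<Delta>_cong[OF h Q]) (simp only: \<Delta>_mult Sc, intro LR)
  also have "... = \<epsilon> h .*_?Q \<Delta> 1_H" by (rule antipode_left[OF h Q \<Delta>_lin])
  finally show "?l = \<epsilon> h .*_?B 1_?B"
   by (simp only: \<Delta>_one BC_one[OF kH kH] tens_sel)
  have "conv ?B \<Delta> k h = tL ?Q (%x y. tL ?Q (%a b. tL ?Q (%p q. pt H H (a *_H S q) (b *_H S p)) (\<Delta> y)) (\<Delta> x)) (\<Delta> h)"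
   unfolding conv_def tens_lift_tens
  proof (rule \<Delta>_cong[OF h Q])
   fix x y assume x: "x : car H" and y: "y : car H"
   have "\<Delta> x *_?B k y = tL ?Q (%a b. tL ?Q (%c d. pt H H (a *_H c) (b *_H d)) (k y)) (\<Delta> x)"
    by (rule BC_mult_def[OF kH kH])
   also have "... = tL ?Q (%a b. tL ?Q (%p q. pt H H (a *_H S q) (b *_H S p)) (\<Delta> y)) (\<Delta> x)"
    by (rule \<Delta>_cong[OF x Q], rule tk[OF Q _ y]; intro LR y)
   finally show "\<Delta> x *_?B k y = tL ?Q (%a b. tL ?Q (%p q. pt H H (a *_H S q) (b *_H S p)) (\<Delta> y)) (\<Delta> x)" .
  qed (intro LR)
  also have "... = tL ?Q (%x y. tL ?Q (%a b. tL ?Q (%p q. pt H H (x *_H S q) (a *_H S p)) (\<Delta> b)) (\<Delta> y)) (\<Delta> h)"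
   by (rule coassoc_\<Delta>[OF h Q]) (intro LR)
  also have "... = tL ?Q (%x y. pt H H (x *_H S y) 1_H) (\<Delta> h)"
  proof (rule \<Delta>_cong[OF h Q])
   fix x y assume x: "x : car H" and y: "y : car H"
   have "tL ?Q (%a b. tL ?Q (%p q. pt H H (x *_H S q) (a *_H S p)) (\<Delta> b)) (\<Delta> y) =
    tL ?Q (%c q. tL ?Q (%a p. pt H H (x *_H S q) (a *_H S p)) (\<Delta> c)) (\<Delta> y)" (is "?l = _")
    by (rule coassoc_\<Delta>[OF y Q, symmetric]) (intro LR x)
   also have "... = tL ?Q (%c q. \<epsilon> c .*_?Q pt H H (x *_H S q) 1_H) (\<Delta> y)"
    by (rule \<Delta>_cong[OF y Q]) (rule antipode_right[OF _ Q], assumption, (intro LR x; assumption), intro LR x)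
   also have "... = pt H H (x *_H S y) 1_H" by (rule counit_left[OF y Q]) (intro LR x)
   finally show "?l = pt H H (x *_H S y) 1_H" .
  qed (intro LR)
  also have "... = \<epsilon> h .*_?Q pt H H 1_H 1_H" by (rule antipode_right[OF h Q]) (intro LR)
  finally show "conv ?B \<Delta> k h = \<epsilon> h .*_?B 1_?B" by (simp only: BC_one[OF kH kH] tens_sel)
 qed
 then have "\<Delta> (S h) = k h" using kc[OF h] B.A.l_one[of "k h"] by (simp only: tens_sel)
 then show ?thesis using tk[OF U \<phi> h] by simp
qed

lemma S_counit:
 assumes h: "h : car H"
 shows "\<epsilon> (S h) = \<epsilon> h"
proof -
 have "\<epsilon> (S h) = tL (reg K) (%x y. \<epsilon> x .*_(reg K) \<epsilon> (S y)) (\<Delta> h)"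
  by (rule counit_left[OF h vs_regular, symmetric]) (rule mh_comp[OF S_lin \<epsilon>_lin])
 also have "... = tL (reg K) (%x y. \<epsilon> (x *_H S y)) (\<Delta> h)"
  by (rule \<Delta>_cong[OF h vs_regular])
   (simp add: \<epsilon>_mult Sc, intro bilI mh_comp[OF _ \<epsilon>_lin] mult_lin1[OF kH] mult_lin2[OF kH] S_comp mh_id Sc)
 also have "... = \<epsilon> h .*_(reg K) \<epsilon> 1_H" by (rule antipode_right[OF h vs_regular \<epsilon>_lin])
 finally show ?thesis using \<epsilon>c[OF h] by (simp add: \<epsilon>_one)
qed

end

section \<open>Sweedler calculus in a Hopf-Galois object\<close>

lemma (in vfield) lin_inv_into:
 assumes V: "vs V" and f: "f : lin V W" and b: "bij_betw f (car V) (car W)"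
 shows "inv_into (car V) f : lin W V"
proof (rule mhI)
 interpret V: left_module K V by (rule V)
 let ?g = "inv_into (car V) f"
 have c: "?g x : car V" "f (?g x) = x" if "x : car W" for x
  using b that by (simp_all add: bij_betw_def inv_into_into f_inv_into_f)
 have i: "?g x = v" if "v : car V" "f v = x" for v x
  using b that by (auto simp: bij_betw_def inv_into_f_f)
 show "?g (x +_W y) = ?g x +_V ?g y" if "x : car W" "y : car W" for x y
  by (rule i) (simp_all add: that c mh_add[OF f])
 show "?g (k .*_W x) = k .*_V ?g x" if "k : car K" "x : car W" for k x
  by (rule i) (simp_all add: that c mh_smult[OF f] V.smult_closed)
qed (use b in \<open>simp add: bij_betw_def inv_into_into\<close>)

lemma (in vfield) tens_bij_left:
 assumes V: "vs V" and V': "vs V'" and W: "vs W"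
  and f: "f : lin V V'" and b: "bij_betw f (car V) (car V')"
 shows "bij_betw (tL (TS V' W) (%v w. pt V' W (f v) w)) (car (TS V W)) (car (TS V' W))"
proof -
 let ?g = "inv_into (car V) f"
 note g = lin_inv_into[OF V f b] and T = TS_module[OF V W] and T' = TS_module[OF V' W]
 have fb: "bil K V W (TS V' W) (%v w. pt V' W (f v) w)" and gb: "bil K V' W (TS V W) (%v w. pt V W (?g v) w)"
  by (intro bilI pure_lin1 pure_lin2 V V' W f g mh_closed[OF f] mh_closed[OF g] mh_id; assumption)+
 note F = tl_hom[OF V W T' fb] and G = tl_hom[OF V' W T gb]
 have i: "?g (f v) = v" if "v : car V" for v using b that by (simp add: bij_betw_def inv_into_f_f)
 have i': "f (?g v) = v" if "v : car V'" for v using b that by (simp add: bij_betw_def f_inv_into_f)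
 have 1: "tL (TS V W) (%v w. pt V W (?g v) w) (tL (TS V' W) (%v w. pt V' W (f v) w) t) = t" if "t : car (TS V W)" for t
  by (rule tens_eqI[OF V W mh_comp[OF F G] mh_id T _ that])
   (simp add: tl_pure[OF V W T' fb] tl_pure[OF V' W T gb] mh_closed[OF f] i)
 have 2: "tL (TS V' W) (%v w. pt V' W (f v) w) (tL (TS V W) (%v w. pt V W (?g v) w) t) = t" if "t : car (TS V' W)" for t
  by (rule tens_eqI[OF V' W mh_comp[OF G F] mh_id T' _ that])
   (simp add: tl_pure[OF V W T' fb] tl_pure[OF V' W T gb] mh_closed[OF g] i')
 show ?thesis
  by (rule bij_betw_byWitness[of _ "tL (TS V W) (%v w. pt V W (?g v) w)"])
   (auto simp: 1 2 mh_closed[OF F] mh_closed[OF G])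
qed

text \<open>In Sweedler form, with \<open>x(-1) \<otimes> x(0)\<close> for
  \<open>\<alpha> x\<close>, the Galois map is
  \<open>x \<otimes> y \<mapsto> x(-1) \<otimes> x(0) y\<close>.\<close>

lemma (in vfield) left_can_eq:
 assumes H: "vs H" and A: "k_algebra K A" and \<alpha>: "\<alpha> : lin A (TS H A)" and t: "t : car (TS A A)"
 shows "tens_map K H A (%h. h) (mult_map K A) (tens_assoc K H A A (tens_map K (tens K H A) A \<alpha> (%a. a) t)) =
  tL (TS H A) (%x y. tL (TS H A) (%g z. pt H A g (z *_A y)) (\<alpha> x)) t"
proof -
 let ?Q = "TS H (TS A A)" and ?W = "TS H A"
 interpret AA: k_algebra K A by (rule A)
 note vsA = alg_vs[OF A]
 note AA = TS_module[OF vsA vsA]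
 note W = TS_module[OF H vsA] and Q = TS_module[OF H AA]
 have tr: "tri K H A A ?W (%h x y. pt H A h (x *_A y))"
  by (intro triI pure_lin1 pure_lin2 H vsA mult_lin1[OF A] mult_lin2[OF A] mh_id AA.A.m_closed)
 have m: "bil K A A A (%x y. x *_A y)" by (intro bilI mult_lin1[OF A] mult_lin2[OF A] mh_id)
 have p: "bil K H A ?Q (%v w. pt H (TS A A) v (pt A A w x))" if "x : car A" for x
  using that by (intro bilI pure_lin1 pure_lin2 H vsA AA mh_id pure_closed)
 have b: "bil K A A ?Q (%c x. tL ?Q (%v w. pt H (TS A A) v (pt A A w x)) (\<alpha> c))"
  by (intro bilI tl_lin_arg[OF H vsA Q p \<alpha>] tl_lin_body[OF H vsA Q vsA mh_closed[OF \<alpha>] _ p] pure_lin2 pure_closed H vsA AA mh_id)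
 have eq: "tens_map K H A (%h. h) (mult_map K A) s = lift3 ?W (%h x y. pt H A h (x *_A y)) s"
  if s: "s : car ?Q" for s
 proof -
  have "tens_map K H A (%h. h) (mult_map K A) s = tL ?W (%h t. pt H A h (tL A (%x y. x *_A y) t)) s"
   by (simp add: tens_map_def mult_map_def)
  also have "... = tL ?W (%h t. tL ?W (%x y. pt H A h (x *_A y)) t) s"
   by (rule tl_cong[OF H AA W s _ lift3_bil[OF H vsA vsA W tr]], rule tl_push[OF vsA vsA vsA W m pure_lin2[OF H vsA _ mh_id]])
  finally show ?thesis by (simp add: lift3_def)
 qed
 show ?thesis
  unfolding tens_map_left[OF H vsA vsA vsA \<alpha> t] lift3_left[OF H vsA vsA W vsA tr \<alpha> t, symmetric]
  by (rule eq[OF tl_closed[OF vsA vsA Q b t]])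
qed

locale lgal = hopfc K H \<Delta> \<epsilon> S
 for K :: "('a, 'b) ring_scheme" (structure) and H :: "('a, 'h) module" and \<Delta> :: "'h => ('a, 'h, 'h) tens" and \<epsilon> :: "'h => 'a" and S :: "'h => 'h" +
 fixes A :: "('a, 'x) module" and \<alpha> :: "'x => ('a, 'h, 'x) tens"
 assumes gal: "left_galois_object K H \<Delta> \<epsilon> A \<alpha>" and bijS: "bij_betw S (car H) (car H)"
begin

lemma kA: "k_algebra K A"
 using gal by (simp add: left_galois_object_def left_comodule_algebra_def)

sublocale AA: k_algebra K A by (rule kA)

lemmas vsA = alg_vs[OF kA]

lemma \<alpha>_hom: "\<alpha> : alg_hom K A (tens K H A)"
 using gal by (simp add: left_galois_object_def left_comodule_algebra_def)

lemma \<alpha>_lin: "\<alpha> : lin A (TS H A)"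
 using \<alpha>_hom by (simp add: alg_hom_def)

lemmas \<alpha>c = mh_closed[OF \<alpha>_lin]

lemma \<alpha>_one: "\<alpha> 1_A = pt H A 1_H 1_A"
 using \<alpha>_hom ring_hom_one[of \<alpha> A "tens K H A"] by (simp add: alg_hom_def BC_one[OF kH kA])

lemma \<alpha>_mult: "x : car A ==> y : car A ==> \<alpha> (x *_A y) = \<alpha> x *_(tens K H A) \<alpha> y"
 using \<alpha>_hom ring_hom_mult[of \<alpha> A "tens K H A"] by (simp add: alg_hom_def)

lemma \<alpha>_comp: "T : lin X A ==> (%x. \<alpha> (T x)) : lin X (TS H A)"
 by (rule mh_comp[OF _ \<alpha>_lin])

lemma \<alpha>_arg: "vs U ==> bil K H A U \<phi> ==> T : lin X A ==> (%x. tL U \<phi> (\<alpha> (T x))) : lin X U"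
 by (rule tl_lin_arg[OF vsH vsA _ _ \<alpha>_comp])

lemma \<alpha>_body: "vs U ==> vs X ==> a : car A ==>
  (!!v w. v : car H ==> w : car A ==> (%x. \<phi> x v w) : lin X U) ==>
  (!!x. x : car X ==> bil K H A U (\<phi> x)) ==> (%x. tL U (\<phi> x) (\<alpha> a)) : lin X U"
 by (rule tl_lin_body[OF vsH vsA _ _ \<alpha>c])

lemma \<alpha>_closed: "vs U ==> bil K H A U \<phi> ==> a : car A ==> tL U \<phi> (\<alpha> a) : car U"
 by (rule tl_closed[OF vsH vsA _ _ \<alpha>c])

lemma \<alpha>_cong: "a : car A ==> vs U ==>
  (!!x y. x : car H ==> y : car A ==> \<phi> x y = \<psi> x y) ==> bil K H A U \<psi> ==> tL U \<phi> (\<alpha> a) = tL U \<psi> (\<alpha> a)"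
 by (rule tl_cong[OF vsH vsA _ \<alpha>c])

lemma \<alpha>_push: "vs U ==> vs U' ==> f : lin U U' ==> bil K H A U \<phi> ==> a : car A ==>
  f (tL U \<phi> (\<alpha> a)) = tL U' (%v w. f (\<phi> v w)) (\<alpha> a)"
 by (rule tl_push[OF vsH vsA _ _ _ _ \<alpha>c])

lemmas LA = LR \<alpha>_comp \<alpha>_arg \<alpha>_body \<alpha>_closed \<alpha>c mult_lin1[OF kA] mult_lin2[OF kA] AA.A.m_closed AA.A.one_closed vsA

lemma coassoc_\<alpha>:
 assumes a: "a : car A" and U: "vs U" and \<phi>: "tri K H H A U \<phi>"
 shows "tL U (%c x. tL U (%v w. \<phi> v w x) (\<Delta> c)) (\<alpha> a) = tL U (%v c. tL U (%w x. \<phi> v w x) (\<alpha> c)) (\<alpha> a)"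
 by (rule coassoc_tri[OF vsH vsH vsA U vsH vsA \<phi> \<Delta>_lin \<alpha>_lin \<alpha>c[OF a] \<alpha>c[OF a]])
  (use gal a in \<open>simp add: left_galois_object_def left_comodule_algebra_def del: tens_sel tens_space_tens pure_tens_tens tens_lift_tens mh_tens\<close>)

lemma counit_\<alpha>:
 assumes a: "a : car A" and U: "vs U" and f: "f : lin A U"
 shows "tL U (%x y. \<epsilon> x .*_U f y) (\<alpha> a) = f a"
proof -
 have "f a = f (tL A (%x y. \<epsilon> x .*_A y) (\<alpha> a))"
  using gal a by (simp add: left_galois_object_def left_comodule_algebra_def)
 also have "... = tL U (%x y. f (\<epsilon> x .*_A y)) (\<alpha> a)"
  by (rule \<alpha>_push[OF vsA U f _ a]) (intro LA)
 also have "... = tL U (%x y. \<epsilon> x .*_U f y) (\<alpha> a)"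
 proof (rule \<alpha>_cong[OF a U])
  show "bil K H A U (%x y. \<epsilon> x .*_U f y)" by (intro LA f U mh_closed[OF f])
  show "f (\<epsilon> x .*_A y) = \<epsilon> x .*_U f y" if "x : car H" "y : car A" for x y
   using mh_smult[OF f \<epsilon>c] that by simp
 qed
 finally show ?thesis by simp
qed

definition can :: "('a, 'x, 'x) tens => ('a, 'h, 'x) tens" where
 "can t = tL (TS H A) (%x y. tL (TS H A) (%g z. pt H A g (z *_A y)) (\<alpha> x)) t"

lemma can_bil: "bil K A A (TS H A) (%x y. tL (TS H A) (%g z. pt H A g (z *_A y)) (\<alpha> x))"
 by (intro LA)

lemma can_lin: "can : lin (TS A A) (TS H A)"
 unfolding can_def by (rule tl_hom[OF vsA vsA TS_module[OF vsH vsA] can_bil])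

lemma can_bij: "bij_betw can (car (TS A A)) (car (TS H A))"
proof -
 have "bij_betw can (car (tens K A A)) (car (tens K H A)) \<longleftrightarrow> bij_betw
   (%x. tens_map K H A (%h. h) (mult_map K A)
    (tens_assoc K H A A (tens_map K (tens K H A) A \<alpha> (%a. a) x)))
   (car (tens K A A)) (car (tens K H A))"
  by (intro bij_betw_cong) (simp only: tens_sel left_can_eq[OF vsH kA \<alpha>_lin] can_def)
 then show ?thesis using gal by (simp add: left_galois_object_def)
qed

lemma tL_can:
 assumes t: "t : car (TS A A)" and U: "vs U" and \<phi>: "bil K H A U \<phi>"
 shows "tL U \<phi> (can t) = tL U (%x y. tL U (%g z. \<phi> g (z *_A y)) (\<alpha> x)) t"
proof -
 let ?W = "TS H A"
 note W = TS_module[OF vsH vsA]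
 note L = LA U bil_lin1[OF \<phi>] bil_lin2[OF \<phi>]
 have "tL U \<phi> (can t) = tL U (%x y. tL U \<phi> (tL ?W (%g z. pt H A g (z *_A y)) (\<alpha> x))) t"
  unfolding can_def by (rule tl_push[OF vsA vsA W U can_bil tl_hom[OF vsH vsA U \<phi>] t])
 also have "... = tL U (%x y. tL U (%g z. \<phi> g (z *_A y)) (\<alpha> x)) t"
 proof (rule tl_cong[OF vsA vsA U t])
  fix x y assume x: "x : car A" and y: "y : car A"
  have "tL U \<phi> (tL ?W (%g z. pt H A g (z *_A y)) (\<alpha> x)) = tL U (%g z. tL U \<phi> (pt H A g (z *_A y))) (\<alpha> x)" (is "?l = _")
   by (rule \<alpha>_push[OF W U tl_hom[OF vsH vsA U \<phi>] _ x]) (intro LA y)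
  also have "... = tL U (%g z. \<phi> g (z *_A y)) (\<alpha> x)"
   by (rule \<alpha>_cong[OF x U], rule tl_pure[OF vsH vsA U \<phi>], assumption, (intro LA y; assumption), intro L y)
  finally show "?l = tL U (%g z. \<phi> g (z *_A y)) (\<alpha> x)" .
 qed (intro L)
 finally show ?thesis .
qed

lemma can_inj: "s : car (TS A A) ==> t : car (TS A A) ==> can s = can t ==> s = t"
 using can_bij by (meson bij_betw_imp_inj_on inj_onD)

text \<open>The translation map \<open>h \<mapsto> h\<^sup>1 \<otimes> h\<^sup>2\<close>.\<close>

definition \<kappa> :: "'h => ('a, 'x, 'x) tens" where
 "\<kappa> h = inv_into (car (TS A A)) can (pt H A h 1_A)"

lemma \<kappa>c: "h : car H ==> \<kappa> h : car (TS A A)"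
 unfolding \<kappa>_def by (rule inv_into_into) (use can_bij in \<open>simp add: bij_betw_def pure_closed[OF vsH vsA]\<close>)

lemma can_\<kappa>: "h : car H ==> can (\<kappa> h) = pt H A h 1_A"
 unfolding \<kappa>_def by (rule f_inv_into_f) (use can_bij in \<open>simp add: bij_betw_def pure_closed[OF vsH vsA]\<close>)

lemma \<kappa>_lin: "\<kappa> : lin H (TS A A)"
proof (rule mhI)
 interpret Q: left_module K "TS A A" by (rule TS_module[OF vsA vsA])
 have p: "(%h. pt H A h 1_A) : lin H (TS H A)" by (intro LA)
 fix x assume x: "x : car H"
 show "\<kappa> x : car (TS A A)" by (rule \<kappa>c[OF x])
 show "\<kappa> (x +_H y) = \<kappa> x +_(TS A A) \<kappa> y" if y: "y : car H" for y
  by (rule can_inj) (simp_all add: x y \<kappa>c can_\<kappa> mh_add[OF can_lin] mh_add[OF p])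
 show "\<kappa> (c .*_H x) = c .*_(TS A A) \<kappa> x" if c: "c : car K" for c
  by (rule can_inj) (simp_all add: x c \<kappa>c can_\<kappa> mh_smult[OF can_lin] mh_smult[OF p] Q.smult_closed)
qed

lemma \<kappa>_comp: "T : lin X H ==> (%x. \<kappa> (T x)) : lin X (TS A A)"
 by (rule mh_comp[OF _ \<kappa>_lin])

lemma \<kappa>_arg: "vs U ==> bil K A A U \<phi> ==> T : lin X H ==> (%x. tL U \<phi> (\<kappa> (T x))) : lin X U"
 by (rule tl_lin_arg[OF vsA vsA _ _ \<kappa>_comp])

lemma \<kappa>_body: "vs U ==> vs X ==> a : car H ==>
  (!!v w. v : car A ==> w : car A ==> (%x. \<phi> x v w) : lin X U) ==>
  (!!x. x : car X ==> bil K A A U (\<phi> x)) ==> (%x. tL U (\<phi> x) (\<kappa> a)) : lin X U"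
 by (rule tl_lin_body[OF vsA vsA _ _ \<kappa>c])

lemma \<kappa>_closed: "vs U ==> bil K A A U \<phi> ==> a : car H ==> tL U \<phi> (\<kappa> a) : car U"
 by (rule tl_closed[OF vsA vsA _ _ \<kappa>c])

lemma \<kappa>_cong: "a : car H ==> vs U ==>
  (!!x y. x : car A ==> y : car A ==> \<phi> x y = \<psi> x y) ==> bil K A A U \<psi> ==> tL U \<phi> (\<kappa> a) = tL U \<psi> (\<kappa> a)"
 by (rule tl_cong[OF vsA vsA _ \<kappa>c])

lemma \<kappa>_push: "vs U ==> vs U' ==> f : lin U U' ==> bil K A A U \<phi> ==> a : car H ==>
  f (tL U \<phi> (\<kappa> a)) = tL U' (%v w. f (\<phi> v w)) (\<kappa> a)"
 by (rule tl_push[OF vsA vsA _ _ _ _ \<kappa>c])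

lemmas LK = LA \<kappa>_comp \<kappa>_arg \<kappa>_body \<kappa>_closed \<kappa>c

text \<open>The defining equation of \<kappa> in Sweedler form: with
  \<open>h\<^sup>1 \<otimes> h\<^sup>2\<close> for \<open>\<kappa> h\<close>, the tensor
  \<open>h\<^sup>1(-1) \<otimes> h\<^sup>1(0) h\<^sup>2\<close> is
  \<open>h \<otimes> 1\<close>.\<close>

lemma kap_can:
 assumes h: "h : car H" and U: "vs U" and \<phi>: "bil K H A U \<phi>"
 shows "tL U (%x y. tL U (%g z. \<phi> g (z *_A y)) (\<alpha> x)) (\<kappa> h) = \<phi> h 1_A"
 using tL_can[OF \<kappa>c[OF h] U \<phi>] tl_pure[OF vsH vsA U \<phi> h AA.A.one_closed] by (simp add: can_\<kappa> h)

text \<open>Multiplying the defining equation of \<kappa> by \<open>a\<close> on the right shows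
  that \<open>h \<otimes> a \<mapsto> h\<^sup>1 \<otimes> h\<^sup>2 a\<close> inverts
  \<open>can\<close>.\<close>

lemma can_pure:
 assumes h: "h : car H" and a: "a : car A"
 shows "can (tL (TS A A) (%p q. pt A A p (q *_A a)) (\<kappa> h)) = pt H A h a"
proof -
 let ?W = "TS H A"
 note W = TS_module[OF vsH vsA] and Q = TS_module[OF vsA vsA]
 have b: "bil K H A ?W (%g z. pt H A g (z *_A a))" by (intro LA a)
 have "can (tL (TS A A) (%p q. pt A A p (q *_A a)) (\<kappa> h)) = tL ?W (%p q. can (pt A A p (q *_A a))) (\<kappa> h)"
  by (rule \<kappa>_push[OF Q W can_lin _ h]) (intro LA a)
 also have "... = tL ?W (%x y. tL ?W (%g z. pt H A g (z *_A y *_A a)) (\<alpha> x)) (\<kappa> h)"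
 proof (rule \<kappa>_cong[OF h W])
  fix x y assume x: "x : car A" and y: "y : car A"
  have "can (pt A A x (y *_A a)) = tL ?W (%g z. pt H A g (z *_A (y *_A a))) (\<alpha> x)"
   unfolding can_def by (rule tl_pure[OF vsA vsA W can_bil x]) (intro LA y a)
  also have "... = tL ?W (%g z. pt H A g (z *_A y *_A a)) (\<alpha> x)"
   by (rule \<alpha>_cong[OF x W]) (simp add: AA.A.m_assoc y a, intro LA y a)
  finally show "can (pt A A x (y *_A a)) = tL ?W (%g z. pt H A g (z *_A y *_A a)) (\<alpha> x)" .
 qed (intro LA a)
 also have "... = pt H A h (1_A *_A a)" by (rule kap_can[OF h W b])
 finally show ?thesis by (simp add: a)
qed

text \<open>By \<open>can_pure\<close>, the injective map \<open>can\<close> has the same value on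
  \<open>x(-1)\<^sup>1 \<otimes> x(-1)\<^sup>2 x(0) y\<close> and on
  \<open>x \<otimes> y\<close>.\<close>

lemma kap_coact:
 assumes x: "x : car A" and y: "y : car A" and U: "vs U" and \<phi>: "bil K A A U \<phi>"
 shows "tL U (%g z. tL U (%p q. \<phi> p (q *_A (z *_A y))) (\<kappa> g)) (\<alpha> x) = \<phi> x y"
proof -
 let ?W = "TS H A" and ?Q = "TS A A"
 note W = TS_module[OF vsH vsA] and Q = TS_module[OF vsA vsA]
 note L = LK U bil_lin1[OF \<phi>] bil_lin2[OF \<phi>]
 define X where "X = tL ?Q (%g z. tL ?Q (%p q. pt A A p (q *_A (z *_A y))) (\<kappa> g)) (\<alpha> x)"
 have b: "bil K H A ?Q (%g z. tL ?Q (%p q. pt A A p (q *_A (z *_A y))) (\<kappa> g))" by (intro LK y)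
 have "can X = tL ?W (%g z. can (tL ?Q (%p q. pt A A p (q *_A (z *_A y))) (\<kappa> g))) (\<alpha> x)"
  unfolding X_def by (rule \<alpha>_push[OF Q W can_lin b x])
 also have "... = tL ?W (%g z. pt H A g (z *_A y)) (\<alpha> x)"
  by (rule \<alpha>_cong[OF x W], rule can_pure, assumption, (intro LA y; assumption), intro LA y)
 also have "... = can (pt A A x y)"
  unfolding can_def by (rule tl_pure[OF vsA vsA W can_bil x y, symmetric])
 finally have cX: "can X = can (pt A A x y)" .
 have "X : car ?Q" unfolding X_def by (intro LK y x)
 then have "X = pt A A x y" using cX by (intro can_inj pure_closed vsA x y)
 then have "\<phi> x y = tL U \<phi> X" by (simp add: tl_pure[OF vsA vsA U \<phi> x y])
 also have "... = tL U (%g z. tL U \<phi> (tL ?Q (%p q. pt A A p (q *_A (z *_A y))) (\<kappa> g))) (\<alpha> x)"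
  unfolding X_def by (rule \<alpha>_push[OF Q U tl_hom[OF vsA vsA U \<phi>] b x])
 also have "... = tL U (%g z. tL U (%p q. \<phi> p (q *_A (z *_A y))) (\<kappa> g)) (\<alpha> x)"
 proof (rule \<alpha>_cong[OF x U])
  fix g z assume g: "g : car H" and z: "z : car A"
  have "tL U \<phi> (tL ?Q (%p q. pt A A p (q *_A (z *_A y))) (\<kappa> g)) = tL U (%p q. tL U \<phi> (pt A A p (q *_A (z *_A y)))) (\<kappa> g)" (is "?l = _")
   by (rule \<kappa>_push[OF Q U tl_hom[OF vsA vsA U \<phi>] _ g]) (intro LA y z)
  also have "... = tL U (%p q. \<phi> p (q *_A (z *_A y))) (\<kappa> g)"
   by (rule \<kappa>_cong[OF g U], rule tl_pure[OF vsA vsA U \<phi>], assumption, (intro LA y z; assumption), intro L y z)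
  finally show "?l = tL U (%p q. \<phi> p (q *_A (z *_A y))) (\<kappa> g)" .
 qed (intro L y)
 finally show ?thesis by simp
qed

lemma kap_coact_one:
 assumes x: "x : car A" and U: "vs U" and \<phi>: "bil K A A U \<phi>"
 shows "tL U (%g z. tL U (%p q. \<phi> p (q *_A z)) (\<kappa> g)) (\<alpha> x) = \<phi> x 1_A"
proof -
 note L = LK U bil_lin1[OF \<phi>] bil_lin2[OF \<phi>]
 have "tL U (%g z. tL U (%p q. \<phi> p (q *_A (z *_A 1_A))) (\<kappa> g)) (\<alpha> x) = tL U (%g z. tL U (%p q. \<phi> p (q *_A z)) (\<kappa> g)) (\<alpha> x)"
  by (rule \<alpha>_cong[OF x U]) (simp, intro L)
 then show ?thesis using kap_coact[OF x AA.A.one_closed U \<phi>] by simp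
qed

text \<open>Colinearity of \<kappa> in its first leg:
  \<open>\<alpha>(h\<^sup>1) \<otimes> h\<^sup>2\<close> is
  \<open>h\<^sub>1 \<otimes> \<kappa>(h\<^sub>2)\<close>. Inserting \<open>kap_coact\<close> creates
  a second coaction, coassociativity turns it into a coproduct, and \<open>kap_can\<close> removes
  the outer translation map.\<close>

lemma coact_kap:
 assumes h: "h : car H" and U: "vs U" and \<phi>: "tri K H A A U \<phi>"
 shows "tL U (%p q. tL U (%g z. \<phi> g z q) (\<alpha> p)) (\<kappa> h) = tL U (%x y. tL U (%p q. \<phi> x p q) (\<kappa> y)) (\<Delta> h)"
proof -
 note L = LK U tri_lin1[OF \<phi>] tri_lin2[OF \<phi>] tri_lin3[OF \<phi>]
 define \<psi> where "\<psi> g a = tL U (%x y. tL U (%p q. \<phi> x p (q *_A a)) (\<kappa> y)) (\<Delta> g)" for g a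
 have \<psi>: "bil K H A U \<psi>" unfolding \<psi>_def by (intro L)
 have "tL U (%p q. tL U (%g z. \<phi> g z q) (\<alpha> p)) (\<kappa> h) = tL U (%p q. tL U (%g z. \<psi> g (z *_A q)) (\<alpha> p)) (\<kappa> h)"
 proof (rule \<kappa>_cong[OF h U])
  fix p q assume p: "p : car A" and q: "q : car A"
  have "tL U (%g z. \<phi> g z q) (\<alpha> p) = tL U (%g z. tL U (%g' z'. tL U (%p' q'. \<phi> g p' (q' *_A (z' *_A q))) (\<kappa> g')) (\<alpha> z)) (\<alpha> p)"
   by (rule \<alpha>_cong[OF p U], rule kap_coact[OF _ q U, symmetric], assumption, (intro L; assumption), intro L q)
  also have "... = tL U (%c z. tL U (%g g'. tL U (%p' q'. \<phi> g p' (q' *_A (z *_A q))) (\<kappa> g')) (\<Delta> c)) (\<alpha> p)"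
   by (rule coassoc_\<alpha>[OF p U, symmetric]) (intro L q)
  finally show "tL U (%g z. \<phi> g z q) (\<alpha> p) = tL U (%g z. \<psi> g (z *_A q)) (\<alpha> p)" by (simp add: \<psi>_def)
 qed (intro LK U bil_lin1[OF \<psi>] bil_lin2[OF \<psi>])
 also have "... = \<psi> h 1_A" by (rule kap_can[OF h U \<psi>])
 also have "... = tL U (%x y. tL U (%p q. \<phi> x p q) (\<kappa> y)) (\<Delta> h)"
  unfolding \<psi>_def
  by (rule \<Delta>_cong[OF h U], rule \<kappa>_cong[OF _ U], assumption, simp, (intro L; assumption), intro L)
 finally show ?thesis .
qed

text \<open>Applying the counit to the first factor of the defining equation of \<kappa> yields
  \<open>h\<^sup>1 h\<^sup>2 = \<epsilon>(h)\<close>.\<close>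

lemma kap_counit:
 assumes h: "h : car H" and U: "vs U" and f: "f : lin A U"
 shows "tL U (%p q. f (p *_A q)) (\<kappa> h) = \<epsilon> h .*_U f 1_A"
proof -
 have fl: "T : lin X A ==> (%x. f (T x)) : lin X U" for T and X :: "('a, 'v) module"
  by (rule mh_comp[OF _ f])
 have b: "bil K H A U (%g a. \<epsilon> g .*_U f a)" by (intro LK f U mh_closed[OF f])
 have "tL U (%p q. f (p *_A q)) (\<kappa> h) = tL U (%p q. tL U (%g z. \<epsilon> g .*_U f (z *_A q)) (\<alpha> p)) (\<kappa> h)"
  by (rule \<kappa>_cong[OF h U], rule counit_\<alpha>[OF _ U, symmetric], assumption, rule fl, (intro LK; assumption),
   intro LK fl U mh_closed[OF f])
 also have "... = \<epsilon> h .*_U f 1_A" by (rule kap_can[OF h U b])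
 finally show ?thesis .
qed

end

section \<open>The translation map as an algebra map, and the map \<theta>\<close>

context lgal
begin

abbreviation "Ae == env_alg K A"

lemmas env_sel = env_alg_sel[OF kA]
lemmas kE = env_alg_algebra[OF kA]
lemmas lin_env = env_alg_lin[OF kA]
lemmas tL_env_mult = tL_env_alg_mult[OF kA]

lemma \<kappa>_one: "\<kappa> 1_H = pt A A 1_A 1_A"
proof (rule can_inj)
 note W = TS_module[OF vsH vsA]
 have b: "bil K H A (TS H A) (%g z. pt H A g (z *_A 1_A))" by (intro LK)
 have "can (pt A A 1_A 1_A) = tL (TS H A) (%g z. pt H A g (z *_A 1_A)) (\<alpha> 1_A)"
  unfolding can_def by (rule tl_pure[OF vsA vsA W can_bil]) simp_all
 also have "... = pt H A 1_H (1_A *_A 1_A)"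
  unfolding \<alpha>_one by (rule tl_pure[OF vsH vsA W b]) simp_all
 finally show "can (\<kappa> 1_H) = can (pt A A 1_A 1_A)" by (simp add: can_\<kappa>)
qed (intro LK)+

text \<open>\<open>can\<close> is applied to both sides. As \<alpha> is multiplicative,
  \<open>kap_can\<close> consumes the inner and the outer translation map one after the other. The
  second legs multiply in reversed order, hence the enveloping algebra.\<close>

lemma \<kappa>_mult:
 assumes g: "g : car H" and h: "h : car H"
 shows "\<kappa> (g *_H h) = \<kappa> g *_Ae \<kappa> h"
proof (rule can_inj)
 let ?W = "TS H A"
 interpret E: k_algebra K Ae by (rule kE)
 note W = TS_module[OF vsH vsA]
 show c: "\<kappa> g *_Ae \<kappa> h : car (TS A A)" using E.A.m_closed[of "\<kappa> g" "\<kappa> h"] by (simp add: env_sel \<kappa>c g h)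
 show "\<kappa> (g *_H h) : car (TS A A)" by (intro LK g h)
 have "can (\<kappa> g *_Ae \<kappa> h) = tL ?W (%p q. tL ?W (%p' q'. tL ?W (%a z. pt H A a (z *_A (q' *_A q))) (\<alpha> (p *_A p'))) (\<kappa> h)) (\<kappa> g)"
  unfolding can_def by (rule tL_env_mult[OF \<kappa>c[OF g] \<kappa>c[OF h] W can_bil])
 also have "... = tL ?W (%p q. tL ?W (%a z. pt H A (a *_H h) (z *_A q)) (\<alpha> p)) (\<kappa> g)"
 proof (rule \<kappa>_cong[OF g W])
  fix p q assume p: "p : car A" and q: "q : car A"
  have "tL ?W (%p' q'. tL ?W (%a z. pt H A a (z *_A (q' *_A q))) (\<alpha> (p *_A p'))) (\<kappa> h) =
   tL ?W (%p' q'. tL ?W (%a z. tL ?W (%a' z'. pt H A (a' *_H a) (z' *_A (z *_A q' *_A q))) (\<alpha> p)) (\<alpha> p')) (\<kappa> h)"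
  proof (rule \<kappa>_cong[OF h W])
   fix p' q' assume p': "p' : car A" and q': "q' : car A"
   have "tL ?W (%a z. pt H A a (z *_A (q' *_A q))) (\<alpha> (p *_A p')) =
    tL ?W (%a' z'. tL ?W (%a z. pt H A (a' *_H a) (z' *_A z *_A (q' *_A q))) (\<alpha> p')) (\<alpha> p)" (is "?l = _")
    unfolding \<alpha>_mult[OF p p'] by (rule tL_mult[OF kH kA \<alpha>c[OF p] \<alpha>c[OF p'] W]) (intro LK q q')
   also have "... = tL ?W (%a z. tL ?W (%a' z'. pt H A (a' *_H a) (z' *_A z *_A (q' *_A q))) (\<alpha> p)) (\<alpha> p')"
    by (rule tl_swap[OF vsH vsA vsH vsA W \<alpha>c[OF p] \<alpha>c[OF p']]; intro LK q q')
   also have "... = tL ?W (%a z. tL ?W (%a' z'. pt H A (a' *_H a) (z' *_A (z *_A q' *_A q))) (\<alpha> p)) (\<alpha> p')"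
    by (rule \<alpha>_cong[OF p' W], rule \<alpha>_cong[OF p W], simp add: AA.A.m_assoc q q', (intro LK p q q'; assumption), intro LK p q q')
   finally show "?l = ..." .
  qed (intro LK p q)
  also have "... = tL ?W (%a' z'. pt H A (a' *_H h) (z' *_A (1_A *_A q))) (\<alpha> p)"
   by (rule kap_can[OF h W, where \<phi> = "%a b. tL ?W (%a' z'. pt H A (a' *_H a) (z' *_A (b *_A q))) (\<alpha> p)"]) (intro LK p q)
  finally show "tL ?W (%p' q'. tL ?W (%a z. pt H A a (z *_A (q' *_A q))) (\<alpha> (p *_A p'))) (\<kappa> h) =
   tL ?W (%a z. pt H A (a *_H h) (z *_A q)) (\<alpha> p)" using q by simp
 qed (intro LK h)
 also have "... = pt H A (g *_H h) 1_A"
  by (rule kap_can[OF g W, where \<phi> = "%a z. pt H A (a *_H h) z"]) (intro LK h)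
 finally show "can (\<kappa> (g *_H h)) = can (\<kappa> g *_Ae \<kappa> h)" by (simp add: can_\<kappa> g h)
qed

lemma \<kappa>_alg_hom: "\<kappa> : alg_hom K H Ae"
 unfolding alg_hom_def
 by (intro IntI ring_hom_memI) (simp_all add: env_sel lin_env \<kappa>c \<kappa>_lin \<kappa>_one \<kappa>_mult mh_add[OF \<kappa>_lin])

lemma kap_product:
 "g : car H ==> h : car H ==> vs U ==> bil K A A U \<phi> ==>
  tL U (%p q. tL U (%p' q'. \<phi> (p *_A p') (q' *_A q)) (\<kappa> h)) (\<kappa> g) = tL U \<phi> (\<kappa> (g *_H h))"
 using tL_env_mult[OF \<kappa>c \<kappa>c, of g h U \<phi>] by (simp add: \<kappa>_mult)

definition \<gamma> :: "'h => 'x" where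
 "\<gamma> h = tL A (%p q. q *_A p) (\<kappa> h)"

text \<open>For \<open>A = H\<close> coacting on itself by \<Delta>, the translation map is
  \<open>h \<mapsto> h\<^sub>1 \<otimes> S h\<^sub>2\<close> and \<theta> is the square of the
  antipode. In general \<theta> expresses \<kappa> \<circ> S through \<kappa>, by
  \<open>kap_antipode\<close>.\<close>

definition \<theta> :: "'x => 'x" where
 "\<theta> x = tL A (%g z. \<gamma> (S g) *_A z) (\<alpha> x)"

lemma \<gamma>_bil: "bil K A A A (%p q. q *_A p)"
 by (intro LK)

lemma \<gamma>_lin: "\<gamma> : lin H A"
 unfolding \<gamma>_def by (intro LK)

lemmas \<gamma>c = mh_closed[OF \<gamma>_lin] and \<gamma>_comp = mh_comp[OF _ \<gamma>_lin]

lemma \<theta>_bil: "bil K H A A (%g z. \<gamma> (S g) *_A z)"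
 by (intro LK \<gamma>_comp \<gamma>c)

lemma \<theta>_lin: "\<theta> : lin A A"
 unfolding \<theta>_def by (intro LK \<gamma>_comp \<gamma>c)

lemmas \<theta>c = mh_closed[OF \<theta>_lin] and \<theta>_comp = mh_comp[OF _ \<theta>_lin]
lemmas LT = LK \<gamma>_comp \<gamma>c \<theta>_comp \<theta>c

text \<open>Colinearity brings the left side into the form
  \<open>f(h\<^sub>2\<^sup>2 \<gamma>(S h\<^sub>1) h\<^sub>2\<^sup>1)\<close>. As \<kappa> is
  multiplicative, this is \<open>f(\<gamma>(S h\<^sub>1 h\<^sub>2))\<close>, where the antipode
  cancels.\<close>

lemma theta_counit:
 assumes h: "h : car H" and U: "vs U" and f: "f : lin A U"
 shows "tL U (%p q. f (q *_A \<theta> p)) (\<kappa> h) = \<epsilon> h .*_U f 1_A"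
proof -
 have fl: "T : lin X A ==> (%x. f (T x)) : lin X U" for T and X :: "('a, 'v) module"
  by (rule mh_comp[OF _ f])
 have fl': "T : lin X A ==> (%x. f (T x)) : lin X U" for T and X :: "('a, 'x) module"
  by (rule mh_comp[OF _ f])
 have flh: "T : lin X A ==> (%x. f (T x)) : lin X U" for T and X :: "('a, 'h) module"
  by (rule mh_comp[OF _ f])
 note L = LT U fl' flh mh_closed[OF f]
 have "tL U (%p q. f (q *_A \<theta> p)) (\<kappa> h) = tL U (%p q. tL U (%g z. f (q *_A (\<gamma> (S g) *_A z))) (\<alpha> p)) (\<kappa> h)"
  by (rule \<kappa>_cong[OF h U], unfold \<theta>_def, rule \<alpha>_push[OF vsA U _ \<theta>_bil], (intro L; assumption), assumption, intro L)
 also have "... = tL U (%x y. tL U (%p q. f (q *_A (\<gamma> (S x) *_A p))) (\<kappa> y)) (\<Delta> h)"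
  by (rule coact_kap[OF h U]) (intro L)
 also have "... = tL U (%x y. f (\<gamma> (S x *_H y))) (\<Delta> h)"
 proof (rule \<Delta>_cong[OF h U])
  fix x y assume x: "x : car H" and y: "y : car H"
  have "tL U (%p q. f (q *_A (\<gamma> (S x) *_A p))) (\<kappa> y) = tL U (%p q. tL U (%p' q'. f ((q *_A q') *_A (p' *_A p))) (\<kappa> (S x))) (\<kappa> y)" (is "?l = _")
  proof (rule \<kappa>_cong[OF y U])
   fix p q assume p: "p : car A" and q: "q : car A"
   have "f (q *_A (\<gamma> (S x) *_A p)) = tL U (%p' q'. f (q *_A ((q' *_A p') *_A p))) (\<kappa> (S x))" (is "?l = _")
    unfolding \<gamma>_def by (rule \<kappa>_push[OF vsA U _ \<gamma>_bil Sc[OF x], of "%z. f (q *_A (z *_A p))"]) (intro L p q)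
   also have "... = tL U (%p' q'. f ((q *_A q') *_A (p' *_A p))) (\<kappa> (S x))"
    by (rule \<kappa>_cong[OF Sc[OF x] U], simp add: AA.A.m_assoc p q, intro L p q)
   finally show "?l = ..." .
  qed (intro L x)
  also have "... = tL U (%p' q'. tL U (%p q. f ((q *_A q') *_A (p' *_A p))) (\<kappa> y)) (\<kappa> (S x))"
   by (rule tl_swap[OF vsA vsA vsA vsA U \<kappa>c[OF y] \<kappa>c[OF Sc[OF x]]]; intro L)
  also have "... = tL U (%p q. f (q *_A p)) (\<kappa> (S x *_H y))"
   by (rule kap_product[OF Sc[OF x] y U]) (intro L)
  also have "... = f (\<gamma> (S x *_H y))"
   unfolding \<gamma>_def by (rule \<kappa>_push[OF vsA U f \<gamma>_bil, symmetric]) (intro LK x y)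
  finally show "?l = f (\<gamma> (S x *_H y))" .
 qed (intro L)
 also have "... = \<epsilon> h .*_U f (\<gamma> 1_H)"
  by (rule antipode_left[OF h U]) (intro L)
 also have "\<gamma> 1_H = 1_A" unfolding \<gamma>_def \<kappa>_one using tl_pure[OF vsA vsA vsA \<gamma>_bil] by simp
 finally show ?thesis .
qed

text \<open>Colinearity turns the coproduct into a coaction on the first leg, which
  \<open>kap_coact_one\<close> contracts.\<close>

lemma kap_comult:
 assumes h: "h : car H" and U: "vs U" and \<phi>: "tri K A A A U \<phi>"
 shows "tL U (%x y. tL U (%p' q'. tL U (%p q. \<phi> p (q *_A p') q') (\<kappa> x)) (\<kappa> y)) (\<Delta> h) = tL U (%p q. \<phi> p 1_A q) (\<kappa> h)"
proof -
 note L = LT U tri_lin1[OF \<phi>] tri_lin2[OF \<phi>] tri_lin3[OF \<phi>]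
 have "tL U (%x y. tL U (%p' q'. tL U (%p q. \<phi> p (q *_A p') q') (\<kappa> x)) (\<kappa> y)) (\<Delta> h) =
  tL U (%p' q'. tL U (%g z. tL U (%p q. \<phi> p (q *_A z) q') (\<kappa> g)) (\<alpha> p')) (\<kappa> h)"
  by (rule coact_kap[OF h U, symmetric]) (intro L)
 also have "... = tL U (%p q. \<phi> p 1_A q) (\<kappa> h)"
  by (rule \<kappa>_cong[OF h U], rule kap_coact_one[OF _ U], assumption, (intro L; assumption), intro L)
 finally show ?thesis .
qed

text \<open>In the convolution algebra of maps from \<open>H\<close> to the enveloping algebra,
  \<open>h \<mapsto> h\<^sup>2 \<otimes> \<theta>(h\<^sup>1)\<close> is a left inverse of \<kappa>
  by \<open>kap_comult\<close> and \<open>theta_counit\<close>, and \<kappa> \<circ> S is a right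
  inverse because \<kappa> is an algebra map.\<close>

lemma kap_antipode:
 assumes h: "h : car H" and U: "vs U" and \<phi>: "bil K A A U \<phi>"
 shows "tL U (%p q. \<phi> q (\<theta> p)) (\<kappa> h) = tL U \<phi> (\<kappa> (S h))"
proof -
 let ?Q = "TS A A"
 interpret E: k_algebra K Ae by (rule kE)
 note Q = TS_module[OF vsA vsA]
 note L = LT U bil_lin1[OF \<phi>] bil_lin2[OF \<phi>]
 define k where "k h = tL ?Q (%p q. pt A A q (\<theta> p)) (\<kappa> h)" for h
 have kb: "bil K A A ?Q (%p q. pt A A q (\<theta> p))" by (intro LT)
 have k: "k : lin H ?Q" unfolding k_def by (intro LT)
 have tk: "tL V \<psi> (k y) = tL V (%p q. \<psi> q (\<theta> p)) (\<kappa> y)"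
  if V: "vs V" and \<psi>: "bil K A A V \<psi>" and y: "y : car H" for V :: "('a, 'v) module" and \<psi> y
 proof -
  have "tL V \<psi> (k y) = tL V (%p q. tL V \<psi> (pt A A q (\<theta> p))) (\<kappa> y)"
   unfolding k_def by (rule \<kappa>_push[OF Q V tl_hom[OF vsA vsA V \<psi>] kb y])
  also have "... = tL V (%p q. \<psi> q (\<theta> p)) (\<kappa> y)"
   by (rule \<kappa>_cong[OF y V], rule tl_pure[OF vsA vsA V \<psi>], assumption, (intro LT; assumption),
    intro LT bil_lin1[OF \<psi>] bil_lin2[OF \<psi>])
  finally show ?thesis .
 qed
 have "k h = 1_Ae *_Ae \<kappa> (S h)"
 proof (rule conv_unique[OF kE, of k \<kappa> "%h. \<kappa> (S h)", OF _ _ _ E.A.one_closed _ _ h])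
  show "k : lin H Ae" "\<kappa> : lin H Ae" "(%h. \<kappa> (S h)) : lin H Ae"
   unfolding lin_env by (rule k \<kappa>_lin \<kappa>_comp[OF S_lin])+
  fix h assume h: "h : car H"
  have tQ: "tL Ae = (tL ?Q :: ('h => 'h => _) => _)" by (intro ext tens_lift_cong_space) (simp_all add: env_sel)
  have "conv Ae k \<kappa> h = tL ?Q (%x y. tL ?Q (%p' q'. tL ?Q (%p q. pt A A (q *_A p') (q' *_A \<theta> p)) (\<kappa> x)) (\<kappa> y)) (\<Delta> h)"
   unfolding conv_def tQ
  proof (rule \<Delta>_cong[OF h Q])
   fix x y assume x: "x : car H" and y: "y : car H"
   have kx: "k x : car ?Q" by (rule mh_closed[OF k x])
   have "k x *_Ae \<kappa> y = tL ?Q (pt A A) (k x *_Ae \<kappa> y)"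
    using E.A.m_closed[of "k x" "\<kappa> y"] kx by (simp add: tl_id[OF vsA vsA] env_sel \<kappa>c y)
   also have "... = tL ?Q (%p q. tL ?Q (%p' q'. pt A A (p *_A p') (q' *_A q)) (\<kappa> y)) (k x)"
    by (rule tL_env_mult[OF kx \<kappa>c[OF y] Q pure_bil[OF vsA vsA]])
   also have "... = tL ?Q (%p q. tL ?Q (%p' q'. pt A A (q *_A p') (q' *_A \<theta> p)) (\<kappa> y)) (\<kappa> x)"
    by (rule tk[OF Q _ x]) (intro LT y)
   also have "... = tL ?Q (%p' q'. tL ?Q (%p q. pt A A (q *_A p') (q' *_A \<theta> p)) (\<kappa> x)) (\<kappa> y)"
    by (rule tl_swap[OF vsA vsA vsA vsA Q \<kappa>c[OF x] \<kappa>c[OF y]]; intro LT)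
   finally show "k x *_Ae \<kappa> y = ..." .
  qed (intro LT)
  also have "... = tL ?Q (%p q. pt A A 1_A (q *_A \<theta> p)) (\<kappa> h)"
   by (rule kap_comult[OF h Q, where \<phi> = "%p m q'. pt A A m (q' *_A \<theta> p)"]) (intro LT)
  also have "... = \<epsilon> h .*_?Q pt A A 1_A 1_A"
   by (rule theta_counit[OF h Q]) (intro pure_lin2 vsA AA.A.one_closed mh_id)
  finally show "conv Ae k \<kappa> h = \<epsilon> h .*_Ae 1_Ae" by (simp add: env_sel)
  have "conv Ae \<kappa> (%h. \<kappa> (S h)) h = tL ?Q (%x y. \<kappa> (x *_H S y)) (\<Delta> h)"
   unfolding conv_def tQ by (rule \<Delta>_cong[OF h Q]) (simp only: \<kappa>_mult Sc, intro LT)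
  also have "... = \<epsilon> h .*_?Q \<kappa> 1_H" by (rule antipode_right[OF h Q \<kappa>_lin])
  finally show "conv Ae \<kappa> (%h. \<kappa> (S h)) h = \<epsilon> h .*_Ae 1_Ae" by (simp add: env_sel \<kappa>_one)
 qed
 then have "k h = \<kappa> (S h)" using E.A.l_one[of "\<kappa> (S h)"] by (simp add: env_sel(1) \<kappa>c Sc h)
 then show ?thesis using tk[OF U \<phi> h] by simp
qed

text \<open>After colinearity, \<open>kap_antipode\<close> recognizes the legs of \<kappa>(S h), and
  multiplicativity collects everything into \<open>\<kappa>(h\<^sub>1 S h\<^sub>2)\<close>.\<close>

lemma theta_coact_counit:
 assumes h: "h : car H" and U: "vs U" and \<phi>: "bil K A A U \<phi>"
 shows "tL U (%p q. tL U (%g z. tL U (%p' q'. \<phi> (p' *_A q) (\<theta> z *_A q')) (\<kappa> g)) (\<alpha> p)) (\<kappa> h) = \<epsilon> h .*_U \<phi> 1_A 1_A"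
proof -
 note L = LT U bil_lin1[OF \<phi>] bil_lin2[OF \<phi>]
 have "tL U (%p q. tL U (%g z. tL U (%p' q'. \<phi> (p' *_A q) (\<theta> z *_A q')) (\<kappa> g)) (\<alpha> p)) (\<kappa> h) =
  tL U (%x y. tL U (%p q. tL U (%p' q'. \<phi> (p' *_A q) (\<theta> p *_A q')) (\<kappa> x)) (\<kappa> y)) (\<Delta> h)"
  by (rule coact_kap[OF h U]) (intro L)
 also have "... = tL U (%x y. tL U \<phi> (\<kappa> (x *_H S y))) (\<Delta> h)"
 proof (rule \<Delta>_cong[OF h U])
  fix x y assume x: "x : car H" and y: "y : car H"
  have "tL U (%p q. tL U (%p' q'. \<phi> (p' *_A q) (\<theta> p *_A q')) (\<kappa> x)) (\<kappa> y) =
   tL U (%p q. tL U (%p' q'. \<phi> (p' *_A p) (q *_A q')) (\<kappa> x)) (\<kappa> (S y))" (is "?l = _")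
   by (rule kap_antipode[OF y U]) (intro L x)
  also have "... = tL U (%p' q'. tL U (%p q. \<phi> (p' *_A p) (q *_A q')) (\<kappa> (S y))) (\<kappa> x)"
   by (rule tl_swap[OF vsA vsA vsA vsA U \<kappa>c[OF Sc[OF y]] \<kappa>c[OF x]]; intro L)
  also have "... = tL U \<phi> (\<kappa> (x *_H S y))" by (rule kap_product[OF x Sc[OF y] U \<phi>])
  finally show "?l = ..." .
 qed (intro L \<phi>)
 also have "... = \<epsilon> h .*_U tL U \<phi> (\<kappa> 1_H)" by (rule antipode_right[OF h U]) (intro L \<phi>)
 also have "tL U \<phi> (\<kappa> 1_H) = \<phi> 1_A 1_A" unfolding \<kappa>_one by (rule tl_pure[OF vsA vsA U \<phi>]) simp_all
 finally show ?thesis .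
qed

text \<open>Using \<open>kap_coact_one\<close> backwards replaces \<open>x\<close> by the legs of
  \<kappa>(x(-1)), with a factor \<open>x(0)\<close> left over. For these legs the identity is
  \<open>theta_coact_counit\<close>, and the counit absorbs the remaining coaction.\<close>

lemma theta_coact:
 assumes x: "x : car A" and U: "vs U" and \<phi>: "bil K A A U \<phi>"
 shows "tL U (%g z. tL U (%p' q'. \<phi> p' (\<theta> z *_A q')) (\<kappa> g)) (\<alpha> x) = \<phi> x 1_A"
proof -
 note L = LT U bil_lin1[OF \<phi>] bil_lin2[OF \<phi>]
 define \<Phi> where "\<Phi> x y = tL U (%g z. tL U (%p' q'. \<phi> (p' *_A y) (\<theta> z *_A q')) (\<kappa> g)) (\<alpha> x)" for x y
 have \<Phi>: "bil K A A U \<Phi>" unfolding \<Phi>_def by (intro L)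
 have "tL U (%g z. tL U (%p' q'. \<phi> p' (\<theta> z *_A q')) (\<kappa> g)) (\<alpha> x) = \<Phi> x 1_A"
  unfolding \<Phi>_def
  by (rule \<alpha>_cong[OF x U], rule \<kappa>_cong[OF _ U], assumption, simp, (intro L; assumption), intro L)
 also have "... = tL U (%h z. tL U (%p q. \<Phi> p (q *_A z)) (\<kappa> h)) (\<alpha> x)"
  by (rule kap_coact_one[OF x U \<Phi>, symmetric])
 also have "... = tL U (%h z. \<epsilon> h .*_U \<phi> z 1_A) (\<alpha> x)"
 proof (rule \<alpha>_cong[OF x U])
  fix h w assume h: "h : car H" and w: "w : car A"
  have "tL U (%p q. \<Phi> p (q *_A w)) (\<kappa> h) =
   tL U (%p q. tL U (%g z. tL U (%p' q'. \<phi> (p' *_A q *_A w) (\<theta> z *_A q')) (\<kappa> g)) (\<alpha> p)) (\<kappa> h)"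
   unfolding \<Phi>_def
   by (rule \<kappa>_cong[OF h U], rule \<alpha>_cong[OF _ U], assumption, rule \<kappa>_cong[OF _ U], assumption, simp add: AA.A.m_assoc w,
    (intro L w; assumption), (intro L w; assumption), intro L w)
  also have "... = \<epsilon> h .*_U \<phi> (1_A *_A w) 1_A"
   by (rule theta_coact_counit[OF h U, where \<phi> = "%a b. \<phi> (a *_A w) b"]) (intro L w)
  finally show "tL U (%p q. \<Phi> p (q *_A w)) (\<kappa> h) = \<epsilon> h .*_U \<phi> w 1_A" by (simp add: w)
 qed (intro L bil_closed[OF \<phi>])
 also have "... = \<phi> x 1_A" by (rule counit_\<alpha>[OF x U]) (intro L)
 finally show ?thesis .
qed

section \<open>The inverse antipode and the freeness of the enveloping algebra along the translation
  map\<close>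

definition R :: "'h => 'h" where
 "R = inv_into (car H) S"

lemma Rc: "h : car H ==> R h : car H"
 unfolding R_def using bijS by (simp add: bij_betw_def inv_into_into)

lemma S_R: "h : car H ==> S (R h) = h"
 unfolding R_def using bijS by (simp add: bij_betw_def f_inv_into_f)

lemma R_S: "h : car H ==> R (S h) = h"
 unfolding R_def using bijS by (simp add: bij_betw_def inv_into_f_f)

lemma S_inj: "g : car H ==> h : car H ==> S g = S h ==> g = h"
 using R_S by metis

lemma R_lin: "R : lin H H"
 unfolding R_def by (rule lin_inv_into[OF vsH S_lin bijS])

lemmas R_comp = mh_comp[OF _ R_lin]
lemmas LQ = LT R_comp Rc

text \<open>The injective map \<open>S\<close> reverses products, so it carries this identity to an
  antipode identity.\<close>

lemma antipode_inv_right: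
 assumes h: "h : car H" and U: "vs U" and f: "f : lin H U"
 shows "tL U (%x y. f (y *_H R x)) (\<Delta> h) = \<epsilon> h .*_U f 1_H"
proof -
 note fl = mh_comp[OF _ f]
 have c: "tL H (%x y. y *_H R x) (\<Delta> h) : car H" by (intro LQ h)
 have "tL H (%x y. y *_H R x) (\<Delta> h) = \<epsilon> h .*_H 1_H"
 proof (rule S_inj)
  have "S (tL H (%x y. y *_H R x) (\<Delta> h)) = tL H (%x y. S (y *_H R x)) (\<Delta> h)" (is "?l = _")
   by (rule \<Delta>_push[OF vsH vsH S_lin _ h]) (intro LQ)
  also have "... = tL H (%x y. x *_H S y) (\<Delta> h)"
   by (rule \<Delta>_cong[OF h vsH], simp add: S_mult S_R Rc, intro LQ)
  also have "... = \<epsilon> h .*_H 1_H" by (rule antipode_right[OF h vsH mh_id])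
  finally show "?l = S (\<epsilon> h .*_H 1_H)"
   using mh_smult[OF S_lin \<epsilon>c[OF h] HA.A.one_closed] by (simp add: S_one)
 qed (simp_all add: c h \<epsilon>c)
 moreover have "f (tL H (%x y. y *_H R x) (\<Delta> h)) = tL U (%x y. f (y *_H R x)) (\<Delta> h)"
  by (rule \<Delta>_push[OF vsH U f _ h]) (intro LQ)
 ultimately show ?thesis using mh_smult[OF f \<epsilon>c[OF h] HA.A.one_closed] by simp
qed

lemma antipode_inv_left:
 assumes h: "h : car H" and U: "vs U" and f: "f : lin H U"
 shows "tL U (%x y. f (R y *_H x)) (\<Delta> h) = \<epsilon> h .*_U f 1_H"
proof -
 note fl = mh_comp[OF _ f]
 have c: "tL H (%x y. R y *_H x) (\<Delta> h) : car H" by (intro LQ h)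
 have "tL H (%x y. R y *_H x) (\<Delta> h) = \<epsilon> h .*_H 1_H"
 proof (rule S_inj)
  have "S (tL H (%x y. R y *_H x) (\<Delta> h)) = tL H (%x y. S (R y *_H x)) (\<Delta> h)" (is "?l = _")
   by (rule \<Delta>_push[OF vsH vsH S_lin _ h]) (intro LQ)
  also have "... = tL H (%x y. S x *_H y) (\<Delta> h)"
   by (rule \<Delta>_cong[OF h vsH], simp add: S_mult S_R Rc, intro LQ)
  also have "... = \<epsilon> h .*_H 1_H" by (rule antipode_left[OF h vsH mh_id])
  finally show "?l = S (\<epsilon> h .*_H 1_H)"
   using mh_smult[OF S_lin \<epsilon>c[OF h] HA.A.one_closed] by (simp add: S_one)
 qed (simp_all add: c h \<epsilon>c)
 moreover have "f (tL H (%x y. R y *_H x) (\<Delta> h)) = tL U (%x y. f (R y *_H x)) (\<Delta> h)"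
  by (rule \<Delta>_push[OF vsH U f _ h]) (intro LQ)
 ultimately show ?thesis using mh_smult[OF f \<epsilon>c[OF h] HA.A.one_closed] by simp
qed

text \<open>Multiplicativity of \<alpha> and \<open>kap_can\<close> give
  \<open>a(-1) h \<otimes> a(0)\<close>, in which no translation map remains. Bijectivity of the
  insertion of \<open>a\<close> to the left of \<open>h\<^sup>1\<close> is thereby reduced to that
  of \<open>coact\<close>.\<close>

lemma can_outer:
 assumes h: "h : car H" and a: "a : car A"
 shows "can (tL (TS A A) (%p q. pt A A (a *_A p) q) (\<kappa> h)) = tL (TS H A) (%u w. pt H A (u *_H h) w) (\<alpha> a)"
proof -
 let ?W = "TS H A" and ?Q = "TS A A"
 note W = TS_module[OF vsH vsA] and Q = TS_module[OF vsA vsA]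
 have "can (tL ?Q (%p q. pt A A (a *_A p) q) (\<kappa> h)) = tL ?W (%p q. can (pt A A (a *_A p) q)) (\<kappa> h)"
  by (rule \<kappa>_push[OF Q W can_lin _ h]) (intro LQ a)
 also have "... = tL ?W (%p q. tL ?W (%v x. tL ?W (%u w. pt H A (u *_H v) (w *_A (x *_A q))) (\<alpha> a)) (\<alpha> p)) (\<kappa> h)"
 proof (rule \<kappa>_cong[OF h W])
  fix p q assume p: "p : car A" and q: "q : car A"
  have "can (pt A A (a *_A p) q) = tL ?W (%u w. pt H A u (w *_A q)) (\<alpha> (a *_A p))"
   unfolding can_def by (rule tl_pure[OF vsA vsA W can_bil _ q]) (intro LA a p)
  also have "... = tL ?W (%u w. tL ?W (%v x. pt H A (u *_H v) (w *_A x *_A q)) (\<alpha> p)) (\<alpha> a)"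
   unfolding \<alpha>_mult[OF a p] by (rule tL_mult[OF kH kA \<alpha>c[OF a] \<alpha>c[OF p] W]) (intro LQ q)
  also have "... = tL ?W (%v x. tL ?W (%u w. pt H A (u *_H v) (w *_A x *_A q)) (\<alpha> a)) (\<alpha> p)"
   by (rule tl_swap[OF vsH vsA vsH vsA W \<alpha>c[OF a] \<alpha>c[OF p]]; intro LQ q)
  also have "... = tL ?W (%v x. tL ?W (%u w. pt H A (u *_H v) (w *_A (x *_A q))) (\<alpha> a)) (\<alpha> p)"
   by (rule \<alpha>_cong[OF p W], rule \<alpha>_cong[OF a W], simp add: AA.A.m_assoc q, (intro LQ q a; assumption), intro LQ a q)
  finally show "can (pt A A (a *_A p) q) = ..." .
 qed (intro LQ a)
 also have "... = tL ?W (%u w. pt H A (u *_H h) (w *_A 1_A)) (\<alpha> a)"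
  by (rule kap_can[OF h W, where \<phi> = "%v x. tL ?W (%u w. pt H A (u *_H v) (w *_A x)) (\<alpha> a)"]) (intro LQ a)
 also have "... = tL ?W (%u w. pt H A (u *_H h) w) (\<alpha> a)"
  by (rule \<alpha>_cong[OF a W], simp, intro LQ h)
 finally show ?thesis .
qed

text \<open>The map \<open>h \<otimes> a \<mapsto> T(a(-1)) h \<otimes> a(0)\<close>. Composing two
  of them produces \<open>T'(x\<^sub>2) T(x\<^sub>1)\<close> with \<open>x = a(-1)\<close>, so the
  inverse for the identity is obtained from the inverse antipode and not from the antipode.\<close>

definition coact :: "('h => 'h) => ('a, 'h, 'x) tens => ('a, 'h, 'x) tens" where
 "coact T = tL (TS H A) (%h a. tL (TS H A) (%u w. pt H A (T u *_H h) w) (\<alpha> a))"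

lemma coact_bil:
 assumes T: "T : lin H H"
 shows "bil K H A (TS H A) (%h a. tL (TS H A) (%u w. pt H A (T u *_H h) w) (\<alpha> a))"
 by (intro LQ mh_comp[OF _ T] mh_closed[OF T])

lemma coact_lin: "T : lin H H ==> coact T : lin (TS H A) (TS H A)"
 unfolding coact_def by (rule tl_hom[OF vsH vsA TS_module[OF vsH vsA] coact_bil])

lemma coact_inverse:
 assumes T: "T : lin H H" "T' : lin H H" and t: "t : car (TS H A)"
  and inv: "!!h f. h : car H ==> f : lin H (TS H A) ==> tL (TS H A) (%x y. f (T' y *_H T x)) (\<Delta> h) = \<epsilon> h .*_(TS H A) f 1_H"
 shows "coact T' (coact T t) = t"
proof (rule tens_eqI[OF vsH vsA mh_comp[OF coact_lin[OF T(1)] coact_lin[OF T(2)]] mh_id _ _ t])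
 let ?W = "TS H A"
 show W: "vs ?W" by (rule TS_module[OF vsH vsA])
 note L = LQ mh_comp[OF _ T(1)] mh_closed[OF T(1)] mh_comp[OF _ T(2)] mh_closed[OF T(2)]
 note p = tl_pure[OF vsH vsA W coact_bil[OF T(1)]] and p' = tl_pure[OF vsH vsA W coact_bil[OF T(2)]]
 fix h a assume h: "h : car H" and a: "a : car A"
 have "coact T' (coact T (pt H A h a)) = coact T' (tL ?W (%u w. pt H A (T u *_H h) w) (\<alpha> a))"
  by (simp add: coact_def p h a)
 also have "... = tL ?W (%u w. coact T' (pt H A (T u *_H h) w)) (\<alpha> a)"
  by (rule \<alpha>_push[OF W W coact_lin[OF T(2)] _ a]) (intro L h)
 also have "... = tL ?W (%u w. tL ?W (%u' w'. pt H A (T' u' *_H (T u *_H h)) w') (\<alpha> w)) (\<alpha> a)"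
  by (rule \<alpha>_cong[OF a W], unfold coact_def, rule p', (intro L h; assumption), assumption, intro L h)
 also have "... = tL ?W (%c w. tL ?W (%x y. pt H A (T' y *_H (T x *_H h)) w) (\<Delta> c)) (\<alpha> a)"
  by (rule coassoc_\<alpha>[OF a W, symmetric]) (intro L h)
 also have "... = tL ?W (%c w. \<epsilon> c .*_?W pt H A (1_H *_H h) w) (\<alpha> a)"
 proof (rule \<alpha>_cong[OF a W])
  fix c w assume c: "c : car H" and w: "w : car A"
  have "tL ?W (%x y. pt H A (T' y *_H (T x *_H h)) w) (\<Delta> c) = tL ?W (%x y. pt H A (T' y *_H T x *_H h) w) (\<Delta> c)" (is "?l = _")
   by (rule \<Delta>_cong[OF c W], simp add: HA.A.m_assoc mh_closed[OF T(1)] mh_closed[OF T(2)] h, intro L h w)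
  also have "... = \<epsilon> c .*_?W pt H A (1_H *_H h) w"
   by (rule inv[OF c, of "%v. pt H A (v *_H h) w"]) (intro L h w)
  finally show "?l = ..." .
 qed (intro L h HA.A.one_closed)
 also have "... = pt H A (1_H *_H h) a" by (rule counit_\<alpha>[OF a W]) (intro pure_lin2 vsH vsA HA.A.m_closed HA.A.one_closed h mh_id)
 finally show "coact T' (coact T (pt H A h a)) = pt H A h a" by (simp add: h)
qed

lemma coact_bij: "bij_betw (coact (%h. h)) (car (TS H A)) (car (TS H A))"
proof (rule bij_betw_byWitness[of _ "coact R"])
 note W = TS_module[OF vsH vsA]
 show "ALL t:car (TS H A). coact R (coact (%h. h) t) = t" "ALL t:car (TS H A). coact (%h. h) (coact R t) = t"
  using coact_inverse[OF mh_id R_lin _ antipode_inv_left[OF _ W]] coact_inverse[OF R_lin mh_id _ antipode_inv_right[OF _ W]]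
  by blast+
qed (auto simp: mh_closed[OF coact_lin] R_lin mh_id)

text \<open>By \<open>T3\<close>, \<open>p \<otimes> q \<mapsto> q \<otimes> \<theta> p\<close> exchanges the two ways of multiplying \<open>\<kappa> h\<close> by elements of \<open>A\<close>, up to \<open>S\<close>.\<close>

definition \<Theta> :: "('a, 'x, 'x) tens => ('a, 'x, 'x) tens" where
 "\<Theta> = tL (TS A A) (%p q. pt A A q (\<theta> p))"

lemma \<Theta>_bil: "bil K A A (TS A A) (%p q. pt A A q (\<theta> p))"
 by (intro LQ)

lemma \<Theta>_\<kappa>:
 assumes h: "h : car H" and f: "f : lin A A"
 shows "\<Theta> (tL (TS A A) (%p q. pt A A p (f q)) (\<kappa> h)) = tL (TS A A) (%p q. pt A A (f p) q) (\<kappa> (S h))"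
proof -
 let ?Q = "TS A A"
 note Q = TS_module[OF vsA vsA]
 note L = LQ mh_comp[OF _ f] mh_closed[OF f]
 have "\<Theta> (tL ?Q (%p q. pt A A p (f q)) (\<kappa> h)) = tL ?Q (%p q. \<Theta> (pt A A p (f q))) (\<kappa> h)"
  unfolding \<Theta>_def by (rule \<kappa>_push[OF Q Q tl_hom[OF vsA vsA Q \<Theta>_bil] _ h]) (intro L)
 also have "... = tL ?Q (%p q. pt A A (f q) (\<theta> p)) (\<kappa> h)"
  unfolding \<Theta>_def by (rule \<kappa>_cong[OF h Q], rule tl_pure[OF vsA vsA Q \<Theta>_bil], assumption, (intro L; assumption), intro L)
 also have "... = tL ?Q (%p q. pt A A (f p) q) (\<kappa> (S h))" by (rule kap_antipode[OF h Q]) (intro L)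
 finally show ?thesis .
qed

lemma \<kappa>_mult_pure:
 assumes h: "h : car H" and a: "a : car A" and b: "b : car A"
 shows "\<kappa> h *_Ae pt A A a b = tL (TS A A) (%p q. pt A A (p *_A a) (b *_A q)) (\<kappa> h)"
  and "pt A A a b *_Ae \<kappa> h = tL (TS A A) (%p q. pt A A (a *_A p) (q *_A b)) (\<kappa> h)"
proof -
 let ?Q = "TS A A"
 interpret E: k_algebra K Ae by (rule kE)
 note Q = TS_module[OF vsA vsA] and p = pure_closed[OF vsA vsA a b]
 have 1: "\<kappa> h *_Ae pt A A a b : car ?Q" "pt A A a b *_Ae \<kappa> h : car ?Q"
  using E.A.m_closed[of "\<kappa> h" "pt A A a b"] E.A.m_closed[of "pt A A a b" "\<kappa> h"] p by (simp_all add: env_sel \<kappa>c h)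
 have "\<kappa> h *_Ae pt A A a b = tL ?Q (pt A A) (\<kappa> h *_Ae pt A A a b)" (is "?l = _") by (simp add: tl_id[OF vsA vsA] 1)
 also have "... = tL ?Q (%p q. tL ?Q (%p' q'. pt A A (p *_A p') (q' *_A q)) (pt A A a b)) (\<kappa> h)"
  by (rule tL_env_mult[OF \<kappa>c[OF h] p Q pure_bil[OF vsA vsA]])
 also have "... = tL ?Q (%p q. pt A A (p *_A a) (b *_A q)) (\<kappa> h)"
  by (rule \<kappa>_cong[OF h Q], rule tl_pure[OF vsA vsA Q _ a b], (intro LQ; assumption), intro LQ a b)
 finally show "?l = ..." .
 have bb: "bil K A A ?Q (%p q. tL ?Q (%p' q'. pt A A (p *_A p') (q' *_A q)) (\<kappa> h))" by (intro LQ h)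
 have "pt A A a b *_Ae \<kappa> h = tL ?Q (pt A A) (pt A A a b *_Ae \<kappa> h)" (is "?l = _") by (simp add: tl_id[OF vsA vsA] 1)
 also have "... = tL ?Q (%p q. tL ?Q (%p' q'. pt A A (p *_A p') (q' *_A q)) (\<kappa> h)) (pt A A a b)"
  by (rule tL_env_mult[OF p \<kappa>c[OF h] Q pure_bil[OF vsA vsA]])
 also have "... = tL ?Q (%p q. pt A A (a *_A p) (q *_A b)) (\<kappa> h)"
  by (rule tl_pure[OF vsA vsA Q bb a b])
 finally show "?l = ..." .
qed

text \<open>Inserts \<open>a\<close> into \<kappa>(h) at one of the four possible places. These are
  the candidates for parametrizing the enveloping algebra by \<open>H \<otimes> A\<close>.\<close>

abbreviation ins :: "('x => 'x => 'x => ('a, 'x, 'x) tens) => ('a, 'h, 'x) tens => ('a, 'x, 'x) tens" where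
 "ins \<phi> == tL (TS A A) (%h a. tL (TS A A) (\<phi> a) (\<kappa> h))"

lemma mult_ins:
 assumes t: "t : car (TS H A)"
 shows "tL (TS A A) (%h a. \<kappa> h *_Ae pt A A 1_A a) t = ins (%a p q. pt A A p (a *_A q)) t"
  and "tL (TS A A) (%h a. \<kappa> h *_Ae pt A A a 1_A) t = ins (%a p q. pt A A (p *_A a) q) t"
  and "tL (TS A A) (%h a. pt A A 1_A a *_Ae \<kappa> h) t = ins (%a p q. pt A A p (q *_A a)) t"
proof -
 note Q = TS_module[OF vsA vsA]
 show "tL (TS A A) (%h a. \<kappa> h *_Ae pt A A 1_A a) t = ins (%a p q. pt A A p (a *_A q)) t"
  by (rule tl_cong[OF vsH vsA Q t], unfold \<kappa>_mult_pure(1)[OF _ AA.A.one_closed], rule \<kappa>_cong[OF _ Q], assumption, simp, (intro LQ; assumption), intro LQ)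
 show "tL (TS A A) (%h a. \<kappa> h *_Ae pt A A a 1_A) t = ins (%a p q. pt A A (p *_A a) q) t"
  by (rule tl_cong[OF vsH vsA Q t], unfold \<kappa>_mult_pure(1)[OF _ _ AA.A.one_closed], rule \<kappa>_cong[OF _ Q], assumption, simp, (intro LQ; assumption), intro LQ)
 show "tL (TS A A) (%h a. pt A A 1_A a *_Ae \<kappa> h) t = ins (%a p q. pt A A p (q *_A a)) t"
  by (rule tl_cong[OF vsH vsA Q t], unfold \<kappa>_mult_pure(2)[OF _ AA.A.one_closed], rule \<kappa>_cong[OF _ Q], assumption, simp, (intro LQ; assumption), intro LQ)
qed

text \<open>The inverse of \<open>h \<otimes> a \<mapsto> h\<^sup>1 \<otimes> a h\<^sup>2\<close> is
  \<open>x \<otimes> y \<mapsto> x(-1) \<otimes> y \<theta>(x(0))\<close>. One composite is the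
  identity by \<open>theta_counit\<close>, the other by \<open>theta_coact\<close>.\<close>

lemma ins_inner_bij: "bij_betw (ins (%a p q. pt A A p (a *_A q))) (car (TS H A)) (car (TS A A))"
proof -
 let ?W = "TS H A" and ?Q = "TS A A"
 note W = TS_module[OF vsH vsA] and Q = TS_module[OF vsA vsA]
 let ?f = "%h a. tL ?Q (%p q. pt A A p (a *_A q)) (\<kappa> h)"
 let ?g = "%x y. tL ?W (%g z. pt H A g (y *_A \<theta> z)) (\<alpha> x)"
 have f: "bil K H A ?Q ?f" by (intro LQ)
 have g: "bil K A A ?W ?g" by (intro LQ)
 note F = tl_hom[OF vsH vsA Q f] and G = tl_hom[OF vsA vsA W g]
 have GF: "tL ?W ?g (tL ?Q ?f t) = t" if t: "t : car ?W" for t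
 proof (rule tens_eqI[OF vsH vsA mh_comp[OF F G] mh_id W _ t])
  fix h a assume h: "h : car H" and a: "a : car A"
  have "tL ?W ?g (tL ?Q ?f (pt H A h a)) = tL ?W ?g (?f h a)" by (simp add: tl_pure[OF vsH vsA Q f h a])
  also have "... = tL ?W (%p q. tL ?W ?g (pt A A p (a *_A q))) (\<kappa> h)"
   by (rule \<kappa>_push[OF Q W G _ h]) (intro LQ a)
  also have "... = tL ?W (%p q. tL ?W (%g z. pt H A g (a *_A (q *_A \<theta> z))) (\<alpha> p)) (\<kappa> h)"
  proof (rule \<kappa>_cong[OF h W])
   fix p q assume p: "p : car A" and q: "q : car A"
   have "tL ?W ?g (pt A A p (a *_A q)) = tL ?W (%g z. pt H A g ((a *_A q) *_A \<theta> z)) (\<alpha> p)" (is "?l = _")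
    by (rule tl_pure[OF vsA vsA W g p]) (intro LQ a q)
   also have "... = tL ?W (%g z. pt H A g (a *_A (q *_A \<theta> z))) (\<alpha> p)"
    by (rule \<alpha>_cong[OF p W], simp add: AA.A.m_assoc a q \<theta>c, intro LQ a q)
   finally show "?l = ..." .
  qed (intro LQ a)
  also have "... = tL ?W (%x y. tL ?W (%p q. pt H A x (a *_A (q *_A \<theta> p))) (\<kappa> y)) (\<Delta> h)"
   by (rule coact_kap[OF h W]) (intro LQ a)
  also have "... = tL ?W (%x y. \<epsilon> y .*_?W pt H A x (a *_A 1_A)) (\<Delta> h)"
   by (rule \<Delta>_cong[OF h W], rule theta_counit[OF _ W, where f = "%z. pt H A _ (a *_A z)"], assumption, (intro LQ a; assumption), intro LQ a)
  also have "... = pt H A h (a *_A 1_A)" by (rule counit_right[OF h W]) (intro LQ a)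
  finally show "tL ?W ?g (tL ?Q ?f (pt H A h a)) = pt H A h a" by (simp add: a)
 qed
 have FG: "tL ?Q ?f (tL ?W ?g t) = t" if t: "t : car ?Q" for t
 proof (rule tens_eqI[OF vsA vsA mh_comp[OF G F] mh_id Q _ t])
  fix x y assume x: "x : car A" and y: "y : car A"
  have "tL ?Q ?f (tL ?W ?g (pt A A x y)) = tL ?Q ?f (?g x y)" by (simp add: tl_pure[OF vsA vsA W g x y])
  also have "... = tL ?Q (%g z. tL ?Q ?f (pt H A g (y *_A \<theta> z))) (\<alpha> x)"
   by (rule \<alpha>_push[OF W Q F _ x]) (intro LQ y)
  also have "... = tL ?Q (%g z. tL ?Q (%p q. pt A A p (y *_A (\<theta> z *_A q))) (\<kappa> g)) (\<alpha> x)"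
  proof (rule \<alpha>_cong[OF x Q])
   fix g z assume g: "g : car H" and z: "z : car A"
   have "tL ?Q ?f (pt H A g (y *_A \<theta> z)) = tL ?Q (%p q. pt A A p ((y *_A \<theta> z) *_A q)) (\<kappa> g)" (is "?l = _")
    by (rule tl_pure[OF vsH vsA Q f g]) (intro LQ y z)
   also have "... = tL ?Q (%p q. pt A A p (y *_A (\<theta> z *_A q))) (\<kappa> g)"
    by (rule \<kappa>_cong[OF g Q], simp add: AA.A.m_assoc y z \<theta>c, intro LQ y z)
   finally show "?l = ..." .
  qed (intro LQ y)
  also have "... = pt A A x (y *_A 1_A)"
   by (rule theta_coact[OF x Q, where \<phi> = "%p w. pt A A p (y *_A w)"]) (intro LQ y)
  finally show "tL ?Q ?f (tL ?W ?g (pt A A x y)) = pt A A x y" by (simp add: y)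
 qed
 show ?thesis
  by (rule bij_betw_byWitness[of _ "tL ?W ?g"]) (auto simp: GF FG mh_closed[OF F] mh_closed[OF G])
qed

text \<open>Here the inverse is \<open>can\<close> itself.\<close>

lemma ins_can_bij: "bij_betw (ins (%a p q. pt A A p (q *_A a))) (car (TS H A)) (car (TS A A))"
proof -
 let ?W = "TS H A" and ?Q = "TS A A"
 note W = TS_module[OF vsH vsA] and Q = TS_module[OF vsA vsA]
 let ?f = "%h a. tL ?Q (%p q. pt A A p (q *_A a)) (\<kappa> h)"
 have f: "bil K H A ?Q ?f" by (intro LQ)
 note F = tl_hom[OF vsH vsA Q f]
 have cF: "can (tL ?Q ?f t) = t" if t: "t : car ?W" for t
  by (rule tens_eqI[OF vsH vsA mh_comp[OF F can_lin] mh_id W _ t])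
   (simp add: tl_pure[OF vsH vsA Q f] can_pure)
 have Fc: "tL ?Q ?f (can t) = t" if t: "t : car ?Q" for t
  by (rule can_inj) (simp_all add: t cF mh_closed[OF F] mh_closed[OF can_lin])
 show ?thesis
  by (rule bij_betw_byWitness[of _ can]) (auto simp: cF Fc mh_closed[OF F] mh_closed[OF can_lin])
qed

lemma ins_swap:
 assumes t: "t : car (TS H A)" and f: "!!a. a : car A ==> f a : lin A A" "!!q. q : car A ==> (%a. f a q) : lin A A"
 shows "\<Theta> (ins (%a p q. pt A A p (f a q)) t) = ins (%a p q. pt A A (f a p) q) (tL (TS H A) (%h a. pt H A (S h) a) t)"
proof -
 let ?W = "TS H A" and ?Q = "TS A A"
 note W = TS_module[OF vsH vsA] and Q = TS_module[OF vsA vsA]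
 note L = LQ f mh_closed[OF f(1)] mh_comp[OF _ f(1)]
 have 1: "bil K H A ?Q (%h a. tL ?Q (%p q. pt A A p (f a q)) (\<kappa> h))" by (intro L)
 have 2: "bil K H A ?Q (%h a. tL ?Q (%p q. pt A A (f a p) q) (\<kappa> h))" by (intro L)
 have 3: "bil K H A ?W (%h a. pt H A (S h) a)" by (intro L)
 note l = tl_hom[OF vsH vsA Q 1] tl_hom[OF vsA vsA Q \<Theta>_bil, folded \<Theta>_def] tl_hom[OF vsH vsA Q 2] tl_hom[OF vsH vsA W 3]
 show ?thesis
  by (rule tens_eqI[OF vsH vsA mh_comp[OF l(1,2)] mh_comp[OF l(4,3)] Q _ t])
   (simp add: tl_pure[OF vsH vsA Q 1] tl_pure[OF vsH vsA Q 2] tl_pure[OF vsH vsA W 3] \<Theta>_\<kappa> f Sc)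
qed

text \<open>Composed with the bijection of \<open>ins_inner_bij\<close>, the map \<Theta> becomes S
  \<otimes> id followed by the insertion of \<open>a\<close> to the left of
  \<open>h\<^sup>1\<close>. The latter is bijective because \<open>can\<close> takes it to
  \<open>coact\<close> of the identity.\<close>

lemma \<Theta>_bij: "bij_betw \<Theta> (car (TS A A)) (car (TS A A))"
proof -
 let ?W = "TS H A" and ?Q = "TS A A" and ?F = "ins (%a p q. pt A A p (a *_A q))" and ?G = "ins (%a p q. pt A A (a *_A p) q)"
 note W = TS_module[OF vsH vsA] and Q = TS_module[OF vsA vsA]
 have G: "bil K H A ?Q (%h a. tL ?Q (%p q. pt A A (a *_A p) q) (\<kappa> h))" by (intro LQ)
 note Gl = tl_hom[OF vsH vsA Q G]
 have "can (?G t) = coact (%h. h) t" if "t : car ?W" for t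
  by (rule tens_eqI[OF vsH vsA mh_comp[OF Gl can_lin] coact_lin[OF mh_id] W _ that])
   (simp add: tl_pure[OF vsH vsA Q G] can_outer coact_def tl_pure[OF vsH vsA W coact_bil[OF mh_id]])
 then have "bij_betw (can \<circ> ?G) (car ?W) (car ?W)"
  using coact_bij by (simp add: comp_def cong: bij_betw_cong)
 moreover have "?G ` car ?W <= car ?Q" using mh_closed[OF Gl] by blast
 ultimately have Gb: "bij_betw ?G (car ?W) (car ?Q)" using bij_betw_comp_iff2[OF can_bij] by blast
 have "\<Theta> (?F t) = ?G (tL ?W (%h a. pt H A (S h) a) t)" if "t : car ?W" for t
  by (rule ins_swap[OF that]) (intro LQ; assumption)+
 then have "bij_betw (\<Theta> \<circ> ?F) (car ?W) (car ?Q)"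
  using bij_betw_trans[OF tens_bij_left[OF vsH vsH vsA S_lin bijS] Gb] by (simp add: comp_def cong: bij_betw_cong)
 then show ?thesis using bij_betw_comp_iff[OF ins_inner_bij] by blast
qed

text \<open>The same square with insertion on the right: \<open>ins_can_bij\<close>, \<Theta> and S
  \<otimes> id are bijective, hence so is the fourth side.\<close>

lemma ins_outer_bij: "bij_betw (ins (%a p q. pt A A (p *_A a) q)) (car (TS H A)) (car (TS A A))"
proof -
 let ?W = "TS H A" and ?s = "tL (TS H A) (%h a. pt H A (S h) a)" and ?G = "ins (%a p q. pt A A (p *_A a) q)" and ?F = "ins (%a p q. pt A A p (q *_A a))"
 have "\<Theta> (?F t) = ?G (?s t)" if "t : car ?W" for t
  by (rule ins_swap[OF that]) (intro LQ; assumption)+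
 then have "bij_betw (?G \<circ> ?s) (car ?W) (car (TS A A))"
  using bij_betw_trans[OF ins_can_bij \<Theta>_bij] by (simp add: comp_def cong: bij_betw_cong)
 then show ?thesis using bij_betw_comp_iff[OF tens_bij_left[OF vsH vsH vsA S_lin bijS]] by blast
qed

end

section \<open>The translation map of a Hopf-Galois object\<close>

abbreviation (in vfield) "param H A \<phi> == bij_betw (tL (TS A A) \<phi>) (car (TS H A)) (car (TS A A))"

text \<open>The common interface of left and right Galois objects to the homological part. Where
  \<kappa> stands on the left, freeness is asked for both copies of \<open>A\<close>; this serves
  the dual complex. Where it stands on the right, which serves the resolution, one copy is enough.
  The alternative in \<open>bij_left\<close> is there because passing to the opposite algebra
  exchanges the two copies.\<close>

locale gdata = hopfc K H \<Delta> \<epsilon> S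
 for K :: "('a, 'b) ring_scheme" (structure) and H :: "('a, 'h) module" and \<Delta> :: "'h => ('a, 'h, 'h) tens" and \<epsilon> :: "'h => 'a" and S :: "'h => 'h" +
 fixes A :: "('a, 'x) module" and \<kappa> :: "'h => ('a, 'x, 'x) tens"
 assumes kA: "k_algebra K A" and A_nonzero: "car A ~= {0_A}"
  and \<kappa>_alg_hom: "\<kappa> : alg_hom K H (env_alg K A)"
  and \<kappa>_augmented: "h : car H ==> tL A (%x y. x *_A y) (\<kappa> h) = \<epsilon> h .*_A 1_A"
  and bij_right_inner: "param H A (%h a. \<kappa> h *_(env_alg K A) pt A A 1_A a)"
  and bij_right_outer: "param H A (%h a. \<kappa> h *_(env_alg K A) pt A A a 1_A)"
  and bij_left: "param H A (%h a. pt A A 1_A a *_(env_alg K A) \<kappa> h) |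
   param H A (%h a. pt A A a 1_A *_(env_alg K A) \<kappa> h)"

lemma (in lgal) gdata: "gdata K H \<Delta> \<epsilon> S A \<kappa>"
proof (intro gdata.intro gdata_axioms.intro hopfc_axioms kA \<kappa>_alg_hom disjI1)
 show "car A ~= {0_A}" using gal by (simp add: left_galois_object_def)
 show "tL A (%x y. x *_A y) (\<kappa> h) = \<epsilon> h .*_A 1_A" if "h : car H" for h
  by (rule kap_counit[OF that vsA mh_id])
qed (simp_all add: mult_ins ins_inner_bij ins_outer_bij ins_can_bij cong: bij_betw_cong)

context vfield
begin

definition flip :: "('a, 'v) module => ('a, 'w) module => ('a, 'v, 'w) tens => ('a, 'w, 'v) tens" where
 "flip V W = tL (TS W V) (%v w. pt W V w v)"

lemma flip_bil: "vs V ==> vs W ==> bil K V W (TS W V) (%v w. pt W V w v)"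
 by (intro bilI pure_lin1 pure_lin2 mh_id)

lemma flip_lin: "vs V ==> vs W ==> flip V W : lin (TS V W) (TS W V)"
 unfolding flip_def by (rule tl_hom[OF _ _ TS_module flip_bil])

lemma flip_pure: "vs V ==> vs W ==> v : car V ==> w : car W ==> flip V W (pt V W v w) = pt W V w v"
 unfolding flip_def by (rule tl_pure[OF _ _ TS_module flip_bil])

lemma flip_flip: "vs V ==> vs W ==> t : car (TS V W) ==> flip W V (flip V W t) = t"
 by (rule tens_eqI[OF _ _ mh_comp[OF flip_lin flip_lin] mh_id TS_module])
  (simp_all add: flip_pure)

lemma flip_bij: "vs V ==> vs W ==> bij_betw (flip V W) (car (TS V W)) (car (TS W V))"
 by (rule bij_betw_byWitness[of _ "flip W V"]) (auto simp: flip_flip mh_closed[OF flip_lin])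

lemma tL_flip:
 assumes V: "vs V" and W: "vs W" and U: "vs U" and \<phi>: "bil K W V U \<phi>" and t: "t : car (TS V W)"
 shows "tL U \<phi> (flip V W t) = tL U (%v w. \<phi> w v) t"
proof -
 have b: "bil K V W U (%v w. \<phi> w v)" using \<phi> by (simp add: bil_def)
 show ?thesis
  by (rule tens_eqI[OF V W mh_comp[OF flip_lin[OF V W] tl_hom[OF W V U \<phi>]] tl_hom[OF V W U b] U _ t])
   (simp add: flip_pure V W tl_pure[OF W V U \<phi>] tl_pure[OF V W U b])
qed

context
 fixes A :: "('a, 'x) module"
 assumes kA: "k_algebra K A"
begin

interpretation AA: k_algebra K A by (rule kA)
private lemmas vs = alg_vs[OF kA]
private lemmas kop = op_alg_algebra[OF kA]

text \<open>The flip is multiplicative because exchanging the factors of the enveloping algebra also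
  exchanges which of them carries the opposite product.\<close>

lemma flip_env_mult:
 assumes X: "X : car (TS A A)" and Y: "Y : car (TS A A)"
 shows "flip A A (X *_(env_alg K (op_alg A)) Y) = flip A A X *_(env_alg K A) flip A A Y"
proof -
 let ?Q = "TS A A" and ?B = "tens K (op_alg A) A" and ?C = "tens K A (op_alg A)" and ?f = "flip A A"
 note f = flip_lin[OF vs vs] and Q = TS_module[OF vs vs]
 have B1: "(%X. X *_?B Y) : lin ?Q ?Q" if "Y : car ?Q" for Y using BC_mult_lin1[OF kop kA, of Y] that by simp
 have B2: "(%Y. X *_?B Y) : lin ?Q ?Q" if "X : car ?Q" for X using BC_mult_lin2[OF kop kA, of X] that by simp
 have C1: "(%X. X *_?C Y) : lin ?Q ?Q" if "Y : car ?Q" for Y using BC_mult_lin1[OF kA kop, of Y] that by simp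
 have C2: "(%Y. X *_?C Y) : lin ?Q ?Q" if "X : car ?Q" for X using BC_mult_lin2[OF kA kop, of X] that by simp
 have Bp: "pt A A a b *_?B pt A A a' b' = pt A A (a' *_A a) (b *_A b')"
  if "a : car A" "b : car A" "a' : car A" "b' : car A" for a b a' b'
  using BC_mult_pure[OF kop kA, of a b a' b'] that by simp
 have Cp: "pt A A a b *_?C pt A A a' b' = pt A A (a *_A a') (b' *_A b)"
  if "a : car A" "b : car A" "a' : car A" "b' : car A" for a b a' b'
  using BC_mult_pure[OF kA kop, of a b a' b'] that by simp
 note fc = mh_closed[OF f]
 have "?f (X *_?B Y) = ?f X *_?C ?f Y"
 proof (rule tens_eqI[of A A "%X. ?f (X *_?B Y)" _ "%X. ?f X *_?C ?f Y", OF vs vs _ _ Q _ X])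
  show "(%X. ?f (X *_?B Y)) : lin ?Q ?Q" by (rule mh_comp[OF B1[OF Y] f])
  show "(%X. ?f X *_?C ?f Y) : lin ?Q ?Q" by (rule mh_comp[OF f C1[OF fc[OF Y]]])
  fix a b assume a: "a : car A" and b: "b : car A"
  note p = pure_closed[OF vs vs]
  show "?f (pt A A a b *_?B Y) = ?f (pt A A a b) *_?C ?f Y"
  proof (rule tens_eqI[of A A "%Y. ?f (pt A A a b *_?B Y)" _ "%Y. ?f (pt A A a b) *_?C ?f Y", OF vs vs _ _ Q _ Y])
   show "(%Y. ?f (pt A A a b *_?B Y)) : lin ?Q ?Q" by (rule mh_comp[OF B2[OF p[OF a b]] f])
   show "(%Y. ?f (pt A A a b) *_?C ?f Y) : lin ?Q ?Q" by (rule mh_comp[OF f C2[OF fc[OF p[OF a b]]]])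
   fix a' b' assume a': "a' : car A" and b': "b' : car A"
   show "?f (pt A A a b *_?B pt A A a' b') = ?f (pt A A a b) *_?C ?f (pt A A a' b')"
    by (simp add: Bp Cp flip_pure[OF vs vs] a b a' b')
  qed
 qed
 then show ?thesis by (simp add: env_alg_def)
qed

end

end

text \<open>The flip identifies the enveloping algebra of the opposite algebra with that of
  \<open>A\<close>. It exchanges \<open>bij_right_inner\<close> with \<open>bij_right_outer\<close>
  and the two alternatives of \<open>bij_left\<close>.\<close>

lemma gdata_op:
 fixes K (structure)
 assumes "gdata K H \<Delta> \<epsilon> S (op_alg A) \<kappa>"
 shows "gdata K H \<Delta> \<epsilon> S A (%h. vfield.flip K A A (\<kappa> h))"
proof -
 interpret G: gdata K H \<Delta> \<epsilon> S "op_alg A" \<kappa> by (rule assms)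
 have kA: "k_algebra K A" using G.op_alg_algebra[OF G.kA] by simp
 interpret AA: k_algebra K A by (rule kA)
 note vsA = G.alg_vs[OF kA]
 let ?f = "G.flip A A" and ?Q = "tens_space K A A" and ?W = "tens_space K H A" and ?E = "env_alg K A" and ?O = "env_alg K (op_alg A)"
 note f = G.flip_lin[OF vsA vsA] and Q = G.TS_module[OF vsA vsA] and vsH = G.vsH
 have kl: "\<kappa> : mhom K H ?Q" and kr: "\<kappa> : ring_hom H ?O"
  using G.\<kappa>_alg_hom by (simp_all add: alg_hom_def env_alg_def)
 note kc = mh_closed[OF kl]
 have kO: "k_algebra K ?O" unfolding env_alg_def by (rule G.tens_algebra[OF G.kA G.op_alg_algebra[OF G.kA]])
 interpret O: k_algebra K ?O by (rule kO)
 have selO: "car ?O = car ?Q" "add ?O = add ?Q" "zero ?O = zero ?Q" "smult ?O = smult ?Q" by (simp_all add: env_alg_def)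
 have selE: "car ?E = car ?Q" "add ?E = add ?Q" "zero ?E = zero ?Q" "smult ?E = smult ?Q" by (simp_all add: env_alg_def)
 have oneE: "1_?E = pure_tens K A A 1_A 1_A" and oneO: "1_?O = pure_tens K A A 1_A 1_A"
  by (simp_all add: env_alg_def tens_def)
 have mc: "x *_?O y : car ?Q" if "x : car ?Q" "y : car ?Q" for x y
  using O.A.m_closed[of x y] that by (simp add: selO)
 note pc = G.pure_closed[OF vsA vsA]
 have lO: "(%x. T x *_?O y) : mhom K X ?Q" if "y : car ?Q" "T : mhom K X ?Q" for T y and X :: "('a, 'v) module"
  using G.mult_lin1[OF kO, of y T X] that by (simp add: env_alg_def)
 have rO: "(%x. y *_?O T x) : mhom K X ?Q" if "y : car ?Q" "T : mhom K X ?Q" for T y and X :: "('a, 'v) module"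
  using G.mult_lin2[OF kO, of y T X] that by (simp add: env_alg_def)
 have bt: "bij_betw (tens_lift K ?Q \<psi>) (car ?W) (car ?Q)"
  if b: "bij_betw (tens_lift K ?Q \<phi>) (car ?W) (car ?Q)" and bl: "bil K H A ?Q \<phi>"
   and e: "!!h a. h : car H ==> a : car A ==> ?f (\<phi> h a) = \<psi> h a" for \<phi> \<psi>
 proof -
  have "bij_betw (%t. ?f (tens_lift K ?Q \<phi> t)) (car ?W) (car ?Q)"
   using bij_betw_trans[OF b G.flip_bij[OF vsA vsA]] by (simp add: comp_def)
  moreover have "?f (tens_lift K ?Q \<phi> t) = tens_lift K ?Q \<psi> t" if t: "t : car ?W" for t
  proof -
   have "bil K H A ?Q \<psi>"
   proof (rule bilI)
    show "(%a. \<psi> h a) : mhom K A ?Q" if h: "h : car H" for h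
     by (rule mh_cong[OF mh_comp[OF bil_lin2[OF bl h mh_id] f] _ vsA]) (simp add: e h)
    show "(%h. \<psi> h a) : mhom K H ?Q" if a: "a : car A" for a
     by (rule mh_cong[OF mh_comp[OF bil_lin1[OF bl a mh_id] f] _ vsH]) (simp add: e a)
   qed
   then show ?thesis
    unfolding G.tl_push[OF vsH vsA Q Q bl f t] by (intro G.tl_cong[OF vsH vsA Q t e])
  qed
  ultimately show ?thesis by (simp cong: bij_betw_cong)
 qed
 have fm: "?f (x *_?O y) = ?f x *_?E ?f y" if "x : car ?Q" "y : car ?Q" for x y
  by (rule G.flip_env_mult[OF kA that])
 have fp: "?f (pure_tens K A A a b) = pure_tens K A A b a" if "a : car A" "b : car A" for a b
  by (rule G.flip_pure[OF vsA vsA that])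
 note LL = bilI lO rO kl kc pc G.pure_lin1 G.pure_lin2 vsA mh_id AA.A.one_closed
 show ?thesis
 proof (intro gdata.intro gdata_axioms.intro G.hopfc_axioms kA)
  show "car A ~= {0_A}" using G.A_nonzero by simp
  show "(%h. ?f (\<kappa> h)) : alg_hom K H ?E"
   unfolding alg_hom_def
  proof (intro IntI ring_hom_memI)
   show "(%h. ?f (\<kappa> h)) : mhom K H ?E" using mh_comp[OF kl f] by (simp add: env_alg_def)
   fix g h assume g: "g : car H" and h: "h : car H"
   show "?f (\<kappa> (g *_H h)) = ?f (\<kappa> g) *_?E ?f (\<kappa> h)" using ring_hom_mult[OF kr g h] fm[OF kc[OF g] kc[OF h]] by simp
   show "?f (\<kappa> (g +_H h)) = ?f (\<kappa> g) +_?E ?f (\<kappa> h)"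
    by (simp add: selE mh_add[OF kl g h] mh_add[OF f kc[OF g] kc[OF h]])
   show "?f (\<kappa> g) : car ?E" by (simp add: selE mh_closed[OF f kc[OF g]])
  next
   show "?f (\<kappa> 1_H) = 1_?E" by (simp add: ring_hom_one[OF kr] oneO oneE fp)
  qed
  show "tens_lift K A (%x y. x *_A y) (?f (\<kappa> h)) = \<epsilon> h .*_A 1_A" if h: "h : car H" for h
  proof -
   have m: "bil K A A A (%x y. x *_A y)" by (intro bilI G.mult_lin1[OF kA] G.mult_lin2[OF kA] mh_id)
   show ?thesis using G.\<kappa>_augmented[OF h] by (simp add: G.tL_flip[OF vsA vsA vsA m kc[OF h]])
  qed
  show "bij_betw (tens_lift K ?Q (%h a. ?f (\<kappa> h) *_?E pure_tens K A A 1_A a)) (car ?W) (car ?Q)"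
   by (rule bt[of "%h a. \<kappa> h *_?O pure_tens K A A a 1_A"])
    (use G.bij_right_outer in simp, (intro LL; assumption), simp add: fm fp kc pc)
  show "bij_betw (tens_lift K ?Q (%h a. ?f (\<kappa> h) *_?E pure_tens K A A a 1_A)) (car ?W) (car ?Q)"
   by (rule bt[of "%h a. \<kappa> h *_?O pure_tens K A A 1_A a"])
    (use G.bij_right_inner in simp, (intro LL; assumption), simp add: fm fp kc pc)
  have "bij_betw (tens_lift K ?Q (%h a. pure_tens K A A a 1_A *_?E ?f (\<kappa> h))) (car ?W) (car ?Q)"
   if "bij_betw (tens_lift K ?Q (%h a. pure_tens K A A 1_A a *_?O \<kappa> h)) (car ?W) (car ?Q)"
   by (rule bt[OF that]) ((intro LL; assumption), simp add: fm fp kc pc)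
  moreover have "bij_betw (tens_lift K ?Q (%h a. pure_tens K A A 1_A a *_?E ?f (\<kappa> h))) (car ?W) (car ?Q)"
   if "bij_betw (tens_lift K ?Q (%h a. pure_tens K A A a 1_A *_?O \<kappa> h)) (car ?W) (car ?Q)"
   by (rule bt[OF that]) ((intro LL; assumption), simp add: fm fp kc pc)
  ultimately show "bij_betw (tens_lift K ?Q (%h a. pure_tens K A A 1_A a *_?E ?f (\<kappa> h))) (car ?W) (car ?Q) |
   bij_betw (tens_lift K ?Q (%h a. pure_tens K A A a 1_A *_?E ?f (\<kappa> h))) (car ?W) (car ?Q)"
   using G.bij_left by auto
 qed
qed

section \<open>Right Hopf-Galois objects\<close>

locale rgal = hopfc K H \<Delta> \<epsilon> S
 for K :: "('a, 'b) ring_scheme" (structure) and H :: "('a, 'h) module" and \<Delta> :: "'h => ('a, 'h, 'h) tens" and \<epsilon> :: "'h => 'a" and S :: "'h => 'h" +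
 fixes A :: "('a, 'x) module" and \<beta> :: "'x => ('a, 'x, 'h) tens"
 assumes gal: "right_galois_object K H \<Delta> \<epsilon> A \<beta>" and bijS: "bij_betw S (car H) (car H)"
begin

lemma kA: "k_algebra K A"
 using gal by (simp add: right_galois_object_def right_comodule_algebra_def)

sublocale AA: k_algebra K A by (rule kA)

lemmas vsA = alg_vs[OF kA]

lemma \<beta>_hom: "\<beta> : alg_hom K A (tens K A H)"
 using gal by (simp add: right_galois_object_def right_comodule_algebra_def)

lemma \<beta>_lin: "\<beta> : lin A (TS A H)"
 using \<beta>_hom by (simp add: alg_hom_def)

lemmas \<beta>c = mh_closed[OF \<beta>_lin]

lemma \<beta>_one: "\<beta> 1_A = pt A H 1_A 1_H"
 using \<beta>_hom ring_hom_one[of \<beta> A "tens K A H"] by (simp add: alg_hom_def BC_one[OF kA kH])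

lemma \<beta>_mult: "x : car A ==> y : car A ==> \<beta> (x *_A y) = \<beta> x *_(tens K A H) \<beta> y"
 using \<beta>_hom ring_hom_mult[of \<beta> A "tens K A H"] by (simp add: alg_hom_def)

lemma \<beta>_comp: "T : lin X A ==> (%x. \<beta> (T x)) : lin X (TS A H)"
 by (rule mh_comp[OF _ \<beta>_lin])

lemma \<beta>_arg: "vs U ==> bil K A H U \<phi> ==> T : lin X A ==> (%x. tL U \<phi> (\<beta> (T x))) : lin X U"
 by (rule tl_lin_arg[OF vsA vsH _ _ \<beta>_comp])

lemma \<beta>_body: "vs U ==> vs X ==> a : car A ==>
  (!!v w. v : car A ==> w : car H ==> (%x. \<phi> x v w) : lin X U) ==>
  (!!x. x : car X ==> bil K A H U (\<phi> x)) ==> (%x. tL U (\<phi> x) (\<beta> a)) : lin X U"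
 by (rule tl_lin_body[OF vsA vsH _ _ \<beta>c])

lemma \<beta>_closed: "vs U ==> bil K A H U \<phi> ==> a : car A ==> tL U \<phi> (\<beta> a) : car U"
 by (rule tl_closed[OF vsA vsH _ _ \<beta>c])

lemma \<beta>_cong: "a : car A ==> vs U ==>
  (!!x y. x : car A ==> y : car H ==> \<phi> x y = \<psi> x y) ==> bil K A H U \<psi> ==> tL U \<phi> (\<beta> a) = tL U \<psi> (\<beta> a)"
 by (rule tl_cong[OF vsA vsH _ \<beta>c])

lemma \<beta>_push: "vs U ==> vs U' ==> f : lin U U' ==> bil K A H U \<phi> ==> a : car A ==>
  f (tL U \<phi> (\<beta> a)) = tL U' (%v w. f (\<phi> v w)) (\<beta> a)"
 by (rule tl_push[OF vsA vsH _ _ _ _ \<beta>c])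

lemmas LB = LR \<beta>_comp \<beta>_arg \<beta>_body \<beta>_closed \<beta>c mult_lin1[OF kA] mult_lin2[OF kA] AA.A.m_closed AA.A.one_closed vsA

lemma coassoc_\<beta>:
 assumes a: "a : car A" and U: "vs U" and \<phi>: "tri K A H H U \<phi>"
 shows "tL U (%c x. tL U (%v w. \<phi> v w x) (\<beta> c)) (\<beta> a) = tL U (%v c. tL U (%w x. \<phi> v w x) (\<Delta> c)) (\<beta> a)"
 by (rule coassoc_tri[OF vsA vsH vsH U vsA vsH \<phi> \<beta>_lin \<Delta>_lin \<beta>c[OF a] \<beta>c[OF a]])
  (use gal a in \<open>simp add: right_galois_object_def right_comodule_algebra_def del: tens_sel tens_space_tens pure_tens_tens tens_lift_tens mh_tens\<close>)

text \<open>With \<open>a(0) \<otimes> a(1)\<close> for \<open>\<beta> a\<close>, this is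
  \<open>S(a(1)) \<otimes> a(0)\<close>. The antipode turns the right coaction into a left one, and
  as it reverses products, the new coaction is multiplicative on the opposite algebra.\<close>

definition opp where "opp a = tL (TS H A) (%x g. pt H A (S g) x) (\<beta> a)"

lemma opp_lin: "opp : lin A (TS H A)"
 unfolding opp_def by (intro LB)

lemmas oppc = mh_closed[OF opp_lin]

lemma tL_opp:
 assumes a: "a : car A" and U: "vs U" and \<phi>: "bil K H A U \<phi>"
 shows "tL U \<phi> (opp a) = tL U (%x g. \<phi> (S g) x) (\<beta> a)"
proof -
 note W = TS_module[OF vsH vsA]
 have "tL U \<phi> (opp a) = tL U (%x g. tL U \<phi> (pt H A (S g) x)) (\<beta> a)"
  unfolding opp_def by (rule \<beta>_push[OF W U tl_hom[OF vsH vsA U \<phi>] _ a]) (intro LB)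
 also have "... = tL U (%x g. \<phi> (S g) x) (\<beta> a)"
  by (rule \<beta>_cong[OF a U], rule tl_pure[OF vsH vsA U \<phi>], (intro LB; assumption), assumption, intro LB bil_lin1[OF \<phi>] bil_lin2[OF \<phi>])
 finally show ?thesis .
qed

lemma opp_mult:
 assumes x: "x : car A" and y: "y : car A"
 shows "opp (y *_A x) = opp x *_(tens K H (op_alg A)) opp y"
proof -
 let ?W = "TS H A"
 note W = TS_module[OF vsH vsA]
 have "opp (y *_A x) = tL ?W (%b h. tL ?W (%a g. pt H A (S (h *_H g)) (b *_A a)) (\<beta> x)) (\<beta> y)"
  unfolding opp_def \<beta>_mult[OF y x] by (rule tL_mult[OF kA kH \<beta>c[OF y] \<beta>c[OF x] W]) (intro LB)
 also have "... = tL ?W (%a g. tL ?W (%b h. pt H A (S (h *_H g)) (b *_A a)) (\<beta> y)) (\<beta> x)"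
  by (rule tl_swap[OF vsA vsH vsA vsH W \<beta>c[OF y] \<beta>c[OF x]]; intro LB)
 also have "... = tL ?W (%a g. tL ?W (%b h. pt H A (S g *_H S h) (b *_A a)) (\<beta> y)) (\<beta> x)"
  by (rule \<beta>_cong[OF x W], rule \<beta>_cong[OF y W], simp add: S_mult, (intro LB y; assumption), intro LB y)
 also have "... = tL ?W (%a g. tL ?W (%h b. pt H A (S g *_H h) (b *_A a)) (opp y)) (\<beta> x)"
  by (rule \<beta>_cong[OF x W], rule tL_opp[OF y W, symmetric], (intro LB y; assumption), intro LB tl_lin_body[OF vsH vsA W _ oppc[OF y]] y)
 also have "... = tL ?W (%g a. tL ?W (%h b. pt H A (g *_H h) (b *_A a)) (opp y)) (opp x)"
  by (rule tL_opp[OF x W, symmetric]) (intro LB tl_lin_body[OF vsH vsA W _ oppc[OF y]] y)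
 also have "... = opp x *_(tens K H (op_alg A)) opp y"
  using BC_mult_def[OF kH op_alg_algebra[OF kA], of "opp x" "opp y"] by simp
 finally show ?thesis .
qed

text \<open>Brings the right Galois map into the Sweedler form
  \<open>x \<otimes> y \<mapsto> x y(0) \<otimes> y(1)\<close>. The inverse of the associator that
  it contains is identified with the explicit map \<open>?n\<close>.\<close>

lemma right_can_bij:
 "bij_betw (tL (TS A H) (%x y. tL (TS A H) (%z g. pt A H (x *_A z) g) (\<beta> y))) (car (TS A A)) (car (TS A H))"
proof -
 let ?Q = "TS A (TS A H)" and ?P = "TS (TS A A) H" and ?W = "TS A H"
 note AA = TS_module[OF vsA vsA] and AH = TS_module[OF vsA vsH]
 note Q = TS_module[OF vsA AH] and P = TS_module[OF AA vsH]
 let ?ass = "tL ?Q (%x w. tL ?Q (%u v. pt A (TS A H) u (pt A H v w)) x)"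
 have ass: "tens_assoc K A A H = ?ass" by (simp add: tens_assoc_def fun_eq_iff)
 have ai: "bil K A A ?Q (%u v. pt A (TS A H) u (pt A H v w))" if "w : car H" for w by (intro LB that AH)
 have ab: "bil K (TS A A) H ?Q (%x w. tL ?Q (%u v. pt A (TS A H) u (pt A H v w)) x)"
  by (intro bilI tl_hom[OF vsA vsA Q ai] tl_lin_body[OF vsA vsA Q vsH _ _ ai] LB AH)
 have tr: "tri K A A H ?P (%u v w. pt (TS A A) H (pt A A u v) w)" by (intro LB)
 have tm: "tri K A A H ?W (%u v w. pt A H (u *_A v) w)" by (intro LB)
 let ?n = "lift3 ?P (%u v w. pt (TS A A) H (pt A A u v) w)"
 note nh = lift3_hom[OF vsA vsA vsH P tr] and np = lift3_pure[OF vsA vsA vsH P tr]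
 note ah = tl_hom[OF AA vsH Q ab]
 have ap: "?ass (pt (TS A A) H (pt A A u v) w) = pt A (TS A H) u (pt A H v w)" if "u : car A" "v : car A" "w : car H" for u v w
  using tl_pure[OF AA vsH Q ab pure_closed[OF vsA vsA that(1,2)] that(3)] tl_pure[OF vsA vsA Q ai that(1,2)] that(3) by simp
 have na: "?n (?ass t) = t" if t: "t : car ?P" for t
 proof (rule tens_eqI[OF AA vsH mh_comp[OF ah nh] mh_id P _ t])
  fix s w assume s: "s : car (TS A A)" and w: "w : car H"
  have l: "(%s. pt (TS A A) H s w) : lin (TS A A) ?P" by (intro pure_lin1 AA vsH w mh_id)
  show "?n (?ass (pt (TS A A) H s w)) = pt (TS A A) H s w"
   by (rule tens_eqI[OF vsA vsA mh_comp[OF l mh_comp[OF ah nh]] l P _ s]) (simp only: ap np w)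
 qed
 have an: "?ass (?n t) = t" if t: "t : car ?Q" for t
 proof (rule tens_eqI[OF vsA AH mh_comp[OF nh ah] mh_id Q _ t])
  fix u s assume u: "u : car A" and s: "s : car (TS A H)"
  have l: "(%s. pt A (TS A H) u s) : lin (TS A H) ?Q" by (intro pure_lin2 AH vsA u mh_id)
  show "?ass (?n (pt A (TS A H) u s)) = pt A (TS A H) u s"
   by (rule tens_eqI[OF vsA vsH mh_comp[OF l mh_comp[OF nh ah]] l Q _ s]) (simp only: ap np u)
 qed
 have inv: "inv_into (car (tens K (tens K A A) H)) (tens_assoc K A A H) t = ?n t" if t: "t : car ?Q" for t
  unfolding ass
  by (rule inv_into_f_eq) (simp_all add: inj_on_inverseI[of _ ?n] na an t mh_closed[OF nh])
 have mm: "tens_map K A H (mult_map K A) (%h. h) (?n t) = lift3 ?W (%u v w. pt A H (u *_A v) w) t" if t: "t : car ?Q" for t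
 proof -
  have m: "bil K A A A (%x y. x *_A y)" by (intro LB)
  note ml = tl_hom[OF vsA vsA vsA m]
  have tb: "bil K (TS A A) H ?W (%s w. pt A H (tL A (%x y. x *_A y) s) w)"
   by (intro bilI pure_lin1 pure_lin2 vsA vsH ml mh_closed[OF ml] mh_id)
  have te: "tens_map K A H (mult_map K A) (%h. h) = tL ?W (%s w. pt A H (tL A (%x y. x *_A y) s) w)"
   by (simp add: tens_map_def mult_map_def)
  show ?thesis
   unfolding te
  proof (rule tens_eqI[OF vsA AH mh_comp[OF nh tl_hom[OF AA vsH AH tb]] lift3_hom[OF vsA vsA vsH AH tm] AH _ t])
   fix u s assume u: "u : car A" and s: "s : car (TS A H)"
   have l: "(%s. pt A (TS A H) u s) : lin (TS A H) ?Q" by (intro pure_lin2 AH vsA u mh_id)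
   show "tL ?W (%s w. pt A H (tL A (%x y. x *_A y) s) w) (?n (pt A (TS A H) u s)) = lift3 ?W (%u v w. pt A H (u *_A v) w) (pt A (TS A H) u s)"
    by (rule tens_eqI[OF vsA vsH mh_comp[OF l mh_comp[OF nh tl_hom[OF AA vsH AH tb]]] mh_comp[OF l lift3_hom[OF vsA vsA vsH AH tm]] AH _ s])
     (simp only: np u lift3_pure[OF vsA vsA vsH AH tm] tl_pure[OF AA vsH AH tb] tl_pure[OF vsA vsA vsA m] pure_closed[OF vsA vsA])
  qed
 qed
 have "tens_map K A H (mult_map K A) (%h. h)
    (inv_into (car (tens K (tens K A A) H)) (tens_assoc K A A H)
     (tens_map K A (tens K A H) (%a. a) \<beta> x)) =
  tL ?W (%x y. tL ?W (%z g. pt A H (x *_A z) g) (\<beta> y)) x" if x: "x : car (TS A A)" for x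
 proof -
  have b: "bil K A A ?Q (%v c. tL ?Q (%w x. pt A (TS A H) v (pt A H w x)) (\<beta> c))" by (intro LB AH)
  show ?thesis
   unfolding tens_map_right[OF vsA vsA vsH vsA \<beta>_lin x] inv[OF tl_closed[OF vsA vsA Q b x]] mm[OF tl_closed[OF vsA vsA Q b x]]
   by (rule lift3_right[OF vsA vsA vsH AH vsA tm \<beta>_lin x])
 qed
 then have "bij_betw (tL ?W (%x y. tL ?W (%z g. pt A H (x *_A z) g) (\<beta> y))) (car (tens K A A)) (car (tens K A H)) \<longleftrightarrow>
  bij_betw (%x. tens_map K A H (mult_map K A) (%h. h)
    (inv_into (car (tens K (tens K A A) H)) (tens_assoc K A A H)
     (tens_map K A (tens K A H) (%a. a) \<beta> x))) (car (tens K A A)) (car (tens K A H))"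
  by (intro bij_betw_cong) (simp only: tens_sel)
 then show ?thesis using gal by (simp add: right_galois_object_def)
qed

lemma antipode_flip_bij: "bij_betw (tL (TS H A) (%x g. pt H A (S g) x)) (car (TS A H)) (car (TS H A))"
proof -
 note W = TS_module[OF vsH vsA]
 have f: "bil K H A (TS H A) (%g x. pt H A (S g) x)" by (intro LB)
 have "tL (TS H A) (%g x. pt H A (S g) x) (flip A H t) = tL (TS H A) (%x g. pt H A (S g) x) t" if "t : car (TS A H)" for t
  by (rule tL_flip[OF vsA vsH W f that])
 then show ?thesis
  using bij_betw_trans[OF flip_bij[OF vsA vsH] tens_bij_left[OF vsH vsH vsA S_lin bijS]] by (simp add: comp_def cong: bij_betw_cong)
qed

text \<open>The left Galois map of the opposite algebra is the flip, followed by the right Galois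
  map of \<open>A\<close>, followed by \<open>x \<otimes> g \<mapsto> S g \<otimes> x\<close>; all
  three are bijective. Coassociativity rests on \<open>S_comult\<close>, the counit condition on
  \<open>S_counit\<close>.\<close>

lemma left_galois_op: "left_galois_object K H \<Delta> \<epsilon> (op_alg A) opp"
 unfolding left_galois_object_def left_comodule_algebra_def
proof (intro conjI ballI)
 let ?W = "TS H A" and ?Q = "TS H (TS H A)"
 note W = TS_module[OF vsH vsA] and AH = TS_module[OF vsA vsH]
 note Q = TS_module[OF vsH W]
 note kO = op_alg_algebra[OF kA]
 have vsO: "vs (op_alg A)" using vsA by simp
 have oppO: "opp : lin (op_alg A) (TS H (op_alg A))" using opp_lin by simp
 show "k_algebra K (op_alg A)" by (rule kO)
 show "opp : alg_hom K (op_alg A) (tens K H (op_alg A))"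
  unfolding alg_hom_def
 proof (intro IntI ring_hom_memI)
  show "opp : lin (op_alg A) (tens K H (op_alg A))" using opp_lin by simp
  show "opp 1_(op_alg A) = 1_(tens K H (op_alg A))"
  proof -
   have b: "bil K A H ?W (%x g. pt H A (S g) x)" by (intro LB)
   show ?thesis unfolding BC_one[OF kH kO] op_alg_sel opp_def \<beta>_one pure_tens_op
    using tl_pure[OF vsA vsH W b] by (simp add: S_one)
  qed
  fix x y assume "x : car (op_alg A)" "y : car (op_alg A)"
  then show "opp (x *_(op_alg A) y) = opp x *_(tens K H (op_alg A)) opp y" using opp_mult by simp
 qed (use oppc mh_add[OF opp_lin] in simp_all)
 show "car (op_alg A) ~= {0_(op_alg A)}" using gal by (simp add: right_galois_object_def)
 {
  fix a assume "a : car (op_alg A)"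
  then have a: "a : car A" by simp
  have tr: "tri K A H H ?Q (%x v w. pt H (TS H A) (S w) (pt H A (S v) x))" by (intro LB)
  have "tens_assoc K H H (op_alg A) (tens_map K (tens K H H) (op_alg A) \<Delta> (%x. x) (opp a)) =
   tL ?Q (%c x. tL ?Q (%v w. pt H (TS H A) v (pt H A w x)) (\<Delta> c)) (opp a)"
   using tens_map_left[OF vsH vsH vsO vsH \<Delta>_lin, of "opp a"] oppc[OF a] by simp
  also have "... = tL ?Q (%x g. tL ?Q (%v w. pt H (TS H A) v (pt H A w x)) (\<Delta> (S g))) (\<beta> a)"
   by (rule tL_opp[OF a Q]) (intro LB)
  also have "... = tL ?Q (%x g. tL ?Q (%v w. pt H (TS H A) (S w) (pt H A (S v) x)) (\<Delta> g)) (\<beta> a)"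
   by (rule \<beta>_cong[OF a Q], rule S_comult[OF _ Q], assumption, (intro LB; assumption), intro LB)
  also have "... = tL ?Q (%c g. tL ?Q (%x g'. pt H (TS H A) (S g) (pt H A (S g') x)) (\<beta> c)) (\<beta> a)"
   by (rule coassoc_\<beta>[OF a Q tr, symmetric])
  also have "... = tL ?Q (%c g. tL ?Q (%h x. pt H (TS H A) (S g) (pt H A h x)) (opp c)) (\<beta> a)"
   by (rule \<beta>_cong[OF a Q], rule tL_opp[OF _ Q, symmetric], assumption, (intro LB; assumption),
    intro bilI tl_lin_arg[OF vsH vsA Q _ opp_lin] tl_lin_body[OF vsH vsA Q vsH oppc] LB)
  also have "... = tL ?Q (%g c. tL ?Q (%h x. pt H (TS H A) g (pt H A h x)) (opp c)) (opp a)"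
   by (rule tL_opp[OF a Q, symmetric]) (intro bilI tl_lin_arg[OF vsH vsA Q _ opp_lin] tl_lin_body[OF vsH vsA Q vsH oppc] LB)
  also have "... = tens_map K H (tens K H (op_alg A)) (%x. x) opp (opp a)"
   using tens_map_right[OF vsH vsH vsO vsO oppO, of "opp a"] oppc[OF a] by simp
  finally show "tens_assoc K H H (op_alg A) (tens_map K (tens K H H) (op_alg A) \<Delta> (%x. x) (opp a)) =
   tens_map K H (tens K H (op_alg A)) (%x. x) opp (opp a)" .
  have "tens_lift K A (%h x. \<epsilon> h .*_A x) (opp a) = tL A (%x g. \<epsilon> (S g) .*_A x) (\<beta> a)"
   by (rule tL_opp[OF a vsA]) (intro LB)
  also have "... = tL A (%x g. \<epsilon> g .*_A x) (\<beta> a)"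
   by (rule \<beta>_cong[OF a vsA], simp add: S_counit, intro LB)
  also have "... = a" using gal a by (simp add: right_galois_object_def right_comodule_algebra_def)
  finally show "tens_lift K (op_alg A) (%h x. \<epsilon> h .*_(op_alg A) x) (opp a) = a" by simp
 }
 let ?c = "tL (TS A H) (%x y. tL (TS A H) (%z g. pt A H (x *_A z) g) (\<beta> y))" and ?s = "tL ?W (%x g. pt H A (S g) x)"
 have cb: "bil K A A (TS A H) (%x y. tL (TS A H) (%z g. pt A H (x *_A z) g) (\<beta> y))" by (intro LB)
 have sb: "bil K A H ?W (%x g. pt H A (S g) x)" by (intro LB)
 note ch = tl_hom[OF vsA vsA AH cb] and sh = tl_hom[OF vsA vsH W sb]
 have b': "bil K A A ?W (%x y. tL ?W (%g z. pt H A g (y *_A z)) (opp x))"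
  by (intro bilI tl_lin_arg[OF vsH vsA W _ opp_lin] tl_lin_body[OF vsH vsA W vsA oppc] LB)
 have eq: "tens_map K H (op_alg A) (%h. h) (mult_map K (op_alg A))
    (tens_assoc K H (op_alg A) (op_alg A) (tens_map K (tens K H (op_alg A)) (op_alg A) opp (%a. a) t)) =
   ?s (?c (flip A A t))" if t: "t : car (TS A A)" for t
 proof -
  have "tens_map K H (op_alg A) (%h. h) (mult_map K (op_alg A))
    (tens_assoc K H (op_alg A) (op_alg A) (tens_map K (tens K H (op_alg A)) (op_alg A) opp (%a. a) t)) =
   tL ?W (%x y. tL ?W (%g z. pt H A g (y *_A z)) (opp x)) t"
   using left_can_eq[OF vsH kO oppO, of t] t by simp
  also have "... = ?s (?c (flip A A t))"
  proof (rule tens_eqI[OF vsA vsA tl_hom[OF vsA vsA W b'] mh_comp[OF flip_lin[OF vsA vsA] mh_comp[OF ch sh]] W _ t])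
   fix x y assume x: "x : car A" and y: "y : car A"
   have "tL ?W (%x y. tL ?W (%g z. pt H A g (y *_A z)) (opp x)) (pt A A x y) = tL ?W (%g z. pt H A g (y *_A z)) (opp x)" (is "?l = _")
    by (rule tl_pure[OF vsA vsA W b' x y])
   also have "... = tL ?W (%z g. pt H A (S g) (y *_A z)) (\<beta> x)"
    by (rule tL_opp[OF x W]) (intro LB y)
   also have "... = tL ?W (%z g. ?s (pt A H (y *_A z) g)) (\<beta> x)"
    by (rule \<beta>_cong[OF x W], rule tl_pure[OF vsA vsH W sb, symmetric], (intro LB y; assumption), assumption,
     intro bilI mh_comp[OF _ sh] LB y)
   also have "... = ?s (tL (TS A H) (%z g. pt A H (y *_A z) g) (\<beta> x))"
    by (rule \<beta>_push[OF AH W sh _ x, symmetric]) (intro LB y)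
   also have "tL (TS A H) (%z g. pt A H (y *_A z) g) (\<beta> x) = ?c (pt A A y x)"
    by (rule tl_pure[OF vsA vsA AH cb y x, symmetric])
   finally show "?l = ?s (?c (flip A A (pt A A x y)))"
    by (simp add: flip_pure[OF vsA vsA x y])
  qed
  finally show ?thesis .
 qed
 have "bij_betw (%t. ?s (?c (flip A A t))) (car (TS A A)) (car ?W)"
  using bij_betw_trans[OF bij_betw_trans[OF flip_bij[OF vsA vsA] right_can_bij] antipode_flip_bij] by (simp add: comp_def)
 then show "bij_betw (%x. tens_map K H (op_alg A) (%h. h) (mult_map K (op_alg A))
    (tens_assoc K H (op_alg A) (op_alg A) (tens_map K (tens K H (op_alg A)) (op_alg A) opp (%a. a) x)))
   (car (tens K (op_alg A) (op_alg A))) (car (tens K H (op_alg A)))"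
  using bij_betw_cong[of "car (TS A A)", OF eq] by (simp only: tens_sel tens_space_op)
qed

lemma gdata_exists: "EX \<kappa>. gdata K H \<Delta> \<epsilon> S A \<kappa>"
proof -
 interpret L: lgal K H \<Delta> \<epsilon> S "op_alg A" opp
  by (intro lgal.intro lgal_axioms.intro hopfc_axioms left_galois_op bijS)
 show ?thesis using gdata_op[OF L.gdata] by blast
qed

end

section \<open>Coordinates of tensors\<close>

context vfield
begin

text \<open>Pure tensors inherit the expansion of their second factor. For a sum the two finite
  supports are united, and \<open>ext\<close> shows that enlarging the index set does not change an
  expansion.\<close>

lemma tens_coord_right:
 fixes V :: "('a, 'v) module" and W :: "('a, 'w) module"
 assumes V: "vs V" and W: "vs W" and B: "vbasis W B c"
 shows "tL V (%v w. c b w .*_V v) : lin (TS V W) V"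
  and "t : car (TS V W) ==> finite {b:B. tL V (%v w. c b w .*_V v) t ~= 0_V}"
  and "t : car (TS V W) ==>
   t = (finsum (TS V W) (%b. pt V W (tL V (%v w. c b w .*_V v) t) b) {b:B. tL V (%v w. c b w .*_V v) t ~= 0_V})"
proof -
 interpret V: left_module K V by (rule V)
 interpret W: left_module K W by (rule W)
 note Q = TS_module[OF V W]
 interpret Q: left_module K "TS V W" by (rule Q)
 note b = vbasisD[OF B]
 let ?c = "%b t. tL V (%v w. c b w .*_V v) t"
 have bb: "bil K V W V (%v w. c b w .*_V v)" for b
  by (intro bilI scalar_lin[OF V] smult_lin[OF V] b(2) b(5) mh_id)
 have L: "?c b : lin (TS V W) V" for b by (rule tl_hom[OF V W V bb])
 have cc: "?c b t : car V" if "t : car (TS V W)" for b t by (rule mh_closed[OF L that])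
 have Bc: "b : car W" if "b : B" for b using b(1) that by blast
 show "?c b : lin (TS V W) V" by (rule L)
 have p0: "pt V W 0_V w = 0_(TS V W)" if "w : car W" for w
  by (rule mh_zero[OF pure_lin1[OF V W that mh_id] V.abelian_group_axioms Q.abelian_group_axioms])
 have ext: "(finsum (TS V W) (%b. pt V W (?c b t) b) F) = (finsum (TS V W) (%b. pt V W (?c b t) b) G)"
  if t: "t : car (TS V W)" and G: "finite G" "F <= G" "G <= B" and z: "!!b. b : G - F ==> ?c b t = 0_V" for F G t
  by (rule Q.M.add.finprod_mono_neutral_cong_left[OF G(1,2)])
   (use G z p0 Bc cc[OF t] in \<open>auto intro!: pure_closed[OF V W]\<close>)
 have ex: "EX F. finite F & F <= B & (ALL b:B - F. ?c b t = 0_V) & t = (finsum (TS V W) (%b. pt V W (?c b t) b) F)"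
  if "t : car (TS V W)" for t
  using that
 proof (induction rule: tens_induct[OF V W, consumes 1])
  case (1 v w)
  let ?F = "{b:B. c b w ~= \<zero>}"
  have cp: "?c b (pt V W v w) = c b w .*_V v" for b by (rule tl_pure[OF V W V bb 1])
  have "pt V W v w = pt V W v (finsum W (%b. c b w .*_W b) ?F)" using b(4)[OF 1(2)] by simp
  also have "... = (finsum (TS V W) (%b. pt V W v (c b w .*_W b)) ?F)"
   by (rule mh_finsum[OF pure_lin2[OF V W 1(1) mh_id] W.abelian_group_axioms Q.abelian_group_axioms b(3)[OF 1(2)]])
    (simp add: Pi_def W.smult_closed b(5)[OF 1(2)] Bc)
  also have "... = (finsum (TS V W) (%b. pt V W (?c b (pt V W v w)) b) ?F)"
  proof (rule Q.M.add.finprod_cong'[OF refl])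
   show "(%b. pt V W (?c b (pt V W v w)) b) : ?F \<rightarrow> car (TS V W)"
    unfolding cp by (auto intro!: pure_closed[OF V W] V.smult_closed b(5)[OF 1(2)] Bc 1)
   fix i assume "i : ?F"
   then have i: "i : car W" using Bc by simp
   show "pt V W v (c i w .*_W i) = pt V W (?c i (pt V W v w)) i"
    unfolding cp
    using mh_smult[OF pure_lin2[OF V W 1(1) mh_id] b(5)[OF 1(2)] i]
     mh_smult[OF pure_lin1[OF V W i mh_id] b(5)[OF 1(2)] 1(1)] by simp
  qed
  finally have e: "pt V W v w = (finsum (TS V W) (%b. pt V W (?c b (pt V W v w)) b) ?F)" .
  show ?case
  proof (intro exI[of _ ?F] conjI ballI e b(3)[OF 1(2)])
   show "?c b (pt V W v w) = 0_V" if "b : B - ?F" for b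
    unfolding cp using that V.smult_zero_left[OF 1(1)] by auto
  qed blast
 next
  case (2 x y)
  from 2(3) obtain F where F': "finite F & F <= B & (ALL b:B - F. ?c b x = 0_V) & x = (finsum (TS V W) (%b. pt V W (?c b x) b) F)"
   by (rule exE)
  from 2(4) obtain G where G': "finite G & G <= B & (ALL b:B - G. ?c b y = 0_V) & y = (finsum (TS V W) (%b. pt V W (?c b y) b) G)"
   by (rule exE)
  note F = conjunct1[OF F'] conjunct1[OF conjunct2[OF F']] bspec[OF conjunct1[OF conjunct2[OF conjunct2[OF F']]]] conjunct2[OF conjunct2[OF conjunct2[OF F']]]
  note G = conjunct1[OF G'] conjunct1[OF conjunct2[OF G']] bspec[OF conjunct1[OF conjunct2[OF conjunct2[OF G']]]] conjunct2[OF conjunct2[OF conjunct2[OF G']]]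
  note x = 2(1) and y = 2(2)
  have FG: "finite (F \<union> G)" "F <= F \<union> G" "G <= F \<union> G" "F \<union> G <= B" using F(1,2) G(1,2) by auto
  have "x = (finsum (TS V W) (%b. pt V W (?c b x) b) (F \<union> G))"
   by (rule trans[OF F(4) ext[OF x FG(1,2,4)]], rule F(3)) (use FG(4) in blast)
  moreover have "y = (finsum (TS V W) (%b. pt V W (?c b y) b) (F \<union> G))"
   by (rule trans[OF G(4) ext[OF y FG(1,3,4)]], rule G(3)) (use FG(4) in blast)
  ultimately have "x +_(TS V W) y = (finsum (TS V W) (%b. pt V W (?c b x) b) (F \<union> G)) +_(TS V W) (finsum (TS V W) (%b. pt V W (?c b y) b) (F \<union> G))"
   by (rule arg_cong2)
  also have "... = (finsum (TS V W) (%b. pt V W (?c b x) b +_(TS V W) pt V W (?c b y) b) (F \<union> G))"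
   by (rule Q.M.finsum_addf[symmetric]) (use FG(4) cc[OF x] cc[OF y] Bc in \<open>auto intro!: pure_closed[OF V W]\<close>)
  also have "... = (finsum (TS V W) (%b. pt V W (?c b (x +_(TS V W) y)) b) (F \<union> G))"
  proof (rule Q.M.add.finprod_cong'[OF refl])
   show "(%b. pt V W (?c b (x +_(TS V W) y)) b) : F \<union> G \<rightarrow> car (TS V W)"
    using FG(4) cc[OF Q.M.a_closed[OF x y]] Bc by (auto intro!: pure_closed[OF V W])
   fix i assume "i : F \<union> G"
   then have i: "i : car W" using Bc FG(4) by blast
   show "pt V W (?c i x) i +_(TS V W) pt V W (?c i y) i = pt V W (?c i (x +_(TS V W) y)) i"
    using mh_add[OF pure_lin1[OF V W i mh_id] cc[OF x] cc[OF y]] mh_add[OF L x y] by simp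
  qed
  finally show ?case
   using FG(1,4) F(3) G(3) mh_add[OF L x y] by (intro exI[of _ "F \<union> G"]) auto
 qed
 assume t: "t : car (TS V W)"
 obtain F where F: "finite F" "F <= B" "!!b. b : B - F ==> ?c b t = 0_V" "t = (finsum (TS V W) (%b. pt V W (?c b t) b) F)"
  using ex[OF t] by blast
 have sub: "{b:B. ?c b t ~= 0_V} <= F" using F(3) by blast
 then show "finite {b:B. ?c b t ~= 0_V}" using F(1) finite_subset by blast
 show "t = (finsum (TS V W) (%b. pt V W (?c b t) b) {b:B. ?c b t ~= 0_V})"
  by (rule trans[OF F(4) ext[OF t F(1) sub F(2), symmetric]]) (use F(2) in blast)
qed

lemma tens_coord_left:
 fixes V :: "('a, 'v) module" and W :: "('a, 'w) module"
 assumes V: "vs V" and W: "vs W" and B: "vbasis V B c"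
 shows "tL W (%v w. c b v .*_W w) : lin (TS V W) W"
  and "t : car (TS V W) ==> finite {b:B. tL W (%v w. c b v .*_W w) t ~= 0_W}"
  and "t : car (TS V W) ==>
   t = (finsum (TS V W) (%b. pt V W b (tL W (%v w. c b v .*_W w) t)) {b:B. tL W (%v w. c b v .*_W w) t ~= 0_W})"
proof -
 interpret W: left_module K W by (rule W)
 interpret V: left_module K V by (rule V)
 note Q = TS_module[OF V W] and Q' = TS_module[OF W V]
 interpret Q: left_module K "TS V W" by (rule Q)
 interpret Q': left_module K "TS W V" by (rule Q')
 note b = vbasisD[OF B]
 have bb: "bil K W V W (%w v. c b v .*_W w)" for b
  by (intro bilI scalar_lin[OF W] smult_lin[OF W] b(2) b(5) mh_id)
 have bb': "bil K V W W (%v w. c b v .*_W w)" for b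
  by (intro bilI scalar_lin[OF W] smult_lin[OF W] b(2) b(5) mh_id)
 show "tL W (%v w. c b v .*_W w) : lin (TS V W) W" for b by (rule tl_hom[OF V W W bb'])
 assume t: "t : car (TS V W)"
 note ft = mh_closed[OF flip_lin[OF V W] t]
 have eq: "tL W (%w v. c b v .*_W w) (flip V W t) = tL W (%v w. c b v .*_W w) t" for b
  by (rule tL_flip[OF V W W bb t])
 let ?F = "{b:B. tL W (%v w. c b v .*_W w) t ~= 0_W}"
 show fin: "finite ?F" using tens_coord_right(2)[OF W V B ft] unfolding eq .
 have "t = flip W V (finsum (TS W V) (%b. pt W V (tL W (%v w. c b v .*_W w) t) b) ?F)"
  using tens_coord_right(3)[OF W V B ft] flip_flip[OF V W t] unfolding eq by simp
 also have "... = (finsum (TS V W) (%b. flip W V (pt W V (tL W (%v w. c b v .*_W w) t) b)) ?F)"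
  by (rule mh_finsum[OF flip_lin[OF W V] Q'.abelian_group_axioms Q.abelian_group_axioms fin])
   (use b(1) in \<open>auto intro!: pure_closed[OF W V] tl_closed[OF V W W bb' t]\<close>)
 also have "... = (finsum (TS V W) (%b. pt V W b (tL W (%v w. c b v .*_W w) t)) ?F)"
  by (rule Q.M.add.finprod_cong'[OF refl])
   (use b(1) in \<open>auto intro!: pure_closed[OF V W] flip_pure[OF W V] tl_closed[OF V W W bb' t]\<close>)
 finally show "t = (finsum (TS V W) (%b. pt V W b (tL W (%v w. c b v .*_W w) t)) ?F)" .
qed

section \<open>Change of algebras\<close>

text \<open>By \<open>bij\<close> a basis of \<open>A\<close> becomes, through \<open>emb\<close>, a
  basis of \<open>S\<close> as a right module over \<open>H\<close>; the coordinates are the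
  coefficients in \<open>H\<close> of the corresponding tensor. The coordinates of
  \<open>emb a\<close> are scalars, so homology parametrized by scalars turns into homology
  parametrized by \<open>A\<close>.\<close>

lemma tensor_ascent:
 fixes H :: "('a, 'h) module" and S :: "('a, 's) module" and A :: "('a, 'x) module"
 assumes kH: "k_algebra K H" and kS: "k_algebra K S" and vsA: "vs A" and nz: "1_H ~= 0_H"
  and \<kappa>: "\<kappa> : alg_hom K H S" and emb: "emb : lin A S"
  and bij: "bij_betw (tL S (%h a. emb a *_S \<kappa> h)) (car (TS H A)) (car S)"
  and mc: "mat_complex H I E D"
  and free: "hfree H I E D p (car K) (%k. k .*_H 1_H) z"
 shows "hfree S I (%n i j. \<kappa> (E n i j)) (%n i j. \<kappa> (D n i j)) p (car A) emb (%i. \<kappa> (z i))"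
proof -
 interpret H: k_algebra K H by (rule kH)
 interpret S: k_algebra K S by (rule kS)
 interpret A: left_module K A by (rule vsA)
 note vsH = alg_vs[OF kH] and vsS = alg_vs[OF kS]
 note W = TS_module[OF vsH vsA]
 interpret W: left_module K "TS H A" by (rule W)
 have kr: "\<kappa> : ring_hom H S" and kl: "\<kappa> : lin H S" using \<kappa> by (simp_all add: alg_hom_def)
 note kc = mh_closed[OF kl] and ec = mh_closed[OF emb]
 have k1: "\<kappa> 1_H = 1_S" using ring_hom_one[OF kr] .
 let ?\<Phi> = "tL S (%h a. emb a *_S \<kappa> h)"
 have fb: "bil K H A S (%h a. emb a *_S \<kappa> h)"
  by (intro bilI mult_lin1[OF kS] mult_lin2[OF kS] emb kl kc ec)
 note \<Phi> = tl_hom[OF vsH vsA vsS fb] and \<Phi>p = tl_pure[OF vsH vsA vsS fb]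
 have \<Phi>inj: "s = t" if "s : car (TS H A)" "t : car (TS H A)" "?\<Phi> s = ?\<Phi> t" for s t
  using bij that by (meson bij_betw_imp_inj_on inj_onD)
 define \<Psi> where "\<Psi> = inv_into (car (TS H A)) ?\<Phi>"
 have \<Psi>: "\<Psi> s : car (TS H A)" "?\<Phi> (\<Psi> s) = s" if "s : car S" for s
  using bij that by (auto simp: \<Psi>_def bij_betw_def inv_into_into f_inv_into_f)
 obtain B c where B: "vbasis A B c" using basis_exists[OF vsA] by blast
 note b = vbasisD[OF B]
 have Bc: "x : car A" if "x : B" for x using b(1) that by blast
 let ?c = "%b t. tL H (%h a. c b a .*_H h) t"
 note cl = tens_coord_right(1)[OF vsH vsA B]
 have cb: "bil K H A H (%h a. c b a .*_H h)" for b
  by (intro bilI scalar_lin[OF vsH] smult_lin[OF vsH] b(2) b(5) mh_id)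
 note cp = tl_pure[OF vsH vsA vsH cb]
 obtain f where f: "f : lin H (reg K)" "f 1_H = \<one>"
  by (rule functional_one[OF vsH H.A.one_closed nz])
 have pinj: "a = a'" if "a : car A" "a' : car A" "pt H A 1_H a = pt H A 1_H a'" for a a'
 proof -
  have fb: "bil K H A A (%h a. f h .*_A a)"
   using mh_closed[OF f(1)] by (intro bilI scalar_lin[OF vsA] smult_lin[OF vsA] f mh_id) auto
  have "tL A (%h a. f h .*_A a) (pt H A 1_H x) = x" if "x : car A" for x
   using tl_pure[OF vsH vsA vsA fb H.A.one_closed that] by (simp add: f(2) A.smult_one that)
  then show ?thesis using that by metis
 qed
 have e\<Phi>: "?\<Phi> (pt H A 1_H a) = emb a" if "a : car A" for a
  using \<Phi>p[OF H.A.one_closed that] by (simp add: k1 ec that)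
 \<comment> \<open>Right multiplication by \<kappa>(r) touches only the factor from \<open>H\<close>
   of the tensor, which makes the coordinates right linear.\<close>
 have mult: "\<Psi> (s *_S \<kappa> r) = tL (TS H A) (%h a. pt H A (h *_H r) a) (\<Psi> s)"
  "?c b (tL (TS H A) (%h a. pt H A (h *_H r) a) (\<Psi> s)) = ?c b (\<Psi> s) *_H r"
  if s: "s : car S" and r: "r : car H" for s r b
 proof -
  have rb: "bil K H A (TS H A) (%h a. pt H A (h *_H r) a)"
   by (intro bilI pure_lin1 pure_lin2 vsH vsA mult_lin1[OF kH] mh_id r H.A.m_closed)
  note rl = tl_hom[OF vsH vsA W rb] and rp = tl_pure[OF vsH vsA W rb]
  have "?\<Phi> (tL (TS H A) (%h a. pt H A (h *_H r) a) (\<Psi> s)) = ?\<Phi> (\<Psi> s) *_S \<kappa> r"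
   by (rule tens_eqI[OF vsH vsA mh_comp[OF rl \<Phi>] mult_lin1[OF kS kc[OF r] \<Phi>] vsS _ \<Psi>(1)[OF s]])
    (simp add: rp \<Phi>p r ring_hom_mult[OF kr] S.A.m_assoc kc ec)
  then show "\<Psi> (s *_S \<kappa> r) = tL (TS H A) (%h a. pt H A (h *_H r) a) (\<Psi> s)"
   by (intro \<Phi>inj) (simp_all add: \<Psi> s kc r mh_closed[OF rl])
  show "?c b (tL (TS H A) (%h a. pt H A (h *_H r) a) (\<Psi> s)) = ?c b (\<Psi> s) *_H r"
   by (rule tens_eqI[OF vsH vsA mh_comp[OF rl cl] mult_lin1[OF kH r cl] vsH _ \<Psi>(1)[OF s]])
    (simp add: rp cp r H.smult_mult_left b)
 qed
 have \<Psi>add: "\<Psi> (s +_S s') = \<Psi> s +_(TS H A) \<Psi> s'" if "s : car S" "s' : car S" for s s'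
  by (rule \<Phi>inj) (simp_all add: that \<Psi> mh_add[OF \<Phi>])
 have kB: "k .*_H 1_H : car H" if "k : car K" for k using that by simp
 interpret F: free_extension H I E D S \<kappa> B emb "%b s. ?c b (\<Psi> s)"
 proof (intro free_extension.intro free_extension_axioms.intro mc S.A.ring_axioms kr)
  fix b s assume s: "s : car S"
  show "?c b (\<Psi> s) : car H" by (rule mh_closed[OF cl \<Psi>(1)[OF s]])
  show "?c b (\<Psi> (s +_S s')) = ?c b (\<Psi> s) +_H ?c b (\<Psi> s')" if "s' : car S" for s'
   by (simp add: \<Psi>add s that mh_add[OF cl] \<Psi>)
  show "?c b (\<Psi> (s *_S \<kappa> r)) = ?c b (\<Psi> s) *_H r" if "r : car H" for r
   by (simp only: mult[OF s that])
  show fin: "finite {b : B. ?c b (\<Psi> s) ~= 0_H}" by (rule tens_coord_right(2)[OF vsH vsA B \<Psi>(1)[OF s]])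
  have "s = ?\<Phi> (finsum (TS H A) (%b. pt H A (?c b (\<Psi> s)) b) {b:B. ?c b (\<Psi> s) ~= 0_H})"
   using \<Psi>(2)[OF s] tens_coord_right(3)[OF vsH vsA B \<Psi>(1)[OF s]] by simp
  also have "... = (finsum S (%b. ?\<Phi> (pt H A (?c b (\<Psi> s)) b)) {b:B. ?c b (\<Psi> s) ~= 0_H})"
   by (rule mh_finsum[OF \<Phi> W.abelian_group_axioms S.A.abelian_group_axioms fin])
    (use Bc in \<open>auto intro!: pure_closed[OF vsH vsA] mh_closed[OF cl \<Psi>(1)[OF s]]\<close>)
  also have "... = (finsum S (%b. emb b *_S \<kappa> (?c b (\<Psi> s))) {b:B. ?c b (\<Psi> s) ~= 0_H})"
   by (rule S.A.add.finprod_cong'[OF refl])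
    (use Bc in \<open>auto intro!: \<Phi>p S.A.m_closed ec kc mh_closed[OF cl \<Psi>(1)[OF s]]\<close>)
  finally show "s = (finsum S (%b. emb b *_S \<kappa> (?c b (\<Psi> s))) {b:B. ?c b (\<Psi> s) ~= 0_H})" .
 qed (use Bc ec in auto)
 show ?thesis
 proof (rule F.homology_ascent[OF free kB ec])
  show "inj_on emb (car A)"
  proof (rule inj_onI)
   fix a a' assume a: "a : car A" "a' : car A" "emb a = emb a'"
   then show "a = a'"
    using pinj[OF a(1,2)] \<Phi>inj[of "pt H A 1_H a" "pt H A 1_H a'"] e\<Phi> pure_closed[OF vsH vsA] by simp
  qed
  show "EX k:car K. ?c b (\<Psi> (emb a)) = k .*_H 1_H" if a: "a : car A" for a b
  proof
   have "\<Psi> (emb a) = pt H A 1_H a"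
    by (rule \<Phi>inj) (simp_all add: \<Psi> ec a e\<Phi> pure_closed[OF vsH vsA])
   then show "?c b (\<Psi> (emb a)) = c b a .*_H 1_H" by (simp add: cp a)
  qed (rule b(5)[OF a])
  show "EX a:car A. emb a = (finsum S (%b. emb b *_S \<kappa> (k b .*_H 1_H)) F)"
   if F: "finite F" "F <= B" and k: "!!b. b : F ==> k b : car K" for F k
  proof
   have kb: "(%b. k b .*_A b) : F \<rightarrow> car A" using F(2) Bc k by (auto intro!: A.smult_closed)
   then show "(finsum A (%b. k b .*_A b) F) : car A" by (rule A.M.finsum_closed)
   have "emb (finsum A (%b. k b .*_A b) F) = (finsum S (%b. emb (k b .*_A b)) F)" (is "?l = _")
    by (rule mh_finsum[OF emb A.abelian_group_axioms S.A.abelian_group_axioms F(1) kb])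
   also have "... = (finsum S (%b. emb b *_S \<kappa> (k b .*_H 1_H)) F)"
   proof (rule S.A.add.finprod_cong'[OF refl])
    show "(%b. emb b *_S \<kappa> (k b .*_H 1_H)) : F \<rightarrow> car S"
     using F(2) Bc k by (auto intro!: S.A.m_closed ec kc kB)
    fix i assume i: "i : F"
    then show "emb (k i .*_A i) = emb i *_S \<kappa> (k i .*_H 1_H)"
     using F(2) Bc k by (auto simp: mh_smult[OF emb] mh_smult[OF kl] k1 S.smult_mult_right ec)
   qed
   finally show "?l = (finsum S (%b. emb b *_S \<kappa> (k b .*_H 1_H)) F)" .
  qed
 qed (use ec in auto)
qed

end

section \<open>Restriction to one side of the enveloping algebra\<close>

context hopfc
begin

abbreviation "He == env_alg K H"

text \<open>Base change along \<open>bar\<close> is tensoring with the trivial module over the inner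
  copy of \<open>H\<close>.\<close>

definition bar :: "('a, 'h, 'h) tens => 'h" where
 "bar = tL H (%h g. \<epsilon> g .*_H h)"

lemma bar_bil: "bil K H H H (%h g. \<epsilon> g .*_H h)"
 by (intro LR)

lemma bar_lin: "bar : lin (TS H H) H"
 unfolding bar_def by (rule tl_hom[OF vsH vsH vsH bar_bil])

lemma bar_pure: "h : car H ==> g : car H ==> bar (pt H H h g) = \<epsilon> g .*_H h"
 unfolding bar_def by (rule tl_pure[OF vsH vsH vsH bar_bil])

lemma kHe: "k_algebra K He"
 by (rule env_alg_algebra[OF kH])

lemma H_one_nonzero: "1_H ~= 0_H"
proof
 assume "1_H = 0_H"
 moreover have "\<epsilon> 0_H = \<zero>"
  using mh_zero[OF \<epsilon>_lin, OF HA.A.abelian_group_axioms] left_module.axioms(2)[OF vs_regular] by simp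
 ultimately show False using \<epsilon>_one by simp
qed

lemma scalar_inj: "inj_on (%k. k .*_H 1_H) (car K)"
proof (rule inj_onI)
 fix k k' assume k: "k : car K" "k' : car K" "k .*_H 1_H = k' .*_H 1_H"
 have "\<epsilon> (x .*_H 1_H) = x" if "x : car K" for x
  using mh_smult[OF \<epsilon>_lin that HA.A.one_closed] that by (simp add: \<epsilon>_one)
 then show "k = k'" using k by metis
qed

lemma bar_ring_hom: "bar : ring_hom He H"
proof (rule ring_hom_memI)
 interpret E: k_algebra K He by (rule kHe)
 note sel = env_alg_sel[OF kH] and Q = TS_module[OF vsH vsH] and p = pure_closed[OF vsH vsH]
 note m1 = mult_lin1[OF kHe, unfolded env_alg_lin[OF kH] sel] and m2 = mult_lin2[OF kHe, unfolded env_alg_lin[OF kH] sel]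
 note bc = mh_closed[OF bar_lin]
 show "bar 1_He = 1_H" by (simp add: sel bar_pure \<epsilon>_one)
 fix x y assume "x : car He" "y : car He"
 then have x: "x : car (TS H H)" and y: "y : car (TS H H)" by (simp_all add: sel)
 show "bar x : car H" by (rule bc[OF x])
 show "bar (x +_He y) = bar x +_H bar y" using mh_add[OF bar_lin x y] by (simp add: sel)
 show "bar (x *_He y) = bar x *_H bar y"
 proof (rule tens_eqI[of H H "%x. bar (x *_He y)" _ "%x. bar x *_H bar y", OF vsH vsH _ _ vsH _ x])
  show "(%x. bar (x *_He y)) : lin (TS H H) H" by (rule mh_comp[OF m1[OF y mh_id] bar_lin])
  show "(%x. bar x *_H bar y) : lin (TS H H) H" by (rule mult_lin1[OF kH bc[OF y] bar_lin])
  fix h g assume h: "h : car H" and g: "g : car H"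
  show "bar (pt H H h g *_He y) = bar (pt H H h g) *_H bar y"
  proof (rule tens_eqI[of H H "%y. bar (pt H H h g *_He y)" _ "%y. bar (pt H H h g) *_H bar y", OF vsH vsH _ _ vsH _ y])
   show "(%y. bar (pt H H h g *_He y)) : lin (TS H H) H" by (rule mh_comp[OF m2[OF p[OF h g] mh_id] bar_lin])
   show "(%y. bar (pt H H h g) *_H bar y) : lin (TS H H) H" by (rule mult_lin2[OF kH bc[OF p[OF h g]] bar_lin])
   fix h' g' assume h': "h' : car H" and g': "g' : car H"
   show "bar (pt H H h g *_He pt H H h' g') = bar (pt H H h g) *_H bar (pt H H h' g')"
    by (simp add: env_alg_mult_pure[OF kH] bar_pure h g h' g' \<epsilon>_mult \<epsilon>c HA.smult_mult_left HA.smult_mult_right HA.smult_assoc1[symmetric] K.m_comm)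
  qed
 qed
qed

lemma inner_ring_hom: "(%t. pt H H 1_H t) : ring_hom (op_alg H) He"
 using mh_add[OF pure_lin2[OF vsH vsH HA.A.one_closed mh_id]]
 by (intro ring_hom_memI) (simp_all add: env_alg_sel[OF kH] env_alg_mult_pure[OF kH] pure_closed[OF vsH vsH])

lemma ring_hom_op: "f : ring_hom A B ==> f : ring_hom (op_ring A) (op_ring B)"
 by (simp add: ring_hom_def)

text \<open>A basis of the outer factor gives coordinates in the inner one. Both multiplications by
  inner elements are recorded, as the dual complex lives over the opposite ring. Applying \<epsilon>
  to the coordinate of \<open>r\<close> gives the coordinate of \<open>bar r\<close>, whence the
  condition on the kernel of \<open>bar\<close>.\<close>

lemma env_coordinates:
 obtains B c where "B <= car H" "!!b. c b : lin (TS H H) H"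
  "!!r. r : car (TS H H) ==> finite {b:B. c b r ~= 0_H}"
  "!!r. r : car (TS H H) ==> r = (finsum (TS H H) (%b. pt H H b (c b r)) {b:B. c b r ~= 0_H})"
  "!!b r. r : car (TS H H) ==> bar r = 0_H ==> \<epsilon> (c b r) = \<zero>"
  "!!b r t. r : car (TS H H) ==> t : car H ==> c b (pt H H 1_H t *_He r) = c b r *_H t"
  "!!b r t. r : car (TS H H) ==> t : car H ==> c b (r *_He pt H H 1_H t) = t *_H c b r"
proof -
 obtain B c where B: "vbasis H B c" using basis_exists[OF vsH] by blast
 note b = vbasisD[OF B]
 let ?c = "%b. tL H (%h g. c b h .*_H g)"
 note co = tens_coord_left[OF vsH vsH B]
 have cb: "bil K H H H (%h g. c b h .*_H g)" for b
  by (intro bilI scalar_lin[OF vsH] smult_lin[OF vsH] b(2) b(5) mh_id)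
 note cp = tl_pure[OF vsH vsH vsH cb]
 note sel = env_alg_sel[OF kH] and p = pure_closed[OF vsH vsH HA.A.one_closed]
 note m1 = mult_lin1[OF kHe, unfolded env_alg_lin[OF kH] sel] and m2 = mult_lin2[OF kHe, unfolded env_alg_lin[OF kH] sel]
 show thesis
 proof (rule that[OF b(1) co])
  fix b r assume r: "r : car (TS H H)"
  have e: "\<epsilon> (?c b r) = c b (bar r)"
  proof (rule tens_eqI[OF vsH vsH mh_comp[OF co(1) \<epsilon>_lin] mh_comp[OF bar_lin b(2)] vs_regular _ r])
   fix h g assume "h : car H" "g : car H"
   then show "\<epsilon> (?c b (pt H H h g)) = c b (bar (pt H H h g))"
    using mh_smult[OF \<epsilon>_lin b(5), of h g b] mh_smult[OF b(2) \<epsilon>c, of g h b]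
    by (simp add: cp bar_pure K.m_comm b(5) \<epsilon>c)
  qed
  show "\<epsilon> (?c b r) = \<zero>" if "bar r = 0_H"
   unfolding e that using mh_zero[OF b(2), OF HA.A.abelian_group_axioms] left_module.axioms(2)[OF vs_regular] by simp
  fix t assume t: "t : car H"
  show "?c b (pt H H 1_H t *_He r) = ?c b r *_H t"
   by (rule tens_eqI[of H H "%r. ?c b (pt H H 1_H t *_He r)" _ "%r. ?c b r *_H t",
      OF vsH vsH mh_comp[OF m2[OF p[OF t] mh_id] co(1)] mult_lin1[OF kH t co(1)] vsH _ r])
    (simp add: env_alg_mult_pure[OF kH] cp t HA.smult_mult_left b(5))
  show "?c b (r *_He pt H H 1_H t) = t *_H ?c b r"
   by (rule tens_eqI[of H H "%r. ?c b (r *_He pt H H 1_H t)" _ "%r. t *_H ?c b r",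
      OF vsH vsH mh_comp[OF m1[OF p[OF t] mh_id] co(1)] mult_lin2[OF kH t co(1)] vsH _ r])
    (simp add: env_alg_mult_pure[OF kH] cp t HA.smult_mult_right b(5))
 qed
qed

lemma bar_inner: "t : car H ==> bar (pt H H 1_H t) = \<epsilon> t .*_H 1_H"
 by (simp add: bar_pure)

lemma bar_surj: "bar ` car (TS H H) = car H"
proof (intro equalityI subsetI)
 fix h assume h: "h : car H"
 have "bar (pt H H h 1_H) = h" using h by (simp add: bar_pure \<epsilon>_one)
 then show "h : bar ` car (TS H H)" using pure_closed[OF vsH vsH h HA.A.one_closed] by (metis imageI)
qed (use mh_closed[OF bar_lin] in blast)

lemma \<epsilon>_surj: "k : car K ==> EX t:car H. \<epsilon> t = k"
 using mh_smult[OF \<epsilon>_lin _ HA.A.one_closed, of k] by (intro bexI[of _ "k .*_H 1_H"]) (simp_all add: \<epsilon>_one)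

text \<open>After \<open>bar\<close> the inner copy of \<open>H\<close> acts through \<epsilon>, so
  freeness over \<open>H\<close> becomes freeness over the scalars.\<close>

lemma env_descent:
 assumes mc: "mat_complex He I E D" and free: "hfree He I E D p (car H) (%t. pt H H 1_H t) z"
 shows "hfree H I (%n i j. bar (E n i j)) (%n i j. bar (D n i j)) p (car K) (%k. k .*_H 1_H) (%i. bar (z i))"
proof (rule env_coordinates)
 fix B c
 assume B: "B <= car H" and c: "!!b. c b : lin (TS H H) H"
  and fin: "!!r. r : car (TS H H) ==> finite {b:B. c b r ~= 0_H}"
  and ex: "!!r. r : car (TS H H) ==> r = (finsum (TS H H) (%b. pt H H b (c b r)) {b:B. c b r ~= 0_H})"
  and e: "!!b r. r : car (TS H H) ==> bar r = 0_H ==> \<epsilon> (c b r) = \<zero>"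
  and cm: "!!b r t. r : car (TS H H) ==> t : car H ==> c b (pt H H 1_H t *_He r) = c b r *_H t"
 interpret E: k_algebra K He by (rule kHe)
 interpret O: k_algebra K "op_alg H" by (rule op_alg_algebra[OF kH])
 interpret Q: left_module K "TS H H" by (rule TS_module[OF vsH vsH])
 note sel = env_alg_sel[OF kH] and p = pure_closed[OF vsH vsH]
 note cc = mh_closed[OF c]
 interpret split_complex He I E D "op_alg H" H "%t. pt H H 1_H t" bar B "%b. pt H H b 1_H" c
 proof (intro split_complex.intro split_complex_axioms.intro mc O.A.ring_axioms HA.A.ring_axioms inner_ring_hom bar_ring_hom; (unfold sel op_alg_sel)?)
  show "bar ` car (TS H H) = car H" by (rule bar_surj)
  show "pt H H b 1_H : car (TS H H)" if "b : B" for b using that B by (auto intro: p)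
  fix b r assume r: "r : car (TS H H)"
  show "c b r : car H" by (rule cc[OF r])
  show "c b (r +_(TS H H) r') = c b r +_H c b r'" if "r' : car (TS H H)" for r' by (rule mh_add[OF c r that])
  show "c b (pt H H 1_H t *_He r) = c b r *_H t" if "t : car H" for t by (rule cm[OF r that])
  show "finite {b : B. c b r ~= 0_H}" by (rule fin[OF r])
  show "bar (pt H H 1_H (c b r)) = 0_H" if "bar r = 0_H"
   by (simp add: bar_inner cc[OF r] e[OF r that])
  have fs: "finsum He = (finsum (TS H H) :: ('h => _) => _)"
   by (intro ext) (simp add: finsum_def finprod_def sel cong: if_cong)
  have "r = (finsum (TS H H) (%b. pt H H b (c b r)) {b:B. c b r ~= 0_H})" by (rule ex[OF r])
  also have "... = (finsum (TS H H) (%b. pt H H 1_H (c b r) *_He pt H H b 1_H) {b:B. c b r ~= 0_H})"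
   by (rule Q.M.add.finprod_cong'[OF refl])
    (use B cc[OF r] in \<open>auto simp: env_alg_mult_pure[OF kH] subset_iff intro!: p\<close>)
  finally show "r = (finsum He (%b. pt H H 1_H (c b r) *_He pt H H b 1_H) {b:B. c b r ~= 0_H})" unfolding fs .
 qed
 show ?thesis
  by (rule homology_descent[where \<chi> = \<epsilon>]) (use free bar_inner \<epsilon>_surj scalar_inj \<epsilon>c in auto)
qed

lemma env_descent_op:
 assumes mc: "mat_complex (op_ring He) I E D" and free: "hfree (op_ring He) I E D p (car H) (%t. pt H H 1_H t) z"
 shows "hfree (op_ring H) I (%n i j. bar (E n i j)) (%n i j. bar (D n i j)) p (car K) (%k. k .*_H 1_H) (%i. bar (z i))"
proof (rule env_coordinates)
 fix B c
 assume B: "B <= car H" and c: "!!b. c b : lin (TS H H) H"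
  and fin: "!!r. r : car (TS H H) ==> finite {b:B. c b r ~= 0_H}"
  and ex: "!!r. r : car (TS H H) ==> r = (finsum (TS H H) (%b. pt H H b (c b r)) {b:B. c b r ~= 0_H})"
  and e: "!!b r. r : car (TS H H) ==> bar r = 0_H ==> \<epsilon> (c b r) = \<zero>"
  and cm: "!!b r t. r : car (TS H H) ==> t : car H ==> c b (r *_He pt H H 1_H t) = t *_H c b r"
 interpret E: k_algebra K He by (rule kHe)
 interpret Q: left_module K "TS H H" by (rule TS_module[OF vsH vsH])
 note sel = env_alg_sel[OF kH] and p = pure_closed[OF vsH vsH]
 note cc = mh_closed[OF c]
 have inner: "(%t. pt H H 1_H t) : ring_hom H (op_ring He)"
  using ring_hom_op[OF inner_ring_hom] by (simp add: op_alg_def)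
 have sel': "car (op_ring He) = car (TS H H)" "add (op_ring He) = add (TS H H)" "x *_(op_ring He) y = y *_He x" for x y
  by (simp_all add: sel)
 interpret split_complex "op_ring He" I E D H "op_ring H" "%t. pt H H 1_H t" bar B "%b. pt H H b 1_H" c
 proof (intro split_complex.intro split_complex_axioms.intro mc op_ring_ring[OF HA.A.ring_axioms] HA.A.ring_axioms inner ring_hom_op[OF bar_ring_hom]; (unfold sel')?)
  show "bar ` car (TS H H) = car (op_ring H)" by (simp add: bar_surj)
  show "pt H H b 1_H : car (TS H H)" if "b : B" for b using that B by (auto intro: p)
  fix b r assume r: "r : car (TS H H)"
  show "c b r : car H" by (rule cc[OF r])
  show "c b (r +_(TS H H) r') = c b r +_H c b r'" if "r' : car (TS H H)" for r' by (rule mh_add[OF c r that])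
  show "c b (r *_He pt H H 1_H t) = t *_H c b r" if "t : car H" for t by (rule cm[OF r that])
  show "finite {b : B. c b r ~= 0_H}" by (rule fin[OF r])
  show "bar (pt H H 1_H (c b r)) = 0_(op_ring H)" if "bar r = 0_(op_ring H)"
   using that by (simp add: bar_inner cc[OF r] e[OF r])
  have fs: "finsum (op_ring He) = (finsum (TS H H) :: ('h => _) => _)"
   by (intro ext) (simp add: finsum_def finprod_def sel cong: if_cong)
  have "r = (finsum (TS H H) (%b. pt H H b (c b r)) {b:B. c b r ~= 0_H})" by (rule ex[OF r])
  also have "... = (finsum (TS H H) (%b. pt H H b 1_H *_He pt H H 1_H (c b r)) {b:B. c b r ~= 0_H})"
   by (rule Q.M.add.finprod_cong'[OF refl])
    (use B cc[OF r] in \<open>auto simp: env_alg_mult_pure[OF kH] subset_iff intro!: p\<close>)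
  finally show "r = (finsum (op_ring He) (%b. pt H H b 1_H *_He pt H H 1_H (c b r)) {b:B. c b r ~= 0_H})" unfolding fs .
 qed
 show ?thesis
  by (rule homology_descent[where \<chi> = \<epsilon>]) (use free bar_inner \<epsilon>_surj scalar_inj \<epsilon>c in auto)
qed

end

text \<open>Rows vanish outside the index sets, so matrix rows with other indices never
  contribute.\<close>

lemma (in mat_complex) hfree_cong:
 assumes "!!n i j. i : I n ==> E' n i j = E n i j" and "!!n i j. i : I (Suc n) ==> D' n i j = D n i j"
 shows "hfree R I E' D' p S emb z \<longleftrightarrow> hfree R I E D p S emb z"
proof -
 have 1: "mrow R (I n) (E' n) x = mrow R (I n) (E n) x" if "x : rows R (I n)" for n x
  by (rule mrow_cong) (auto simp: assms(1) freeD(1)[OF that] freeD(1)[OF funcset_mem[OF E_rows]])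
 have 2: "mrow R (I (Suc n)) (D' n) x = mrow R (I (Suc n)) (D n) x" if "x : rows R (I (Suc n))" for n x
  by (rule mrow_cong) (auto simp: assms(2) freeD(1)[OF that] freeD(1)[OF funcset_mem[OF D_rows]])
 have "mcycle R I E' D' n x \<longleftrightarrow> cyc n x" "mbdry R I D' n x \<longleftrightarrow> bdr n x" for n x
  using 1 2 by (auto simp: mcycle_def mbdry_def)
 then show ?thesis by (simp add: hfree_def)
qed

section \<open>Cohomology classes\<close>

context resolution
begin

context
 fixes N :: "('r, 'n) module" and act :: "'s => 'n => 'n" and n :: nat
 assumes N: "lmod R N"
begin

interpretation N: left_module R N by (rule N)

abbreviation "ZZ == (hom_module R (P n) N act)\<lparr>carrier := cocs R P \<delta> N n\<rparr>"
abbreviation "BB == cobs R P \<delta> N n"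
abbreviation "cls f == BB +>\<^bsub>ZZ\<^esub> f"

lemma ZZ_sel: "car ZZ = cocs R P \<delta> N n" "zero ZZ = (\<lambda>x\<in>car (P n). 0_N)"
 "f +_ZZ g = (\<lambda>x\<in>car (P n). f x +_N g x)" "s .*_ZZ f = (\<lambda>x\<in>car (P n). act s (f x))"
 by (simp_all add: hom_module_def)

lemma cocycle_closed: "f : cocs R P \<delta> N n ==> x : car (P n) ==> f x : car N"
 by (rule mh_closed[OF cocyclesD(1)[OF N]])

lemma cocycle_vanish: "f : cocs R P \<delta> N n ==> x : car (P (Suc n)) ==> f (\<delta> n x) = 0_N"
 by (simp add: cocycles_def)

lemma cocycles_plus: "f : cocs R P \<delta> N n ==> g : cocs R P \<delta> N n ==>
  (\<lambda>x\<in>car (P n). f x +_N g x) : cocs R P \<delta> N n"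
 by (rule cocyclesI[OF N mh_plus[OF cocyclesD(1)[OF N] cocyclesD(1)[OF N] N]]) (simp_all add: cocycle_vanish)

lemma cocycles_diff: "f : cocs R P \<delta> N n ==> g : cocs R P \<delta> N n ==>
  (\<lambda>x\<in>car (P n). f x -_N g x) : cocs R P \<delta> N n"
 by (rule cocyclesI[OF N mh_minus[OF cocyclesD(1)[OF N] cocyclesD(1)[OF N] N]]) (simp_all add: cocycle_vanish N.M.minus_self)

lemma cocycles_act: "f : cocs R P \<delta> N n ==> a : mhom R N N ==> (\<lambda>x\<in>car (P n). a (f x)) : cocs R P \<delta> N n"
 by (rule cocyclesI[OF N mh_comp[OF cocyclesD(1)[OF N]]])
  (simp_all add: cocycle_vanish mh_zero[OF _ N.abelian_group_axioms N.abelian_group_axioms])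

lemma cocycle_zero: "(\<lambda>x\<in>car (P n). 0_N) : cocs R P \<delta> N n"
 using coboundaries_zero[OF N] coboundaries_cocycles[OF N] by blast

lemma cocycle_eqI: "f : cocs R P \<delta> N n ==> g : cocs R P \<delta> N n ==> (!!x. x : car (P n) ==> f x = g x) ==> f = g"
 by (rule extensionalityI[OF cocyclesD(2)[OF N] cocyclesD(2)[OF N]])

lemma ZZ_group: "abelian_group ZZ"
proof (rule abelian_groupI; unfold ZZ_sel)
 fix f g h assume f: "f : cocs R P \<delta> N n" and g: "g : cocs R P \<delta> N n" and h: "h : cocs R P \<delta> N n"
 show "(\<lambda>x\<in>car (P n). f x +_N g x) : cocs R P \<delta> N n" by (rule cocycles_plus[OF f g])
 show "(\<lambda>x\<in>car (P n). (\<lambda>x\<in>car (P n). f x +_N g x) x +_N h x) = (\<lambda>x\<in>car (P n). f x +_N (\<lambda>x\<in>car (P n). g x +_N h x) x)"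
  using cocycle_closed[OF f] cocycle_closed[OF g] cocycle_closed[OF h] by (auto simp: N.M.a_assoc)
 show "(\<lambda>x\<in>car (P n). f x +_N g x) = (\<lambda>x\<in>car (P n). g x +_N f x)"
  using cocycle_closed[OF f] cocycle_closed[OF g] by (auto simp: N.M.a_comm)
next
 show "(\<lambda>x\<in>car (P n). 0_N) : cocs R P \<delta> N n" by (rule cocycle_zero)
 fix f assume f: "f : cocs R P \<delta> N n"
 show "(\<lambda>x\<in>car (P n). (\<lambda>x\<in>car (P n). 0_N) x +_N f x) = f"
  by (rule cocycle_eqI[OF cocycles_plus[OF cocycle_zero f] f]) (simp add: cocycle_closed[OF f])
 show "EX g:cocs R P \<delta> N n. (\<lambda>x\<in>car (P n). g x +_N f x) = (\<lambda>x\<in>car (P n). 0_N)"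
  by (rule bexI[OF _ cocycles_diff[OF cocycle_zero f]]) (auto simp: cocycle_closed[OF f] N.M.minus_add_cancel)
qed

interpretation Z: abelian_group ZZ by (rule ZZ_group)

lemma ZZ_minus: "f : cocs R P \<delta> N n ==> g : cocs R P \<delta> N n ==> f -_ZZ g = (\<lambda>x\<in>car (P n). f x -_N g x)"
proof -
 assume f: "f : cocs R P \<delta> N n" and g: "g : cocs R P \<delta> N n"
 have "(\<lambda>x\<in>car (P n). f x -_N g x) +_ZZ g = f"
  unfolding ZZ_sel
  by (rule cocycle_eqI[OF cocycles_plus[OF cocycles_diff[OF f g] g] f])
   (simp add: N.M.minus_add_cancel cocycle_closed[OF f] cocycle_closed[OF g])
 then show ?thesis
  using Z.minus_eq_iff[of f g "\<lambda>x\<in>car (P n). f x -_N g x"] f g cocycles_diff[OF f g] by (simp only: ZZ_sel)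
qed

lemma BB_subgroup: "abelian_subgroup BB ZZ"
proof (intro abelian_subgroupI3 additive_subgroupI ZZ_group)
 have sub: "b : cocs R P \<delta> N n" if "b : BB" for b using that coboundaries_cocycles[OF N] by blast
 have neg: "\<ominus>\<^bsub>ZZ\<^esub> b : BB" if b: "b : BB" for b
 proof -
  have "\<ominus>\<^bsub>ZZ\<^esub> b = 0_ZZ -_ZZ b" using Z.l_zero[OF Z.a_inv_closed[of b]] sub[OF b] by (simp only: Z.minus_eq ZZ_sel(1))
  also have "... = (\<lambda>x\<in>car (P n). (\<lambda>x\<in>car (P n). 0_N) x -_N b x)"
   using ZZ_minus[OF cocycle_zero sub[OF b]] by (simp only: ZZ_sel)
  also have "... : BB" by (rule coboundaries_minus[OF N coboundaries_zero[OF N] b])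
  finally show ?thesis .
 qed
 show "subgroup BB (add_monoid ZZ)"
 proof (rule group.subgroupI[OF Z.a_group])
  show "BB <= car (add_monoid ZZ)" using sub by (auto simp: hom_module_def)
  show "BB ~= {}" using coboundaries_zero[OF N] by blast
  show "inv\<^bsub>add_monoid ZZ\<^esub> b : BB" if "b : BB" for b using neg[OF that] by (simp add: a_inv_def)
  show "b *_(add_monoid ZZ) b' : BB" if b: "b : BB" and b': "b' : BB" for b b'
  proof -
   note nb = neg[OF b']
   have "b +_ZZ b' = b -_ZZ (\<ominus>\<^bsub>ZZ\<^esub> b')"
    using Z.minus_minus[of b'] sub[OF b'] by (simp only: Z.minus_eq ZZ_sel)
   also have "... = (\<lambda>x\<in>car (P n). b x -_N (\<ominus>\<^bsub>ZZ\<^esub> b') x)" by (rule ZZ_minus[OF sub[OF b] sub[OF nb]])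
   also have "... : BB" by (rule coboundaries_minus[OF N b nb])
   finally show ?thesis by simp
  qed
 qed
qed

interpretation B: abelian_subgroup BB ZZ by (rule BB_subgroup)

lemma cls_eq_iff: "f : cocs R P \<delta> N n ==> g : cocs R P \<delta> N n ==>
  cls f = cls g \<longleftrightarrow> (\<lambda>x\<in>car (P n). f x -_N g x) : BB"
 using B.coset_eq_iff[of f g] by (simp only: ZZ_sel ZZ_minus)

lemma hom_cohomology_sel:
 "car (hom_cohomology R P \<delta> N act n) = (%f. cls f) ` cocs R P \<delta> N n"
 "0_(hom_cohomology R P \<delta> N act n) = BB"
proof -
 have "a_rcosets\<^bsub>ZZ\<^esub> BB = (%f. cls f) ` car ZZ" by (auto simp: A_RCOSETS_def')
 then show "car (hom_cohomology R P \<delta> N act n) = (%f. cls f) ` cocs R P \<delta> N n"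
  by (simp only: hom_cohomology_def quotient_module_sel ZZ_sel)
 show "0_(hom_cohomology R P \<delta> N act n) = BB" by (simp only: hom_cohomology_def quotient_module_sel)
qed

lemma hom_cohomology_add: "f : cocs R P \<delta> N n ==> g : cocs R P \<delta> N n ==>
  cls f +_(hom_cohomology R P \<delta> N act n) cls g = cls (\<lambda>x\<in>car (P n). f x +_N g x)"
 using B.a_rcos_sum[of f g] by (simp only: hom_cohomology_def quotient_module_sel ZZ_sel)

lemma hom_cohomology_smult:
 assumes f: "f : cocs R P \<delta> N n" and a: "act s : mhom R N N"
 shows "s .*_(hom_cohomology R P \<delta> N act n) cls f = cls (\<lambda>x\<in>car (P n). act s (f x))"
proof -
 have "s .*_(quotient_module ZZ BB) cls f = cls (s .*_ZZ f)"
 proof (rule quotient_smult[OF BB_subgroup]; (unfold ZZ_sel)?)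
  show "f : cocs R P \<delta> N n" by (rule f)
  show "(\<lambda>x\<in>car (P n). act s (g x)) : cocs R P \<delta> N n" if "g : cocs R P \<delta> N n" for g
   by (rule cocycles_act[OF that a])
  show "(\<lambda>x\<in>car (P n). act s (g x)) : BB" if "g : BB" for g by (rule coboundaries_image[OF N that a])
  show "(\<lambda>x\<in>car (P n). act s ((\<lambda>x\<in>car (P n). g x +_N h x) x)) =
   (\<lambda>x\<in>car (P n). (\<lambda>x\<in>car (P n). act s (g x)) x +_N (\<lambda>x\<in>car (P n). act s (h x)) x)"
   if "g : cocs R P \<delta> N n" "h : cocs R P \<delta> N n" for g h
   using cocycle_closed[OF that(1)] cocycle_closed[OF that(2)] by (auto simp: mh_add[OF a])
 qed
 then show ?thesis by (simp only: hom_cohomology_def ZZ_sel)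
qed

lemma hom_cohomology_trivial:
 "car (hom_cohomology R P \<delta> N act n) = {0_(hom_cohomology R P \<delta> N act n)} \<longleftrightarrow> cocs R P \<delta> N n <= BB"
proof -
 have "cls f = BB \<longleftrightarrow> f : BB" if "f : cocs R P \<delta> N n" for f
  using B.coset_eq_zero_iff[of f] that by (simp only: ZZ_sel)
 then show ?thesis
  unfolding hom_cohomology_sel using cocycle_zero by auto
qed

end

end

section \<open>Twisted bimodules\<close>

context vfield
begin

context
 fixes A :: "('a, 'x) module"
 assumes kA: "k_algebra K A"
begin

interpretation AA: k_algebra K A by (rule kA)
interpretation E: k_algebra K "env_alg K A" by (rule env_alg_algebra[OF kA])
private lemmas vsA = alg_vs[OF kA]
private lemmas sel = env_alg_sel[OF kA]
private lemmas Q = TS_module[OF vsA vsA]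
private lemmas pc = pure_closed[OF vsA vsA]
private lemmas pm = env_alg_mult_pure[OF kA]
private lemmas m1 = mult_lin1[OF env_alg_algebra[OF kA], unfolded env_alg_lin[OF kA] sel]
private lemmas m2 = mult_lin2[OF env_alg_algebra[OF kA], unfolded env_alg_lin[OF kA] sel]
private lemmas LM = mult_lin1[OF kA] mult_lin2[OF kA] AA.A.m_closed AA.A.one_closed mh_id bilI

lemma twist_bil: "\<mu> : lin A A ==> m : car A ==> bil K A A A (%a b. (a *_A m) *_A \<mu> b)"
 by (intro LM mh_closed[of \<mu> K A A])

lemma bimodule_left_module: "lmod (env_alg K A) (twisted_bimodule K A (%a. a))"
proof (rule left_moduleI)
 let ?M = "twisted_bimodule K A (%a. a)"
 have b: "bil K A A A (%a b. (a *_A m) *_A b)" if "m : car A" for m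
  by (rule twist_bil[OF mh_id that])
 note h = tl_hom[OF vsA vsA vsA b]
 have ms: "car ?M = car A" "add ?M = add A" "zero ?M = zero A"
  "r .*_?M m = tL A (%a b. (a *_A m) *_A b) r" for r m by (simp_all add: twisted_bimodule_def)
 show "ring (env_alg K A)" by (rule E.A.ring_axioms)
 show "abelian_group ?M"
  by (rule abelian_groupI) (auto simp: ms AA.A.a_ac intro: AA.A.l_neg)
 note l = tl_lin_body[OF vsA vsA vsA vsA _ _ b]
 fix r x assume "r : car (env_alg K A)" and "x : car ?M"
 then have r: "r : car (TS A A)" and x: "x : car A" by (simp_all add: sel ms)
 have lx: "(%x. tL A (%a b. (a *_A x) *_A b) r) : lin A A" if "r : car (TS A A)" for r
  by (rule l[OF that]) (intro LM)
 show "r .*_?M x : car ?M" using mh_closed[OF h[OF x] r] by (simp add: ms)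
 show "r .*_?M (x +_?M y) = r .*_?M x +_?M r .*_?M y" if "y : car ?M" for y
  using mh_add[OF lx[OF r] x, of y] that by (simp add: ms)
 fix s assume "s : car (env_alg K A)"
 then have s: "s : car (TS A A)" by (simp add: sel)
 show "(r +_(env_alg K A) s) .*_?M x = r .*_?M x +_?M s .*_?M x"
  using mh_add[OF h[OF x] r s] by (simp add: ms sel)
 have "tL A (%a b. (a *_A x) *_A b) (r *_(env_alg K A) s) = tL A (%p q. tL A (%p' q'. ((p *_A p') *_A x) *_A (q' *_A q)) s) r"
  by (rule tL_env_alg_mult[OF kA r s vsA b[OF x]])
 also have "... = tL A (%p q. (p *_A tL A (%a b. (a *_A x) *_A b) s) *_A q) r"
 proof (rule tl_cong[OF vsA vsA vsA r _ b[OF mh_closed[OF h[OF x] s]]])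
  fix p q assume p: "p : car A" and q: "q : car A"
  have "(p *_A tL A (%a b. (a *_A x) *_A b) s) *_A q = tL A (%a b. (p *_A ((a *_A x) *_A b)) *_A q) s"
   by (rule tl_push[OF vsA vsA vsA vsA b[OF x] _ s, of "%z. (p *_A z) *_A q"]) (intro LM p q)
  also have "... = tL A (%p' q'. ((p *_A p') *_A x) *_A (q' *_A q)) s"
   by (rule tl_cong[OF vsA vsA vsA s], simp add: AA.A.m_assoc p q x, intro LM p q x)
  finally show "tL A (%p' q'. ((p *_A p') *_A x) *_A (q' *_A q)) s = (p *_A tL A (%a b. (a *_A x) *_A b) s) *_A q"
   by simp
 qed
 finally show "(r *_(env_alg K A) s) .*_?M x = r .*_?M (s .*_?M x)" by (simp only: ms)
next
 fix x assume "x : car (twisted_bimodule K A (%a. a))"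
 then have x: "x : car A" by (simp add: twisted_bimodule_def)
 show "1_(env_alg K A) .*_(twisted_bimodule K A (%a. a)) x = x"
  using tl_pure[OF vsA vsA vsA twist_bil[OF mh_id x]] x by (simp add: twisted_bimodule_def sel)
qed

lemma env_flip_flip: "env_flip K A = flip A A"
 by (simp add: env_flip_def env_alg_def flip_def)

text \<open>
 If \<open>\<psi> r\<close> is the index of the class \<open>z r\<close> with respect to the basis \<open>z\<close> of a free \<open>A\<close>-module of
 classes, the left multiplication by elements of \<open>A\<close> determines the twist.
\<close>

lemma twist_from_index:
 assumes \<psi>c: "!!r. r : car (TS A A) ==> \<psi> r : car A"
  and \<psi>_add: "!!r s. r : car (TS A A) ==> s : car (TS A A) ==> \<psi> (r +_(TS A A) s) = \<psi> r +_A \<psi> s"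
  and \<psi>_pure: "!!a. a : car A ==> \<psi> (pt A A 1_A a) = a"
  and \<psi>_mult: "!!r s. r : car (TS A A) ==> s : car (TS A A) ==>
   \<psi> (r *_(env_alg K A) s) = \<psi> (pt A A 1_A (\<psi> r) *_(env_alg K A) s)"
  and bij: "bij_betw (%b. \<psi> (pt A A b 1_A)) (car A) (car A)"
 shows "(%b. \<psi> (pt A A b 1_A)) : alg_aut K A"
  and "r : car (TS A A) ==> m : car A ==>
   \<psi> (pt A A 1_A m *_(env_alg K A) env_flip K A r) = tL A (%a b. (a *_A m) *_A \<psi> (pt A A b 1_A)) r"
proof -
 let ?\<mu> = "%b. \<psi> (pt A A b 1_A)"
 have \<mu>c: "?\<mu> b : car A" if "b : car A" for b by (rule \<psi>c) (simp add: pc that)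
 interpret Q: left_module K "TS A A" by (rule Q)
 have \<psi>_lin: "\<psi> : lin (TS A A) A"
 proof (rule mhI[OF \<psi>c \<psi>_add])
  fix k r assume k: "k : car K" and r: "r : car (TS A A)"
  \<comment> \<open>The action of a scalar is right multiplication by an inner element, so
    homogeneity of \<psi> follows from \<open>\<psi>_mult\<close>.\<close>
  have "k .*_(TS A A) r = r *_(env_alg K A) pt A A 1_A (k .*_A 1_A)"
   using E.smult_mult_right[of k r "1_(env_alg K A)"] E.A.r_one[of r] E.A.one_closed k r
    mh_smult[OF pure_lin2[OF vsA vsA AA.A.one_closed mh_id] k AA.A.one_closed] by (simp add: sel)
  then have "\<psi> (k .*_(TS A A) r) = \<psi> (pt A A 1_A (\<psi> r) *_(env_alg K A) pt A A 1_A (k .*_A 1_A))"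
   using \<psi>_mult[OF r pc[of "1_A" "k .*_A 1_A"]] k by simp
  then show "\<psi> (k .*_(TS A A) r) = k .*_A \<psi> r" using k \<psi>c[OF r] by (simp add: pm \<psi>_pure AA.smult_mult_left)
 qed
 have \<mu>l: "?\<mu> : lin A A" by (rule mh_comp[OF pure_lin1[OF vsA vsA AA.A.one_closed mh_id] \<psi>_lin])
 \<comment> \<open>The tensor is split as (b \<otimes> 1)(1 \<otimes> c). The inner factors multiply
   in reversed order, which puts \<open>c\<close> to the left of the twist of
   \<open>b\<close>.\<close>
 have \<psi>p: "\<psi> (pt A A b c) = c *_A ?\<mu> b" if b: "b : car A" and c: "c : car A" for b c
 proof -
  have "pt A A b c = pt A A b 1_A *_(env_alg K A) pt A A 1_A c" using b c by (simp add: pm)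
  then have "\<psi> (pt A A b c) = \<psi> (pt A A 1_A (?\<mu> b) *_(env_alg K A) pt A A 1_A c)"
   using \<psi>_mult[OF pc[OF b AA.A.one_closed] pc[OF AA.A.one_closed c]] by simp
  then show ?thesis using \<mu>c[OF b] c by (simp add: pm \<psi>_pure)
 qed
 show "?\<mu> : alg_aut K A"
  unfolding alg_aut_def alg_hom_def
 proof (intro CollectI conjI IntI bij \<mu>l ring_hom_memI \<mu>c)
  show "?\<mu> 1_A = 1_A" by (simp add: \<psi>_pure)
  fix b b' assume b: "b : car A" and b': "b' : car A"
  show "?\<mu> (b +_A b') = ?\<mu> b +_A ?\<mu> b'" by (rule mh_add[OF \<mu>l b b'])
  have "pt A A (b *_A b') 1_A = pt A A b 1_A *_(env_alg K A) pt A A b' 1_A" using b b' by (simp add: pm)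
  then have "?\<mu> (b *_A b') = \<psi> (pt A A 1_A (?\<mu> b) *_(env_alg K A) pt A A b' 1_A)"
   using \<psi>_mult[OF pc[OF b AA.A.one_closed] pc[OF b' AA.A.one_closed]] by simp
  then show "?\<mu> (b *_A b') = ?\<mu> b *_A ?\<mu> b'" using \<psi>p[OF b' \<mu>c[OF b]] \<mu>c[OF b] b' by (simp add: pm)
 qed
 assume r: "r : car (TS A A)" and m: "m : car A"
 note tb = twist_bil[OF \<mu>l m]
 show "\<psi> (pt A A 1_A m *_(env_alg K A) env_flip K A r) = tL A (%a b. (a *_A m) *_A ?\<mu> b) r"
  unfolding env_flip_flip
  by (rule tens_eqI[of A A "%r. \<psi> (pt A A 1_A m *_(env_alg K A) flip A A r)" _ "tL A (%a b. (a *_A m) *_A ?\<mu> b)",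
     OF vsA vsA mh_comp[OF m2[OF pc[OF AA.A.one_closed m] flip_lin[OF vsA vsA]] \<psi>_lin] tl_hom[OF vsA vsA vsA tb] vsA _ r])
   (simp add: flip_pure[OF vsA vsA] pm m \<psi>p[OF _ AA.A.m_closed[OF _ m]] tl_pure[OF vsA vsA vsA tb])
qed

private abbreviation "Aenv == env_alg K A"
private abbreviation "Areg == reg (env_alg K A)"
private abbreviation "inner_free P \<delta> d == coh_free Aenv P \<delta> Areg d (car A) (%a x. x *_Aenv pt A A 1_A a)"
private abbreviation "outer_free P \<delta> d == coh_free Aenv P \<delta> Areg d (car A) (%a x. x *_Aenv pt A A a 1_A)"

private lemma RRm: "lmod Aenv Areg" by (rule regular_left_module[OF E.A.ring_axioms])

private lemma RRs: "car Areg = car (TS A A)" "zero Areg = zero (TS A A)" "add Areg = add (TS A A)"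
 by (simp_all add: regular_module_def sel)

lemma right_mult_hom: "a : car (TS A A) ==> (%x. x *_Aenv a) : mhom Aenv Areg Areg"
 by (rule mhI) (simp_all add: regular_module_def E.A.l_distr E.A.m_assoc sel(1)[symmetric])

lemma env_inner_act_hom: "r : car (TS A A) ==> env_inner_act K A r : mhom Aenv Areg Areg"
 unfolding env_inner_act_def env_flip_flip
 by (rule right_mult_hom[OF mh_closed[OF flip_lin[OF vsA vsA]]])

text \<open>The preimage of 1 under \<phi> is a free generator: acting with
  \<open>t \<otimes> 1\<close> is right multiplication of values by \<open>1 \<otimes> t\<close>,
  and \<phi> takes the result to \<open>t \<mu>(1) = t\<close>.\<close>

lemma coh_free_from_iso:
 fixes C :: "nat => (('a, 'x, 'x) tens, 'p) module"
 assumes C: "resolution Aenv (twisted_bimodule K A (%a. a)) C \<gamma> \<eta>" and \<mu>: "\<mu> : alg_aut K A"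
  and \<phi>: "\<phi> : mhom Aenv (hom_cohomology Aenv C \<gamma> Areg (env_inner_act K A) d) (twisted_bimodule K A \<mu>)"
  and bij: "bij_betw \<phi> (car (hom_cohomology Aenv C \<gamma> Areg (env_inner_act K A) d)) (car A)"
 shows "EX z. inner_free C \<gamma> d z"
proof -
 interpret C: resolution Aenv "twisted_bimodule K A (%a. a)" C \<gamma> \<eta> by (rule C)
 let ?H = "hom_cohomology Aenv C \<gamma> Areg (env_inner_act K A) d" and ?Z = "cocs Aenv C \<gamma> Areg d"
 let ?cl = "%f. cobs Aenv C \<gamma> Areg d +>\<^bsub>(hom_module Aenv (C d) Areg (env_inner_act K A))\<lparr>carrier := ?Z\<rparr>\<^esub> f"
 note car = C.hom_cohomology_sel(1)[OF RRm, where act = "env_inner_act K A" and n = d]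
 have "1_A : \<phi> ` car ?H" unfolding bij_betw_imp_surj_on[OF bij] by (rule AA.A.one_closed)
 then obtain X where X': "1_A = \<phi> X" "X : car ?H" by (rule imageE)
 note X = X'(2) X'(1)[symmetric]
 from X(1) obtain z where z: "z : ?Z" "X = ?cl z" unfolding car by blast
 have \<mu>l: "\<mu> : lin A A" and \<mu>1: "\<mu> 1_A = 1_A"
  using \<mu> ring_hom_one[of \<mu> A A] by (auto simp: alg_aut_def alg_hom_def)
 have zc: "(\<lambda>x\<in>car (C d). z x *_Aenv pt A A 1_A t) : ?Z" if "t : car A" for t
  by (rule C.cocycles_act[OF RRm z(1), of "%x. x *_Aenv pt A A 1_A t"], rule right_mult_hom[OF pc[OF AA.A.one_closed that]])
 have \<phi>z: "\<phi> (?cl (\<lambda>x\<in>car (C d). z x *_Aenv pt A A 1_A t)) = t" if t: "t : car A" for t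
 proof -
  note p = pc[OF t AA.A.one_closed]
  have "pt A A t 1_A .*_?H X = ?cl (\<lambda>x\<in>car (C d). env_inner_act K A (pt A A t 1_A) (z x))"
   unfolding z(2) by (rule C.hom_cohomology_smult[where act = "env_inner_act K A" and s = "pt A A t 1_A", OF RRm z(1) env_inner_act_hom[OF p]])
  also have "... = ?cl (\<lambda>x\<in>car (C d). z x *_Aenv pt A A 1_A t)"
   by (simp add: env_inner_act_def env_flip_flip flip_pure[OF vsA vsA] t)
  finally have "\<phi> (?cl (\<lambda>x\<in>car (C d). z x *_Aenv pt A A 1_A t)) = pt A A t 1_A .*_(twisted_bimodule K A \<mu>) 1_A"
   using mh_smult[OF \<phi> _ X(1), of "pt A A t 1_A"] p X(2) by (simp add: sel)
  also have "... = t"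
   using tl_pure[OF vsA vsA vsA twist_bil[OF \<mu>l AA.A.one_closed] t AA.A.one_closed] t by (simp add: twisted_bimodule_def \<mu>1)
  finally show ?thesis .
 qed
 have "inner_free C \<gamma> d z"
  unfolding coh_free_def
 proof (intro conjI ballI z(1))
  fix f assume f: "f : ?Z"
  have fc: "?cl f : car ?H" unfolding car using f by blast
  have zt: "?cl (\<lambda>x\<in>car (C d). z x *_Aenv pt A A 1_A t) : car ?H" if "t : car A" for t
   unfolding car using zc[OF that] by blast
  have iff: "(\<lambda>x\<in>car (C d). f x -_Areg z x *_Aenv pt A A 1_A t) : cobs Aenv C \<gamma> Areg d \<longleftrightarrow> \<phi> (?cl f) = t"
   if t: "t : car A" for t
  proof -
   have "(\<lambda>x\<in>car (C d). f x -_Areg z x *_Aenv pt A A 1_A t) =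
    (\<lambda>x\<in>car (C d). f x -_Areg (\<lambda>x\<in>car (C d). z x *_Aenv pt A A 1_A t) x)" by (rule restrict_ext) simp
   then have "(\<lambda>x\<in>car (C d). f x -_Areg z x *_Aenv pt A A 1_A t) : cobs Aenv C \<gamma> Areg d \<longleftrightarrow>
    ?cl f = ?cl (\<lambda>x\<in>car (C d). z x *_Aenv pt A A 1_A t)"
    using C.cls_eq_iff[OF RRm f zc[OF t], of "env_inner_act K A"] by simp
   also have "... \<longleftrightarrow> \<phi> (?cl f) = t"
    using inj_on_eq_iff[OF bij_betw_imp_inj_on[OF bij] fc zt[OF t]] \<phi>z[OF t] by simp
   finally show ?thesis .
  qed
  have fA: "\<phi> (?cl f) : car A" using bij fc by (auto simp: bij_betw_def)
  show "EX! t. t : car A & (\<lambda>x\<in>car (C d). f x -_Areg z x *_Aenv pt A A 1_A t) : cobs Aenv C \<gamma> Areg d"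
   by (rule ex1I[of _ "\<phi> (?cl f)"]) (use iff fA in auto)
 qed
 then show ?thesis by blast
qed

text \<open>The inner coordinate \<open>ix\<close> of a class is the isomorphism. The index
  \<open>\<psi> r\<close> of the class of \<open>z\<close> multiplied by \<open>r\<close> gives the
  twist at \<open>r = b \<otimes> 1\<close>, and freeness over the outer copy, for the same
  \<open>z\<close>, says that this twist is bijective.\<close>

lemma iso_from_cohomology_free:
 fixes C :: "nat => (('a, 'x, 'x) tens, 'p) module"
 assumes C: "resolution Aenv (twisted_bimodule K A (%a. a)) C \<gamma> \<eta>"
  and free1: "inner_free C \<gamma> d z"
  and free2: "outer_free C \<gamma> d z"
 shows "EX \<mu>:alg_aut K A. EX \<phi>:mhom Aenv (hom_cohomology Aenv C \<gamma> Areg (env_inner_act K A) d) (twisted_bimodule K A \<mu>).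
  bij_betw \<phi> (car (hom_cohomology Aenv C \<gamma> Areg (env_inner_act K A) d)) (car A)"
proof -
 interpret C: resolution Aenv "twisted_bimodule K A (%a. a)" C \<gamma> \<eta> by (rule C)
 let ?H = "hom_cohomology Aenv C \<gamma> Areg (env_inner_act K A) d" and ?Z = "cocs Aenv C \<gamma> Areg d"
 let ?cl = "%f. cobs Aenv C \<gamma> Areg d +>\<^bsub>(hom_module Aenv (C d) Areg (env_inner_act K A))\<lparr>carrier := ?Z\<rparr>\<^esub> f"
 note car = C.hom_cohomology_sel(1)[OF RRm, where act = "env_inner_act K A" and n = d]
 note cle = C.cls_eq_iff[OF RRm, where act = "env_inner_act K A" and n = d]
 have z: "z : ?Z" using free1 by (simp add: coh_free_def)
 define zr where "zr r = (\<lambda>x\<in>car (C d). z x *_Aenv r)" for r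
 have ac: "(\<lambda>x\<in>car (C d). f x *_Aenv r) : ?Z" if "f : ?Z" "r : car (TS A A)" for f r
  by (rule C.cocycles_act[OF RRm that(1) right_mult_hom[OF that(2)]])
 have zc: "zr r : ?Z" if "r : car (TS A A)" for r unfolding zr_def by (rule ac[OF z that])
 note zx = C.cocycle_closed[OF RRm z, unfolded RRs]
 have res: "(\<lambda>x\<in>car (C d). f x -_Areg z x *_Aenv r) = (\<lambda>x\<in>car (C d). f x -_Areg zr r x)" for f r
  by (rule restrict_ext) (simp add: zr_def)
 note p1 = pc[OF AA.A.one_closed] and p2 = pc[OF _ AA.A.one_closed]
 have U1: "EX! a. a : car A & ?cl f = ?cl (zr (pt A A 1_A a))" if f: "f : ?Z" for f
  using free1 f cle[OF f zc[OF p1]] by (simp add: coh_free_def res cong: conj_cong)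
 have U2: "EX! a. a : car A & ?cl f = ?cl (zr (pt A A a 1_A))" if f: "f : ?Z" for f
  using free2 f cle[OF f zc[OF p2]] by (simp add: coh_free_def res cong: conj_cong)
 define ix where "ix X = (THE a. a : car A & X = ?cl (zr (pt A A 1_A a)))" for X
 have ix: "ix (?cl f) : car A" "?cl f = ?cl (zr (pt A A 1_A (ix (?cl f))))" if "f : ?Z" for f
  using theI'[OF U1[OF that]] by (auto simp: ix_def)
 have ixu: "ix (?cl f) = a" if "f : ?Z" "a : car A" "?cl f = ?cl (zr (pt A A 1_A a))" for f a
  using U1[OF that(1)] ix[OF that(1)] that(2,3) by blast
 \<comment> \<open>Right multiplication of values preserves coboundaries, so it is well defined on
   classes.\<close>
 have cla: "?cl (\<lambda>x\<in>car (C d). f x *_Aenv r) = ?cl (\<lambda>x\<in>car (C d). g x *_Aenv r)"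
  if f: "f : ?Z" and g: "g : ?Z" and r: "r : car (TS A A)" and e: "?cl f = ?cl g" for f g r
 proof -
  have "(\<lambda>x\<in>car (C d). (\<lambda>x\<in>car (C d). f x -_Areg g x) x *_Aenv r) : cobs Aenv C \<gamma> Areg d"
   using C.coboundaries_image[OF RRm _ right_mult_hom[OF r]] e cle[OF f g] by blast
  moreover have "(\<lambda>x\<in>car (C d). (\<lambda>x\<in>car (C d). f x -_Areg g x) x *_Aenv r) =
   (\<lambda>x\<in>car (C d). (\<lambda>x\<in>car (C d). f x *_Aenv r) x -_Areg (\<lambda>x\<in>car (C d). g x *_Aenv r) x)"
  proof (rule restrict_ext)
   fix x assume x: "x : car (C d)"
   interpret Areg: left_module Aenv Areg by (rule RRm)
   show "(\<lambda>x\<in>car (C d). f x -_Areg g x) x *_Aenv r = (\<lambda>x\<in>car (C d). f x *_Aenv r) x -_Areg (\<lambda>x\<in>car (C d). g x *_Aenv r) x"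
    using mh_diff[OF right_mult_hom[OF r] Areg.abelian_group_axioms Areg.abelian_group_axioms
     C.cocycle_closed[OF RRm f x] C.cocycle_closed[OF RRm g x]] x by simp
  qed
  ultimately show ?thesis using cle[OF ac[OF f r] ac[OF g r]] by simp
 qed
 have zrm: "(\<lambda>x\<in>car (C d). zr r x *_Aenv s) = zr (r *_Aenv s)" if "r : car (TS A A)" "s : car (TS A A)" for r s
  unfolding zr_def by (rule restrict_ext) (use that zx in \<open>simp add: E.A.m_assoc sel(1)\<close>)
 have cladd: "?cl (zr r) +_?H ?cl (zr s) = ?cl (zr (r +_(TS A A) s))" if "r : car (TS A A)" "s : car (TS A A)" for r s
 proof -
  have "(\<lambda>x\<in>car (C d). zr r x +_Areg zr s x) = zr (r +_(TS A A) s)"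
   unfolding zr_def by (rule restrict_ext) (use that zx E.A.r_distr in \<open>simp add: RRs sel\<close>)
  then show ?thesis using C.hom_cohomology_add[OF RRm zc[OF that(1)] zc[OF that(2)], of "env_inner_act K A"] by simp
 qed
 define \<psi> where "\<psi> r = ix (?cl (zr r))" for r
 note em = E.A.m_closed[unfolded sel(1)] and ea = E.A.a_closed[unfolded sel(1,3)]
 have \<psi>c: "\<psi> r : car A" and \<psi>e: "?cl (zr r) = ?cl (zr (pt A A 1_A (\<psi> r)))" if "r : car (TS A A)" for r
  unfolding \<psi>_def by (rule ix[OF zc[OF that]])+
 have \<psi>u: "\<psi> r = a" if "r : car (TS A A)" "a : car A" "?cl (zr r) = ?cl (zr (pt A A 1_A a))" for r a
  unfolding \<psi>_def by (rule ixu[OF zc[OF that(1)] that(2,3)])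
 have p1add: "pt A A 1_A (a +_A b) = pt A A 1_A a +_(TS A A) pt A A 1_A b" if "a : car A" "b : car A" for a b
  by (rule mh_add[OF pure_lin2[OF vsA vsA AA.A.one_closed mh_id] that])
 have 1: "\<psi> (r +_(TS A A) s) = \<psi> r +_A \<psi> s" if r: "r : car (TS A A)" and s: "s : car (TS A A)" for r s
 proof (rule \<psi>u[OF ea[OF r s]])
  show "\<psi> r +_A \<psi> s : car A" using \<psi>c r s by simp
  show "?cl (zr (r +_(TS A A) s)) = ?cl (zr (pt A A 1_A (\<psi> r +_A \<psi> s)))"
   unfolding p1add[OF \<psi>c[OF r] \<psi>c[OF s]] cladd[OF r s, symmetric] cladd[OF p1[OF \<psi>c[OF r]] p1[OF \<psi>c[OF s]], symmetric]
   using \<psi>e[OF r] \<psi>e[OF s] by simp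
 qed
 have 2: "\<psi> (pt A A 1_A a) = a" if "a : car A" for a by (rule \<psi>u[OF p1[OF that] that refl])
 have 3: "\<psi> (r *_Aenv s) = \<psi> (pt A A 1_A (\<psi> r) *_Aenv s)" if r: "r : car (TS A A)" and s: "s : car (TS A A)" for r s
 proof -
  have "?cl (zr (r *_Aenv s)) = ?cl (zr (pt A A 1_A (\<psi> r) *_Aenv s))"
   using cla[OF zc[OF r] zc[OF p1[OF \<psi>c[OF r]]] s \<psi>e[OF r]] unfolding zrm[OF r s] zrm[OF p1[OF \<psi>c[OF r]] s] .
  then show ?thesis by (simp only: \<psi>_def)
 qed
 have 4: "bij_betw (%b. \<psi> (pt A A b 1_A)) (car A) (car A)"
  unfolding bij_betw_def
 proof (intro conjI inj_onI equalityI subsetI)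
  fix b b' assume b: "b : car A" "b' : car A" and e: "\<psi> (pt A A b 1_A) = \<psi> (pt A A b' 1_A)"
  have "?cl (zr (pt A A b 1_A)) = ?cl (zr (pt A A b' 1_A))"
   using \<psi>e[OF p2[OF b(1)]] \<psi>e[OF p2[OF b(2)]] e by simp
  then show "b = b'" using U2[OF zc[OF p2[OF b(1)]]] b by blast
 next
  fix a assume a: "a : car A"
  obtain b where "b : car A" "?cl (zr (pt A A 1_A a)) = ?cl (zr (pt A A b 1_A))"
   using U2[OF zc[OF p1[OF a]]] by blast
  then show "a : (%b. \<psi> (pt A A b 1_A)) ` car A"
   using \<psi>u[OF p2 a] by (intro image_eqI[of _ _ b]) simp_all
 qed (use \<psi>c p2 in blast)
 let ?\<mu> = "%b. \<psi> (pt A A b 1_A)"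
 have tw1: "?\<mu> : alg_aut K A"
  by (rule twist_from_index(1)[of \<psi>]) (fact \<psi>c 1 2 3 4)+
 have tw2: "\<psi> (pt A A 1_A m *_Aenv env_flip K A r) = tL A (%a b. (a *_A m) *_A ?\<mu> b) r"
  if "r : car (TS A A)" "m : car A" for r m
  by (rule twist_from_index(2)[of \<psi>]) (fact \<psi>c 1 2 3 4 that)+
 have \<phi>: "ix : mhom Aenv ?H (twisted_bimodule K A ?\<mu>)"
 proof (rule mhI)
  have ms: "car (twisted_bimodule K A ?\<mu>) = car A" "add (twisted_bimodule K A ?\<mu>) = add A"
   "r .*_(twisted_bimodule K A ?\<mu>) m = tL A (%a b. (a *_A m) *_A ?\<mu> b) r" for r m
   by (simp_all add: twisted_bimodule_def)
  fix X assume "X : car ?H"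
  then obtain f where f: "f : ?Z" "X = ?cl f" unfolding car by blast
  note i = ix[OF f(1), folded f(2)]
  show "ix X : car (twisted_bimodule K A ?\<mu>)" using i by (simp add: ms)
  show "ix (X +_?H Y) = ix X +_(twisted_bimodule K A ?\<mu>) ix Y" if "Y : car ?H" for Y
  proof -
   obtain g where g: "g : ?Z" "Y = ?cl g" using \<open>Y : car ?H\<close> unfolding car by blast
   note j = ix[OF g(1), folded g(2)]
   have "X +_?H Y = ?cl (zr (pt A A 1_A (ix X))) +_?H ?cl (zr (pt A A 1_A (ix Y)))" using i(2) j(2) by simp
   also have "... = ?cl (zr (pt A A 1_A (ix X +_A ix Y)))"
    unfolding p1add[OF i(1) j(1)] by (rule cladd[OF p1[OF i(1)] p1[OF j(1)]])
   finally show ?thesis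
    using ixu[OF zc[OF p1[OF AA.A.a_closed[OF i(1) j(1)]]] AA.A.a_closed[OF i(1) j(1)] refl] by (simp add: ms)
  qed
  fix r assume "r : car Aenv"
  then have r: "r : car (TS A A)" by (simp add: sel)
  have fr: "env_flip K A r : car (TS A A)" unfolding env_flip_flip by (rule mh_closed[OF flip_lin[OF vsA vsA] r])
  have "r .*_?H X = ?cl (\<lambda>x\<in>car (C d). env_inner_act K A r (f x))"
   unfolding f(2) by (rule C.hom_cohomology_smult[where act = "env_inner_act K A" and s = r, OF RRm f(1) env_inner_act_hom[OF r]])
  also have "... = ?cl (\<lambda>x\<in>car (C d). f x *_Aenv env_flip K A r)" by (simp only: env_inner_act_def)
  also have "... = ?cl (\<lambda>x\<in>car (C d). zr (pt A A 1_A (ix X)) x *_Aenv env_flip K A r)"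
   by (rule cla[OF f(1) zc[OF p1[OF i(1)]] fr trans[OF f(2)[symmetric] i(2)]])
  also have "... = ?cl (zr (pt A A 1_A (ix X) *_Aenv env_flip K A r))" by (simp only: zrm[OF p1[OF i(1)] fr])
  finally have "ix (r .*_?H X) = \<psi> (pt A A 1_A (ix X) *_Aenv env_flip K A r)" by (simp only: \<psi>_def)
  then show "ix (r .*_?H X) = r .*_(twisted_bimodule K A ?\<mu>) ix X" by (simp only: ms tw2[OF r i(1)])
 qed
 have "bij_betw ix (car ?H) (car A)"
  unfolding bij_betw_def
 proof (rule conjI, rule inj_onI)
  fix X Y assume "X : car ?H" "Y : car ?H" and e: "ix X = ix Y"
  then obtain f g where f: "f : ?Z" "X = ?cl f" and g: "g : ?Z" "Y = ?cl g" unfolding car by blast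
  show "X = Y" using ix(2)[OF f(1), folded f(2)] ix(2)[OF g(1), folded g(2)] e by simp
 next
  show "ix ` car ?H = car A"
  proof (intro equalityI subsetI)
   fix a assume "a : ix ` car ?H"
   then show "a : car A" unfolding car using ix(1) by blast
  next
   fix a assume a: "a : car A"
   have "ix (?cl (zr (pt A A 1_A a))) = a" by (rule ixu[OF zc[OF p1[OF a]] a refl])
   moreover have "?cl (zr (pt A A 1_A a)) : car ?H" unfolding car by (rule imageI[OF zc[OF p1[OF a]]])
   ultimately show "a : ix ` car ?H" by (rule image_eqI[OF sym])
  qed
 qed
 with \<phi> tw1 show ?thesis by blast
qed

section \<open>Comparison with the chosen resolution\<close>

private abbreviation "Abim == twisted_bimodule K A (%a. a)"

text \<open>The choice inside \<open>Ext\<close> ranges over complexes in one fixed type, so it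
  picks a resolution as soon as some resolution lives in that type. \<open>P\<close> is the
  witness.\<close>

lemma Ext_env_resolution:
 fixes P :: "nat => (('a, 'x, 'x) tens, (('a, 'x, 'x) tens, 'x) resolution_elem) module"
 assumes "projective_resolution Aenv Abim P \<delta> \<epsilon>"
 shows "EX (C :: nat => (('a, 'x, 'x) tens, (('a, 'x, 'x) tens, 'x) resolution_elem) module) \<gamma> \<eta>.
  resolution Aenv Abim C \<gamma> \<eta> & (ALL i. Ext_env K A i = hom_cohomology Aenv C \<gamma> Areg (env_inner_act K A) i)"
proof -
 define C where "C = (SOME C :: (nat => (('a, 'x, 'x) tens, (('a, 'x, 'x) tens, 'x) resolution_elem) module) \<times> _.
  EX \<epsilon>. projective_resolution Aenv Abim (fst C) (snd C) \<epsilon>)"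
 have "EX \<epsilon>. projective_resolution Aenv Abim (fst (P, \<delta>)) (snd (P, \<delta>)) \<epsilon>" using assms by auto
 then have "EX \<epsilon>. projective_resolution Aenv Abim (fst C) (snd C) \<epsilon>" unfolding C_def by (rule someI)
 then obtain \<eta> where "projective_resolution Aenv Abim (fst C) (snd C) \<eta>" by blast
 then have "resolution Aenv Abim (fst C) (snd C) \<eta>"
  by (intro resolution.intro resolution_axioms.intro bimodule_left_module)
 moreover have "Ext_env K A i = hom_cohomology Aenv (fst C) (snd C) Areg (env_inner_act K A) i" for i
  by (simp add: Ext_env_def Ext_def C_def Let_def)
 ultimately show ?thesis by blast
qed

text \<open>Ext is defined by a chosen resolution about which nothing is known; the comparison moves
  its cohomology to any given one, in particular to a bounded one with finitely generated
  terms.\<close>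

lemma twisted_CY_cohomology:
 fixes P :: "nat => (('a, 'x, 'x) tens, 'p) module"
 assumes cy: "twisted_CY K A d" and P: "resolution Aenv Abim P \<delta> \<epsilon>"
 shows "EX z. (ALL n. n ~= d --> exact_at Aenv P \<delta> Areg n) &
  inner_free P \<delta> d z"
proof -
 obtain Q :: "nat => (('a, 'x, 'x) tens, (('a, 'x, 'x) tens, 'x) resolution_elem) module" and \<beta> \<zeta>
  where "projective_resolution Aenv Abim Q \<beta> \<zeta>"
  using cy by (auto simp: twisted_CY_def homologically_smooth_def)
 then obtain C \<gamma> \<eta> where C: "resolution Aenv Abim C \<gamma> \<eta>"
  and ext: "!!i. Ext_env K A i = hom_cohomology Aenv C \<gamma> Areg (env_inner_act K A) i"
  using Ext_env_resolution by blast
 obtain \<mu> \<phi> where \<mu>: "\<mu> : alg_aut K A" and van: "!!i. i ~= d ==> car (Ext_env K A i) = {0_(Ext_env K A i)}"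
  and \<phi>: "\<phi> : mhom Aenv (Ext_env K A d) (twisted_bimodule K A \<mu>)" "bij_betw \<phi> (car (Ext_env K A d)) (car A)"
  using cy by (auto simp: twisted_CY_def)
 obtain z where z: "inner_free C \<gamma> d z"
  using coh_free_from_iso[OF C \<mu> \<phi>[unfolded ext]] by blast
 have van': "exact_at Aenv C \<gamma> Areg n" if "n ~= d" for n
  using van[OF that] resolution.hom_cohomology_trivial[OF C RRm, of "env_inner_act K A" n] by (simp add: ext)
 have act: "(%x. x *_Aenv pt A A 1_A a) : mhom Aenv Areg Areg" if "a : car A" for a
  by (rule right_mult_hom[OF pc[OF AA.A.one_closed that]])
 show ?thesis
 proof (rule resolution_independence[OF C P RRm])
  fix T
  assume 1: "!!n. exact_at Aenv C \<gamma> Areg n ==> exact_at Aenv P \<delta> Areg n"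
   and 2: "!!n (S :: 'x set) act z. (!!s. s : S ==> act s : mhom Aenv Areg Areg) ==>
    coh_free Aenv C \<gamma> Areg n S act z ==> coh_free Aenv P \<delta> Areg n S act (T n z)"
  show ?thesis
   using 1[OF van'] 2[OF act z] by blast
 qed
qed

text \<open>The way back to the chosen resolution. Both freeness statements concern one class, and
  the transport keeps it common to both.\<close>

lemma twisted_CY_from_cohomology:
 fixes P :: "nat => (('a, 'x, 'x) tens, 'p) module"
 assumes smooth: "homologically_smooth K A" and P: "resolution Aenv Abim P \<delta> \<epsilon>"
  and van: "!!n. n ~= d ==> exact_at Aenv P \<delta> Areg n"
  and free1: "inner_free P \<delta> d z"
  and free2: "outer_free P \<delta> d z"
 shows "twisted_CY K A d"
proof -
 obtain Q :: "nat => (('a, 'x, 'x) tens, (('a, 'x, 'x) tens, 'x) resolution_elem) module" and \<beta> \<zeta>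
  where "projective_resolution Aenv Abim Q \<beta> \<zeta>"
  using smooth by (auto simp: homologically_smooth_def)
 then obtain C \<gamma> \<eta> where C: "resolution Aenv Abim C \<gamma> \<eta>"
  and ext: "!!i. Ext_env K A i = hom_cohomology Aenv C \<gamma> Areg (env_inner_act K A) i"
  using Ext_env_resolution by blast
 note p1 = right_mult_hom[OF pc[OF AA.A.one_closed]] and p2 = right_mult_hom[OF pc[OF _ AA.A.one_closed]]
 have "EX w. (ALL n. n ~= d --> exact_at Aenv C \<gamma> Areg n) &
  inner_free C \<gamma> d w &
  outer_free C \<gamma> d w"
 proof (rule resolution_independence[OF P C RRm])
  fix T
  assume 1: "!!n. exact_at Aenv P \<delta> Areg n ==> exact_at Aenv C \<gamma> Areg n"
   and 2: "!!n (S :: 'x set) act z. (!!s. s : S ==> act s : mhom Aenv Areg Areg) ==>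
    coh_free Aenv P \<delta> Areg n S act z ==> coh_free Aenv C \<gamma> Areg n S act (T n z)"
  show ?thesis
   using 1[OF van] 2[OF p1 free1] 2[OF p2 free2] by blast
 qed
 then obtain w where van': "!!n. n ~= d ==> exact_at Aenv C \<gamma> Areg n"
  and w1: "inner_free C \<gamma> d w"
  and w2: "outer_free C \<gamma> d w" by blast
 have "car (Ext_env K A i) = {0_(Ext_env K A i)}" if "i ~= d" for i
  unfolding ext resolution.hom_cohomology_trivial[OF C RRm] by (rule van'[OF that])
 moreover obtain \<mu> \<phi> where "\<mu> : alg_aut K A" "\<phi> : mhom Aenv (Ext_env K A d) (twisted_bimodule K A \<mu>)"
  "bij_betw \<phi> (car (Ext_env K A d)) (car A)"
  using iso_from_cohomology_free[OF C w1 w2] unfolding ext by blast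
 ultimately show ?thesis
  unfolding twisted_CY_def using kA smooth by blast
qed

end

end

section \<open>Transfer from the Hopf algebra to the Galois object\<close>

context gdata
begin

interpretation AA: k_algebra K A by (rule kA)

abbreviation "Ae == env_alg K A"
abbreviation "MH == twisted_bimodule K H (%h. h)"
abbreviation "MA == twisted_bimodule K A (%a. a)"

lemmas vsA = alg_vs[OF kA]
lemmas kAe = env_alg_algebra[OF kA]
lemmas selA = env_alg_sel[OF kA]
lemmas selH = env_alg_sel[OF kH]

interpretation E: k_algebra K Ae by (rule kAe)
interpretation EH: k_algebra K He by (rule kHe)

lemma MA_sel: "car MA = car A" "add MA = add A" "zero MA = zero A"
 "r .*_MA m = tL A (%a b. (a *_A m) *_A b) r"
 by (simp_all add: twisted_bimodule_def)

lemma MH_sel: "car MH = car H" "add MH = add H" "zero MH = zero H"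
 "r .*_MH m = tL H (%a b. (a *_H m) *_H b) r"
 by (simp_all add: twisted_bimodule_def)

lemmas MA_module = bimodule_left_module[OF kA]
lemmas MH_module = bimodule_left_module[OF kH]

interpretation MA: left_module Ae MA by (rule MA_module)
interpretation MH: left_module He MH by (rule MH_module)

lemma MA_pure: "a : car A ==> b : car A ==> m : car A ==> pt A A a b .*_MA m = (a *_A m) *_A b"
 unfolding MA_sel by (rule tl_pure[OF vsA vsA vsA twist_bil[OF kA mh_id]])

lemma MH_pure: "a : car H ==> b : car H ==> m : car H ==> pt H H a b .*_MH m = (a *_H m) *_H b"
 unfolding MH_sel by (rule tl_pure[OF vsH vsH vsH twist_bil[OF kH mh_id]])

text \<open>On the bimodule \<open>H\<close> the counit sees the enveloping algebra only through
  \<open>bar\<close>, as it is multiplicative. So \<epsilon> composed with the augmentation is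
  compatible with the first base change.\<close>

lemma \<epsilon>_action:
 assumes r: "r : car (TS H H)" and h: "h : car H"
 shows "\<epsilon> (r .*_MH h) = \<epsilon> (bar r) \<otimes> \<epsilon> h"
proof -
 note b = twist_bil[OF kH mh_id h]
 have l: "(%r. \<epsilon> (bar r) \<otimes> \<epsilon> h) : lin (TS H H) (reg K)"
  using scalar_lin[OF vs_regular _ mh_comp[OF bar_lin \<epsilon>_lin], of "\<epsilon> h"] \<epsilon>c[OF h] by simp
 show ?thesis
  unfolding MH_sel
 proof (rule tens_eqI[OF vsH vsH mh_comp[OF tl_hom[OF vsH vsH vsH b] \<epsilon>_lin] l vs_regular _ r])
  fix a c assume a: "a : car H" and c: "c : car H"
  have "\<epsilon> (\<epsilon> c .*_H a) = \<epsilon> c \<otimes> \<epsilon> a" using mh_smult[OF \<epsilon>_lin \<epsilon>c[OF c] a] by simp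
  then show "\<epsilon> (tL H (%a b. (a *_H h) *_H b) (pt H H a c)) = \<epsilon> (bar (pt H H a c)) \<otimes> \<epsilon> h"
   using a c h by (simp add: tl_pure[OF vsH vsH vsH b] \<epsilon>_mult bar_pure \<epsilon>c K.m_ac)
 qed
qed

text \<open>The two base changes as one ring homomorphism between enveloping algebras.\<close>

definition kb :: "('a, 'h, 'h) tens => ('a, 'x, 'x) tens" where
 "kb r = \<kappa> (bar r)"

lemma \<kappa>_ring_hom: "\<kappa> : ring_hom H Ae" and \<kappa>_lin: "\<kappa> : lin H (TS A A)"
 using \<kappa>_alg_hom by (simp_all add: alg_hom_def env_alg_lin[OF kA])

lemma kb_ring_hom: "kb : ring_hom He Ae"
 unfolding kb_def[abs_def] using ring_hom_trans[OF bar_ring_hom \<kappa>_ring_hom] by (simp add: comp_def)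

lemma kb_zero: "kb 0_He = 0_Ae"
 by (rule ring_hom_additive(1)[OF kb_ring_hom alg_ring[OF kHe] alg_ring[OF kAe]])

text \<open>The product of the two legs of \<kappa>(h) is \<epsilon>(h), so on multiples of 1 in the
  bimodule \<open>A\<close> the algebra \<open>H\<close> acts through \<epsilon>.\<close>

lemma kb_action:
 assumes r: "r : car (TS H H)" and k: "k : car K"
 shows "kb r .*_MA (k .*_A 1_A) = (\<epsilon> (bar r) \<otimes> k) .*_A 1_A"
proof -
 note br = mh_closed[OF bar_lin r]
 note kr = mh_closed[OF \<kappa>_lin br]
 interpret V: left_module K A by (rule vsA)
 have m: "bil K A A A (%x y. x *_A y)" by (intro bilI mult_lin1[OF kA] mult_lin2[OF kA] mh_id)
 have m': "bil K A A A (%x y. k .*_A (x *_A y))"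
  by (intro bilI smult_lin[OF vsA k] mult_lin1[OF kA] mult_lin2[OF kA] mh_id)
 have "kb r .*_MA (k .*_A 1_A) = tL A (%a b. k .*_A (a *_A b)) (\<kappa> (bar r))"
  unfolding MA_sel kb_def by (rule tl_cong[OF vsA vsA vsA kr _ m']) (simp add: k AA.smult_mult_left AA.smult_mult_right)
 also have "... = k .*_A tL A (%a b. a *_A b) (\<kappa> (bar r))"
  by (rule tl_push[OF vsA vsA vsA vsA m smult_lin[OF vsA k mh_id] kr, symmetric])
 also have "... = (\<epsilon> (bar r) \<otimes> k) .*_A 1_A"
  unfolding \<kappa>_augmented[OF br] using V.smult_assoc[of k "\<epsilon> (bar r)" "1_A"] k \<epsilon>c[OF br] by (simp add: K.m_comm)
 finally show ?thesis .
qed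

lemma env_one_nonzero: "1_Ae ~= 0_Ae"
proof
 assume e: "1_Ae = 0_Ae"
 have "a = 0_A" if "a : car A" for a
  using MA.smult_one[of a] MA.smult_zero_left[of a] that unfolding e by (simp only: MA_sel)
 then show False using A_nonzero by auto
qed

text \<open>By descent and ascent the homology of the image matrices is concentrated in degree 0 and
  parametrized by \<open>A\<close>. An augmentation that sends the generating class to 1 identifies
  it with the bimodule \<open>A\<close>. The index sets stay the same, so the dual complexes can be
  compared entry by entry.\<close>

lemma transfer_resolution:
 fixes I :: "nat => 'i set"
 assumes PR: "presented He MH P \<delta> \<eta> I \<iota> \<pi>" and bnd: "!!n. L < n ==> car (P n) = {0_(P n)}"
 obtains P' \<delta>' \<eta>' \<pi>' where "presented Ae MA P' \<delta>' \<eta>' I (%n x. x) \<pi>'"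
  "!!n. fin_generated Ae (P' n)" "!!n. L < n ==> car (P' n) = {0_(P' n)}"
  "!!n i j. i : I n ==> presented.E Ae (%n x. x) \<pi>' n i j = kb (presented.E He \<iota> \<pi> n i j)"
  "!!n i j. i : I (Suc n) ==> presented.D Ae \<delta>' (%n x. x) \<pi>' n i j = kb (presented.D He \<delta> \<iota> \<pi> n i j)"
proof -
 interpret PR: presented He MH P \<delta> \<eta> I \<iota> \<pi> by (rule PR)
 have "1_H : \<eta> ` car (P 0)" unfolding PR.\<epsilon>_surj MH_sel by (rule HA.A.one_closed)
 then obtain q where q: "1_H = \<eta> q" "q : car (P 0)" by (rule imageE)
 \<comment> \<open>The bimodule \<open>H\<close> is free on 1 over its inner copy, which is the
   freeness that descent asks for.\<close>
 have free0: "hfree He I PR.E PR.D 0 (car H) (%t. pt H H 1_H t) (\<iota> 0 q)"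
 proof (rule PR.hfree_0[OF q(2)])
  show "pt H H 1_H s : car He" if "s : car H" for s using that by (simp add: selH pure_closed[OF vsH vsH])
  fix m assume "m : car MH"
  then have m: "m : car H" by (simp add: MH_sel)
  have "pt H H 1_H s .*_MH \<eta> q = s" if "s : car H" for s using that by (simp add: q(1)[symmetric] MH_pure)
  then show "EX! s. s : car H & m = pt H H 1_H s .*_MH \<eta> q" using m by auto
 qed
 note free1 = env_descent[OF PR.mat_complex free0]
 note mc1 = mat_complex.base_change(1)[OF PR.mat_complex bar_ring_hom alg_ring[OF kH]]
 let ?E = "%n i j. kb (PR.E n i j)" and ?D = "%n i j. kb (PR.D n i j)" and ?Z = "%i. kb (\<iota> 0 q i)"
 interpret M: mat_complex Ae I ?E ?D
  by (rule mat_complex.base_change(1)[OF PR.mat_complex kb_ring_hom alg_ring[OF kAe]])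
 have "EX emb. (ALL a:car A. emb a : car Ae & emb a .*_MA 1_A = a) & emb 0_A = 0_Ae & hfree Ae I ?E ?D 0 (car A) emb ?Z"
 proof -
  have "hfree Ae I ?E ?D 0 (car A) emb ?Z"
   if emb: "emb : lin A (TS A A)" and bij: "param H A (%h a. emb a *_Ae \<kappa> h)" for emb
  proof -
   have tE: "tL Ae = (tL (TS A A) :: ('h => 'x => _) => _)" by (simp add: env_alg_def)
   show ?thesis
    unfolding kb_def
    by (rule tensor_ascent[OF kH kAe vsA H_one_nonzero \<kappa>_alg_hom _ _ mc1 free1])
     (use emb bij in \<open>simp_all add: env_alg_lin[OF kA] selA tE\<close>)
  qed
  note r = this
  have l0: "emb 0_A = 0_Ae" if "emb : lin A (TS A A)" for emb
   using mh_zero[OF that AA.A.abelian_group_axioms left_module.axioms(2)[OF TS_module[OF vsA vsA]]] by (simp add: selA)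
  note l1 = pure_lin2[OF vsA vsA AA.A.one_closed mh_id] and l2 = pure_lin1[OF vsA vsA AA.A.one_closed mh_id]
  from bij_left show ?thesis
  proof
   assume b: "param H A (%h a. pt A A 1_A a *_Ae \<kappa> h)"
   show ?thesis
    by (rule exI[of _ "%a. pt A A 1_A a"])
     (use r[OF l1 b] l0[OF l1] in \<open>simp add: selA pure_closed[OF vsA vsA] MA_pure\<close>)
  next
   assume b: "param H A (%h a. pt A A a 1_A *_Ae \<kappa> h)"
   show ?thesis
    by (rule exI[of _ "%a. pt A A a 1_A"])
     (use r[OF l2 b] l0[OF l2] in \<open>simp add: selA pure_closed[OF vsA vsA] MA_pure\<close>)
  qed
 qed
 then obtain emb where emb: "!!a. a : car A ==> emb a : car Ae" "!!a. a : car A ==> emb a .*_MA 1_A = a"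
  and emb0: "emb 0_A = 0_Ae" and free2: "hfree Ae I ?E ?D 0 (car A) emb ?Z" by blast
 \<comment> \<open>The new augmentation is to restrict to \<epsilon> after the old one on images of
   rows over \<open>He\<close>; this dictates its values on the basis.\<close>
 define e where "e i = \<epsilon> (\<eta> (\<pi> 0 (free_basis He i)))" for i
 define \<eta>i where "\<eta>i i = e i .*_A 1_A" for i
 note \<eta>c = mh_closed[OF PR.\<epsilon>_hom, unfolded MH_sel]
 have ec: "e i : car K" if "i : I 0" for i
  unfolding e_def by (intro \<epsilon>c \<eta>c PR.\<pi>c EH.A.basis_closed that)
 have \<eta>ic: "\<eta>i : I 0 \<rightarrow> car MA" unfolding \<eta>i_def MA_sel using ec by auto
 let ?aug = "flift MA Ae \<eta>i"
 note ah = E.A.flift_hom[OF MA_module \<eta>ic]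
 \<comment> \<open>Both sides are sums over the basis, compared term by term with
   \<open>kb_action\<close> and \<open>\<epsilon>_action\<close>.\<close>
 have aug: "?aug (%i. kb (x i)) = \<epsilon> (\<eta> (\<pi> 0 x)) .*_A 1_A" if x: "x : rows He (I 0)" for x
 proof -
  have xc: "x i : car (TS H H)" for i using freeD(1)[OF x] by (simp add: selH)
  have kx: "(%i. kb (x i)) : rows Ae (I 0)"
   by (rule ring_hom_rows[OF kb_ring_hom alg_ring[OF kHe] alg_ring[OF kAe] PR.finI x])
  note bc = mh_closed[OF bar_lin]
  have hc: "\<eta> (\<pi> 0 (free_basis He i)) : car H" if "i : I 0" for i
   by (intro \<eta>c PR.\<pi>c EH.A.basis_closed that)
  have fsA: "finsum MA = (finsum A :: ('i => _) => _)" and fsH: "finsum MH = (finsum H :: ('i => _) => _)"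
   and fsK: "finsum (reg K) = (finsum K :: ('i => _) => _)"
   by (intro ext, simp add: finsum_def finprod_def MA_sel MH_sel cong: if_cong)+
  have sx: "{i. x i ~= 0_He} <= I 0" and sk: "{i. kb (x i) ~= 0_Ae} <= I 0"
   using x kx by (simp_all add: free_sel)
  have "?aug (%i. kb (x i)) = (finsum MA (%i. kb (x i) .*_MA \<eta>i i) (I 0))"
   by (rule E.A.flift_superset'[OF MA_module PR.finI kx sk subset_refl \<eta>ic])
  also have "... = (finsum A (%i. (\<epsilon> (bar (x i)) \<otimes> e i) .*_A 1_A) (I 0))"
   unfolding fsA by (rule AA.A.add.finprod_cong'[OF refl]) (use ec bc xc \<epsilon>c kb_action in \<open>auto simp: \<eta>i_def\<close>)
  also have "... = (finsum K (%i. \<epsilon> (bar (x i)) \<otimes> e i) (I 0)) .*_A 1_A"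
  proof -
   have l: "(%k. k .*_A 1_A) : lin (reg K) A"
    by (rule scalar_lin[OF vsA AA.A.one_closed mh_id])
   show ?thesis
    using mh_finsum[OF l left_module.axioms(2)[OF vs_regular] AA.A.abelian_group_axioms PR.finI, of "%i. \<epsilon> (bar (x i)) \<otimes> e i"]
     ec bc xc \<epsilon>c by (simp add: fsK Pi_def)
  qed
  also have "(finsum K (%i. \<epsilon> (bar (x i)) \<otimes> e i) (I 0)) = (finsum K (%i. \<epsilon> (x i .*_MH \<eta> (\<pi> 0 (free_basis He i)))) (I 0))"
   by (rule K.add.finprod_cong'[OF refl]) (use ec bc xc \<epsilon>c hc \<epsilon>_action in \<open>auto simp: e_def\<close>)
  also have "... = \<epsilon> (finsum H (%i. x i .*_MH \<eta> (\<pi> 0 (free_basis He i))) (I 0))"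
  proof -
   have "(%i. x i .*_MH \<eta> (\<pi> 0 (free_basis He i))) : I 0 \<rightarrow> car H"
    using MH.smult_closed[unfolded selH MH_sel(1)] xc hc by blast
   then show ?thesis
    using mh_finsum[OF \<epsilon>_lin HA.A.abelian_group_axioms left_module.axioms(2)[OF vs_regular] PR.finI] by (simp add: fsK)
  qed
  also have "(finsum H (%i. x i .*_MH \<eta> (\<pi> 0 (free_basis He i))) (I 0)) = flift MH He (%i. \<eta> (\<pi> 0 (free_basis He i))) x"
   unfolding fsH[symmetric]
   by (rule EH.A.flift_superset'[OF MH_module PR.finI x sx subset_refl, symmetric]) (use hc in \<open>auto simp: MH_sel\<close>)
  also have "... = \<eta> (\<pi> 0 x)"
   by (rule EH.A.free_hom_flift[OF mh_comp[OF PR.\<pi> PR.\<epsilon>_hom] MH_module x, symmetric])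
  finally show ?thesis .
 qed
 have augZ: "?aug ?Z = 1_A"
  unfolding aug[OF PR.\<iota>c[OF q(2)]] by (simp add: PR.\<pi>_\<iota>[OF q(2)] q(1)[symmetric] \<epsilon>_one)
 have augD: "?aug (?D 0 i) = 0_MA" if i: "i : I (Suc 0)" for i
 proof -
  note b = PR.\<pi>c[OF EH.A.basis_closed[OF i]]
  note db = PR.\<delta>c[OF b]
  have "?aug (?D 0 i) = \<epsilon> (\<eta> (\<pi> 0 (PR.D 0 i))) .*_A 1_A"
   by (rule aug[OF funcset_mem[OF PR.D_rows i]])
  also have "\<eta> (\<pi> 0 (PR.D 0 i)) = 0_H" by (simp add: PR.D_def PR.\<pi>_\<iota>[OF db] PR.\<epsilon>_\<delta>[OF b] MH_sel)
  also have "\<epsilon> 0_H = \<zero>"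
   using mh_zero[OF \<epsilon>_lin HA.A.abelian_group_axioms left_module.axioms(2)[OF vs_regular]] by simp
  finally show ?thesis using left_module.smult_zero_left[OF vsA AA.A.one_closed] by (simp add: MA_sel)
 qed
 have augB: "?aug x = 0_A" if x: "M.bdr 0 x" for x
 proof -
  obtain y where y: "y : rows Ae (I (Suc 0))" "x = mrow Ae (I (Suc 0)) (?D 0) y" using x by (auto simp: mbdry_def)
  note mh = E.A.mrow_hom[OF M.fin M.D_rows]
  have "?aug (mrow Ae (I (Suc 0)) (?D 0) y) = 0_MA"
   by (rule E.A.free_hom_eqI[OF mh_comp[OF mh ah] mh_const_zero[OF MA_module] MA_module _ y(1)])
    (simp only: E.A.mrow_basis[OF M.fin M.D_rows] augD)
  then show ?thesis by (simp add: y(2) MA_sel)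
 qed
 have Zc: "M.cyc 0 ?Z" and ex: "!!n x. n ~= 0 ==> M.cyc n x ==> M.bdr n x"
  and exp: "!!x. M.cyc 0 x ==> EX! a. a : car A & M.bdr 0 (%i. x i -_Ae emb a *_Ae ?Z i)"
  using free2 by (auto simp: hfree_def)
 note Zr = M.cyc_rows[OF Zc]
 have augE: "?aug (%i. emb a *_Ae ?Z i) = a" if a: "a : car A" for a
  using mh_smult[OF ah emb(1)[OF a] Zr] by (simp add: free_sel(4) augZ emb(2)[OF a])
 have PA: "presented Ae MA M.modl (%n. mrow Ae (I (Suc n)) (?D n)) ?aug I (%n x. x) (%n. mrow Ae (I n) (?E n))"
 proof (rule M.modl_resolution[OF env_one_nonzero MA_module \<eta>ic ex _ augD])
  \<comment> \<open>Modulo boundaries \<open>x\<close> is \<open>emb a\<close> times the generator,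
    and its augmentation is \<open>a\<close>. So if the augmentation vanishes, \<open>x\<close>
    itself is a boundary.\<close>
  fix x assume x: "M.cyc 0 x" and x0: "?aug x = 0_MA"
  obtain a where a: "a : car A" and b: "M.bdr 0 (%i. x i -_Ae emb a *_Ae ?Z i)" using exp[OF x] by blast
  note xr = M.cyc_rows[OF x] and er = E.A.rows_smult[OF emb(1)[OF a] Zr]
  have "?aug (%i. x i -_Ae emb a *_Ae ?Z i) = ?aug x -_MA ?aug (%i. emb a *_Ae ?Z i)"
   using mh_diff[OF ah E.A.free_module_abelian_group MA.abelian_group_axioms xr er] E.A.free_module_minus[OF xr er] by simp
  then have "0_A = 0_MA -_MA a" unfolding augB[OF b] x0 augE[OF a] .
  then have "a = 0_A"
   using MA.M.minus_eq_zero_iff[of "0_MA" a] MA.M.zero_closed a by (simp add: MA_sel)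
  moreover have "(%i. x i -_Ae 0_Ae *_Ae ?Z i) = x"
   using freeD(1)[OF xr] freeD(1)[OF Zr] by (simp add: E.A.minus_zero_right)
  ultimately show "M.bdr 0 x" using b by (simp add: emb0)
 next
  fix m assume "m : car MA"
  then have m: "m : car A" by (simp add: MA_sel)
  show "EX x. M.cyc 0 x & ?aug x = m"
   by (rule exI[of _ "%i. emb m *_Ae ?Z i"]) (simp add: augE[OF m] M.cyc_smult[OF emb(1)[OF m] Zc])
 qed simp_all
 interpret PA: presented Ae MA M.modl "%n. mrow Ae (I (Suc n)) (?D n)" ?aug I "%n x. x" "%n. mrow Ae (I n) (?E n)" by (rule PA)
 have EA: "PA.E n i = ?E n i" if "i : I n" for n i
  unfolding PA.E_def by (rule E.A.mrow_basis[OF M.fin M.E_rows that])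
 have DA: "PA.D n i = ?D n i" if i: "i : I (Suc n)" for n i
  unfolding PA.D_def E.A.mrow_basis[OF M.fin M.E_rows i] by (rule M.E_D[OF i])
 show thesis
 proof (rule that[OF PA M.modl_fin_generated])
  fix n assume n: "L < n"
  show "car (M.modl n) = {0_(M.modl n)}"
  proof (rule M.modl_zero)
   fix i j assume i: "i : I n"
   have "\<pi> n (free_basis He i) = 0_(P n)" using PR.\<pi>c[OF EH.A.basis_closed[OF i]] bnd[OF n] by simp
   then show "?E n i j = 0_Ae" by (simp add: PR.E_def PR.\<iota>_zero kb_zero)
  qed
 qed (simp_all add: EA DA)
qed

text \<open>The transposed matrices undergo the same base changes over the opposite rings. The class
  \<open>w\<close> is the image of \<open>z\<close> and does not depend on which copy of
  \<open>A\<close> provides the coordinates, so it is a free generator for both at once.\<close>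

lemma dual_transfer:
 fixes I :: "nat => 'i set"
 assumes PR: "presented He MH P \<delta> \<eta> I \<iota> \<pi>" and bnd: "!!n. L < n ==> car (P n) = {0_(P n)}"
  and PA: "presented Ae MA P' \<delta>' \<eta>' I (%n x. x) \<pi>'" and bnd': "!!n. L < n ==> car (P' n) = {0_(P' n)}"
  and EA: "!!n i j. i : I n ==> presented.E Ae (%n x. x) \<pi>' n i j = kb (presented.E He \<iota> \<pi> n i j)"
  and DA: "!!n i j. i : I (Suc n) ==> presented.D Ae \<delta>' (%n x. x) \<pi>' n i j = kb (presented.D He \<delta> \<iota> \<pi> n i j)"
  and d: "d <= L"
  and van: "!!n. n ~= d ==> exact_at He P \<delta> (reg He) n"
  and free: "coh_free He P \<delta> (reg He) d (car H) (%t x. x *_He pt H H 1_H t) z"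
 shows "EX w. (ALL n. n ~= d --> exact_at Ae P' \<delta>' (reg Ae) n) &
  coh_free Ae P' \<delta>' (reg Ae) d (car A) (%a x. x *_Ae pt A A 1_A a) w &
  coh_free Ae P' \<delta>' (reg Ae) d (car A) (%a x. x *_Ae pt A A a 1_A) w"
proof -
 interpret PR: presented He MH P \<delta> \<eta> I \<iota> \<pi> by (rule PR)
 interpret PA: presented Ae MA P' \<delta>' \<eta>' I "%n x. x" \<pi>' by (rule PA)
 let ?J = "PR.J L" and ?E = "PR.E' L" and ?D = "PR.D' L" and ?z = "PR.col d z"
 have kop: "op_alg H = op_ring H" "op_alg Ae = op_ring Ae" by (simp_all add: op_alg_def)
 have z: "z : cocs He P \<delta> (reg He) d" using free by (simp add: coh_free_def)
 have pH: "pt H H 1_H t : car He" if "t : car H" for t using that by (simp add: selH pure_closed[OF vsH vsH])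
 have free3: "hfree (op_ring He) ?J ?E ?D (L - d) (car H) (%t. pt H H 1_H t) ?z"
 proof -
  have "(ALL n. n ~= d --> exact_at He P \<delta> (reg He) n) &
    coh_free He P \<delta> (reg He) d (car H) (%t x. x *_He pt H H 1_H t) z \<longleftrightarrow>
   hfree (op_ring He) ?J ?E ?D (L - d) (car H) (%t. pt H H 1_H t) ?z"
   by (rule PR.dual_free_iff[OF bnd d z pH])
  then show ?thesis using van free by (blast intro: iffD1)
 qed
 have mcH: "mat_complex (op_ring He) ?J ?E ?D" by (rule PR.dual_mat_complex[OF bnd])
 note mcb = mat_complex.base_change(1)[OF mcH ring_hom_op[OF bar_ring_hom] op_ring_ring[OF alg_ring[OF kH]]]
 have mcA: "mat_complex (op_ring Ae) (PA.J L) (PA.E' L) (PA.D' L)" by (rule PA.dual_mat_complex[OF bnd'])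
 note free4 = env_descent_op[OF mcH free3]
 have \<kappa>op: "\<kappa> : alg_hom K (op_alg H) (op_alg Ae)"
  using \<kappa>_alg_hom ring_hom_op[OF \<kappa>_ring_hom] by (simp add: alg_hom_def kop[symmetric])
 have free5: "hfree (op_ring Ae) ?J (%n i j. kb (?E n i j)) (%n i j. kb (?D n i j)) (L - d) (car A) emb (%i. kb (?z i))"
  if emb: "emb : lin A (TS A A)" and bij: "param H A (%h a. \<kappa> h *_Ae emb a)" for emb
 proof -
  have tE: "tL Ae = (tL (TS A A) :: ('h => 'x => _) => _)" by (simp add: env_alg_def)
  show ?thesis
   unfolding kb_def kop[symmetric]
   by (rule tensor_ascent[OF op_alg_algebra[OF kH] op_alg_algebra[OF kAe] vsA _ \<kappa>op _ _ mcb[folded kop] free4[folded kop, unfolded op_alg_sel[symmetric, of H]]])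
    (use emb bij H_one_nonzero in \<open>simp_all add: env_alg_lin[OF kA] selA tE\<close>)
 qed
 have JH: "?J n = (if n <= L then I (L - n) else {})" for n by (rule PR.J_def[OF bnd])
 have EH': "?E n i j = (if j : ?J n then PR.E (L - n) j i else 0_He)" for n i j
  using PR.E'_def[of L n] bnd by (simp add: mtrans_def)
 have EA': "PA.E' L n i j = (if j : ?J n then PA.E (L - n) j i else 0_Ae)" for n i j
  using PA.E'_def[of L n] bnd' by (simp add: mtrans_def)
 have DH': "?D n i j = (if j : ?J n then PR.D (L - Suc n) j i else 0_He)" for n i j
  using PR.D'_def[of L n] bnd by (simp add: mtrans_def)
 have DA': "PA.D' L n i j = (if j : ?J n then PA.D (L - Suc n) j i else 0_Ae)" for n i j
  using PA.D'_def[of L n] bnd' by (simp add: mtrans_def)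
 \<comment> \<open>Transposition commutes with entrywise maps, and the two transposes have the same
   index sets as guards.\<close>
 have EE: "kb (?E n i j) = PA.E' L n i j" if i: "i : ?J n" for n i j
 proof -
  have "n <= L" using i by (simp add: JH split: if_splits)
  then have "j : I (L - n)" if "j : ?J n" using that by (simp add: JH)
  then show ?thesis by (simp add: EH' EA' EA kb_zero)
 qed
 have DD: "kb (?D n i j) = PA.D' L n i j" if i: "i : ?J (Suc n)" for n i j
 proof -
  have "Suc n <= L" using i by (simp add: JH split: if_splits)
  then have "j : I (Suc (L - Suc n))" if "j : ?J n" using that by (simp add: JH Suc_diff_Suc)
  then show ?thesis by (simp add: DH' DA' DA kb_zero)
 qed
 let ?w = "%i. kb (?z i)"
 have free6: "hfree (op_ring Ae) (PA.J L) (PA.E' L) (PA.D' L) (L - d) (car A) emb ?w"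
  if emb: "emb : lin A (TS A A)" and bij: "param H A (%h a. \<kappa> h *_Ae emb a)" for emb
 proof -
  have "hfree (op_ring Ae) (PA.J L) (%n i j. kb (?E n i j)) (%n i j. kb (?D n i j)) (L - d) (car A) emb ?w \<longleftrightarrow>
   hfree (op_ring Ae) (PA.J L) (PA.E' L) (PA.D' L) (L - d) (car A) emb ?w"
   by (rule mat_complex.hfree_cong[OF mcA]) (simp_all only: EE DD)
  then show ?thesis using free5[OF that] by (rule iffD1)
 qed
 let ?f = "PA.fun_of_col d ?w"
 have concl: "(ALL n. n ~= d --> exact_at Ae P' \<delta>' (reg Ae) n) &
   coh_free Ae P' \<delta>' (reg Ae) d (car A) (%a x. x *_Ae emb a) ?f"
  if emb: "emb : lin A (TS A A)" and bij: "param H A (%h a. \<kappa> h *_Ae emb a)" for emb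
 proof -
  note f = free6[OF that]
  have ec: "emb a : car Ae" if "a : car A" for a using mh_closed[OF emb that] by (simp add: selA)
  have c: "?f : cocs Ae P' \<delta>' (reg Ae) d" by (rule PA.dual_free_col(1)[OF bnd' d f])
  have c': "PA.col d ?f = ?w" by (rule PA.dual_free_col(2)[OF bnd' d f])
  have "(ALL n. n ~= d --> exact_at Ae P' \<delta>' (reg Ae) n) &
    coh_free Ae P' \<delta>' (reg Ae) d (car A) (%a x. x *_Ae emb a) ?f \<longleftrightarrow>
   hfree (op_ring Ae) (PA.J L) (PA.E' L) (PA.D' L) (L - d) (car A) emb (PA.col d ?f)"
   by (rule PA.dual_free_iff[OF bnd' d c ec])
  then show ?thesis unfolding c' using f by (rule iffD2)
 qed
 show ?thesis
  using concl[OF pure_lin2[OF vsA vsA AA.A.one_closed mh_id] bij_right_inner]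
   concl[OF pure_lin1[OF vsA vsA AA.A.one_closed mh_id] bij_right_outer] by blast
qed

theorem twisted_CY_transfer:
 assumes cy: "twisted_CY K H d"
 shows "twisted_CY K A d"
proof -
 have sm: "homologically_smooth K H" using cy by (simp add: twisted_CY_def)
 then obtain P :: "nat => (('a, 'h, 'h) tens, (('a, 'h, 'h) tens, 'h) resolution_elem) module" and \<delta> \<eta> L
  where P0: "projective_resolution He MH P \<delta> \<eta>" and fg: "!!n. fin_generated He (P n)"
   and bnd: "!!n. L < n ==> car (P n) = {0_(P n)}"
  unfolding homologically_smooth_def by metis
 have P: "resolution He MH P \<delta> \<eta>"
  by (intro resolution.intro resolution_axioms.intro MH_module P0)
 interpret P: resolution He MH P \<delta> \<eta> by (rule P)
 \<comment> \<open>The index type is taken from \<open>A\<close>: rows over the enveloping algebra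
   of \<open>A\<close> with these indices have exactly the type in which smoothness of
   \<open>A\<close> asks for a resolution.\<close>
 have "ALL n. EX (J :: (('a, 'x, 'x) tens + 'x) list set) \<iota> \<pi>. finite J & \<iota> : mhom He (P n) (freem He J) &
   \<pi> : mhom He (freem He J) (P n) & (ALL x:car (P n). \<pi> (\<iota> x) = x)"
  using fin_generated_summand[OF P.proj fg infinite_UNIV_listI] by blast
 then obtain I :: "nat => (('a, 'x, 'x) tens + 'x) list set" and \<iota> \<pi>
  where I: "!!n. finite (I n) & \<iota> n : mhom He (P n) (freem He (I n)) &
   \<pi> n : mhom He (freem He (I n)) (P n) & (ALL x:car (P n). \<pi> n (\<iota> n x) = x)"
  by metis
 have PR: "presented He MH P \<delta> \<eta> I \<iota> \<pi>"
  by (intro presented.intro presented_axioms.intro P) (use I in auto)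
 obtain z where van: "!!n. n ~= d ==> exact_at He P \<delta> (reg He) n"
  and z: "coh_free He P \<delta> (reg He) d (car H) (%t x. x *_He pt H H 1_H t) z"
  using twisted_CY_cohomology[OF kH cy P] by blast
 \<comment> \<open>If \<open>P d\<close> were zero, every \<open>t\<close> would be a coefficient of
   the zero class, against uniqueness, as 1 and 0 differ in \<open>H\<close>.\<close>
 have d: "d <= L"
 proof (rule ccontr)
  assume "~ d <= L"
  then have Pd: "car (P d) = {0_(P d)}" using bnd by simp
  note reg = regular_left_module[OF alg_ring[OF kHe]]
  have zc: "z : cocs He P \<delta> (reg He) d" using z by (simp add: coh_free_def)
  have b: "(\<lambda>x\<in>car (P d). z x -_(reg He) z x *_He pt H H 1_H t) : cobs He P \<delta> (reg He) d"
   if t: "t : car H" for t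
  proof -
   interpret N: left_module He "reg He" by (rule reg)
   have z0: "z 0_(P d) = 0_(reg He)"
    by (rule mh_zero[OF P.cocyclesD(1)[OF reg zc] P.P_group N.abelian_group_axioms])
   have "(\<lambda>x\<in>car (P d). z x -_(reg He) z x *_He pt H H 1_H t) = (\<lambda>x\<in>car (P d). 0_(reg He))"
   proof (rule restrict_ext)
    fix x assume "x : car (P d)"
    then have x: "z x = 0_(reg He)" using Pd z0 by simp
    have "0_(reg He) *_He pt H H 1_H t = 0_(reg He)"
     using EH.A.l_null[of "pt H H 1_H t"] t by (simp add: regular_module_def selH pure_closed[OF vsH vsH])
    then show "z x -_(reg He) z x *_He pt H H 1_H t = 0_(reg He)"
     unfolding x by (simp add: N.M.minus_self)
   qed
   then show ?thesis using P.coboundaries_zero[OF reg] by simp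
  qed
  have "EX! t. t : car H & (\<lambda>x\<in>car (P d). z x -_(reg He) z x *_He pt H H 1_H t) : cobs He P \<delta> (reg He) d"
   using z zc by (simp add: coh_free_def)
  then have "1_H = 0_H" using b[OF HA.A.one_closed] b[OF HA.A.zero_closed] HA.A.one_closed HA.A.zero_closed by blast
  then show False using H_one_nonzero by simp
 qed
 show ?thesis
 proof (rule transfer_resolution[OF PR bnd])
  fix P' \<delta>' \<eta>' \<pi>'
  assume PA: "presented Ae MA P' \<delta>' \<eta>' I (%n x. x) \<pi>'"
   and fg': "!!n. fin_generated Ae (P' n)" and bnd': "!!n. L < n ==> car (P' n) = {0_(P' n)}"
   and EA: "!!n i j. i : I n ==> presented.E Ae (%n x. x) \<pi>' n i j = kb (presented.E He \<iota> \<pi> n i j)"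
   and DA: "!!n i j. i : I (Suc n) ==> presented.D Ae \<delta>' (%n x. x) \<pi>' n i j = kb (presented.D He \<delta> \<iota> \<pi> n i j)"
  have RA: "resolution Ae MA P' \<delta>' \<eta>'" using PA by (rule presented.axioms(1))
  have "projective_resolution Ae MA P' \<delta>' \<eta>'" using resolution.res[OF RA] .
  then have smA: "homologically_smooth K A"
   unfolding homologically_smooth_def using fg' bnd' by blast
  obtain w where w: "!!n. n ~= d ==> exact_at Ae P' \<delta>' (reg Ae) n"
   "coh_free Ae P' \<delta>' (reg Ae) d (car A) (%a x. x *_Ae pt A A 1_A a) w"
   "coh_free Ae P' \<delta>' (reg Ae) d (car A) (%a x. x *_Ae pt A A a 1_A) w"
   using dual_transfer[OF PR bnd PA bnd' EA DA d van z] by blast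
  show ?thesis by (rule twisted_CY_from_cohomology[OF kA smA RA w])
 qed
qed

end

theorem corollary0p2:
 fixes K :: "('k, 'z) ring_scheme"
  and H :: "('k, 'h) module"
  and \<Delta> :: "'h \<Rightarrow> ('k, 'h, 'h) tens"
  and \<epsilon> :: "'h \<Rightarrow> 'k"
  and S :: "'h \<Rightarrow> 'h"
  and A :: "('k, 'a) module"
  and d :: nat
 assumes "field K"
  and "hopf_algebra K H \<Delta> \<epsilon> S"
  and "bij_betw S (carrier H) (carrier H)"
  and "twisted_CY K H d"
  and "hopf_galois_object K H \<Delta> \<epsilon> A"
 shows "twisted_CY K A d"
proof -
 have h: "hopfc K H \<Delta> \<epsilon> S"
  by (intro hopfc.intro hopfc_axioms.intro vfield.intro assms)
 have "EX \<kappa>. gdata K H \<Delta> \<epsilon> S A \<kappa>"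
 proof (cases "EX \<alpha>. left_galois_object K H \<Delta> \<epsilon> A \<alpha>")
  case True
  then obtain \<alpha> where "left_galois_object K H \<Delta> \<epsilon> A \<alpha>" by blast
  then have "lgal K H \<Delta> \<epsilon> S A \<alpha>" by (intro lgal.intro lgal_axioms.intro h assms(3))
  then show ?thesis using lgal.gdata by blast
 next
  case False
  then obtain \<beta> where "right_galois_object K H \<Delta> \<epsilon> A \<beta>"
   using assms(5) by (auto simp: hopf_galois_object_def)
  then have "rgal K H \<Delta> \<epsilon> S A \<beta>" by (intro rgal.intro rgal_axioms.intro h assms(3))
  then show ?thesis by (rule rgal.gdata_exists)
 qed
 then show ?thesis using gdata.twisted_CY_transfer[OF _ assms(4)] by blast
qed

end
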